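(* Let $D$ be a division ring with center $F$ and let $G$ be a subnormal subgroup of $D^*$. Assume that $M$ is a maximal subgroup of $G$ containing an element $\alpha$ which is a non-central $FC$-element of $M$ (i.e. $\alpha\in M\setminus Z(M)$ and $\alpha^M$ is finite). Put $K=F(\alpha^M)$ and $H=C_D(K)$. Then the following conditions hold: (i) $K$ is a field, $[K:F]=[D:H]_r<\infty$, and $F(M)=D$. (ii) $K^*\cap G$ is the $FC$-center of $M$, and it is also the Fitting subgroup of $M$. (iii) The field extension $K/F$ is Galois, $H^*\cap G$ is a normal subgroup of $M$, and $M/(H^*\cap G)\cong \mathrm{Gal}(K/F)$. Moreover, $\mathrm{Gal}(K/F)$ is a finite simple group. (iv) If $H^*\cap G\subseteq K$, then $H=K$ and $[D:F]<\infty$.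
   Context: $D^*$ is the multiplicative group of $D$. A maximal subgroup of $G$ is a maximal proper subgroup. For a subset $S\subseteq D$, $F(S)$ denotes the division subring of $D$ generated by $F\cup S$. For $x\in D$ and a subgroup $M\le D^*$, $x^M=\{mxm^{-1} : m\in M\}$; an element $x$ of a group $M$ is an $FC$-element of $M$ if $x^M$ is finite, and the $FC$-center of $M$ is the set of all $FC$-elements of $M$. $Z(M)$ is the center of $M$; $C_D(K)$ is the centralizer of $K$ in $D$; $[D:H]_r$ is the dimension of $D$ as a right vector space over $H$. The Fitting subgroup of a group is the subgroup generated by all its nilpotent normal subgroups. *)

theory Defs
  imports "HOL-Algebra.Algebra" "HOL-Algebra.Algebraic_Closure_Type"
begin

section \<open>Groups\<close>

inductive subnormal :: "('a, 'b) monoid_scheme \<Rightarrow> 'a set \<Rightarrow> bool" for G where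
  whole: "subnormal G (carrier G)"
| step: "subnormal G K \<Longrightarrow> N \<lhd> G\<lparr>carrier := K\<rparr> \<Longrightarrow> subnormal G N"

definition maximal_subgroup :: "('a, 'b) monoid_scheme \<Rightarrow> 'a set \<Rightarrow> bool" where
  "maximal_subgroup G M \<longleftrightarrow> subgroup M G \<and> M \<noteq> carrier G \<and>
     (\<forall>N. subgroup N G \<and> M \<subseteq> N \<longrightarrow> N = M \<or> N = carrier G)"

fun lower_central :: "('a, 'b) monoid_scheme \<Rightarrow> nat \<Rightarrow> 'a set" where
  "lower_central G 0 = carrier G"
| "lower_central G (Suc n) = generate G
     {x \<otimes>\<^bsub>G\<^esub> y \<otimes>\<^bsub>G\<^esub> inv\<^bsub>G\<^esub> x \<otimes>\<^bsub>G\<^esub> inv\<^bsub>G\<^esub> y | x y. x \<in> lower_central G n \<and> y \<in> carrier G}"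

definition nilpotent_group :: "('a, 'b) monoid_scheme \<Rightarrow> bool" where
  "nilpotent_group G \<longleftrightarrow> group G \<and> (\<exists>n. lower_central G n = {\<one>\<^bsub>G\<^esub>})"

definition fitting_subgroup :: "('a, 'b) monoid_scheme \<Rightarrow> 'a set" where
  "fitting_subgroup G =
     generate G (\<Union>{N. N \<lhd> G \<and> nilpotent_group (G\<lparr>carrier := N\<rparr>)})"

section \<open>Division rings\<close>

text \<open>
  The division ring \<open>D\<close> is a type of class \<^class>\<open>division_ring\<close>. The two records below give
  access to the notions of HOL-Algebra: \<open>D_ring\<close> is \<open>D\<close> as a ring, and \<open>D_units\<close> is the
  multiplicative group of \<open>D\<close>.
\<close>

abbreviation D_ring :: "'a::division_ring ring" where
  "D_ring \<equiv> ring_of_type_algebra"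

abbreviation D_units :: "'a::division_ring monoid" where
  "D_units \<equiv> units_of D_ring"

lemma ring_D_ring: "ring (D_ring :: 'a::division_ring ring)"
proof -
  have "\<exists>y. x + y = 0" for x :: 'a
    by (rule exI[of _ "- x"]) simp
  moreover have "\<exists>y. y + x = 0" for x :: 'a
    by (rule exI[of _ "- x"]) simp
  ultimately show ?thesis
    unfolding ring_of_type_algebra_def
    by unfold_locales (auto simp: algebra_simps Units_def)
qed

lemma carrier_D_units: "carrier (D_units :: 'a::division_ring monoid) = UNIV - {0}"
proof -
  have "\<exists>y. y * x = 1 \<and> x * y = 1" if "x \<noteq> 0" for x :: 'a
    by (rule exI[of _ "inverse x"]) (use that in auto)
  then show ?thesis
    by (auto simp: units_of_def Units_def ring_of_type_algebra_def)
qed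

lemma group_D_units: "group (D_units :: 'a::division_ring monoid)"
  by (rule monoid.units_group) (rule ring.is_monoid[OF ring_D_ring])

definition centralizer :: "'a::division_ring set \<Rightarrow> 'a set" where
  "centralizer S = {x. \<forall>s\<in>S. x * s = s * x}"

abbreviation D_center :: "'a::division_ring set" where
  "D_center \<equiv> centralizer UNIV"

text \<open>
  \<^const>\<open>generate_field\<close> closes a set under the ring operations and under inverses of nonzero
  elements and does not force commutativity, so in a division ring it is the division subring
  generated by the set. Thus \<open>adjoin S\<close> is \<open>F(S)\<close>, where \<open>F\<close> is the center of \<open>D\<close>.
\<close>

definition adjoin :: "'a::division_ring set \<Rightarrow> 'a set" where
  "adjoin S = generate_field D_ring (D_center \<union> S)"

definition conjugates :: "'a::division_ring \<Rightarrow> 'a set \<Rightarrow> 'a set" where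
  "conjugates x M = {m * x * inverse m | m. m \<in> M}"

definition FC_center :: "'a::division_ring set \<Rightarrow> 'a set" where
  "FC_center M = {x \<in> M. finite (conjugates x M)}"

text \<open>
  \<open>right_dimension n H V\<close>: \<open>V\<close> has a basis of \<open>n\<close> elements as a right vector space over the
  division subring \<open>H\<close>. The HOL-Algebra predicate \<^const>\<open>ring.dimension\<close> takes scalars on the
  left.
\<close>

definition right_basis :: "'a::division_ring set \<Rightarrow> 'a set \<Rightarrow> 'a set \<Rightarrow> bool" where
  "right_basis H V B \<longleftrightarrow> finite B \<and> B \<subseteq> V \<and>
     (\<forall>c. (\<forall>b\<in>B. c b \<in> H) \<and> (\<Sum>b\<in>B. b * c b) = 0 \<longrightarrow> (\<forall>b\<in>B. c b = 0)) \<and>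
     V = {(\<Sum>b\<in>B. b * c b) | c. \<forall>b\<in>B. c b \<in> H}"

definition right_dimension :: "nat \<Rightarrow> 'a::division_ring set \<Rightarrow> 'a set \<Rightarrow> bool" where
  "right_dimension n H V \<longleftrightarrow> (\<exists>B. right_basis H V B \<and> card B = n)"

section \<open>Galois extensions\<close>

text \<open>
  Automorphisms are extensional on \<open>K\<close> (as in \<^const>\<open>Bij\<close>), so that each one is represented by a
  single function.
\<close>

definition galois_group :: "('a, 'b) ring_scheme \<Rightarrow> 'a set \<Rightarrow> 'a set \<Rightarrow> ('a \<Rightarrow> 'a) monoid" where
  "galois_group R K F = (BijGroup K)\<lparr>carrier :=
     {\<sigma> \<in> Bij K. \<sigma> \<in> ring_hom (R\<lparr>carrier := K\<rparr>) (R\<lparr>carrier := K\<rparr>) \<and> (\<forall>x\<in>F. \<sigma> x = x)}\<rparr>"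

text \<open>
  Finite Galois extensions, defined by the condition that the fixed field of the automorphism
  group is the base field.
\<close>

definition galois_extension :: "('a, 'b) ring_scheme \<Rightarrow> 'a set \<Rightarrow> 'a set \<Rightarrow> bool" where
  "galois_extension R K F \<longleftrightarrow> subfield K R \<and> subfield F R \<and> ring.finite_dimension R F K \<and>
     {x \<in> K. \<forall>\<sigma> \<in> carrier (galois_group R K F). \<sigma> x = x} = F"

end

theory Submission imports Defs begin

text \<open>
  The group \<open>M\<close> acts on \<open>K\<close> by conjugation through a finite group, because
  an automorphism from this action is determined on the finite set \<open>\<alpha>\<^sup>M\<close> that generates \<open>K\<close> over the
  center. Maximality is used in one way only: a subgroup of \<open>G\<close> that contains \<open>M\<close>, such as the
  normalizer of an \<open>M\<close>-stable set or the intersection of \<open>G\<close> with a division subring containing \<open>M\<close>,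
  is \<open>M\<close> or \<open>G\<close>. Each time one alternative is refuted by a theorem on subnormal subgroups of a
  multiplicative group:

  \<^item> a subnormal subgroup normalizing a subfield centralizes it (\<open>normalized_field_centralized\<close>);

  \<^item> a subnormal subgroup that is not central generates the division ring, once an infinite set of
    central elements is available (\<open>subnormal_generates\<close>), or in positive characteristic once it
    contains a noncentral element of finite order (\<open>torsion_subnormal_generates\<close>);

  \<^item> a maximal subgroup of a subnormal subgroup that spans a division ring and is finite modulo its
    infinite center is commutative (\<open>maximal_commutative\<close>).

  All three are applied inside varying division subrings of \<open>D\<close>, mostly centralizers.

  The first two statements rest on one device. If \<open>A\<close> is reached by a subnormal chain of length \<open>n\<close>,
  then bracketing \<open>1 + t u\<close> with \<open>x \<in> A\<close> in the group \<open>n\<close> times gives an element of \<open>A\<close>, for every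
  central parameter \<open>t\<close>. As a function of \<open>t\<close> it is a fraction of skew polynomials whose first-order
  coefficient is the \<open>n\<close>-fold additive bracket \<open>(dl x ^^ n) u\<close>. Multiplicative information on \<open>A\<close> thus
  becomes the information that \<open>dl x\<close> is nilpotent, and a nilpotent \<open>dl x\<close> vanishes if \<open>x\<close> lies in a
  subnormal subgroup (\<open>nilpotent_dl_trivial\<close>). When \<open>x\<close> acts on a field with infinite order, \<open>x\<close>
  itself serves as the parameter. Finite fields are handled by a Wedderburn-type argument with
  Hilbert 90 (\<open>finite_multiplicative_commute\<close>). For the third statement, a valuation of the center
  gives congruence subgroups; \<open>M\<close> would be dense in \<open>G\<close>, yet it is finite modulo the center.

  For the theorem itself, \<open>G\<close> cannot normalize \<open>K\<close>, so the normalizer of \<open>K\<close> in \<open>G\<close> is \<open>M\<close>. Hence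
  \<open>K\<^sup>* \<inter> G\<close> lies in \<open>M\<close>; it is subnormal in \<open>K\<^sup>*\<close> and finite modulo the center of \<open>K\<close>, and
  \<open>K\<close> is a field (\<open>K_field\<close>). The division ring generated by \<open>M\<close> is \<open>D\<close> (\<open>generated\<close>), so the
  fixed field of \<open>M\<close> in \<open>K\<close> is \<open>F\<close>, and Artin's theorem and Dedekind independence give the Galois group
  and both dimensions. The same alternative for the normalizer of a fixed field shows that a normal
  subgroup of \<open>M\<close> acts on \<open>K\<close> trivially or with fixed field \<open>F\<close> (\<open>normal_subgroup_dichotomy\<close>). By the
  Galois correspondence this is simplicity of \<open>Gal(K/F)\<close>; applied to the field that belongs to
  a second FC-element, it shows that this element is in \<open>K\<close> (\<open>finite_class_in_K\<close>). A nilpotent normal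
  subgroup of \<open>M\<close> consists of FC-elements (\<open>nilpotent_normal_in_K\<close>), which identifies the Fitting
  subgroup. If \<open>H\<^sup>* \<inter> G \<subseteq> K\<close>, representatives of \<open>M\<close> modulo \<open>H\<^sup>* \<inter> G\<close> span \<open>D\<close> over \<open>K\<close> as in a
  crossed product, and so \<open>H = K\<close>.
\<close>

section \<open>Division subrings, multiplicative subgroups and conjugation\<close>

definition div_subring :: "'a::division_ring set \<Rightarrow> bool" where
  "div_subring W \<longleftrightarrow> 0 \<in> W \<and> 1 \<in> W \<and> (\<forall>x\<in>W. \<forall>y\<in>W. x + y \<in> W) \<and> (\<forall>x\<in>W. - x \<in> W) \<and>
     (\<forall>x\<in>W. \<forall>y\<in>W. x * y \<in> W) \<and> (\<forall>x\<in>W. inverse x \<in> W)"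

definition mult_group :: "'a::division_ring set \<Rightarrow> bool" where
  "mult_group A \<longleftrightarrow> 1 \<in> A \<and> 0 \<notin> A \<and> (\<forall>x\<in>A. \<forall>y\<in>A. x * y \<in> A) \<and> (\<forall>x\<in>A. inverse x \<in> A)"

definition cj :: "'a::division_ring \<Rightarrow> 'a \<Rightarrow> 'a" where
  "cj m x = m * x * inverse m"

definition div_gen :: "'a::division_ring set \<Rightarrow> 'a set" where
  "div_gen S = \<Inter>{W. div_subring W \<and> S \<subseteq> W}"

text \<open>Subnormality in the multiplicative group of a division subring \<open>W\<close>. Working relative to a
  varying \<open>W\<close> inside one fixed type lets us pass to centralizers, where the center is larger.\<close>

inductive subnormal_in :: "'a::division_ring set \<Rightarrow> 'a set \<Rightarrow> bool" for W where
  units: "subnormal_in W (W - {0})"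
| step: "subnormal_in W B \<Longrightarrow> mult_group A \<Longrightarrow> A \<subseteq> B \<Longrightarrow>
    (\<And>b a. b \<in> B \<Longrightarrow> a \<in> A \<Longrightarrow> cj b a \<in> A) \<Longrightarrow> subnormal_in W A"

lemma div_subringD:
  assumes "div_subring W"
  shows "0 \<in> W" "1 \<in> W" "x \<in> W \<Longrightarrow> y \<in> W \<Longrightarrow> x + y \<in> W" "x \<in> W \<Longrightarrow> - x \<in> W"
    "x \<in> W \<Longrightarrow> y \<in> W \<Longrightarrow> x - y \<in> W" "x \<in> W \<Longrightarrow> y \<in> W \<Longrightarrow> x * y \<in> W" "x \<in> W \<Longrightarrow> inverse x \<in> W"
    "x \<in> W \<Longrightarrow> y \<in> W \<Longrightarrow> cj x y \<in> W"
proof -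
  show "x - y \<in> W" if "x \<in> W" "y \<in> W"
    using assms that unfolding div_subring_def by (metis diff_conv_add_uminus)
qed (use assms in \<open>auto simp: div_subring_def cj_def\<close>)

lemma div_subring_sum:
  assumes "div_subring W" "\<And>i. i \<in> I \<Longrightarrow> f i \<in> W"
  shows "sum f I \<in> W"
  using assms(2) by (induction I rule: infinite_finite_induct)
    (auto intro: div_subringD[OF assms(1)])

lemma div_subring_power: "div_subring W \<Longrightarrow> x \<in> W \<Longrightarrow> x ^ n \<in> W"
  by (induction n) (auto intro: div_subringD)

lemma div_subring_of_nat: "div_subring W \<Longrightarrow> of_nat n \<in> W"
  by (induction n) (auto intro: div_subringD)

lemma div_subring_Int: "div_subring V \<Longrightarrow> div_subring W \<Longrightarrow> div_subring (V \<inter> W)"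
  by (auto simp: div_subring_def)

lemma div_subring_UNIV [simp]: "div_subring UNIV"
  by (auto simp: div_subring_def)

lemma mult_groupD:
  assumes "mult_group A"
  shows "1 \<in> A" "0 \<notin> A" "x \<in> A \<Longrightarrow> x \<noteq> 0" "x \<in> A \<Longrightarrow> y \<in> A \<Longrightarrow> x * y \<in> A" "x \<in> A \<Longrightarrow> inverse x \<in> A"
    "x \<in> A \<Longrightarrow> y \<in> A \<Longrightarrow> cj x y \<in> A"
  using assms by (auto simp: mult_group_def cj_def)

lemma mult_group_power: "mult_group A \<Longrightarrow> x \<in> A \<Longrightarrow> x ^ n \<in> A"
  by (induction n) (auto intro: mult_groupD)

lemma mult_group_units: "div_subring W \<Longrightarrow> mult_group (W - {0})"
  by (auto simp: mult_group_def div_subring_def)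

lemma mult_group_Int: "mult_group A \<Longrightarrow> div_subring W \<Longrightarrow> mult_group (A \<inter> W)"
  by (auto simp: mult_group_def div_subring_def)

lemma inverse_mult_rev: "inverse (x * y) = inverse y * inverse (x :: 'a::division_ring)"
  by (cases "x = 0 \<or> y = 0") (auto simp: nonzero_inverse_mult_distrib)

lemma cj_simps [simp]: "cj m 0 = 0" "m \<noteq> 0 \<Longrightarrow> cj m 1 = 1" "cj 1 x = x" "cj x x = x"
  by (auto simp: cj_def) (cases "x = 0", auto simp: mult.assoc)

lemma cj_add: "cj m (x + y) = cj m x + cj m y"
  and cj_minus: "cj m (- x) = - cj m x"
  and cj_diff: "cj m (x - y) = cj m x - cj m y"
  by (auto simp: cj_def algebra_simps)

lemma cj_sum: "cj m (sum f I) = (\<Sum>i\<in>I. cj m (f i))"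
  by (auto simp: cj_def sum_distrib_left sum_distrib_right)

lemma cj_mult: "m \<noteq> 0 \<Longrightarrow> cj m (x * y) = cj m x * cj m y"
proof -
  assume m: "m \<noteq> 0"
  have "cj m x * cj m y = m * x * (inverse m * m) * y * inverse m"
    by (simp only: cj_def mult.assoc)
  then show ?thesis using m by (simp add: cj_def) (simp add: mult.assoc)
qed

lemma cj_power: "m \<noteq> 0 \<Longrightarrow> cj m (x ^ n) = cj m x ^ n"
  by (induction n) (auto simp: cj_mult)

lemma cj_inverse: "m \<noteq> 0 \<Longrightarrow> cj m (inverse x) = inverse (cj m x)"
  by (simp add: cj_def inverse_mult_rev mult.assoc)

lemma cj_cj: "cj m (cj n x) = cj (m * n) x"
  by (simp add: cj_def inverse_mult_rev mult.assoc)

lemma cj_inv_cancel [simp]: "m \<noteq> 0 \<Longrightarrow> cj (inverse m) (cj m x) = x" "m \<noteq> 0 \<Longrightarrow> cj m (cj (inverse m) x) = x"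
  by (auto simp: cj_cj)

lemma cj_eq_iff: "m \<noteq> 0 \<Longrightarrow> cj m x = y \<longleftrightarrow> m * x = y * m"
proof -
  assume m: "m \<noteq> 0"
  have "y * m * inverse m = y" using m by (simp add: mult.assoc)
  moreover have "m * x * inverse m * m = m * x" using m by (simp add: mult.assoc)
  ultimately show ?thesis unfolding cj_def by metis
qed

lemma cj_left: "m \<noteq> 0 \<Longrightarrow> cj m x * m = m * x"
  by (simp add: cj_def mult.assoc)

lemma cj_eq_0_iff [simp]: "m \<noteq> 0 \<Longrightarrow> cj m x = 0 \<longleftrightarrow> x = 0"
  by (auto simp: cj_def)

lemma cj_inj: "m \<noteq> 0 \<Longrightarrow> cj m x = cj m y \<longleftrightarrow> x = y"
  by (metis cj_inv_cancel(1))

subsection \<open>Centralizers and generated division subrings\<close>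

lemma inverse_commute: "x * s = s * x \<Longrightarrow> inverse x * s = s * inverse (x :: 'a::division_ring)"
proof (cases "x = 0")
  case False
  assume c: "x * s = s * x"
  have "inverse x * s = inverse x * (s * x) * inverse x"
    using False by (simp add: mult.assoc)
  also have "\<dots> = s * inverse x"
    using False by (simp add: c[symmetric] mult.assoc[symmetric])
  finally show ?thesis .
qed simp

lemma centralizerD: "x \<in> centralizer S \<Longrightarrow> s \<in> S \<Longrightarrow> x * s = s * x"
  by (auto simp: centralizer_def)

lemma div_subring_centralizer [simp]: "div_subring (centralizer S)"
  unfolding div_subring_def
proof (intro conjI ballI)
  fix x y assume x: "x \<in> centralizer S" and y: "y \<in> centralizer S"
  show "x * y \<in> centralizer S"
    unfolding centralizer_def using centralizerD[OF x] centralizerD[OF y]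
    by (simp add: mult.assoc) (simp add: mult.assoc[symmetric])
  show "x + y \<in> centralizer S"
    unfolding centralizer_def using centralizerD[OF x] centralizerD[OF y] by (simp add: algebra_simps)
next
  fix x assume x: "x \<in> centralizer S"
  show "inverse x \<in> centralizer S"
    unfolding centralizer_def using centralizerD[OF x] by (simp add: inverse_commute)
qed (auto simp: centralizer_def)

lemma centralizer_galois: "S \<subseteq> centralizer T \<longleftrightarrow> T \<subseteq> centralizer S"
  by (auto simp: centralizer_def)

lemma centralizer_antimono: "S \<subseteq> T \<Longrightarrow> centralizer T \<subseteq> centralizer S"
  by (auto simp: centralizer_def)

lemma div_subring_div_gen [simp]: "div_subring (div_gen S)"
  unfolding div_gen_def div_subring_def by auto

lemma div_gen_superset: "S \<subseteq> div_gen S" and div_gen_least: "div_subring W \<Longrightarrow> S \<subseteq> W \<Longrightarrow> div_gen S \<subseteq> W"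
  unfolding div_gen_def by auto

lemma div_gen_mono: "S \<subseteq> T \<Longrightarrow> div_gen S \<subseteq> div_gen T"
  by (rule div_gen_least) (use div_gen_superset[of T] in auto)

lemma centralizer_div_gen [simp]: "centralizer (div_gen S) = centralizer S"
proof
  show "centralizer (div_gen S) \<subseteq> centralizer S"
    by (rule centralizer_antimono[OF div_gen_superset])
  have "div_gen S \<subseteq> centralizer (centralizer S)"
    by (rule div_gen_least[OF div_subring_centralizer]) (auto simp: centralizer_def)
  then show "centralizer S \<subseteq> centralizer (div_gen S)" by (simp add: centralizer_galois)
qed

lemma div_gen_commutative: "S \<subseteq> centralizer S \<Longrightarrow> div_gen S \<subseteq> centralizer (div_gen S)"
  by (simp add: div_gen_least)

lemma div_gen_normalized:
  assumes "m \<noteq> 0" "\<And>s. s \<in> S \<Longrightarrow> cj m s \<in> div_gen S" "x \<in> div_gen S"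
  shows "cj m x \<in> div_gen S"
proof -
  have "div_subring {x. cj m x \<in> div_gen S}"
    using assms(1) by (auto simp: div_subring_def cj_add cj_minus cj_mult cj_inverse
        intro: div_subringD[OF div_subring_div_gen])
  from div_gen_least[OF this, of S] assms show ?thesis by blast
qed

subsection \<open>Iterated commutators\<close>

text \<open>\<open>iter_comm x n v\<close> is \<open>[\<dots>[[v, x], x], \<dots>, x]\<close> with \<open>n\<close> brackets, where
  \<open>[v, x] = v (x v x\<inverse>)\<inverse>\<close>.\<close>

fun iter_comm :: "'a::division_ring \<Rightarrow> nat \<Rightarrow> 'a \<Rightarrow> 'a" where
  "iter_comm x 0 v = v"
| "iter_comm x (Suc n) v = iter_comm x n v * inverse (cj x (iter_comm x n v))"

lemma subnormal_in_group: "subnormal_in W A \<Longrightarrow> div_subring W \<Longrightarrow> mult_group A"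
  by (induction rule: subnormal_in.induct) (auto simp: mult_group_units)

lemma subnormal_in_subset: "subnormal_in W A \<Longrightarrow> A \<subseteq> W"
  by (induction rule: subnormal_in.induct) auto

lemma subnormal_in_Int:
  assumes "subnormal_in W A" "div_subring W" "div_subring V" "V \<subseteq> W"
  shows "subnormal_in V (A \<inter> V)"
  using assms(1)
proof (induction rule: subnormal_in.induct)
  case units
  have "(W - {0}) \<inter> V = V - {0}" using assms(4) by auto
  then show ?case using subnormal_in.units[of V] by simp
next
  case (step B A)
  show ?case
    by (rule subnormal_in.step[OF step.IH mult_group_Int[OF step.hyps(2) assms(3)]])
      (use step.hyps div_subringD(8)[OF assms(3)] in auto)
qed

text \<open>The mechanism behind every use of subnormality: bracketing with an element of \<open>A\<close> moves
  one step down a subnormal chain, so that enough brackets carry all of \<open>W\<close> into \<open>A\<close>.\<close>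

lemma subnormal_in_iter_comm:
  assumes "subnormal_in W A" "div_subring W"
  shows "\<exists>n. \<forall>x\<in>A. \<forall>v\<in>W - {0}. iter_comm x n v \<in> A"
  using assms(1)
proof (induction rule: subnormal_in.induct)
  case units
  show ?case by (rule exI[of _ 0]) simp
next
  case (step B A)
  then obtain n where n: "\<forall>x\<in>B. \<forall>v\<in>W - {0}. iter_comm x n v \<in> B" by blast
  have "iter_comm x (Suc n) v \<in> A" if "x \<in> A" "v \<in> W - {0}" for x v
  proof -
    define w where "w = iter_comm x n v"
    have w: "w \<in> B" using n that step.hyps(3) by (auto simp: w_def)
    have "w * inverse (cj x w) = cj w x * inverse x"
      by (simp add: cj_def inverse_mult_rev mult.assoc)
    moreover have "cj w x * inverse x \<in> A"
      using mult_groupD[OF step.hyps(2)] step.hyps(4)[OF w that(1)] that(1) by auto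
    ultimately show ?thesis by (simp add: w_def)
  qed
  then show ?case by blast
qed

lemma iter_comm_in:
  assumes "div_subring W" "v \<in> W" "\<And>w. w \<in> W \<Longrightarrow> cj x w \<in> W"
  shows "iter_comm x n v \<in> W"
  by (induction n) (use assms div_subringD[OF assms(1)] in auto)

lemma iter_comm_nonzero: "x \<noteq> 0 \<Longrightarrow> v \<noteq> 0 \<Longrightarrow> iter_comm x n v \<noteq> 0"
  by (induction n) auto

section \<open>Twisted polynomials and first-order expansions of commutators\<close>

definition peval :: "'a::division_ring \<Rightarrow> nat \<Rightarrow> (nat \<Rightarrow> 'a) \<Rightarrow> 'a" where
  "peval y n f = (\<Sum>i\<le>n. y ^ i * f i)"

text \<open>Polynomials \<open>\<Sum>i. y ^ i * f i\<close> over \<open>R\<close>, where moving a coefficient to the right past the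
  variable applies conjugation by \<open>m\<close>. With \<open>m = 1\<close> the variable is central.\<close>

locale twisted_poly =
  fixes R :: "'a::division_ring set" and m :: 'a
  assumes R: "div_subring R" and m: "m \<noteq> 0" and m_R: "a \<in> R \<Longrightarrow> cj m a \<in> R"
begin

definition twisted :: "'a \<Rightarrow> bool" where
  "twisted y \<longleftrightarrow> (\<forall>a\<in>R. a * y = y * cj m a)"

definition poly :: "nat \<Rightarrow> (nat \<Rightarrow> 'a) \<Rightarrow> bool" where
  "poly n f \<longleftrightarrow> (\<forall>i. f i \<in> R) \<and> (\<forall>i>n. f i = 0)"

lemma cj_m_pow_R: "a \<in> R \<Longrightarrow> cj (m ^ i) a \<in> R"
  by (induction i) (auto simp: cj_cj[symmetric] m_R)

lemma twisted_power: "twisted y \<Longrightarrow> a \<in> R \<Longrightarrow> a * y ^ i = y ^ i * cj (m ^ i) a"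
proof (induction i)
  case (Suc i)
  have "a * y ^ Suc i = y ^ i * (cj (m ^ i) a * y)"
    using Suc by (simp add: power_Suc2 mult.assoc[symmetric] del: power_Suc)
  also have "\<dots> = y ^ Suc i * cj (m ^ Suc i) a"
    using Suc.prems cj_m_pow_R[of a i]
    by (simp add: twisted_def power_Suc2 mult.assoc cj_cj[symmetric] del: power_Suc)
      (simp add: cj_cj power_commutes)
  finally show ?case .
qed auto

definition shift :: "(nat \<Rightarrow> 'a) \<Rightarrow> nat \<Rightarrow> 'a" where
  "shift c i = (case i of 0 \<Rightarrow> 0 | Suc j \<Rightarrow> c j)"

lemma shift_simps [simp]: "shift c 0 = 0" "shift c (Suc j) = c j"
  by (auto simp: shift_def)

lemma peval_shift: "peval y (Suc n) (shift c) = (\<Sum>j\<le>n. y ^ Suc j * c j)"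
  unfolding peval_def by (subst sum.atMost_Suc_shift) simp

lemma poly_mono: "poly n f \<Longrightarrow> n \<le> k \<Longrightarrow> poly k f"
  by (auto simp: poly_def)

lemma peval_mono: "poly n f \<Longrightarrow> n \<le> k \<Longrightarrow> peval y k f = peval y n f"
  unfolding peval_def poly_def by (rule sum.mono_neutral_right) auto

lemma peval_add: "peval y n (\<lambda>i. f i + g i) = peval y n f + peval y n g"
  by (simp add: peval_def algebra_simps sum.distrib)

definition mulL :: "'a \<Rightarrow> (nat \<Rightarrow> 'a) \<Rightarrow> nat \<Rightarrow> 'a" where
  "mulL b f i = f i + shift (\<lambda>j. cj (m ^ j) b * f j) i"

definition mulR :: "(nat \<Rightarrow> 'a) \<Rightarrow> 'a \<Rightarrow> nat \<Rightarrow> 'a" where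
  "mulR f p i = f i + shift (\<lambda>j. cj m (f j) * p) i"

lemma poly_mulL: "poly n f \<Longrightarrow> b \<in> R \<Longrightarrow> poly (Suc n) (mulL b f)"
  unfolding poly_def mulL_def shift_def
  by (auto split: nat.split intro!: div_subringD(1,3,6)[OF R] cj_m_pow_R)

lemma poly_mulR: "poly n f \<Longrightarrow> b \<in> R \<Longrightarrow> poly (Suc n) (mulR f b)"
  unfolding poly_def mulR_def shift_def
  by (auto split: nat.split intro!: div_subringD(1,3,6)[OF R] m_R)

lemma peval_mulL:
  assumes "poly n f" "b \<in> R" "twisted y"
  shows "peval y (Suc n) (mulL b f) = (1 + y * b) * peval y n f"
proof -
  have "y * b * peval y n f = (\<Sum>j\<le>n. y ^ Suc j * (cj (m ^ j) b * f j))"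
    unfolding peval_def sum_distrib_left
    using twisted_power[OF assms(3,2)] by (simp add: mult.assoc) (simp add: mult.assoc[symmetric])
  then show ?thesis
    using peval_mono[OF assms(1), of "Suc n" y]
    by (simp add: mulL_def[abs_def] peval_add peval_shift algebra_simps)
qed

lemma peval_mulR:
  assumes "poly n f" "p \<in> R" "twisted y"
  shows "peval y (Suc n) (mulR f p) = peval y n f * (1 + y * p)"
proof -
  have "f j * y = y * cj m (f j)" for j using assms(1,3) by (auto simp: poly_def twisted_def)
  then have "peval y n f * (y * p) = (\<Sum>j\<le>n. y ^ Suc j * (cj m (f j) * p))"
    unfolding peval_def sum_distrib_right
    by (intro sum.cong refl) (simp only: power_Suc2 mult.assoc, metis mult.assoc)
  then show ?thesis
    using peval_mono[OF assms(1), of "Suc n" y]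
    by (simp add: mulR_def[abs_def] peval_add peval_shift distrib_left)
qed

text \<open>The Ore condition for linear polynomials: \<open>f\<close> and \<open>1 + y b\<close> have a common right multiple
  \<open>f (1 + y p) = (1 + y b) h\<close>. Dividing \<open>f\<close> by \<open>1 + y b\<close> from the left leaves the recursion for
  \<open>A\<close> below; the remainders of \<open>f\<close> and \<open>f y\<close> are both right multiples of one element, and
  \<open>p\<close> is the ratio that cancels them.\<close>

lemma ore_linear:
  assumes f: "poly n f" and b: "b \<in> R"
  obtains p h where "p \<in> R" "poly n h" "h 0 = f 0" "h 1 = f 1 + cj m (f 0) * p - b * f 0"
    "mulR f p = mulL b h"
proof -
  define A where "A = rec_nat (f 0) (\<lambda>i a. f (Suc i) - cj (m ^ i) b * a)"
  have A0: "A 0 = f 0" and AS: "A (Suc i) = f (Suc i) - cj (m ^ i) b * A i" for i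
    by (simp_all add: A_def)
  have fR: "f i \<in> R" for i using f by (auto simp: poly_def)
  have AR: "A i \<in> R" for i
    by (induction i) (auto simp: A0 AS fR intro!: div_subringD[OF R] cj_m_pow_R b)
  define p where "p = inverse (cj m (A n)) * cj (m ^ n) b * A n"
  have p: "p \<in> R" unfolding p_def by (intro div_subringD[OF R] m_R AR cj_m_pow_R b)
  have Ap: "cj m (A n) * p = cj (m ^ n) b * A n"
    using m by (cases "A n = 0") (auto simp: p_def mult.assoc[symmetric])
  define h where "h = rec_nat (f 0) (\<lambda>i a. f (Suc i) + cj m (f i) * p - cj (m ^ i) b * a)"
  have h0: "h 0 = f 0" and hS: "h (Suc i) = f (Suc i) + cj m (f i) * p - cj (m ^ i) b * h i" for i
    by (simp_all add: h_def)
  have hR: "h i \<in> R" for i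
    by (induction i) (auto simp: h0 hS fR intro!: div_subringD[OF R] cj_m_pow_R m_R b p)
  have hA: "h (Suc i) = A (Suc i) + cj m (A i) * p" for i
  proof (induction i)
    case 0
    show ?case by (simp add: hS AS h0 A0)
  next
    case (Suc i)
    have "cj m (f (Suc i)) = cj m (A (Suc i)) + cj (m ^ Suc i) b * cj m (A i)"
      using m by (simp add: AS cj_diff cj_mult cj_cj)
    then show ?case using Suc by (simp add: hS[of "Suc i"] AS[of "Suc i"] algebra_simps)
  qed
  have f0: "f i = 0" if "i > n" for i using f that by (auto simp: poly_def)
  have "h (Suc n + k) = 0" for k
  proof (induction k)
    case 0
    show ?case using hA[of n] AS[of n] Ap f0[of "Suc n"] by simp
  next
    case (Suc k)
    then show ?case using hS[of "Suc n + k"] f0 by simp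
  qed
  then have "h i = 0" if "i > n" for i using that less_iff_Suc_add[of n i] by auto
  then have hp: "poly n h" using hR by (auto simp: poly_def)
  have "mulR f p i = mulL b h i" for i
    by (cases i) (auto simp: mulR_def mulL_def h0 hS)
  then have "mulR f p = mulL b h" by auto
  with that[OF p hp h0 _] show ?thesis using hS[of 0] h0 by auto
qed

end

subsection \<open>Words in linear factors\<close>

text \<open>A word \<open>[(b\<^sub>1, s\<^sub>1), \<dots>]\<close> stands for the product of the factors \<open>1 + y * b\<^sub>i\<close> or their
  inverses, according to the sign \<open>s\<^sub>i\<close>; its slope is the first-order coefficient in \<open>y\<close>.\<close>

fun word_eval :: "'a::division_ring \<Rightarrow> ('a \<times> bool) list \<Rightarrow> 'a" where
  "word_eval y [] = 1"
| "word_eval y ((b, s) # ws) = (if s then 1 + y * b else inverse (1 + y * b)) * word_eval y ws"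

definition word_slope :: "('a::division_ring \<times> bool) list \<Rightarrow> 'a" where
  "word_slope ws = (\<Sum>(b, s)\<leftarrow>ws. if s then b else - b)"

definition word_inv :: "('a \<times> bool) list \<Rightarrow> ('a \<times> bool) list" where
  "word_inv ws = rev (map (\<lambda>(b, s). (b, \<not> s)) ws)"

fun comm_word :: "'a::division_ring \<Rightarrow> nat \<Rightarrow> 'a \<Rightarrow> ('a \<times> bool) list" where
  "comm_word x 0 u = [(u, True)]"
| "comm_word x (Suc n) u = comm_word x n u @ word_inv (map (\<lambda>(b, s). (cj x b, s)) (comm_word x n u))"

definition dl :: "'a::division_ring \<Rightarrow> 'a \<Rightarrow> 'a" where
  "dl x d = d - cj x d"

lemma word_eval_append: "word_eval y (ws @ ws') = word_eval y ws * word_eval y ws'"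
  by (induction ws) (auto simp: mult.assoc)

lemma word_eval_inv: "word_eval y (word_inv ws) = inverse (word_eval y ws)"
  by (induction ws) (auto simp: word_inv_def word_eval_append inverse_mult_rev)

lemma word_eval_cj:
  assumes "x \<noteq> 0" "cj x y = y"
  shows "word_eval y (map (\<lambda>(b, s). (cj x b, s)) ws) = cj x (word_eval y ws)"
  using assms by (induction ws) (auto simp: cj_mult cj_add cj_inverse)

lemma word_eval_comm_word:
  assumes "x \<noteq> 0" "cj x y = y"
  shows "word_eval y (comm_word x n u) = iter_comm x n (1 + y * u)"
  by (induction n) (auto simp: word_eval_append word_eval_inv word_eval_cj[OF assms])

lemma word_slope_simps:
  "word_slope [] = 0" "word_slope ((b, s) # ws) = (if s then b else - b) + word_slope ws"
  "word_slope (ws @ ws') = word_slope ws + word_slope ws'"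
  by (auto simp: word_slope_def)

lemma word_slope_inv: "word_slope (word_inv ws) = - word_slope ws"
  by (induction ws) (auto simp: word_inv_def word_slope_simps)

lemma word_slope_cj: "word_slope (map (\<lambda>(b, s). (cj x b, s)) ws) = cj x (word_slope ws)"
  by (induction ws) (auto simp: word_slope_simps cj_add cj_minus)

lemma word_slope_comm_word: "word_slope (comm_word x n u) = (dl x ^^ n) u"
  by (induction n) (auto simp: word_slope_simps word_slope_inv word_slope_cj dl_def)

lemma comm_word_letters:
  assumes "u \<in> U" "\<And>b. b \<in> U \<Longrightarrow> cj x b \<in> U"
  shows "(b, s) \<in> set (comm_word x n u) \<Longrightarrow> b \<in> U"
proof (induction n arbitrary: b s)
  case (Suc n)
  then show ?case using assms by (auto simp: word_inv_def)
qed (use assms in auto)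

context twisted_poly
begin

text \<open>Induction on the word: a factor \<open>1 + y b\<close> multiplies the numerator from the left, and an inverse factor
  is moved past the numerator by the Ore condition \<open>ore_linear\<close> and then joins the denominator.\<close>

lemma word_fraction:
  assumes "\<And>b s. (b, s) \<in> set ws \<Longrightarrow> b \<in> R"
  obtains n f g where "poly n f" "poly n g" "f 0 = 1" "g 0 = 1" "f 1 - g 1 = word_slope ws"
    "\<And>y. twisted y \<Longrightarrow> (\<And>b s. (b, s) \<in> set ws \<Longrightarrow> 1 + y * b \<noteq> 0) \<Longrightarrow>
       word_eval y ws * peval y n g = peval y n f"
  using assms
proof (induction ws arbitrary: thesis)
  case Nil
  define e :: "nat \<Rightarrow> 'a" where "e = (\<lambda>i. if i = 0 then 1 else 0)"
  have "poly 0 e" using div_subringD[OF R] by (auto simp: poly_def e_def)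
  then show ?case by (intro Nil(1)[of 0 e e]) (auto simp: e_def word_slope_simps)
next
  case (Cons w ws)
  obtain b s where w: "w = (b, s)" by force
  have b: "b \<in> R" using Cons.prems(2) w by auto
  obtain n f g where fg: "poly n f" "poly n g" "f 0 = 1" "g 0 = 1" "f 1 - g 1 = word_slope ws"
    and ev: "\<And>y. twisted y \<Longrightarrow> (\<And>b s. (b, s) \<in> set ws \<Longrightarrow> 1 + y * b \<noteq> 0) \<Longrightarrow>
       word_eval y ws * peval y n g = peval y n f"
    using Cons.IH Cons.prems(2) by (metis list.set_intros(2))
  show ?case
  proof (cases s)
    case True
    show ?thesis
    proof (rule Cons.prems(1)[of "Suc n" "mulL b f" g])
      show "poly (Suc n) (mulL b f)" "poly (Suc n) g"
        using fg b by (auto intro: poly_mulL poly_mono)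
      show "mulL b f 1 - g 1 = word_slope (w # ws)"
        using fg True by (simp add: mulL_def w word_slope_simps algebra_simps)
      fix y assume y: "twisted y" and nz: "\<And>b s. (b, s) \<in> set (w # ws) \<Longrightarrow> 1 + y * b \<noteq> 0"
      have "word_eval y ws * peval y n g = peval y n f"
        by (rule ev[OF y]) (use nz in \<open>meson list.set_intros(2)\<close>)
      then show "word_eval y (w # ws) * peval y (Suc n) g = peval y (Suc n) (mulL b f)"
        using True peval_mulL[OF fg(1) b y] peval_mono[OF fg(2), of "Suc n" y]
        by (simp add: w mult.assoc)
    qed (use fg in \<open>auto simp: mulL_def\<close>)
  next
    case False
    obtain p h where p: "p \<in> R" "poly n h" "h 0 = f 0" "h 1 = f 1 + cj m (f 0) * p - b * f 0"
      "mulR f p = mulL b h" using ore_linear[OF fg(1) b] by blast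
    show ?thesis
    proof (rule Cons.prems(1)[of "Suc n" h "mulR g p"])
      show "poly (Suc n) h" "poly (Suc n) (mulR g p)"
        using fg p by (auto intro: poly_mulR poly_mono)
      show "h 1 - mulR g p 1 = word_slope (w # ws)"
        using fg p False m by (simp add: mulR_def w word_slope_simps algebra_simps)
      fix y assume y: "twisted y" and nz: "\<And>b s. (b, s) \<in> set (w # ws) \<Longrightarrow> 1 + y * b \<noteq> 0"
      have nz': "1 + y * b \<noteq> 0" using nz[of b s] w by simp
      have evy: "word_eval y ws * peval y n g = peval y n f"
        by (rule ev[OF y]) (use nz in \<open>meson list.set_intros(2)\<close>)
      have "word_eval y (w # ws) * peval y (Suc n) (mulR g p) =
          inverse (1 + y * b) * (word_eval y ws * peval y n g) * (1 + y * p)"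
        using False peval_mulR[OF fg(2) p(1) y] by (simp add: w mult.assoc)
      also have "\<dots> = inverse (1 + y * b) * peval y (Suc n) (mulR f p)"
        by (simp only: evy peval_mulR[OF fg(1) p(1) y] mult.assoc)
      also have "\<dots> = inverse (1 + y * b) * (1 + y * b) * peval y n h"
        using peval_mulL[OF p(2) b y] p(5) by (simp add: mult.assoc)
      also have "\<dots> = peval y (Suc n) h"
        using nz' peval_mono[OF p(2), of "Suc n" y] by simp
      finally show "word_eval y (w # ws) * peval y (Suc n) (mulR g p) = peval y (Suc n) h" .
    qed (use fg p in \<open>auto simp: mulR_def\<close>)
  qed
qed

end

subsection \<open>Infinitely many central values\<close>

text \<open>Synthetic division by \<open>t - t0\<close> preserves the leading coefficient, so that a root can be split off at
  each of infinitely many commuting values.\<close>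

lemma synthetic_division:
  fixes f :: "nat \<Rightarrow> 'a::division_ring"
  assumes "div_subring R" "\<And>i. f i \<in> R" "t0 \<in> R"
  obtains q r where "\<And>i. q i \<in> R" "q n = f (Suc n)"
    "\<And>t. (\<And>a. a \<in> R \<Longrightarrow> t * a = a * t) \<Longrightarrow> peval t (Suc n) f = (t - t0) * peval t n q + r"
  using assms(2)
proof (induction n arbitrary: f thesis)
  case 0
  show ?case
    by (rule 0(1)[of "\<lambda>_. f 1" "f 0 + t0 * f 1"])
      (use 0(2) in \<open>auto simp: peval_def algebra_simps\<close>)
next
  case (Suc n)
  obtain q r where q: "\<And>i. q i \<in> R" "q n = f (Suc (Suc n))" and
    ev: "\<And>t. (\<And>a. a \<in> R \<Longrightarrow> t * a = a * t) \<Longrightarrow>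
      peval t (Suc n) (\<lambda>i. f (Suc i)) = (t - t0) * peval t n q + r"
    by (rule Suc.IH[of "\<lambda>i. f (Suc i)"]) (use Suc.prems in auto)
  have split: "peval t (Suc k) f = f 0 + t * peval t k (\<lambda>i. f (Suc i))" for t k and f :: "nat \<Rightarrow> 'a"
    unfolding peval_def by (subst sum.atMost_Suc_shift) (simp add: sum_distrib_left mult.assoc)
  have r: "r \<in> R"
  proof -
    have "t0 * a = a * t0 \<Longrightarrow> True" for a by simp
    have "\<And>a. a \<in> R \<Longrightarrow> 0 * a = a * (0::'a)" by simp
    from ev[OF this] have "r = peval 0 (Suc n) (\<lambda>i. f (Suc i)) + t0 * peval 0 n q" by simp
    then show ?thesis unfolding peval_def
      using Suc.prems(2) q assms
      by (auto intro!: div_subringD[OF assms(1)] div_subring_sum[OF assms(1)] div_subring_power[OF assms(1)])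
  qed
  show ?case
  proof (rule Suc.prems(1)[of "\<lambda>i. case i of 0 \<Rightarrow> r | Suc j \<Rightarrow> q j" "f 0 + t0 * r"])
    fix t assume t: "\<And>a. a \<in> R \<Longrightarrow> t * a = a * t"
    have c: "t * (t - t0) = (t - t0) * t" using t[OF assms(3)] by (simp add: algebra_simps)
    have "peval t (Suc (Suc n)) f = f 0 + t * ((t - t0) * peval t n q + r)"
      using ev[OF t] by (simp add: split)
    also have "t * ((t - t0) * peval t n q) = (t - t0) * (t * peval t n q)"
      by (simp only: mult.assoc[symmetric] c)
    then have "f 0 + t * ((t - t0) * peval t n q + r) = (t - t0) * (r + t * peval t n q) + (f 0 + t0 * r)"
      by (simp add: algebra_simps)
    finally show "peval t (Suc (Suc n)) f = (t - t0) * peval t (Suc n) (\<lambda>i. case i of 0 \<Rightarrow> r | Suc j \<Rightarrow> q j)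
        + (f 0 + t0 * r)" by (simp add: split)
  qed (use q r in \<open>auto split: nat.split\<close>)
qed

lemma peval_zero_imp_coeffs_zero:
  fixes f :: "nat \<Rightarrow> 'a::division_ring"
  assumes R: "div_subring R" and f: "\<And>i. f i \<in> R" and Y: "infinite Y" "Y \<subseteq> R"
    "\<And>t a. t \<in> Y \<Longrightarrow> a \<in> R \<Longrightarrow> t * a = a * t" and z: "\<And>t. t \<in> Y \<Longrightarrow> peval t n f = 0"
  shows "\<forall>i\<le>n. f i = 0"
  using f Y z
proof (induction n arbitrary: f Y)
  case 0
  then obtain t where "t \<in> Y" by (metis finite.emptyI all_not_in_conv)
  then show ?case using 0(5) by (auto simp: peval_def)
next
  case (Suc n)
  obtain t0 where t0: "t0 \<in> Y" using Suc.prems by (metis finite.emptyI all_not_in_conv)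
  obtain q r where q: "\<And>i. q i \<in> R" "q n = f (Suc n)" and
    ev: "\<And>t. (\<And>a. a \<in> R \<Longrightarrow> t * a = a * t) \<Longrightarrow> peval t (Suc n) f = (t - t0) * peval t n q + r"
    using synthetic_division[OF R, of f t0 n] Suc.prems t0 by blast
  have "r = 0" using ev[of t0] Suc.prems(4,5) t0 by simp
  then have "peval t n q = 0" if "t \<in> Y - {t0}" for t
    using ev[of t] Suc.prems(4,5) that by auto
  then have "\<forall>i\<le>n. q i = 0"
    by (intro Suc.IH[of q "Y - {t0}"]) (use q Suc.prems in auto)
  then have fn: "f (Suc n) = 0" using q by auto
  then have "\<forall>i\<le>n. f i = 0"
    by (intro Suc.IH[of f Y]) (use Suc.prems fn in \<open>auto simp: peval_def\<close>)
  then show ?case using fn le_Suc_eq by auto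
qed

lemma finite_roots_of_unity:
  assumes P: "div_subring P" "P \<subseteq> centralizer P" and n: "n > 0"
  shows "finite {z \<in> P. z ^ n = 1}"
proof (rule ccontr)
  assume inf: "infinite {z \<in> P. z ^ n = 1}"
  define f :: "nat \<Rightarrow> 'a" where "f = (\<lambda>i. if i = 0 then - 1 else if i = n then 1 else 0)"
  have "peval z n f = z ^ n - 1" for z
  proof -
    have "peval z n f = (\<Sum>i\<in>{0,n}. z ^ i * f i)"
      unfolding peval_def by (rule sum.mono_neutral_right) (auto simp: f_def)
    then show ?thesis using n by (simp add: f_def)
  qed
  then have "\<forall>i\<le>n. f i = 0"
    using P by (intro peval_zero_imp_coeffs_zero[OF P(1) _ inf])
      (auto simp: f_def centralizer_def intro: div_subringD[OF P(1)])
  then show False by (auto simp: f_def)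
qed

text \<open>Uniqueness of the fraction: if a word is a fraction \<open>f g\<inverse>\<close> at infinitely many central values,
  peeling off its factors one by one, with \<open>ore_linear\<close> for the positive ones, turns
  the relation into an identity of polynomials, and the slope can be read off.\<close>

lemma word_fraction_unique:
  fixes R :: "'a::division_ring set"
  assumes R: "div_subring R" and Y: "infinite Y" "Y \<subseteq> R" "\<And>t a. t \<in> Y \<Longrightarrow> a \<in> R \<Longrightarrow> t * a = a * t"
    and ws: "\<And>b s. (b, s) \<in> set ws \<Longrightarrow> b \<in> R"
    and nz: "\<And>t b s. t \<in> Y \<Longrightarrow> (b, s) \<in> set ws \<Longrightarrow> 1 + t * b \<noteq> 0"
    and fg: "twisted_poly.poly R n f" "twisted_poly.poly R n g" "g 0 = 1"
    and ev: "\<And>t. t \<in> Y \<Longrightarrow> word_eval t ws * peval t n g = peval t n f"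
  shows "f 0 = 1 \<and> f 1 - g 1 = word_slope ws"
proof -
  interpret twisted_poly R 1 by unfold_locales (use R in auto)
  have tw: "twisted t" if "t \<in> Y" for t using Y(3)[OF that] by (auto simp: twisted_def)
  show ?thesis using ws nz fg ev
  proof (induction ws arbitrary: n f g)
    case Nil
    have "\<forall>i\<le>n. (\<lambda>i. f i - g i) i = 0"
      using Nil.prems R Y by (intro peval_zero_imp_coeffs_zero[OF R _ Y])
        (auto simp: poly_def peval_def algebra_simps sum_subtractf intro: div_subringD)
    then have "f i = g i" for i using Nil.prems by (cases "i \<le> n") (auto simp: poly_def)
    then show ?case using Nil.prems by (simp add: word_slope_simps)
  next
    case (Cons w ws)
    obtain b s where w: "w = (b, s)" by force
    have b: "b \<in> R" and nzb: "\<And>t. t \<in> Y \<Longrightarrow> 1 + t * b \<noteq> 0"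
      using Cons.prems(1)[of b s] Cons.prems(2)[of _ b s] w by auto
    show ?case
    proof (cases s)
      case True
      obtain p h where p: "p \<in> R" "poly n h" "h 0 = f 0" "h 1 = f 1 + cj 1 (f 0) * p - b * f 0"
        "mulR f p = mulL b h" using ore_linear[OF Cons.prems(3) b] by blast
      have "h 0 = 1 \<and> h 1 - mulR g p 1 = word_slope ws"
      proof (rule Cons.IH[of "Suc n"])
        show "poly (Suc n) h" "poly (Suc n) (mulR g p)" "mulR g p 0 = 1"
          using Cons.prems p poly_mulR[of n g p] by (auto intro: poly_mono simp: mulR_def)
        fix t assume t: "t \<in> Y"
        have "(1 + t * b) * (word_eval t ws * peval t (Suc n) (mulR g p)) = (1 + t * b) * peval t (Suc n) h"
          using Cons.prems(6)[OF t] True peval_mulR[OF Cons.prems(4) p(1) tw[OF t]]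
            peval_mulR[OF Cons.prems(3) p(1) tw[OF t]] peval_mulL[OF p(2) b tw[OF t]] p(5)
            peval_mono[OF p(2), of "Suc n" t]
          by (simp add: w mult.assoc[symmetric])
        then show "word_eval t ws * peval t (Suc n) (mulR g p) = peval t (Suc n) h"
          using nzb[OF t] by simp
      qed (use Cons.prems(1,2) in \<open>meson list.set_intros(2)\<close>)+
      then show ?thesis using p Cons.prems True by (simp add: w word_slope_simps mulR_def algebra_simps)
    next
      case False
      have "mulL b f 0 = 1 \<and> mulL b f 1 - g 1 = word_slope ws"
      proof (rule Cons.IH[of "Suc n"])
        show "poly (Suc n) (mulL b f)" "poly (Suc n) g"
          using Cons.prems b by (auto intro: poly_mulL poly_mono)
        fix t assume t: "t \<in> Y"
        have "(1 + t * b) * (inverse (1 + t * b) * (word_eval t ws * peval t n g)) = (1 + t * b) * peval t n f"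
          using Cons.prems(6)[OF t] False by (simp add: w mult.assoc)
        then show "word_eval t ws * peval t (Suc n) g = peval t (Suc n) (mulL b f)"
          using nzb[OF t] peval_mulL[OF Cons.prems(3) b tw[OF t]] peval_mono[OF Cons.prems(4), of "Suc n" t]
          by (simp add: mult.assoc[symmetric])
      qed (use Cons.prems(1,2,5) in \<open>meson list.set_intros(2)\<close>)+
      then show ?thesis using Cons.prems False by (auto simp: w word_slope_simps mulL_def algebra_simps)
    qed
  qed
qed

section \<open>Nilpotent commutator operators\<close>

lemma char_cases:
  obtains (zero) "\<And>n. n > 0 \<Longrightarrow> (of_nat n :: 'a::division_ring) \<noteq> 0"
  | (prime) p where "Factorial_Ring.prime p" "of_nat p = (0 :: 'a)"
proof (cases "CHAR('a) = 0")
  case True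
  then show ?thesis using zero by (simp add: of_nat_eq_0_iff_char_dvd)
next
  case False
  have "Factorial_Ring.prime CHAR('a)"
  proof (rule prime_natI)
    show "CHAR('a) \<ge> 2"
    proof (rule ccontr)
      assume "\<not> ?thesis"
      then have "CHAR('a) dvd 1" using False by (cases "CHAR('a) = 1") auto
      then show False by (metis of_nat_1 of_nat_eq_0_iff_char_dvd zero_neq_one)
    qed
    fix a b assume "CHAR('a) dvd a * b"
    then have "of_nat a * of_nat b = (0::'a)" by (metis of_nat_eq_0_iff_char_dvd of_nat_mult)
    then show "CHAR('a) dvd a \<or> CHAR('a) dvd b" by (simp add: of_nat_eq_0_iff_char_dvd)
  qed
  then show ?thesis using prime[of "CHAR('a)"] by simp
qed

lemma power_mult_commuting:
  fixes a b :: "'a::monoid_mult"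
  assumes "a * b = b * a"
  shows "(a * b) ^ n = a ^ n * b ^ n"
proof (induction n)
  case (Suc n)
  have "(a * b) ^ Suc n = a * (b * a ^ n) * b ^ n" using Suc by (simp add: mult.assoc)
  also have "b * a ^ n = a ^ n * b" using power_commuting_commutes[OF assms, of n] by simp
  finally show ?case by (simp add: mult.assoc)
qed simp

lemma dl_simps [simp]: "dl x 0 = 0" "dl x x = 0"
  by (auto simp: dl_def)

lemma dl_add: "dl x (a + b) = dl x a + dl x b"
  and dl_diff: "dl x (a - b) = dl x a - dl x b"
  by (auto simp: dl_def cj_add cj_diff)

lemma dl_eq_0_iff: "x \<noteq> 0 \<Longrightarrow> dl x d = 0 \<longleftrightarrow> x * d = d * x"
  by (metis cj_eq_iff dl_def eq_iff_diff_eq_0)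

lemma dl_mult: "x \<noteq> 0 \<Longrightarrow> dl x (a * b) = a * dl x b + dl x a * cj x b"
  by (simp add: dl_def cj_mult algebra_simps)

lemma dl_mult_left: "x \<noteq> 0 \<Longrightarrow> x * a = a * x \<Longrightarrow> dl x (a * b) = a * dl x b"
  by (simp add: dl_mult dl_eq_0_iff[symmetric])

lemma dl_pow_mult_left: "x \<noteq> 0 \<Longrightarrow> x * a = a * x \<Longrightarrow> (dl x ^^ n) (a * b) = a * (dl x ^^ n) b"
  by (induction n) (auto simp: dl_mult_left)

lemma dl_pow_0 [simp]: "(dl x ^^ n) 0 = 0"
  by (induction n) auto

lemma dl_pow_add: "(dl x ^^ n) (a + b) = (dl x ^^ n) a + (dl x ^^ n) b"
  by (induction n) (auto simp: dl_add)

lemma dl_pow_in: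
  "div_subring K \<Longrightarrow> (\<And>k. k \<in> K \<Longrightarrow> cj x k \<in> K) \<Longrightarrow> k \<in> K \<Longrightarrow> (dl x ^^ n) k \<in> K"
  by (induction n) (auto simp: dl_def div_subringD(5))

lemma dl_pow_ge:
  assumes "(dl x ^^ n) k = 0" "n \<le> m"
  shows "(dl x ^^ m) k = 0"
proof -
  have "(dl x ^^ (m - n + n)) k = (dl x ^^ (m - n)) ((dl x ^^ n) k)"
    by (simp only: funpow_add o_apply)
  then show ?thesis using assms by simp
qed

text \<open>Iterated differences of a sequence; in characteristic \<open>p\<close> the \<open>p\<close>-th one has only its
  two extreme terms. This is the freshman's dream for two commuting operators.\<close>

lemma iterated_difference:
  fixes Z :: "nat \<Rightarrow> nat \<Rightarrow> 'a::division_ring"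
  assumes Z: "\<And>n j. Z (Suc n) j = Z n j - Z n (Suc j)"
  shows "Z n j = (\<Sum>k\<le>n. of_int ((-1) ^ k * int (n choose k)) * Z 0 (j + k))"
proof (induction n arbitrary: j)
  case (Suc n)
  define c where "c = (\<lambda>n k. of_int ((-1) ^ k * int (n choose k)) :: 'a)"
  have c: "c (Suc n) (Suc k) = c n (Suc k) - c n k" for k
    by (simp add: c_def algebra_simps)
  have c0: "c n (Suc n) = 0" "c (Suc n) 0 = c n 0" by (simp_all add: c_def binomial_eq_0)
  have "(\<Sum>k\<le>Suc n. c (Suc n) k * Z 0 (j + k)) =
      c n 0 * Z 0 j + (\<Sum>k\<le>n. c n (Suc k) * Z 0 (j + Suc k)) - (\<Sum>k\<le>n. c n k * Z 0 (j + Suc k))"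
    by (subst sum.atMost_Suc_shift) (simp add: c c0 algebra_simps sum_subtractf)
  also have "c n 0 * Z 0 j + (\<Sum>k\<le>n. c n (Suc k) * Z 0 (j + Suc k)) = (\<Sum>k\<le>Suc n. c n k * Z 0 (j + k))"
    by (subst sum.atMost_Suc_shift) simp
  also have "\<dots> = (\<Sum>k\<le>n. c n k * Z 0 (j + k))" by (simp add: c0)
  finally show ?case using Suc.IH[of j] Suc.IH[of "Suc j"] Z[of n j] by (simp add: c_def)
qed simp

lemma iterated_difference_prime:
  fixes Z :: "nat \<Rightarrow> nat \<Rightarrow> 'a::division_ring"
  assumes Z: "\<And>n j. Z (Suc n) j = Z n j - Z n (Suc j)" and p: "Factorial_Ring.prime p" "of_nat p = (0::'a)"
  shows "Z p 0 = Z 0 0 - Z 0 p"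
proof -
  define c where "c = (\<lambda>k. of_int ((-1) ^ k * int (p choose k)) :: 'a)"
  have c: "c k = 0" if "k \<noteq> 0" "k < p" for k
  proof -
    have "p dvd p choose k" by (rule dvd_choose_prime) (use that p in auto)
    then obtain q where "p choose k = p * q" by blast
    then show ?thesis using p by (simp add: c_def)
  qed
  have cp: "c p = - 1"
  proof (cases "p = 2")
    case True
    then have "(1 :: 'a) + 1 = 0" using p by simp
    then have "(1 :: 'a) = - 1" by (simp only: eq_neg_iff_add_eq_0)
    then show ?thesis using True by (simp add: c_def)
  next
    case False
    then have "odd p" using p prime_odd_nat[of p] prime_ge_2_nat[of p] by linarith
    then show ?thesis by (simp add: c_def)
  qed
  have p0: "p \<noteq> 0" using p by auto
  have "Z p 0 = (\<Sum>k\<le>p. c k * Z 0 k)" using iterated_difference[of Z p 0, OF Z] by (simp add: c_def)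
  also have "\<dots> = (\<Sum>k\<in>{0, p}. c k * Z 0 k)"
    by (rule sum.mono_neutral_right) (use c in \<open>auto\<close>)
  also have "\<dots> = Z 0 0 - Z 0 p" using p0 cp by (simp add: c_def)
  finally show ?thesis .
qed

lemma dl_pow_prime:
  fixes x :: "'a::division_ring"
  assumes p: "Factorial_Ring.prime p" "of_nat p = (0::'a)" and x: "x \<noteq> 0"
  shows "dl x ^^ p = dl (x ^ p)"
proof
  fix d
  define Z where "Z = (\<lambda>n j. cj (x ^ j) ((dl x ^^ n) d))"
  have "Z (Suc n) j = Z n j - Z n (Suc j)" for n j
    by (simp add: Z_def dl_def cj_diff cj_cj power_commutes)
  from iterated_difference_prime[of Z p, OF this p] show "(dl x ^^ p) d = dl (x ^ p) d"
    by (simp add: Z_def dl_def)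
qed

lemma dl_pow_prime_power:
  fixes x :: "'a::division_ring"
  assumes p: "Factorial_Ring.prime p" "of_nat p = (0::'a)" and x: "x \<noteq> 0"
  shows "dl x ^^ (p ^ s) = dl (x ^ (p ^ s))"
proof (induction s)
  case (Suc s)
  have "dl x ^^ (p ^ Suc s) = (dl x ^^ (p ^ s)) ^^ p"
    by (simp add: funpow_mult mult.commute)
  also have "\<dots> = dl (x ^ p ^ Suc s)"
    using Suc x by (simp add: dl_pow_prime[OF p] power_mult[symmetric] mult.commute)
  finally show ?case .
qed simp

text \<open>In characteristic \<open>p\<close> one has \<open>(1 - c)\<^sup>q = 1 - c\<^sup>q\<close> for \<open>q = p\<^sup>s\<close>.\<close>

lemma prime_root_of_unity:
  fixes c :: "'a::division_ring"
  assumes p: "Factorial_Ring.prime p" "of_nat p = (0::'a)" and c: "c ^ (p ^ s) = 1"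
  shows "c = 1"
proof -
  have *: "c = 1" if "c ^ p = 1" for c :: 'a
  proof -
    define Z where "Z = (\<lambda>n j. (1 - c) ^ n * c ^ j)"
    have "Z (Suc n) j = Z n j - Z n (Suc j)" for n j
      by (simp add: Z_def power_Suc2 algebra_simps del: power_Suc) (simp add: algebra_simps power_commutes)
    from iterated_difference_prime[of Z p, OF this p] have "(1 - c) ^ p = 0"
      using that by (simp add: Z_def)
    then show ?thesis by simp
  qed
  show ?thesis using c
  proof (induction s arbitrary: c)
    case (Suc s)
    have "(c ^ p) ^ (p ^ s) = 1" using Suc.prems by (simp add: power_mult)
    then have "c ^ p = 1" by (rule Suc.IH)
    then show ?case by (rule *)
  qed simp
qed

text \<open>A nilpotent \<open>dl x\<close> that is not zero produces some \<open>g\<close> with \<open>x g x\<inverse> = g - 1\<close>, the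
  first two steps of a Jordan chain.\<close>

lemma nilpotent_dl_unipotent_element:
  assumes K: "div_subring K" "\<And>k. k \<in> K \<Longrightarrow> cj x k \<in> K" and x: "x \<noteq> 0"
    and nil: "\<And>k. k \<in> K \<Longrightarrow> (dl x ^^ N) k = 0" and k: "k \<in> K" "x * k \<noteq> k * x"
  obtains g where "g \<in> K" "cj x g = g - 1"
proof -
  define n where "n = (LEAST n. (dl x ^^ n) k = 0)"
  have n: "(dl x ^^ n) k = 0" unfolding n_def by (rule LeastI) (rule nil[OF k(1)])
  have min: "(dl x ^^ j) k \<noteq> 0" if "j < n" for j using not_less_Least that n_def by auto
  have "n \<noteq> 0" using n k by (metis funpow_0 mult_zero_left mult_zero_right)
  moreover have "n \<noteq> 1" using n k x dl_eq_0_iff[of x k] by auto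
  ultimately
  obtain j where j: "n = Suc (Suc j)" by (metis One_nat_def not0_implies_Suc)
  define e where "e = (dl x ^^ j) k"
  define f where "f = dl x e"
  have e: "e \<in> K" unfolding e_def by (rule dl_pow_in[OF K k(1)])
  have f: "f \<noteq> 0" using min[of "Suc j"] j by (simp add: f_def e_def)
  have "dl x f = 0" using n j by (simp add: f_def e_def)
  then have "x * f = f * x" using x by (simp add: dl_eq_0_iff)
  then have "x * inverse f = inverse f * x" using inverse_commute[of f x] by simp
  then have "dl x (inverse f * e) = 1" using dl_mult_left[OF x] f by (simp add: f_def)
  then have "cj x (inverse f * e) = inverse f * e - 1" by (simp add: dl_def algebra_simps)
  moreover have "inverse f * e \<in> K"
    using dl_pow_in[OF K e, of 1] e by (auto simp: f_def intro!: div_subringD[OF K(1)])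
  ultimately show ?thesis using that by blast
qed

text \<open>In characteristic \<open>0\<close> the rising factorials of \<open>g\<close> contradict nilpotency. In characteristic
  \<open>p\<close> conjugation by \<open>x\<close> has order \<open>p\<close> on the commuting translates of \<open>g\<close>, and there a
  multiplicatively unipotent action is trivial because \<open>1\<close> is the only \<open>p\<close>-th root of unity.\<close>

lemma no_unipotent_element_char_0:
  fixes x g :: "'a::division_ring"
  assumes char: "\<And>n. n > 0 \<Longrightarrow> (of_nat n :: 'a) \<noteq> 0" and x: "x \<noteq> 0" and g: "cj x g = g - 1"
    and K: "div_subring K" "g \<in> K" and nil: "\<And>k. k \<in> K \<Longrightarrow> (dl x ^^ N) k = 0"
  shows False
proof -
  define q where "q = rec_nat (1::'a) (\<lambda>j a. a * (g + of_nat j))"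
  have q0: "q 0 = 1" and qS: "q (Suc j) = q j * (g + of_nat j)" for j by (simp_all add: q_def)
  have qK: "q j \<in> K" for j
    by (induction j) (auto simp: q0 qS intro!: div_subringD[OF K(1)] K div_subring_of_nat)
  have of_nat_comm: "of_nat j * a = a * (of_nat j :: 'a)" for j a by (rule mult_of_nat_commute)
  have C: "div_subring (centralizer {g})" by simp
  have gC: "g \<in> centralizer {g}" by (simp add: centralizer_def)
  have "q j \<in> centralizer {g}" for j
    by (induction j) (auto simp: q0 qS intro!: div_subringD[OF C] div_subring_of_nat[OF C] gC)
  then have comm: "q j * g = g * q j" for j by (simp add: centralizer_def)
  have cj_of_nat: "cj x (of_nat j) = of_nat j" for j
    using x of_nat_comm[of j x] by (simp add: cj_eq_iff)
  have tau: "cj x (q (Suc j)) = (g - 1) * q j" for j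
  proof (induction j)
    case 0
    show ?case using x g by (simp add: q0 qS)
  next
    case (Suc j)
    have "cj x (q (Suc (Suc j))) = (g - 1) * q j * (g - 1 + of_nat (Suc j))"
      unfolding qS[of "Suc j"] cj_mult[OF x] cj_add g cj_of_nat Suc ..
    moreover have "g - 1 + of_nat (Suc j) = g + of_nat j" by simp
    ultimately show ?case by (simp only: qS[of j] mult.assoc)
  qed
  have "dl x (q (Suc j)) = of_nat (Suc j) * q j" for j
    unfolding dl_def tau using comm[of j] of_nat_comm[of j "q j"] by (simp add: qS algebra_simps)
  then have "(dl x ^^ Suc j) (q (Suc j)) = of_nat (Suc j) * (dl x ^^ j) (q j)" for j
    using dl_pow_mult_left[OF x of_nat_comm[symmetric], of j "Suc j" "q j"]
    by (simp add: funpow_swap1)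
  then have "(dl x ^^ j) (q j) = of_nat (fact j)" for j
    by (induction j) (simp_all add: q0 algebra_simps del: funpow.simps(2))
  moreover have "(of_nat (fact N) :: 'a) \<noteq> 0" by (rule char) simp
  ultimately show False using nil[OF qK[of N]] by simp
qed

lemma no_unipotent_element_char_p:
  fixes x g :: "'a::division_ring"
  assumes p: "Factorial_Ring.prime p" "of_nat p = (0::'a)" and x: "x \<noteq> 0" and g: "cj x g = g - 1"
    and r: "(iter_comm x r g) ^ (p ^ s) * x = x * (iter_comm x r g) ^ (p ^ s)"
  shows False
proof -
  define Y where "Y = centralizer (centralizer {g})"
  have Y: "div_subring Y" by (simp add: Y_def)
  have gX: "g \<in> Y" by (auto simp: Y_def centralizer_def)
  have "Y \<subseteq> centralizer {g}" unfolding Y_def by (rule centralizer_antimono) (auto simp: centralizer_def)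
  then have comm: "z * z' = z' * z" if "z \<in> Y" "z' \<in> Y" for z z'
  proof -
    have "z' \<in> centralizer {g}" using \<open>Y \<subseteq> centralizer {g}\<close> that by blast
    with that(1) show ?thesis unfolding Y_def by (rule centralizerD)
  qed
  have tau: "cj x z \<in> Y" if z: "z \<in> Y" for z
  proof -
    have *: "cj x z * d = d * cj x z" if d: "d * g = g * d" for d
    proof -
    define d' where "d' = cj (inverse x) d"
    have dd: "cj x d' = d" using x by (simp add: d'_def)
    have "cj x (d' * g) = cj x (g * d')"
      using d by (simp add: cj_mult[OF x] dd g algebra_simps)
    then have "d' * g = g * d'" using x by (simp add: cj_inj)
    then have "d' \<in> centralizer {g}" by (simp add: centralizer_def)
    with z have "z * d' = d' * z" unfolding Y_def by (rule centralizerD)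
    then have "cj x (z * d') = cj x (d' * z)" by (rule arg_cong)
    then show ?thesis by (simp only: cj_mult[OF x] dd)
    qed
    then show ?thesis unfolding Y_def centralizer_def[of "centralizer {g}"]
      by (auto dest: centralizerD)
  qed
  have "cj (x ^ n) g = g - of_nat n" for n
  proof (induction n)
    case (Suc n)
    have "cj x (of_nat n) = of_nat n"
      using x mult_of_nat_commute[of n x] by (simp add: cj_eq_iff)
    then show ?case using Suc g by (simp add: cj_cj[symmetric] cj_diff)
  qed simp
  then have "cj (x ^ p) g = g" using p by simp
  then have "x ^ p \<in> centralizer {g}" using x by (auto simp: centralizer_def cj_eq_iff)
  then have xp: "cj (x ^ p) z = z" if "z \<in> Y" for z
    using centralizerD[of z "centralizer {g}" "x ^ p"] that x by (simp add: Y_def cj_eq_iff)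
  define w where "w = (\<lambda>n. iter_comm x n g)"
  have wX: "w n \<in> Y" for n unfolding w_def by (rule iter_comm_in[OF Y gX tau])
  have g0: "g \<noteq> 0" using g by auto
  have w0: "w n \<noteq> 0" for n unfolding w_def by (rule iter_comm_nonzero[OF x g0])
  have wS: "w (Suc n) = w n * inverse (cj x (w n))" for n by (simp add: w_def)
  \<comment> \<open>powers of a quotient of commuting elements\<close>
  have quot_pow: "(a * inverse b) ^ n = a ^ n * inverse b ^ n" if "a \<in> Y" "b \<in> Y" for a b n
  proof -
    have "inverse b * a = a * inverse b" by (rule comm) (use that Y in \<open>auto intro: div_subringD\<close>)
    then show ?thesis by (intro power_mult_commuting) simp
  qed
  have "cj x (w r ^ (p ^ s)) = w r ^ (p ^ s)" using r x by (simp add: cj_eq_iff w_def)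
  then have "w (Suc r) ^ (p ^ s) = 1"
    unfolding wS quot_pow[OF wX tau[OF wX]] power_inverse
    using x w0[of r] by (simp add: cj_power)
  then have "w (Suc r) = 1" by (rule prime_root_of_unity[OF p])
  moreover have "w (Suc n) = 1" if "w (Suc (Suc n)) = 1" for n
  proof -
    define c where "c = w (Suc n)"
    have "c * inverse (cj x c) = 1" using that unfolding wS[of "Suc n"] c_def .
    then have "cj x c = c" by (metis inverse_unique inverse_inverse_eq)
    then have tc: "cj x (inverse c) = inverse c" using x by (simp add: cj_inverse)
    have cX: "c \<in> Y" unfolding c_def by (rule wX)
    have "c \<noteq> 0" unfolding c_def by (rule w0)
    have "c * cj x (w n) = w n" using x w0[of n] by (simp add: c_def wS mult.assoc)
    then have "inverse c * (c * cj x (w n)) = inverse c * w n" by simp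
    then have t: "cj x (w n) = inverse c * w n" using \<open>c \<noteq> 0\<close> by (simp add: mult.assoc[symmetric])
    have "cj (x ^ k) (w n) = inverse c ^ k * w n" for k
    proof (induction k)
      case (Suc k)
      have "cj (x ^ Suc k) (w n) = cj x (inverse c ^ k * w n)"
        by (simp only: power_Suc cj_cj[symmetric] Suc)
      also have "\<dots> = inverse c ^ k * (inverse c * w n)"
        unfolding cj_mult[OF x] cj_power[OF x] tc t ..
      also have "\<dots> = inverse c ^ Suc k * w n"
        by (simp only: power_Suc2 mult.assoc)
      finally show ?case .
    qed simp
    from this[of p] have "inverse c ^ p * w n = 1 * w n" using xp[OF wX] by simp
    then have "inverse c ^ p = 1" using w0[of n] by (metis mult_right_cancel)
    then have "inverse c ^ (p ^ 1) = 1" by simp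
    from prime_root_of_unity[OF p this] have "inverse (inverse c) = inverse 1" by simp
    then show ?thesis by (simp only: c_def inverse_inverse_eq inverse_1)
  qed
  ultimately have "w (Suc 0) = 1" by (induction r) auto
  then have "g * inverse (cj x g) = 1" by (simp add: w_def)
  then have "cj x g = g" using g0 x by (metis inverse_unique inverse_inverse_eq)
  then show False using g by simp
qed

text \<open>A nonzero nilpotent \<open>dl x\<close> yields an element \<open>g\<close> that both lemmas on unipotent elements exclude. The
  hypothesis in characteristic \<open>p\<close> is what a subnormal chain provides: brackets of \<open>g\<close> with \<open>x\<close> end in the
  subgroup and there commute with a power of \<open>x\<close> or with \<open>x\<close> itself.\<close>

lemma nilpotent_dl_trivial:
  fixes x :: "'a::division_ring"
  assumes K: "div_subring K" "\<And>k. k \<in> K \<Longrightarrow> cj x k \<in> K" and x: "x \<noteq> 0"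
    and nil: "\<And>k. k \<in> K \<Longrightarrow> (dl x ^^ N) k = 0"
    and char_p: "\<And>p g. Factorial_Ring.prime p \<Longrightarrow> of_nat p = (0::'a) \<Longrightarrow> g \<in> K \<Longrightarrow> g \<noteq> 0 \<Longrightarrow>
      \<exists>r s. (iter_comm x r g) ^ (p ^ s) * x = x * (iter_comm x r g) ^ (p ^ s)"
    and k: "k \<in> K"
  shows "x * k = k * x"
proof (rule ccontr)
  assume "x * k \<noteq> k * x"
  then obtain g where g: "g \<in> K" "cj x g = g - 1"
    using nilpotent_dl_unipotent_element[OF K x nil k] by blast
  then have "g \<noteq> 0" by auto
  show False
  proof (rule char_cases[where 'a = 'a])
    assume "\<And>n. n > 0 \<Longrightarrow> (of_nat n :: 'a) \<noteq> 0"
    then show False by (rule no_unipotent_element_char_0[OF _ x g(2) K(1) g(1) nil])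
  next
    fix p assume p: "Factorial_Ring.prime p" "of_nat p = (0::'a)"
    then show False
      using char_p[OF p g(1) \<open>g \<noteq> 0\<close>] no_unipotent_element_char_p[OF p x g(2)] by blast
  qed
qed

section \<open>Subnormal subgroups when the center is infinite\<close>

lemma comm_word_factors_nonzero:
  assumes W: "div_subring W" and x: "x \<in> W" "x \<noteq> 0" and u: "u \<in> W"
    and Y: "\<And>t a. t \<in> Y \<Longrightarrow> a \<in> W \<Longrightarrow> t * a = a * t" "\<And>t. t \<in> Y \<Longrightarrow> 1 + t * u \<noteq> 0"
    and b: "(b, s) \<in> set (comm_word x n u)"
  shows "b \<in> W" "t \<in> Y \<Longrightarrow> 1 + t * b \<noteq> 0"
proof -
  have "b \<in> {b \<in> W. \<forall>t\<in>Y. 1 + t * b \<noteq> 0}"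
  proof (rule comm_word_letters[OF _ _ b])
    fix b assume b: "b \<in> {b \<in> W. \<forall>t\<in>Y. 1 + t * b \<noteq> 0}"
    have "1 + t * cj x b \<noteq> 0" if t: "t \<in> Y" for t
    proof -
      have "cj x t = t" using Y(1)[OF t x(1)] x by (simp add: cj_eq_iff)
      then have "1 + t * cj x b = cj x (1 + t * b)" using x by (simp add: cj_add cj_mult)
      then show ?thesis using b t x by simp
    qed
    then show "cj x b \<in> {b \<in> W. \<forall>t\<in>Y. 1 + t * b \<noteq> 0}"
      using b x div_subringD(8)[OF W] by auto
  qed (use u Y in auto)
  then show "b \<in> W" "t \<in> Y \<Longrightarrow> 1 + t * b \<noteq> 0" by auto
qed

text \<open>Parameters \<open>t\<close> with \<open>t u = -1\<close> have to be avoided, and there is at most one of them.\<close>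

lemma infinite_invertible_parameters:
  fixes u :: "'a::division_ring"
  assumes "infinite T"
  shows "infinite {t \<in> T. 1 + t * u \<noteq> 0}"
proof -
  have "t = - inverse u" if "1 + t * u = 0" for t
  proof -
    have u: "u \<noteq> 0" using that by auto
    have "t = t * u * inverse u" using u by (simp add: mult.assoc)
    also have "t * u = - 1" using minus_unique[OF that] by (rule sym)
    finally show ?thesis by simp
  qed
  then have "T \<subseteq> insert (- inverse u) {t \<in> T. 1 + t * u \<noteq> 0}" by blast
  then show ?thesis using assms finite_subset by blast
qed

text \<open>First-order consequences of a commutator identity along the line \<open>1 + t u\<close>.\<close>

lemma dl_pow_eq_0_if_iter_comm_const:
  fixes W :: "'a::division_ring set"
  assumes W: "div_subring W" and T: "infinite T" "T \<subseteq> W" "\<And>t a. t \<in> T \<Longrightarrow> a \<in> W \<Longrightarrow> t * a = a * t"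
    and x: "x \<in> W" "x \<noteq> 0" and u: "u \<in> W" and k: "k \<in> W"
    and const: "\<And>t. t \<in> T \<Longrightarrow> 1 + t * u \<noteq> 0 \<Longrightarrow> iter_comm x n (1 + t * u) = k"
  shows "(dl x ^^ n) u = 0"
proof -
  interpret twisted_poly W 1 by unfold_locales (use W in auto)
  define Y where "Y = {t \<in> T. 1 + t * u \<noteq> 0}"
  have Y: "infinite Y" "Y \<subseteq> W" "\<And>t a. t \<in> Y \<Longrightarrow> a \<in> W \<Longrightarrow> t * a = a * t"
    "\<And>t. t \<in> Y \<Longrightarrow> 1 + t * u \<noteq> 0"
    using T infinite_invertible_parameters[OF T(1)] by (auto simp: Y_def)
  note nz = comm_word_factors_nonzero[OF W x u Y(3,4)]
  define f g :: "nat \<Rightarrow> 'a" where "f = (\<lambda>i. if i = 0 then k else 0)" and "g = (\<lambda>i. if i = 0 then 1 else 0)"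
  have "f 0 = 1 \<and> f 1 - g 1 = word_slope (comm_word x n u)"
  proof (rule word_fraction_unique[OF W Y(1-3), where n = 0])
    show "poly 0 f" "poly 0 g" using k div_subringD[OF W] by (auto simp: poly_def f_def g_def)
    fix t assume t: "t \<in> Y"
    have "cj x t = t" using Y(3)[OF t x(1)] x by (simp add: cj_eq_iff)
    then show "word_eval t (comm_word x n u) * peval t 0 g = peval t 0 f"
      using const t word_eval_comm_word[OF x(2)] by (simp add: peval_def f_def g_def Y_def)
  qed (use nz in \<open>auto simp: g_def\<close>)
  then show ?thesis by (simp add: word_slope_comm_word f_def g_def)
qed

text \<open>A \<open>K\<close>-linear functional that fixes \<open>1\<close>, restricted to finitely many vectors: the image of a new vector is
  forced if it depends on \<open>1\<close> and the earlier ones, and otherwise it may be \<open>0\<close>.\<close>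

lemma linear_functional_on_finite_family:
  fixes K :: "'a::division_ring set"
  assumes K: "div_subring K" and I: "finite I"
  shows "\<exists>c. (\<forall>i\<in>I. c i \<in> K) \<and> (\<forall>z r. z \<in> K \<and> (\<forall>i\<in>I. r i \<in> K) \<and> z + (\<Sum>i\<in>I. r i * v i) = 0 \<longrightarrow>
    z + (\<Sum>i\<in>I. r i * c i) = 0)"
  using I
proof (induction I)
  case empty
  show ?case by auto
next
  case (insert j I)
  then obtain c where c: "\<forall>i\<in>I. c i \<in> K" and rel: "\<And>z r. z \<in> K \<Longrightarrow> (\<forall>i\<in>I. r i \<in> K) \<Longrightarrow>
      z + (\<Sum>i\<in>I. r i * v i) = 0 \<Longrightarrow> z + (\<Sum>i\<in>I. r i * c i) = 0" by blast
  have sum_upd: "(\<Sum>i\<in>insert j I. r i * (c(j := d)) i) = r j * d + (\<Sum>i\<in>I. r i * c i)" for r d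
    using insert.hyps by (auto intro!: arg_cong2[where f = "(+)"] sum.cong)
  show ?case
  proof (cases "\<exists>z0 r0. z0 \<in> K \<and> (\<forall>i\<in>I. r0 i \<in> K) \<and> v j = z0 + (\<Sum>i\<in>I. r0 i * v i)")
    case True
    then obtain z0 r0 where 0: "z0 \<in> K" "\<forall>i\<in>I. r0 i \<in> K" "v j = z0 + (\<Sum>i\<in>I. r0 i * v i)" by blast
    define d where "d = z0 + (\<Sum>i\<in>I. r0 i * c i)"
    have dK: "d \<in> K" unfolding d_def
      using 0 c by (intro div_subringD[OF K] div_subring_sum[OF K]) auto
    have "z + (\<Sum>i\<in>insert j I. r i * (c(j := d)) i) = 0"
      if z: "z \<in> K" and r: "\<forall>i\<in>insert j I. r i \<in> K" and eq: "z + (\<Sum>i\<in>insert j I. r i * v i) = 0" for z r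
    proof -
      have "(z + r j * z0) + (\<Sum>i\<in>I. (r j * r0 i + r i) * v i) = 0"
        using eq insert.hyps 0(3)
        by (simp add: distrib_left distrib_right sum.distrib sum_distrib_left mult.assoc add_ac)
      then have "(z + r j * z0) + (\<Sum>i\<in>I. (r j * r0 i + r i) * c i) = 0"
        by (intro rel) (use z r 0 in \<open>auto intro!: div_subringD[OF K]\<close>)
      then show ?thesis unfolding sum_upd d_def
        by (simp add: distrib_left distrib_right sum.distrib sum_distrib_left mult.assoc add_ac)
    qed
    moreover have "\<forall>i\<in>insert j I. (c(j := d)) i \<in> K" using c dK by simp
    ultimately show ?thesis by blast
  next
    case False
    have "z + (\<Sum>i\<in>insert j I. r i * (c(j := 0)) i) = 0"
      if z: "z \<in> K" and r: "\<forall>i\<in>insert j I. r i \<in> K" and eq: "z + (\<Sum>i\<in>insert j I. r i * v i) = 0" for z r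
    proof -
      have "r j = 0"
      proof (rule ccontr)
        assume rj: "r j \<noteq> 0"
        have "r j * v j = (z + (\<Sum>i\<in>insert j I. r i * v i)) - z - (\<Sum>i\<in>I. r i * v i)"
          using insert.hyps by simp
        then have "r j * v j = - z - (\<Sum>i\<in>I. r i * v i)" unfolding eq by simp
        then have "inverse (r j) * (r j * v j) = inverse (r j) * (- z - (\<Sum>i\<in>I. r i * v i))" by simp
        then have "v j = - (inverse (r j) * z) + (\<Sum>i\<in>I. (- inverse (r j) * r i) * v i)"
          using rj by (simp add: mult.assoc[symmetric] right_diff_distrib sum_distrib_left sum_negf)
        moreover have "- (inverse (r j) * z) \<in> K" "\<forall>i\<in>I. - inverse (r j) * r i \<in> K"
          using z r by (auto intro!: div_subringD[OF K])
        ultimately have "\<exists>z0 r0. z0 \<in> K \<and> (\<forall>i\<in>I. r0 i \<in> K) \<and> v j = z0 + (\<Sum>i\<in>I. r0 i * v i)"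
          by (intro exI[of _ "- (inverse (r j) * z)"] exI[of _ "\<lambda>i. - inverse (r j) * r i"] conjI)
        with False show False ..
      qed
      then show ?thesis using rel[of z r] z r eq insert.hyps unfolding sum_upd by simp
    qed
    moreover have "\<forall>i\<in>insert j I. (c(j := 0)) i \<in> K" using c div_subringD(1)[OF K] by simp
    ultimately show ?thesis by blast
  qed
qed

text \<open>The bracket is a fraction \<open>f g\<inverse>\<close> of polynomials over \<open>W\<close>. Its values at \<open>T\<close> lie in \<open>K\<close>, so the
  equations \<open>w(t) g(t) = f(t)\<close> are \<open>K\<close>-linear relations between the coefficients; a functional that
  preserves these relations replaces \<open>f\<close> and \<open>g\<close> by polynomials over \<open>K\<close> with the same values. By
  uniqueness of the first-order coefficient, this coefficient is in \<open>K\<close>.\<close>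

lemma dl_pow_in_if_iter_comm_in:
  fixes W :: "'a::division_ring set"
  assumes W: "div_subring W" and K: "div_subring K" "K \<subseteq> W"
    and T: "infinite T" "T \<subseteq> K" "\<And>t a. t \<in> T \<Longrightarrow> a \<in> W \<Longrightarrow> t * a = a * t"
    and x: "x \<in> W" "x \<noteq> 0" and u: "u \<in> W"
    and inK: "\<And>t. t \<in> T \<Longrightarrow> 1 + t * u \<noteq> 0 \<Longrightarrow> iter_comm x n (1 + t * u) \<in> K"
  shows "(dl x ^^ n) u \<in> K"
proof -
  interpret twisted_poly W 1 by unfold_locales (use W in auto)
  define Y where "Y = {t \<in> T. 1 + t * u \<noteq> 0}"
  have Y: "infinite Y" "Y \<subseteq> W" "\<And>t a. t \<in> Y \<Longrightarrow> a \<in> W \<Longrightarrow> t * a = a * t"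
    "\<And>t. t \<in> Y \<Longrightarrow> 1 + t * u \<noteq> 0"
    using T K infinite_invertible_parameters[OF T(1)] by (auto simp: Y_def)
  define ws where "ws = comm_word x n u"
  note nz = comm_word_factors_nonzero[OF W x u Y(3,4), where n = n, folded ws_def]
  have ev: "word_eval t ws = iter_comm x n (1 + t * u)" if t: "t \<in> Y" for t
  proof -
    have "cj x t = t" using Y(3)[OF t x(1)] x by (simp add: cj_eq_iff)
    then show ?thesis unfolding ws_def by (rule word_eval_comm_word[OF x(2)])
  qed
  obtain N f g where fg: "poly N f" "poly N g" "f 0 = 1" "g 0 = 1"
    and fgev: "\<And>y. twisted y \<Longrightarrow> (\<And>b s. (b, s) \<in> set ws \<Longrightarrow> 1 + y * b \<noteq> 0) \<Longrightarrow>
       word_eval y ws * peval y N g = peval y N f"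
    using word_fraction[of ws] nz by metis
  obtain c where cK: "\<forall>i\<in>{..N} <+> {..N}. c i \<in> K"
    and rel': "\<forall>z r. z \<in> K \<and> (\<forall>i\<in>{..N} <+> {..N}. r i \<in> K) \<and>
      z + (\<Sum>i\<in>{..N} <+> {..N}. r i * case_sum g f i) = 0 \<longrightarrow> z + (\<Sum>i\<in>{..N} <+> {..N}. r i * c i) = 0"
    using linear_functional_on_finite_family[OF K(1), of "{..N} <+> {..N}" "case_sum g f"] by auto
  have c: "c i \<in> K" if "i \<in> {..N} <+> {..N}" for i using cK that by blast
  have rel: "z + (\<Sum>i\<in>{..N} <+> {..N}. r i * c i) = 0" if "z \<in> K"
    "\<And>i. i \<in> {..N} <+> {..N} \<Longrightarrow> r i \<in> K" "z + (\<Sum>i\<in>{..N} <+> {..N}. r i * case_sum g f i) = 0" for z r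
    by (rule rel'[rule_format]) (intro conjI ballI that)
  define f' g' where "f' = (\<lambda>i. if i \<le> N then c (Inr i) else 0)" and "g' = (\<lambda>i. if i \<le> N then c (Inl i) else 0)"
  have f'K: "f' i \<in> K" and g'K: "g' i \<in> K" for i
    using c div_subringD[OF K(1)] by (auto simp: f'_def g'_def)
  have poly': "poly N f'" "poly N g'"
  proof -
    have "f' i \<in> W" "g' i \<in> W" for i using f'K[of i] g'K[of i] K(2) by blast+
    then show "poly N f'" "poly N g'" by (simp_all add: poly_def) (simp_all add: f'_def g'_def)
  qed
  \<comment> \<open>the functional fixes \<open>1\<close>\<close>
  have g'0: "g' 0 = 1"
  proof -
    define r :: "nat + nat \<Rightarrow> 'a" where "r = (\<lambda>i. if i = Inl 0 then - 1 else 0)"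
    have *: "(\<Sum>i\<in>{..N} <+> {..N}. r i * h i) = - h (Inl 0)" for h
    proof -
      have "(\<Sum>i\<in>{..N} <+> {..N}. r i * h i) = (\<Sum>i\<in>{Inl 0}. r i * h i)"
        by (rule sum.mono_neutral_right) (auto simp: r_def)
      then show ?thesis by (simp add: r_def)
    qed
    have "1 + (\<Sum>i\<in>{..N} <+> {..N}. r i * c i) = 0"
    proof (rule rel)
      show "1 + (\<Sum>i\<in>{..N} <+> {..N}. r i * case_sum g f i) = 0" by (simp add: * fg)
    qed (use div_subringD[OF K(1)] in \<open>auto simp: r_def\<close>)
    then show ?thesis by (simp add: * g'_def)
  qed
  have "f' 0 = 1 \<and> f' 1 - g' 1 = word_slope ws"
  proof (rule word_fraction_unique[OF W Y(1-3) _ _ poly' g'0])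
    fix t assume t: "t \<in> Y"
    define w where "w = word_eval t ws"
    have w: "w \<in> K" using ev[OF t] inK t by (auto simp: w_def Y_def)
    have tK: "t ^ i \<in> K" for i using t T by (auto simp: Y_def intro: div_subring_power[OF K(1)])
    have tw: "twisted t" using Y(3)[OF t] by (auto simp: twisted_def)
    define r where "r = case_sum (\<lambda>i. w * t ^ i) (\<lambda>i. - (t ^ i))"
    have *: "(\<Sum>i\<in>{..N} <+> {..N}. r i * h i) =
        w * peval t N (\<lambda>i. h (Inl i)) - peval t N (\<lambda>i. h (Inr i))" for h
      by (simp add: sum.Plus r_def peval_def sum_distrib_left mult.assoc sum_negf)
    have "0 + (\<Sum>i\<in>{..N} <+> {..N}. r i * c i) = 0"
    proof (rule rel)
      show "0 + (\<Sum>i\<in>{..N} <+> {..N}. r i * case_sum g f i) = 0"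
        unfolding * using fgev[OF tw] nz t by (simp add: w_def)
    qed (use w tK in \<open>auto simp: r_def intro!: div_subringD[OF K(1)]\<close>)
    moreover have "peval t N f' = peval t N (\<lambda>i. c (Inr i))" "peval t N g' = peval t N (\<lambda>i. c (Inl i))"
      by (auto simp: peval_def f'_def g'_def)
    ultimately show "word_eval t ws * peval t N g' = peval t N f'"
      unfolding * w_def by simp
  qed (use nz in auto)
  then have "word_slope ws \<in> K" using div_subringD(5)[OF K(1) f'K g'K] by metis
  then show ?thesis by (simp add: ws_def word_slope_comm_word)
qed

text \<open>If \<open>dl x ^^ n\<close> maps \<open>W\<close> into a proper subring \<open>K\<close>, take \<open>e \<notin> K\<close> with \<open>dl x e \<in> K\<close>: modulo
  \<open>K\<close>, applying \<open>dl x ^^ n\<close> to \<open>k * e\<close> gives \<open>(dl x ^^ n) k * e\<close>, so \<open>dl x ^^ n\<close> kills \<open>K\<close>.\<close>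

lemma dl_nilpotent_if_pow_in_proper_subring:
  assumes W: "div_subring W" and K: "div_subring K" "K \<subseteq> W" "K \<noteq> W" and x: "x \<in> K" "x \<noteq> 0"
    and n: "\<And>u. u \<in> W \<Longrightarrow> (dl x ^^ n) u \<in> K"
  shows "\<exists>N. \<forall>u\<in>W. (dl x ^^ N) u = 0"
proof -
  define n0 where "n0 = (LEAST n. \<forall>u\<in>W. (dl x ^^ n) u \<in> K)"
  have n0: "\<forall>u\<in>W. (dl x ^^ n0) u \<in> K" unfolding n0_def by (rule LeastI[of _ n]) (use n in blast)
  have "n0 \<noteq> 0"
  proof
    assume "n0 = 0"
    then have "W \<subseteq> K" using n0 by auto
    then show False using K by blast
  qed
  then obtain j where j: "n0 = Suc j" by (metis not0_implies_Suc)
  have "j < n0" using j by simp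
  then have "\<not> (\<forall>u\<in>W. (dl x ^^ j) u \<in> K)" unfolding n0_def by (rule not_less_Least)
  then obtain d where d: "d \<in> W" "(dl x ^^ j) d \<notin> K" by blast
  define e where "e = (dl x ^^ j) d"
  have xK: "cj x k \<in> K" if "k \<in> K" for k using x that div_subringD(8)[OF K(1)] by blast
  have dlK: "(dl x ^^ i) k \<in> K" if "k \<in> K" for k i by (rule dl_pow_in[OF K(1) xK that])
  have xW: "cj x w \<in> W" if "w \<in> W" for w using x K that div_subringD(8)[OF W] by blast
  have e: "e \<in> W" "e \<notin> K" "dl x e \<in> K"
    using dl_pow_in[OF W xW d(1)] d n0 j by (auto simp: e_def)
  have step: "(dl x ^^ i) (k * e) - (dl x ^^ i) k * e \<in> K" if k: "k \<in> K" for k i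
  proof (induction i)
    case 0
    show ?case using div_subringD[OF K(1)] by simp
  next
    case (Suc i)
    define a where "a = (dl x ^^ i) (k * e)"
    define b where "b = (dl x ^^ i) k"
    have b: "b \<in> K" "dl x b \<in> K" using dlK[OF k, of i] dlK[OF k, of "Suc i"] by (auto simp: b_def)
    have "dl x a - dl x b * e = dl x (a - b * e) + (b * dl x e - dl x b * dl x e)"
      using x by (simp add: dl_diff dl_mult) (simp add: dl_def algebra_simps)
    moreover have "dl x (a - b * e) \<in> K" using dlK[of "a - b * e" 1] Suc by (simp add: a_def b_def)
    ultimately show ?case
      using b e by (simp add: a_def[symmetric] b_def[symmetric] div_subringD[OF K(1)])
  qed
  have kill: "(dl x ^^ n0) k = 0" if k: "k \<in> K" for k
  proof (rule ccontr)
    assume nz: "(dl x ^^ n0) k \<noteq> 0"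
    have "k * e \<in> W" using k e(1) K(2) by (auto intro: div_subringD(6)[OF W])
    then have "(dl x ^^ n0) (k * e) \<in> K" by (rule n0[rule_format])
    then have "(dl x ^^ n0) k * e \<in> K"
      using div_subringD(5)[OF K(1) _ step[OF k, of n0], of "(dl x ^^ n0) (k * e)"] by simp
    then have "inverse ((dl x ^^ n0) k) * ((dl x ^^ n0) k * e) \<in> K"
      by (rule div_subringD(6)[OF K(1) div_subringD(7)[OF K(1) dlK[OF k]]])
    then show False using e(2) nz by (simp add: mult.assoc[symmetric])
  qed
  have "(dl x ^^ (n0 + n0)) u = 0" if "u \<in> W" for u
    using kill n0 that by (simp add: funpow_add)
  then show ?thesis by blast
qed

text \<open>In characteristic \<open>p\<close>, a bracket \<open>x'\<close> that has arrived in \<open>A\<close> also has a nilpotent \<open>dl x'\<close>, and then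
  \<open>dl (x' ^ p\<^sup>s) = dl x' ^^ p\<^sup>s = 0\<close> for large \<open>s\<close>, as \<open>nilpotent_dl_trivial\<close> requires.\<close>

lemma subnormal_central_if_dl_nilpotent:
  fixes W :: "'a::division_ring set"
  assumes A: "subnormal_in W A" and W: "div_subring W"
    and nil: "\<And>x. x \<in> A \<Longrightarrow> \<exists>N. \<forall>u\<in>W. (dl x ^^ N) u = 0"
    and x: "x \<in> A" and w: "w \<in> W"
  shows "x * w = w * x"
proof -
  note grp = mult_groupD[OF subnormal_in_group[OF A W]]
  have sub: "A \<subseteq> W" by (rule subnormal_in_subset[OF A])
  obtain r where r: "\<forall>x\<in>A. \<forall>v\<in>W - {0}. iter_comm x r v \<in> A"
    using subnormal_in_iter_comm[OF A W] by blast
  obtain N where N: "\<forall>u\<in>W. (dl x ^^ N) u = 0" using nil[OF x] by blast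
  show ?thesis
  proof (rule nilpotent_dl_trivial[OF W _ _ _ _ w, of x N])
    fix p g assume p: "Factorial_Ring.prime p" "of_nat p = (0::'a)" and g: "g \<in> W" "g \<noteq> 0"
    define x' where "x' = iter_comm x r g"
    have x': "x' \<in> A" using r x g by (auto simp: x'_def)
    obtain N' where N': "\<forall>u\<in>W. (dl x' ^^ N') u = 0" using nil[OF x'] by blast
    have "N' \<le> p ^ N'" using self_le_power less_exp p
      by (metis less_imp_le_nat order_trans power_mono prime_ge_2_nat zero_le)
    then have "(dl x' ^^ (p ^ N')) x = 0" using N' dl_pow_ge x sub by blast
    then have "dl (x' ^ (p ^ N')) x = 0" using dl_pow_prime_power[OF p grp(3)[OF x']] by simp
    then have "x' ^ (p ^ N') * x = x * x' ^ (p ^ N')"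
      using grp(3)[OF x'] by (simp add: dl_eq_0_iff)
    then show "\<exists>r s. iter_comm x r g ^ p ^ s * x = x * iter_comm x r g ^ p ^ s"
      unfolding x'_def by blast
  qed (use N x sub grp(3) div_subringD(8)[OF W] in auto)
qed

text \<open>Bracketing \<open>1 + t u\<close> with \<open>x \<in> A\<close> lands in \<open>K\<close> for all \<open>t\<close>, so its first-order term \<open>(dl x ^^ n) u\<close> lies in
  \<open>K\<close> as well, and a proper \<open>K\<close> makes \<open>dl x\<close> nilpotent.\<close>

theorem subnormal_generates:
  assumes W: "div_subring W" and A: "subnormal_in W A" and K: "div_subring K" "K \<subseteq> W" "A \<subseteq> K"
    and T: "infinite T" "T \<subseteq> K" "\<And>t a. t \<in> T \<Longrightarrow> a \<in> W \<Longrightarrow> t * a = a * t"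
    and nc: "a \<in> A" "w \<in> W" "a * w \<noteq> w * a"
  shows "K = W"
proof (rule ccontr)
  assume KW: "K \<noteq> W"
  note grp = mult_groupD[OF subnormal_in_group[OF A W]]
  obtain n where n: "\<forall>x\<in>A. \<forall>v\<in>W - {0}. iter_comm x n v \<in> A"
    using subnormal_in_iter_comm[OF A W] by blast
  have "\<exists>N. \<forall>u\<in>W. (dl x ^^ N) u = 0" if x: "x \<in> A" for x
  proof (rule dl_nilpotent_if_pow_in_proper_subring[OF W K(1,2) KW, of x n])
    fix u assume u: "u \<in> W"
    show "(dl x ^^ n) u \<in> K"
    proof (rule dl_pow_in_if_iter_comm_in[OF W K(1,2) T _ _ u])
      fix t assume t: "t \<in> T" "1 + t * u \<noteq> 0"
      then have "1 + t * u \<in> W - {0}" using u T K by (auto intro!: div_subringD[OF W])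
      then show "iter_comm x n (1 + t * u) \<in> K" using n x K by blast
    qed (use x K grp in auto)
  qed (use x K grp in auto)
  from subnormal_central_if_dl_nilpotent[OF A W this nc(1,2)] nc(3) show False by blast
qed

text \<open>\<open>A \<inter> K\<close> is subnormal and contained in the proper subring \<open>K\<close>, hence central. For \<open>a \<in> A\<close> the
  brackets of \<open>a\<close> with elements of \<open>K\<close> stay in \<open>K\<close> and end in \<open>A \<inter> K\<close>; one more bracket gives \<open>1\<close>, so
  \<open>dl a\<close> is nilpotent on \<open>K\<close>.\<close>

theorem normalized_subring_centralized:
  assumes W: "div_subring W" and A: "subnormal_in W A" and K: "div_subring K" "K \<subseteq> W" "K \<noteq> W"
    and T: "infinite T" "T \<subseteq> K" "\<And>t a. t \<in> T \<Longrightarrow> a \<in> W \<Longrightarrow> t * a = a * t"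
    and norm: "\<And>a k. a \<in> A \<Longrightarrow> k \<in> K \<Longrightarrow> cj a k \<in> K" and a: "a \<in> A" "k \<in> K"
  shows "a * k = k * a"
proof -
  note grp = mult_groupD[OF subnormal_in_group[OF A W]]
  have sub: "A \<subseteq> W" by (rule subnormal_in_subset[OF A])
  have AK: "subnormal_in W (A \<inter> K)"
    by (rule subnormal_in.step[OF A mult_group_Int[OF subnormal_in_group[OF A W] K(1)]])
      (use grp(6) norm in auto)
  have central: "x * w = w * x" if "x \<in> A \<inter> K" "w \<in> W" for x w
    using subnormal_generates[OF W AK K(1,2) _ T that] K(3) by blast
  obtain n where n: "\<forall>x\<in>A. \<forall>v\<in>W - {0}. iter_comm x n v \<in> A"
    using subnormal_in_iter_comm[OF A W] by blast
  have inAK: "iter_comm a n v \<in> A \<inter> K" if "v \<in> K" "v \<noteq> 0" for v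
    using n a(1) that K iter_comm_in[OF K(1) that(1), of a n] norm by blast
  show ?thesis
  proof (rule nilpotent_dl_trivial[OF K(1) _ grp(3)[OF a(1)] _ _ a(2), of "Suc n"])
    fix k assume k: "k \<in> K"
    show "(dl a ^^ Suc n) k = 0"
    proof (rule dl_pow_eq_0_if_iter_comm_const[OF W T(1) _ T(3), where k = 1])
      fix t assume t: "t \<in> T" "1 + t * k \<noteq> 0"
      define v where "v = iter_comm a n (1 + t * k)"
      have v: "v \<in> A \<inter> K" unfolding v_def using t k T
        by (intro inAK div_subringD[OF K(1)]) auto
      have "cj a v = v" using central[OF v, of a] a sub grp by (auto simp: cj_eq_iff)
      then show "iter_comm a (Suc n) (1 + t * k) = 1"
        using v grp(3) by (simp add: v_def[symmetric])
    qed (use k T K a sub grp div_subringD[OF W] in auto)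
  next
    fix p g assume "g \<in> K" "g \<noteq> 0"
    then have "iter_comm a n g \<in> A \<inter> K" by (rule inAK)
    then have "iter_comm a n g ^ (p ^ 0) * a = a * iter_comm a n g ^ (p ^ 0)"
      using central a sub by auto
    then show "\<exists>r s. iter_comm a r g ^ p ^ s * a = a * iter_comm a r g ^ p ^ s" by blast
  qed (use norm a in auto)
qed

text \<open>By the pigeonhole principle the bracket is constant for infinitely many parameters, and then its
  first-order coefficient \<open>(dl x ^^ n) u\<close> vanishes.\<close>

lemma subnormal_central_if_comm_finite:
  assumes W: "div_subring W" and A: "subnormal_in W A"
    and T: "\<And>x u. x \<in> A \<Longrightarrow> u \<in> W \<Longrightarrow> \<exists>T. infinite T \<and> T \<subseteq> W \<and> (\<forall>t\<in>T. \<forall>a\<in>W. t * a = a * t) \<and>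
      finite ((\<lambda>t. iter_comm x n (1 + t * u)) ` {t \<in> T. 1 + t * u \<noteq> 0})"
    and x: "x \<in> A" "w \<in> W"
  shows "x * w = w * x"
proof (rule subnormal_central_if_dl_nilpotent[OF A W _ x])
  fix x assume x: "x \<in> A"
  note grp = mult_groupD[OF subnormal_in_group[OF A W]]
  have sub: "A \<subseteq> W" by (rule subnormal_in_subset[OF A])
  have "(dl x ^^ n) u = 0" if u: "u \<in> W" for u
  proof -
    obtain T where T: "infinite T" "T \<subseteq> W" "\<forall>t\<in>T. \<forall>a\<in>W. t * a = a * t"
      and fin: "finite ((\<lambda>t. iter_comm x n (1 + t * u)) ` {t \<in> T. 1 + t * u \<noteq> 0})"
      using T[OF x u] by blast
    obtain t0 where t0: "t0 \<in> {t \<in> T. 1 + t * u \<noteq> 0}" and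
      inf: "infinite {t \<in> {t \<in> T. 1 + t * u \<noteq> 0}. iter_comm x n (1 + t * u) = iter_comm x n (1 + t0 * u)}"
      using pigeonhole_infinite[OF infinite_invertible_parameters[OF T(1)] fin] by blast
    show ?thesis
    proof (rule dl_pow_eq_0_if_iter_comm_const[OF W inf])
      show "iter_comm x n (1 + t0 * u) \<in> W"
        using t0 T u x sub by (intro iter_comm_in[OF W] div_subringD[OF W]) auto
    qed (use T x u sub grp(3) in auto)
  qed
  then show "\<exists>N. \<forall>u\<in>W. (dl x ^^ N) u = 0" by blast
qed

text \<open>A subgroup that is finite modulo the center has only finitely many commutators with \<open>x\<close>.\<close>

lemma subnormal_central_if_finite_mod_center:
  assumes W: "div_subring W" and A: "subnormal_in W A"
    and T: "infinite T" "T \<subseteq> W" "\<And>t a. t \<in> T \<Longrightarrow> a \<in> W \<Longrightarrow> t * a = a * t"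
    and R: "finite R" "\<And>a. a \<in> A \<Longrightarrow> \<exists>r\<in>R. \<exists>z. a = r * z \<and> z \<in> centralizer W"
    and x: "x \<in> A" "w \<in> W"
  shows "x * w = w * x"
proof -
  note grp = mult_groupD[OF subnormal_in_group[OF A W]]
  have sub: "A \<subseteq> W" by (rule subnormal_in_subset[OF A])
  obtain n where n: "\<forall>x\<in>A. \<forall>v\<in>W - {0}. iter_comm x n v \<in> A"
    using subnormal_in_iter_comm[OF A W] by blast
  show ?thesis
  proof (rule subnormal_central_if_comm_finite[OF W A _ x, where n = "Suc n"])
    fix x u assume x: "x \<in> A" and u: "u \<in> W"
    have "(\<lambda>t. iter_comm x (Suc n) (1 + t * u)) ` {t \<in> T. 1 + t * u \<noteq> 0} \<subseteq>
        (\<lambda>r. r * inverse (cj x r)) ` R"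
    proof clarify
      fix t assume t: "t \<in> T" "1 + t * u \<noteq> 0"
      define v where "v = iter_comm x n (1 + t * u)"
      have "1 + t * u \<in> W" using t u T by (intro div_subringD(2,3,6)[OF W]) auto
      then have v: "v \<in> A" unfolding v_def using n x t by blast
      obtain r z where rz: "r \<in> R" "v = r * z" "z \<in> centralizer W" using R(2)[OF v] by blast
      have z: "z \<noteq> 0" using rz(2) grp(3)[OF v] by auto
      have "cj x z = z" using centralizerD[OF rz(3), of x] x sub grp(3)[OF x] by (auto simp: cj_eq_iff)
      then have "v * inverse (cj x v) = r * (z * inverse z) * inverse (cj x r)"
        using rz grp(3)[OF x] by (simp add: cj_mult inverse_mult_rev mult.assoc)
      then have "v * inverse (cj x v) = r * inverse (cj x r)" using z by simp
      then show "iter_comm x (Suc n) (1 + t * u) \<in> (\<lambda>r. r * inverse (cj x r)) ` R"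
        using rz(1) by (auto simp: v_def)
    qed
    then have "finite ((\<lambda>t. iter_comm x (Suc n) (1 + t * u)) ` {t \<in> T. 1 + t * u \<noteq> 0})"
      by (rule finite_subset) (intro finite_imageI R(1))
    moreover have "\<forall>t\<in>T. \<forall>a\<in>W. t * a = a * t" using T(3) by blast
    ultimately show "\<exists>T. infinite T \<and> T \<subseteq> W \<and> (\<forall>t\<in>T. \<forall>a\<in>W. t * a = a * t) \<and>
      finite ((\<lambda>t. iter_comm x (Suc n) (1 + t * u)) ` {t \<in> T. 1 + t * u \<noteq> 0})"
      using T(1,2) by (intro exI[of _ T] conjI)
  qed
qed

section \<open>Independence of conjugations and Artin's theorem\<close>

text \<open>Dedekind's argument for elements of different types: \<open>a i\<close> has type \<open>s i\<close> if
  \<open>a i * k = s i k * a i\<close> for all \<open>k\<close>.\<close>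

lemma independence_of_types:
  fixes a :: "'i \<Rightarrow> 'a::division_ring"
  assumes "finite I" "\<And>i k. i \<in> I \<Longrightarrow> k \<in> P \<Longrightarrow> a i * k = s i k * a i"
    "\<And>i j k k'. i \<in> I \<Longrightarrow> j \<in> I \<Longrightarrow> k \<in> P \<Longrightarrow> k' \<in> P \<Longrightarrow> s i k * s j k' = s j k' * s i k"
    "\<And>i j. i \<in> I \<Longrightarrow> j \<in> I \<Longrightarrow> i \<noteq> j \<Longrightarrow> \<exists>k\<in>P. s i k \<noteq> s j k" "sum a I = 0"
  shows "\<forall>i\<in>I. a i = 0"
  using assms
proof (induction I arbitrary: a rule: finite_induct)
  case (insert j I)
  have "a i = 0" if i: "i \<in> I" for i
  proof -
    obtain k where k: "k \<in> P" "s i k \<noteq> s j k" using insert.prems(3)[of i j] insert.hyps i by auto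
    define a' where "a' = (\<lambda>l. (s l k - s j k) * a l)"
    have "\<forall>l\<in>I. a' l = 0"
    proof (rule insert.IH)
      fix l k' assume l: "l \<in> I" and k': "k' \<in> P"
      have "a' l * k' = (s l k - s j k) * s l k' * a l"
        using insert.prems(1)[of l k'] l k' by (simp add: a'_def mult.assoc)
      also have "(s l k - s j k) * s l k' = s l k' * (s l k - s j k)"
        using insert.prems(2)[of l l k k'] insert.prems(2)[of j l k k'] l k k'
        by (simp add: left_diff_distrib right_diff_distrib)
      finally show "a' l * k' = s l k' * a' l" by (simp add: a'_def mult.assoc)
    next
      have "sum a' I = sum a' (insert j I)" using insert.hyps by (simp add: a'_def)
      also have "\<dots> = (\<Sum>l\<in>insert j I. a l * k - s j k * a l)"
        using insert.prems(1) k by (intro sum.cong) (auto simp: a'_def left_diff_distrib)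
      also have "\<dots> = sum a (insert j I) * k - s j k * sum a (insert j I)"
        by (simp only: sum_subtractf sum_distrib_left sum_distrib_right)
      finally show "sum a' I = 0" using insert.prems(4) by simp
    qed (use insert.prems in auto)
    then show ?thesis using k i by (auto simp: a'_def)
  qed
  then show ?case using insert.prems(4) insert.hyps by simp
qed simp

text \<open>Dedekind's lemma on the independence of characters. Here the homomorphisms are defined on \<open>Q\<close>
  and take values in the larger field \<open>P\<close>.\<close>

lemma independence_of_homs:
  fixes a :: "'i \<Rightarrow> 'a::division_ring"
  assumes P: "div_subring P" "P \<subseteq> centralizer P" and Q: "div_subring Q" "Q \<subseteq> P"
  assumes "finite I" "\<And>i. i \<in> I \<Longrightarrow> a i \<in> P" "\<And>i z. i \<in> I \<Longrightarrow> z \<in> Q \<Longrightarrow> s i z \<in> P"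
    "\<And>i z w. i \<in> I \<Longrightarrow> z \<in> Q \<Longrightarrow> w \<in> Q \<Longrightarrow> s i (z * w) = s i z * s i w"
    "\<And>i. i \<in> I \<Longrightarrow> s i 1 = 1"
    "\<And>i j. i \<in> I \<Longrightarrow> j \<in> I \<Longrightarrow> i \<noteq> j \<Longrightarrow> \<exists>k\<in>Q. s i k \<noteq> s j k"
    "\<And>z. z \<in> Q \<Longrightarrow> (\<Sum>i\<in>I. a i * s i z) = 0"
  shows "\<forall>i\<in>I. a i = 0"
  using assms(5-)
proof (induction I arbitrary: a rule: finite_induct)
  case (insert j I)
  have comm: "x * y = y * x" if "x \<in> P" "y \<in> P" for x y using that P(2) centralizerD by blast
  have "a i = 0" if i: "i \<in> I" for i
  proof -
    obtain w where w: "w \<in> Q" "s i w \<noteq> s j w" using insert.prems(5)[of i j] insert.hyps i by auto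
    have swP: "s l w \<in> P" if "l \<in> insert j I" for l using insert.prems(2) that w by blast
    define a' where "a' = (\<lambda>l. a l * (s l w - s j w))"
    have "\<forall>l\<in>I. a' l = 0"
    proof (rule insert.IH)
      fix l assume "l \<in> I"
      then show "a' l \<in> P" unfolding a'_def
        using insert.prems(1)[of l] swP by (intro div_subringD(5,6)[OF P(1)]) auto
    next
      fix z assume z: "z \<in> Q"
      have zw: "w * z \<in> Q" by (rule div_subringD(6)[OF Q(1) w(1) z])
      have e: "a' l * s l z = a l * s l (w * z) - s j w * (a l * s l z)" if l: "l \<in> insert j I" for l
      proof -
        have "s j w * (a l * s l z) = a l * s j w * s l z"
          using comm[OF swP insert.prems(1), of j l] l by (simp add: mult.assoc[symmetric])
        then show ?thesis using insert.prems(3)[OF l w(1) z]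
          by (simp add: a'_def left_diff_distrib right_diff_distrib mult.assoc)
      qed
      have "(\<Sum>l\<in>I. a' l * s l z) = (\<Sum>l\<in>insert j I. a' l * s l z)"
        using insert.hyps by (simp add: a'_def)
      also have "\<dots> = (\<Sum>l\<in>insert j I. a l * s l (w * z) - s j w * (a l * s l z))"
        by (rule sum.cong[OF refl e])
      also have "\<dots> = (\<Sum>l\<in>insert j I. a l * s l (w * z)) - s j w * (\<Sum>l\<in>insert j I. a l * s l z)"
        by (simp only: sum_subtractf sum_distrib_left)
      finally show "(\<Sum>l\<in>I. a' l * s l z) = 0" using insert.prems(6)[OF zw] insert.prems(6)[OF z] by simp
    qed (use insert.prems in auto)
    then show ?thesis using w i by (auto simp: a'_def)
  qed
  then have "(\<Sum>i\<in>insert j I. a i * s i 1) = a j" using insert.hyps insert.prems(4) by simp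
  then have "a j = 0" using insert.prems(6)[OF div_subringD(2)[OF Q(1)]] by simp
  then show ?case using \<open>\<And>i. i \<in> I \<Longrightarrow> a i = 0\<close> by auto
qed simp

text \<open>Gaussian elimination on the matrix \<open>s i (c j)\<close>: a new homomorphism reduced by the previous
  ones is a nontrivial combination, so it does not vanish at some new \<open>c k\<close>.\<close>

lemma dual_system:
  fixes s :: "nat \<Rightarrow> 'a::division_ring \<Rightarrow> 'a"
  assumes P: "div_subring P" "P \<subseteq> centralizer P" and Q: "div_subring Q" "Q \<subseteq> P"
    and sP: "\<And>i z. i < k \<Longrightarrow> z \<in> P \<Longrightarrow> s i z \<in> P"
    and mult: "\<And>i z w. i < k \<Longrightarrow> z \<in> Q \<Longrightarrow> w \<in> Q \<Longrightarrow> s i (z * w) = s i z * s i w"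
    and one: "\<And>i. i < k \<Longrightarrow> s i 1 = 1"
    and dist: "\<And>i j. i < k \<Longrightarrow> j < k \<Longrightarrow> i \<noteq> j \<Longrightarrow> \<exists>z\<in>Q. s i z \<noteq> s j z"
  obtains c a where "\<And>j. j < k \<Longrightarrow> c j \<in> Q" "\<And>j i. j < k \<Longrightarrow> i < k \<Longrightarrow> a j i \<in> P"
    "\<And>j l. j < k \<Longrightarrow> l < k \<Longrightarrow> (\<Sum>i<k. a j i * s i (c l)) = (if j = l then 1 else 0)"
    "\<And>i z. i < k \<Longrightarrow> z \<in> P \<Longrightarrow> s i z = (\<Sum>j<k. s i (c j) * (\<Sum>l<k. a j l * s l z))"
  using sP mult one dist
proof (induction k arbitrary: thesis)
  case 0
  show ?case by (rule 0(1)[of "\<lambda>_. 0" "\<lambda>_ _. 0"]) auto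
next
  case (Suc k)
  obtain c a where c: "\<And>j. j < k \<Longrightarrow> c j \<in> Q" and a: "\<And>j i. j < k \<Longrightarrow> i < k \<Longrightarrow> a j i \<in> P"
    and dual: "\<And>j l. j < k \<Longrightarrow> l < k \<Longrightarrow> (\<Sum>i<k. a j i * s i (c l)) = (if j = l then 1 else 0)"
    and expand: "\<And>i z. i < k \<Longrightarrow> z \<in> P \<Longrightarrow> s i z = (\<Sum>j<k. s i (c j) * (\<Sum>l<k. a j l * s l z))"
    by (rule Suc.IH) (use Suc.prems in \<open>auto simp: less_Suc_eq\<close>)
  have sP: "s i z \<in> P" if "i \<le> k" "z \<in> P" for i z using Suc.prems(2) that by simp
  have cP: "c j \<in> P" if "j < k" for j using c[OF that] Q by blast
  define \<phi> where "\<phi> = (\<lambda>j z. \<Sum>i<k. a j i * s i z)"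
  have \<phi>P: "\<phi> j z \<in> P" if "j < k" "z \<in> P" for j z unfolding \<phi>_def
    by (intro div_subring_sum[OF P(1)] div_subringD(6)[OF P(1)]) (use a sP that in auto)
  define e where "e = (\<lambda>i. if i < k then - (\<Sum>j<k. s k (c j) * a j i) else 1)"
  have eP: "e i \<in> P" for i unfolding e_def
    using a sP[OF order.refl cP] div_subringD(2)[OF P(1)]
    by (auto intro!: div_subring_sum[OF P(1)] div_subringD(4,6)[OF P(1)])
  define \<psi> where "\<psi> = (\<lambda>z. s k z - (\<Sum>j<k. s k (c j) * \<phi> j z))"
  have \<psi>: "\<psi> z = (\<Sum>i<Suc k. e i * s i z)" for z
  proof -
    have "(\<Sum>j<k. s k (c j) * \<phi> j z) = (\<Sum>i<k. (\<Sum>j<k. s k (c j) * a j i) * s i z)"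
      unfolding \<phi>_def sum_distrib_left sum_distrib_right by (subst sum.swap) (simp add: mult.assoc)
    then show ?thesis by (simp add: \<psi>_def e_def sum_negf)
  qed
  have "\<exists>z\<in>Q. \<psi> z \<noteq> 0"
  proof (rule ccontr)
    assume "\<not> ?thesis"
    then have z: "\<And>z. z \<in> Q \<Longrightarrow> (\<Sum>i<Suc k. e i * s i z) = 0" by (auto simp: \<psi>)
    have "\<forall>i\<in>{..<Suc k}. e i = 0"
      by (rule independence_of_homs[OF P Q, where s = s])
        (use eP z Suc.prems(3-5) sP Q in \<open>auto simp: less_Suc_eq_le\<close>)
    then have "e k = 0" by simp
    then show False by (simp add: e_def)
  qed
  then obtain d where d: "d \<in> Q" "\<psi> d \<noteq> 0" by blast
  have dP: "d \<in> P" using d Q by blast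
  define u where "u = inverse (\<psi> d)"
  have "\<psi> d \<in> P" unfolding \<psi> by (intro div_subring_sum[OF P(1)] div_subringD(6)[OF P(1)] eP sP dP) simp
  then have uP: "u \<in> P" unfolding u_def by (rule div_subringD(7)[OF P(1)])
  define c' where "c' = c(k := d)"
  define a' where "a' = (\<lambda>j i. if j < k then (if i < k then a j i else 0) - \<phi> j d * (u * e i) else u * e i)"
  define \<phi>' where "\<phi>' = (\<lambda>j z. \<Sum>i<Suc k. a' j i * s i z)"
  have u\<psi>: "(\<Sum>i<Suc k. u * e i * s i z) = u * \<psi> z" for z
    unfolding \<psi> sum_distrib_left by (simp only: mult.assoc)
  have \<phi>'k: "\<phi>' k z = u * \<psi> z" for z unfolding \<phi>'_def u\<psi>[symmetric] by (simp add: a'_def)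
  have \<phi>'j: "\<phi>' j z = \<phi> j z - \<phi> j d * (u * \<psi> z)" if "j < k" for j z
  proof -
    have "\<phi>' j z = (\<Sum>i<Suc k. (if i < k then a j i else 0) * s i z) - \<phi> j d * (\<Sum>i<Suc k. u * e i * s i z)"
      unfolding \<phi>'_def sum_distrib_left sum_subtractf[symmetric]
      using that by (intro sum.cong) (auto simp: a'_def left_diff_distrib mult.assoc)
    also have "(\<Sum>i<Suc k. (if i < k then a j i else 0) * s i z) = \<phi> j z"
      by (simp add: \<phi>_def)
    finally show ?thesis by (simp only: u\<psi>)
  qed
  have \<psi>c: "\<psi> (c l) = 0" if l: "l < k" for l
  proof -
    have "(\<Sum>j<k. s k (c j) * \<phi> j (c l)) = (\<Sum>j<k. if j = l then s k (c j) else 0)"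
      by (intro sum.cong) (use dual l in \<open>auto simp: \<phi>_def\<close>)
    also have "\<dots> = s k (c l)" using l by simp
    finally show ?thesis by (simp add: \<psi>_def)
  qed
  have u1: "u * \<psi> d = 1" using d by (simp add: u_def)
  show ?case
  proof (rule Suc.prems(1)[of c' a'])
    show "c' j \<in> Q" if "j < Suc k" for j using that c d by (auto simp: c'_def less_Suc_eq)
    show "a' j i \<in> P" if "j < Suc k" "i < Suc k" for j i
      using that a[of j i] \<phi>P[OF _ dP, of j] eP[of i] uP div_subringD(1)[OF P(1)]
      by (auto simp: a'_def intro!: div_subringD(4,5,6)[OF P(1)])
  next
    fix j l assume j: "j < Suc k" and l: "l < Suc k"
    have "\<phi>' j (c' l) = (if j = l then 1 else 0)"
    proof (cases "j < k")
      case True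
      show ?thesis
      proof (cases "l < k")
        case l: True
        have "\<phi> j (c l) = (if j = l then 1 else 0)" using dual[OF True l] by (simp only: \<phi>_def)
        then show ?thesis using \<psi>c[OF l] l by (simp add: \<phi>'j[OF True] c'_def)
      next
        case False
        then have "l = k" using l by simp
        then show ?thesis using True u1 by (simp add: \<phi>'j[OF True] c'_def)
      qed
    next
      case False
      then have "j = k" using j by simp
      then show ?thesis using l \<psi>c u1 by (auto simp: \<phi>'k c'_def less_Suc_eq)
    qed
    then show "(\<Sum>i<Suc k. a' j i * s i (c' l)) = (if j = l then 1 else 0)" by (simp only: \<phi>'_def)
  next
    fix i z assume i: "i < Suc k" and z: "z \<in> P"
    have *: "(\<Sum>j<Suc k. s i (c' j) * \<phi>' j z) =
        (\<Sum>j<k. s i (c j) * \<phi> j z) + (s i d - (\<Sum>j<k. s i (c j) * \<phi> j d)) * (u * \<psi> z)"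
      by (simp add: \<phi>'j \<phi>'k c'_def right_diff_distrib left_diff_distrib sum_subtractf
          sum_distrib_right mult.assoc)
    have "s i z = (\<Sum>j<Suc k. s i (c' j) * \<phi>' j z)"
    proof (cases "i < k")
      case True
      have "s i w = (\<Sum>j<k. s i (c j) * \<phi> j w)" if "w \<in> P" for w
        using expand[OF True that] by (simp only: \<phi>_def)
      from this[OF z] this[OF dP] show ?thesis unfolding * by simp
    next
      case False
      then have ik: "i = k" using i by simp
      have "s k d - (\<Sum>j<k. s k (c j) * \<phi> j d) = \<psi> d" by (simp add: \<psi>_def)
      moreover have "\<psi> d * (u * \<psi> z) = \<psi> z" using d by (simp add: u_def mult.assoc[symmetric])
      ultimately show ?thesis unfolding ik *[unfolded ik] by (simp add: \<psi>_def)
    qed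
    then show "s i z = (\<Sum>j<Suc k. s i (c' j) * (\<Sum>l<Suc k. a' j l * s l z))" by (simp only: \<phi>'_def)
  qed
qed

subsection \<open>Groups acting on a field by conjugation\<close>

definition finite_action :: "'a::division_ring set \<Rightarrow> 'a set \<Rightarrow> bool" where
  "finite_action M P \<longleftrightarrow> finite ((\<lambda>m. restrict (cj m) P) ` M)"

lemma finite_action_representatives:
  assumes "finite_action M P"
  obtains k :: nat and r where "\<And>i. i < k \<Longrightarrow> r i \<in> M"
    "\<And>i j. i < k \<Longrightarrow> j < k \<Longrightarrow> i \<noteq> j \<Longrightarrow> \<exists>z\<in>P. cj (r i) z \<noteq> cj (r j) z"
    "\<And>m. m \<in> M \<Longrightarrow> \<exists>i<k. \<forall>z\<in>P. cj m z = cj (r i) z"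
proof -
  define S where "S = (\<lambda>m. restrict (cj m) P) ` M"
  have "finite S" using assms by (simp add: finite_action_def S_def)
  then obtain h where h: "bij_betw h {0..<card S} S" using ex_bij_betw_nat_finite by blast
  have "\<exists>m. m \<in> M \<and> h i = restrict (cj m) P" if "i < card S" for i
  proof -
    have "h i \<in> S" using bij_betw_apply[OF h, of i] that by simp
    then show ?thesis unfolding S_def by blast
  qed
  then obtain r where r: "\<And>i. i < card S \<Longrightarrow> r i \<in> M \<and> h i = restrict (cj (r i)) P" by metis
  show ?thesis
  proof (rule that[of "card S" r])
    show "r i \<in> M" if "i < card S" for i using r that by blast
    show "\<exists>z\<in>P. cj (r i) z \<noteq> cj (r j) z" if "i < card S" "j < card S" "i \<noteq> j" for i j
    proof (rule ccontr)
      assume "\<not> ?thesis"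
      then have "restrict (cj (r i)) P = restrict (cj (r j)) P" by (intro restrict_ext) auto
      then have "h i = h j" using r that by simp
      then show False using inj_onD[OF bij_betw_imp_inj_on[OF h]] that by auto
    qed
    show "\<exists>i<card S. \<forall>z\<in>P. cj m z = cj (r i) z" if "m \<in> M" for m
    proof -
      have "restrict (cj m) P \<in> h ` {0..<card S}"
        using that bij_betw_imp_surj_on[OF h] by (simp add: S_def)
      then obtain i where i: "i < card S" "h i = restrict (cj m) P" by auto
      then have e: "restrict (cj (r i)) P = restrict (cj m) P" using r by simp
      have "cj m z = cj (r i) z" if "z \<in> P" for z using fun_cong[OF e, of z] that by simp
      then show ?thesis using i by blast
    qed
  qed
qed

text \<open>The subfield \<open>Q\<close> is one on which the representatives still act differently; the basis can be
  chosen in it.\<close>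

locale galois_action =
  fixes P Q M :: "'a::division_ring set" and k :: nat and r :: "nat \<Rightarrow> 'a"
  assumes P: "div_subring P" "P \<subseteq> centralizer P" and Q: "div_subring Q" "Q \<subseteq> P"
    and M: "mult_group M" and norm: "\<And>m z. m \<in> M \<Longrightarrow> z \<in> P \<Longrightarrow> cj m z \<in> P"
    and r: "\<And>i. i < k \<Longrightarrow> r i \<in> M"
    and dist: "\<And>i j. i < k \<Longrightarrow> j < k \<Longrightarrow> i \<noteq> j \<Longrightarrow> \<exists>z\<in>Q. cj (r i) z \<noteq> cj (r j) z"
    and cover: "\<And>m. m \<in> M \<Longrightarrow> \<exists>i<k. \<forall>z\<in>P. cj m z = cj (r i) z"
begin

lemma commP: "x \<in> P \<Longrightarrow> y \<in> P \<Longrightarrow> x * y = y * x"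
  using P(2) centralizerD by blast

lemma r_nonzero: "i < k \<Longrightarrow> r i \<noteq> 0"
  using r mult_groupD(3)[OF M] by blast

text \<open>The matrices \<open>cj (r i) (c j)\<close> and \<open>a j i\<close> are inverse to each other, and \<open>z \<mapsto> \<Sum>i. a j i * cj (r i) z\<close> is the \<open>j\<close>-th
  coordinate in the basis \<open>c\<close> over the fixed field.\<close>

definition dual_bases :: "(nat \<Rightarrow> 'a) \<Rightarrow> (nat \<Rightarrow> nat \<Rightarrow> 'a) \<Rightarrow> bool" where
  "dual_bases c a \<longleftrightarrow> (\<forall>j<k. c j \<in> Q) \<and> (\<forall>j<k. \<forall>i<k. a j i \<in> P) \<and>
    (\<forall>j<k. \<forall>l<k. (\<Sum>i<k. a j i * cj (r i) (c l)) = (if j = l then 1 else 0)) \<and>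
    (\<forall>i<k. \<forall>l<k. (\<Sum>j<k. cj (r i) (c j) * a j l) = (if i = l then 1 else 0)) \<and>
    (\<forall>j<k. \<forall>z\<in>P. (\<Sum>i<k. a j i * cj (r i) z) \<in> P \<inter> centralizer M) \<and>
    (\<forall>z\<in>P. z = (\<Sum>j<k. (\<Sum>i<k. a j i * cj (r i) z) * c j))"

lemma dual_basesD:
  assumes "dual_bases c a"
  shows "j < k \<Longrightarrow> c j \<in> Q" "j < k \<Longrightarrow> i < k \<Longrightarrow> a j i \<in> P"
    "j < k \<Longrightarrow> l < k \<Longrightarrow> (\<Sum>i<k. a j i * cj (r i) (c l)) = (if j = l then 1 else 0)"
    "i < k \<Longrightarrow> l < k \<Longrightarrow> (\<Sum>j<k. cj (r i) (c j) * a j l) = (if i = l then 1 else 0)"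
    "j < k \<Longrightarrow> z \<in> P \<Longrightarrow> (\<Sum>i<k. a j i * cj (r i) z) \<in> P \<inter> centralizer M"
    "z \<in> P \<Longrightarrow> z = (\<Sum>j<k. (\<Sum>i<k. a j i * cj (r i) z) * c j)"
  using assms unfolding dual_bases_def by blast+

text \<open>Applying \<open>g \<in> M\<close> to the expansion in \<open>dual_system\<close> permutes its equations, so the
  coefficients, being determined by them, are fixed by \<open>g\<close>.\<close>

lemma artin_basis:
  obtains c a where "dual_bases c a"
proof -
  have sP: "cj (r i) z \<in> P" if "i < k" "z \<in> P" for i z using norm r that by blast
  obtain c a where c: "\<And>j. j < k \<Longrightarrow> c j \<in> Q" and a: "\<And>j i. j < k \<Longrightarrow> i < k \<Longrightarrow> a j i \<in> P"
    and dual: "\<And>j l. j < k \<Longrightarrow> l < k \<Longrightarrow> (\<Sum>i<k. a j i * cj (r i) (c l)) = (if j = l then 1 else 0)"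
    and expand: "\<And>i z. i < k \<Longrightarrow> z \<in> P \<Longrightarrow> cj (r i) z = (\<Sum>j<k. cj (r i) (c j) * (\<Sum>l<k. a j l * cj (r l) z))"
    by (rule dual_system[OF P Q, where s = "\<lambda>i. cj (r i)" and k = k, OF sP cj_mult[OF r_nonzero]
          cj_simps(2)[OF r_nonzero] dist]) (assumption | rule that)+
  have cP: "c j \<in> P" if "j < k" for j using c[OF that] Q by blast
  define \<phi> where "\<phi> = (\<lambda>j z. \<Sum>i<k. a j i * cj (r i) z)"
  have \<phi>P: "\<phi> j z \<in> P" if "j < k" "z \<in> P" for j z unfolding \<phi>_def
    by (intro div_subring_sum[OF P(1)] div_subringD(6)[OF P(1)]) (use a sP that in auto)
  have dual2: "(\<Sum>j<k. cj (r i) (c j) * a j l) = (if i = l then 1 else 0)" if i: "i < k" and l: "l < k" for i l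
  proof -
    define b where "b = (\<lambda>l. (\<Sum>j<k. cj (r i) (c j) * a j l) - (if i = l then 1 else 0))"
    have "\<forall>l\<in>{..<k}. b l = 0"
    proof (rule independence_of_homs[OF P Q, where s = "\<lambda>i. cj (r i)"])
      show "b l \<in> P" if "l \<in> {..<k}" for l
        using that a sP[OF i cP] div_subringD(1,2)[OF P(1)] unfolding b_def
        by (intro div_subringD(5)[OF P(1)] div_subring_sum[OF P(1)] div_subringD(6)[OF P(1)]) auto
      fix z assume z: "z \<in> Q"
      then have zP: "z \<in> P" using Q by blast
      have "(\<Sum>l<k. (\<Sum>j<k. cj (r i) (c j) * a j l) * cj (r l) z) =
          (\<Sum>j<k. cj (r i) (c j) * (\<Sum>l<k. a j l * cj (r l) z))"
        unfolding sum_distrib_left sum_distrib_right by (subst sum.swap) (simp add: mult.assoc)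
      then have "(\<Sum>l<k. (\<Sum>j<k. cj (r i) (c j) * a j l) * cj (r l) z) = cj (r i) z"
        using expand[OF i zP] by (rule trans[OF _ sym])
      moreover have "(\<Sum>l<k. (if i = l then 1 else 0) * cj (r l) z) = cj (r i) z"
      proof -
        have "(\<Sum>l<k. (if i = l then 1 else 0) * cj (r l) z) = (\<Sum>l<k. if l = i then cj (r l) z else 0)"
          by (intro sum.cong) auto
        then show ?thesis using i by simp
      qed
      ultimately show "(\<Sum>l<k. b l * cj (r l) z) = 0"
        by (simp add: b_def left_diff_distrib sum_subtractf)
    qed (use sP Q dist r_nonzero in \<open>auto simp: cj_mult\<close>)
    then show ?thesis using l by (simp add: b_def)
  qed
  have fixed: "\<phi> l z \<in> P \<inter> centralizer M" if l: "l < k" and z: "z \<in> P" for l z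
  proof -
    have "\<phi> l z * g = g * \<phi> l z" if g: "g \<in> M" for g
    proof -
      have g0: "g \<noteq> 0" by (rule mult_groupD(3)[OF M g])
      have y: "cj (r i) z = (\<Sum>j<k. cj (r i) (c j) * cj g (\<phi> j z))" if i: "i < k" for i
      proof -
        have "inverse g * r i \<in> M" by (rule mult_groupD(4)[OF M mult_groupD(5)[OF M g] r[OF i]])
        then obtain i' where i': "i' < k" "\<forall>w\<in>P. cj (inverse g * r i) w = cj (r i') w" using cover by blast
        have s: "cj g (cj (r i') w) = cj (r i) w" if "w \<in> P" for w
        proof -
          have "cj (r i') w = cj (inverse g) (cj (r i) w)" using i'(2) that by (simp add: cj_cj)
          then show ?thesis using g0 by simp
        qed
        have "cj (r i) z = cj g (cj (r i') z)" using s[OF z] by simp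
        also have "cj (r i') z = (\<Sum>j<k. cj (r i') (c j) * \<phi> j z)"
          using expand[OF i'(1) z] by (simp only: \<phi>_def)
        also have "cj g \<dots> = (\<Sum>j<k. cj (r i) (c j) * cj g (\<phi> j z))"
          unfolding cj_sum using g0 s[OF cP] by (intro sum.cong) (auto simp: cj_mult)
        finally show ?thesis .
      qed
      have "\<phi> l z = (\<Sum>i<k. a l i * cj (r i) z)" by (simp only: \<phi>_def)
      also have "\<dots> = (\<Sum>i<k. a l i * (\<Sum>j<k. cj (r i) (c j) * cj g (\<phi> j z)))"
        by (intro sum.cong arg_cong2[where f = "(*)"] refl y) auto
      also have "\<dots> = (\<Sum>j<k. (\<Sum>i<k. a l i * cj (r i) (c j)) * cj g (\<phi> j z))"
        unfolding sum_distrib_left sum_distrib_right by (subst sum.swap) (simp add: mult.assoc)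
      also have "\<dots> = (\<Sum>j<k. if j = l then cj g (\<phi> j z) else 0)"
        by (intro sum.cong) (use dual[OF l] in auto)
      also have "\<dots> = cj g (\<phi> l z)" using l by simp
      finally have "cj g (\<phi> l z) = \<phi> l z" by (rule sym)
      then show ?thesis using g0 by (simp add: cj_eq_iff)
    qed
    then show ?thesis using \<phi>P[OF l z] by (auto simp: centralizer_def)
  qed
  have span: "z = (\<Sum>j<k. \<phi> j z * c j)" if z: "z \<in> P" for z
  proof -
    obtain i where i: "i < k" "\<forall>w\<in>P. cj 1 w = cj (r i) w" using cover mult_groupD(1)[OF M] by blast
    have "z = cj (r i) z" using i(2) z by simp
    also have "\<dots> = (\<Sum>j<k. cj (r i) (c j) * \<phi> j z)"
      using expand[OF i(1) z] by (simp only: \<phi>_def)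
    also have "\<dots> = (\<Sum>j<k. \<phi> j z * c j)"
    proof (rule sum.cong[OF refl])
      fix j assume "j \<in> {..<k}"
      then have j: "j < k" by simp
      have "cj (r i) (c j) = c j" using i(2) cP[OF j] by simp
      then show "cj (r i) (c j) * \<phi> j z = \<phi> j z * c j" using commP[OF cP[OF j] \<phi>P[OF j z]] by simp
    qed
    finally show ?thesis .
  qed
  have "dual_bases c a"
    unfolding dual_bases_def
    by (intro conjI allI impI ballI c a dual dual2 fixed[unfolded \<phi>_def] span[unfolded \<phi>_def])
  then show ?thesis by (rule that)
qed

text \<open>The field has finite dimension over the fixed field.\<close>

lemma finite_if_fixed_finite:
  assumes "finite (P \<inter> centralizer M)"
  shows "finite P"
proof -
  obtain c a where ca: "dual_bases c a" by (rule artin_basis)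
  note c = dual_basesD(1)[OF ca] and a = dual_basesD(2)[OF ca] and dual2 = dual_basesD(4)[OF ca]
    and fixed = dual_basesD(5)[OF ca] and span = dual_basesD(6)[OF ca]
  have "P \<subseteq> (\<lambda>f. \<Sum>j<k. f j * c j) ` (PiE {..<k} (\<lambda>_. P \<inter> centralizer M))"
  proof
    fix z assume z: "z \<in> P"
    define f where "f = restrict (\<lambda>j. \<Sum>i<k. a j i * cj (r i) z) {..<k}"
    have "f \<in> PiE {..<k} (\<lambda>_. P \<inter> centralizer M)" unfolding f_def
      by (rule restrict_PiE_iff[THEN iffD2]) (use fixed z in blast)
    moreover have "z = (\<Sum>j<k. f j * c j)" using span[OF z] by (simp add: f_def)
    ultimately show "z \<in> (\<lambda>f. \<Sum>j<k. f j * c j) ` (PiE {..<k} (\<lambda>_. P \<inter> centralizer M))" by blast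
  qed
  moreover have "finite (PiE {..<k} (\<lambda>_. P \<inter> centralizer M))"
    by (rule finite_PiE) (use assms in auto)
  ultimately show ?thesis by (rule finite_subset[OF _ finite_imageI])
qed

text \<open>A homomorphism \<open>f\<close> over the fixed field is determined by its values at the Artin basis, which makes it a
  linear combination of the conjugations; by independence it is one of them.\<close>

lemma hom_is_conjugation:
  assumes QP: "Q = P" and f: "\<And>z. z \<in> P \<Longrightarrow> f z \<in> P" "\<And>z w. z \<in> P \<Longrightarrow> w \<in> P \<Longrightarrow> f (z + w) = f z + f w"
    "\<And>z w. z \<in> P \<Longrightarrow> w \<in> P \<Longrightarrow> f (z * w) = f z * f w"
    and fx: "\<And>z. z \<in> P \<inter> centralizer M \<Longrightarrow> f z = z"
  shows "\<exists>i<k. \<forall>z\<in>P. f z = cj (r i) z"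
proof (rule ccontr)
  assume neg: "\<not> ?thesis"
  obtain c a where ca: "dual_bases c a" by (rule artin_basis)
  note c = dual_basesD(1)[OF ca] and a = dual_basesD(2)[OF ca] and dual2 = dual_basesD(4)[OF ca]
    and fixed = dual_basesD(5)[OF ca] and span = dual_basesD(6)[OF ca]
  have cP: "c j \<in> P" if "j < k" for j using c[OF that] QP by simp
  have f0: "f 0 = 0" and f1: "f 1 = 1"
    using fx[of 0] fx[of 1] div_subringD(1,2)[OF P(1)] div_subringD(1,2)[OF div_subring_centralizer] by auto
  have fsum: "f (\<Sum>j<n. g j) = (\<Sum>j<n. f (g j))" if "\<And>j. j < n \<Longrightarrow> g j \<in> P" for g :: "nat \<Rightarrow> 'a" and n
    using that
  proof (induction n)
    case (Suc n)
    have "(\<Sum>j<n. g j) \<in> P" by (rule div_subring_sum[OF P(1)]) (use Suc.prems in auto)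
    then show ?case using Suc f(2) by simp
  qed (simp add: f0)
  define s where "s = (\<lambda>i. if i < k then cj (r i) else f)"
  define b where "b = (\<lambda>i. if i < k then (\<Sum>j<k. a j i * f (c j)) else - 1)"
  have sP: "s i z \<in> P" if "z \<in> P" for i z using that f(1) norm r by (auto simp: s_def)
  have "\<forall>i\<in>{..<Suc k}. b i = 0"
  proof (rule independence_of_homs[OF P P(1) order.refl, where s = s])
    show "b i \<in> P" for i
      using a f(1) cP div_subringD(2)[OF P(1)] unfolding b_def
      by (auto intro!: div_subring_sum[OF P(1)] div_subringD(4,6)[OF P(1)])
    show "s i (z * w) = s i z * s i w" if "z \<in> P" "w \<in> P" for i z w
      using that f(3) r_nonzero by (auto simp: s_def cj_mult)
    show "s i 1 = 1" for i using f1 r_nonzero by (auto simp: s_def)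
    show "\<exists>z\<in>P. s i z \<noteq> s j z" if ij: "i \<in> {..<Suc k}" "j \<in> {..<Suc k}" "i \<noteq> j" for i j
    proof -
      consider "i < k" "j < k" | "i < k" "j = k" | "i = k" "j < k" using ij by fastforce
      then show ?thesis
      proof cases
        case 1
        then show ?thesis using dist[of i j] ij QP by (auto simp: s_def)
      next
        case 2
        then show ?thesis using neg by (auto simp: s_def eq_commute)
      next
        case 3
        then show ?thesis using neg by (auto simp: s_def)
      qed
    qed
    fix z assume z: "z \<in> P"
    have "f z = (\<Sum>j<k. (\<Sum>i<k. a j i * cj (r i) z) * f (c j))"
    proof -
      have "f z = f (\<Sum>j<k. (\<Sum>i<k. a j i * cj (r i) z) * c j)" using span[OF z] by simp
      also have "\<dots> = (\<Sum>j<k. f ((\<Sum>i<k. a j i * cj (r i) z) * c j))"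
        by (rule fsum) (use fixed[OF _ z] cP in \<open>auto intro: div_subringD(6)[OF P(1)]\<close>)
      also have "\<dots> = (\<Sum>j<k. (\<Sum>i<k. a j i * cj (r i) z) * f (c j))"
        using fixed[OF _ z] fx f(3) cP by (intro sum.cong) auto
      finally show ?thesis .
    qed
    also have "\<dots> = (\<Sum>i<k. (\<Sum>j<k. a j i * f (c j)) * cj (r i) z)"
      unfolding sum_distrib_right
    proof (subst sum.swap, intro sum.cong refl)
      fix i j assume "i \<in> {..<k}" "j \<in> {..<k}"
      then have "cj (r i) z * f (c j) = f (c j) * cj (r i) z" by (intro commP norm r z f(1) cP) auto
      then show "a j i * cj (r i) z * f (c j) = a j i * f (c j) * cj (r i) z" by (simp add: mult.assoc)
    qed
    finally show "(\<Sum>i<Suc k. b i * s i z) = 0" by (simp add: b_def s_def)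
  qed (use sP in auto)
  then have "b k = 0" by simp
  then show False by (simp add: b_def)
qed

text \<open>If the fixed field is central, \<open>\<Sum>j. a j i \<otimes> c j\<close> is an idempotent of \<open>P \<otimes> P\<close>, which acts on
  the whole division ring and projects it to the elements of type \<open>cj (r i)\<close>.\<close>

lemma type_decomposition:
  assumes QP: "Q = P" and central: "\<And>z d. z \<in> P \<inter> centralizer M \<Longrightarrow> z * d = d * z"
  obtains \<pi> where "d = (\<Sum>i<k. \<pi> i)" "\<And>i z. i < k \<Longrightarrow> z \<in> P \<Longrightarrow> \<pi> i * z = cj (r i) z * \<pi> i"
proof -
  obtain c a where ca: "dual_bases c a" by (rule artin_basis)
  note c = dual_basesD(1)[OF ca] and a = dual_basesD(2)[OF ca] and dual2 = dual_basesD(4)[OF ca]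
    and fixed = dual_basesD(5)[OF ca] and span = dual_basesD(6)[OF ca]
  have cP: "c j \<in> P" if "j < k" for j using c[OF that] QP by simp
  define \<phi> where "\<phi> = (\<lambda>j z. \<Sum>i<k. a j i * cj (r i) z)"
  have \<phi>c: "\<phi> j z * d = d * \<phi> j z" if "j < k" "z \<in> P" for j z d
    using central fixed[OF that] by (simp add: \<phi>_def)
  define \<pi> where "\<pi> = (\<lambda>i. \<Sum>j<k. a j i * d * c j)"
  show ?thesis
  proof (rule that[of \<pi>])
    have P1: "1 \<in> P" by (rule div_subringD(2)[OF P(1)])
    have "(\<Sum>i<k. \<pi> i) = (\<Sum>j<k. \<phi> j 1 * d * c j)"
      unfolding \<pi>_def \<phi>_def sum_distrib_right using r_nonzero
      by (subst sum.swap) simp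
    also have "\<dots> = (\<Sum>j<k. d * (\<phi> j 1 * c j))"
      using \<phi>c[OF _ P1] by (intro sum.cong) (auto simp: mult.assoc)
    also have "\<dots> = d * (\<Sum>j<k. \<phi> j 1 * c j)" by (simp only: sum_distrib_left)
    also have "(\<Sum>j<k. \<phi> j 1 * c j) = 1" using span[OF P1] by (simp add: \<phi>_def)
    finally show "d = (\<Sum>i<k. \<pi> i)" by simp
  next
    fix i z assume i: "i < k" and z: "z \<in> P"
    have zP: "c j * z \<in> P" if "j < k" for j by (rule div_subringD(6)[OF P(1) cP[OF that] z])
    have key: "(\<Sum>j<k. a j i * \<phi> l (c j * z)) = cj (r i) z * a l i" if l: "l < k" for l
    proof -
      have "(\<Sum>j<k. a j i * \<phi> l (c j * z)) = (\<Sum>j<k. \<Sum>n<k. a l n * cj (r n) z * (cj (r n) (c j) * a j i))"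
        unfolding \<phi>_def sum_distrib_left
      proof (intro sum.cong refl)
        fix j n assume "j \<in> {..<k}" "n \<in> {..<k}"
        then have j: "j < k" and n: "n < k" by auto
        have n1: "cj (r n) (c j) \<in> P" "cj (r n) z \<in> P" using norm r[OF n] cP[OF j] z by auto
        have "a j i * (a l n * cj (r n) (c j * z)) = a j i * (a l n * (cj (r n) z * cj (r n) (c j)))"
          using r_nonzero[OF n] commP[OF n1] by (simp add: cj_mult)
        also have "\<dots> = a l n * (cj (r n) z * cj (r n) (c j)) * a j i"
          by (intro commP a i j l n n1 div_subringD(6)[OF P(1)])
        finally show "a j i * (a l n * cj (r n) (c j * z)) = a l n * cj (r n) z * (cj (r n) (c j) * a j i)"
          by (simp add: mult.assoc)
      qed
      also have "\<dots> = (\<Sum>n<k. a l n * cj (r n) z * (\<Sum>j<k. cj (r n) (c j) * a j i))"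
        unfolding sum_distrib_left by (rule sum.swap)
      also have "\<dots> = (\<Sum>n<k. if n = i then a l n * cj (r n) z else 0)"
        by (intro sum.cong) (use dual2[OF _ i] in auto)
      also have "\<dots> = a l i * cj (r i) z" using i by simp
      also have "\<dots> = cj (r i) z * a l i" by (intro commP a i l norm r z)
      finally show ?thesis .
    qed
    have "\<pi> i * z = (\<Sum>j<k. a j i * d * (c j * z))"
      unfolding \<pi>_def sum_distrib_right by (simp only: mult.assoc)
    also have "\<dots> = (\<Sum>j<k. a j i * d * (\<Sum>l<k. \<phi> l (c j * z) * c l))"
      using span[OF zP] by (intro sum.cong) (auto simp: \<phi>_def)
    also have "\<dots> = (\<Sum>j<k. \<Sum>l<k. a j i * \<phi> l (c j * z) * d * c l)"
      unfolding sum_distrib_left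
    proof (intro sum.cong refl)
      fix j l assume "j \<in> {..<k}" "l \<in> {..<k}"
      then have "\<phi> l (c j * z) * d = d * \<phi> l (c j * z)" by (intro \<phi>c zP) auto
      then show "a j i * d * (\<phi> l (c j * z) * c l) = a j i * \<phi> l (c j * z) * d * c l"
        by (simp add: mult.assoc[symmetric]) (simp add: mult.assoc)
    qed
    also have "\<dots> = (\<Sum>l<k. (\<Sum>j<k. a j i * \<phi> l (c j * z)) * d * c l)"
      unfolding sum_distrib_right by (rule sum.swap)
    also have "\<dots> = (\<Sum>l<k. cj (r i) z * (a l i * d * c l))"
      using key by (intro sum.cong) (auto simp: mult.assoc)
    also have "\<dots> = cj (r i) z * \<pi> i" unfolding \<pi>_def sum_distrib_left ..
    finally show "\<pi> i * z = cj (r i) z * \<pi> i" .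
  qed
qed

end

section \<open>Torsion elements in positive characteristic\<close>

lemma finite_order:
  fixes x :: "'a::division_ring"
  assumes "finite S" "\<And>n. x ^ n \<in> S" "x \<noteq> 0"
  obtains n where "n > 0" "x ^ n = 1"
proof -
  have "\<not> inj (\<lambda>n::nat. x ^ n)"
  proof
    assume "inj (\<lambda>n::nat. x ^ n)"
    then have "infinite (range (\<lambda>n::nat. x ^ n))" using finite_imageD by blast
    moreover have "range (\<lambda>n::nat. x ^ n) \<subseteq> S" using assms(2) by blast
    ultimately show False using finite_subset[OF _ assms(1)] by blast
  qed
  then obtain a b :: nat where ab: "x ^ a = x ^ b" "a < b"
    unfolding inj_def by (metis linorder_neqE_nat)
  have "x ^ a * x ^ (b - a) = x ^ b" using ab(2) by (simp add: power_add[symmetric])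
  then have "x ^ a * x ^ (b - a) = x ^ a * 1" using ab(1) by simp
  then have "x ^ (b - a) = 1" using assms(3) by simp
  then show ?thesis using that[of "b - a"] ab by simp
qed

lemma geometric_sum_mult:
  fixes y :: "'a::ring_1"
  shows "(\<Sum>j<n. y ^ j) * (y - 1) = y ^ n - 1"
proof (induction n)
  case (Suc n)
  have "(\<Sum>j<Suc n. y ^ j) * (y - 1) = (\<Sum>j<n. y ^ j) * (y - 1) + y ^ n * (y - 1)"
    by (simp add: distrib_right)
  also have "\<dots> = (y ^ n - 1) + (y ^ n * y - y ^ n)"
    unfolding Suc by (simp only: right_diff_distrib mult_1_right)
  finally show ?case by (simp add: power_commutes)
qed simp

lemma geometric_sum_zero:
  fixes y :: "'a::division_ring"
  assumes "y ^ n = 1" "y \<noteq> 1"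
  shows "(\<Sum>j<n. y ^ j) = 0"
  using geometric_sum_mult[of y n] assms by simp

lemma card_eq_if_fibres_equal:
  assumes "finite A" "\<And>b. b \<in> f ` A \<Longrightarrow> card {a \<in> A. f a = b} = c"
  shows "card A = c * card (f ` A)"
proof -
  have "card A = (\<Sum>b\<in>f ` A. \<Sum>a\<in>{a \<in> A. f a = b}. 1)"
    using sum.image_gen[OF assms(1), of "\<lambda>_. 1 :: nat" f] by simp
  also have "\<dots> = (\<Sum>b\<in>f ` A. c)" by (rule sum.cong[OF refl]) (use assms(2) in simp)
  finally show ?thesis by simp
qed

subsection \<open>Norms of finite fields\<close>

text \<open>\<open>twisted_norm g i k\<close> is \<open>k \<sigma>(k) \<dots> \<sigma>\<^sup>i\<^sup>-\<^sup>1(k)\<close> for \<open>\<sigma> = cj g\<close>; it occurs in \<open>(k g)\<^sup>i\<close>.\<close>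

fun twisted_norm :: "'a::division_ring \<Rightarrow> nat \<Rightarrow> 'a \<Rightarrow> 'a" where
  "twisted_norm g 0 k = 1"
| "twisted_norm g (Suc i) k = twisted_norm g i k * cj (g ^ i) k"

lemma power_mult_twisted_norm: "g \<noteq> 0 \<Longrightarrow> (k * g) ^ i = twisted_norm g i k * g ^ i"
proof (induction i)
  case (Suc i)
  have "(k * g) ^ Suc i = twisted_norm g i k * (g ^ i * k) * g"
    using Suc by (simp add: power_Suc2 mult.assoc del: power_Suc)
  also have "g ^ i * k = cj (g ^ i) k * g ^ i" using Suc.prems by (simp add: cj_left)
  finally show ?case by (simp add: power_Suc2 mult.assoc del: power_Suc)
qed simp

lemma twisted_norm_shift: "g \<noteq> 0 \<Longrightarrow> k * cj g (twisted_norm g i k) = twisted_norm g (Suc i) k"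
  by (induction i) (simp_all add: cj_mult cj_cj mult.assoc[symmetric])

locale finite_cyclic_action =
  fixes P :: "'a::division_ring set" and g :: 'a and m :: nat
  assumes P: "div_subring P" "P \<subseteq> centralizer P" "finite P"
    and g: "g \<noteq> 0" and norm: "\<And>z. z \<in> P \<Longrightarrow> cj g z \<in> P"
    and m: "m > 0" "\<And>z. z \<in> P \<Longrightarrow> cj (g ^ m) z = z"
    and min: "\<And>i. 0 < i \<Longrightarrow> i < m \<Longrightarrow> \<exists>z\<in>P. cj (g ^ i) z \<noteq> z"
begin

lemma comm: "x \<in> P \<Longrightarrow> y \<in> P \<Longrightarrow> x * y = y * x"
  using P(2) centralizerD by blast

lemma cj_pow_P: "z \<in> P \<Longrightarrow> cj (g ^ i) z \<in> P"
  by (induction i) (auto simp: cj_cj[symmetric] norm)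

lemma distinct_powers:
  assumes "i < m" "j < m" "i \<noteq> j"
  shows "\<exists>z\<in>P. cj (g ^ i) z \<noteq> cj (g ^ j) z"
proof -
  have *: "\<exists>z\<in>P. cj (g ^ i) z \<noteq> cj (g ^ j) z" if "i < j" "j < m" for i j
  proof -
    have "0 < j - i" "j - i < m" using that by auto
    then obtain z where z: "z \<in> P" "cj (g ^ (j - i)) z \<noteq> z" using min by blast
    have "cj (g ^ j) z = cj (g ^ i) (cj (g ^ (j - i)) z)"
      using that by (simp add: cj_cj power_add[symmetric])
    then have "cj (g ^ j) z \<noteq> cj (g ^ i) z" using z(2) g by (simp add: cj_inj)
    then show ?thesis using z(1) by metis
  qed
  show ?thesis using *[of i j] *[of j i] assms by (metis linorder_neqE_nat)
qed

lemma twisted_norm_P: "k \<in> P \<Longrightarrow> twisted_norm g i k \<in> P"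
  by (induction i) (auto intro: div_subringD(2,6)[OF P(1)] cj_pow_P)

lemma twisted_norm_mult:
  assumes "k \<in> P" "l \<in> P"
  shows "twisted_norm g i (k * l) = twisted_norm g i k * twisted_norm g i l"
proof (induction i)
  case (Suc i)
  have "cj (g ^ i) k * twisted_norm g i l = twisted_norm g i l * cj (g ^ i) k"
    by (intro comm cj_pow_P twisted_norm_P assms)
  then show ?case using Suc g by (simp add: cj_mult mult.assoc) (simp add: mult.assoc[symmetric])
qed simp

lemma twisted_norm_fixed: "k \<in> P \<Longrightarrow> cj g (twisted_norm g m k) = twisted_norm g m k"
proof (cases "k = 0")
  case True
  then show ?thesis using m(1) g by (cases m) simp_all
next
  case False
  assume k: "k \<in> P"
  have "k * cj g (twisted_norm g m k) = k * twisted_norm g m k"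
    using twisted_norm_shift[OF g, of k m] m(2)[OF k] comm[OF k twisted_norm_P[OF k, of m]] by simp
  then show ?thesis using False by simp
qed

text \<open>Hilbert 90: the Lagrange resolvent of \<open>k\<close> is nonzero for some \<open>c\<close>.\<close>

lemma hilbert_90:
  assumes k: "k \<in> P" "twisted_norm g m k = 1"
  shows "\<exists>a\<in>P - {0}. k = a * inverse (cj g a)"
proof -
  have "\<exists>c\<in>P. (\<Sum>i<m. twisted_norm g i k * cj (g ^ i) c) \<noteq> 0"
  proof (rule ccontr)
    assume "\<not> ?thesis"
    then have z: "\<And>c. c \<in> P \<Longrightarrow> (\<Sum>i<m. twisted_norm g i k * cj (g ^ i) c) = 0" by blast
    have "\<forall>i\<in>{..<m}. twisted_norm g i k = 0"
      by (rule independence_of_homs[OF P(1,2) P(1) order.refl, where s = "\<lambda>i. cj (g ^ i)"])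
        (use g z twisted_norm_P[OF k(1)] cj_pow_P distinct_powers in \<open>auto simp: cj_mult\<close>)
    then show False using m(1) by (auto dest: bspec[of _ _ 0])
  qed
  then obtain c where c: "c \<in> P" "(\<Sum>i<m. twisted_norm g i k * cj (g ^ i) c) \<noteq> 0" by blast
  define F where "F = (\<lambda>i. twisted_norm g i k * cj (g ^ i) c)"
  define a where "a = (\<Sum>i<m. F i)"
  have a0: "a \<noteq> 0" using c by (simp add: a_def F_def)
  have aP: "a \<in> P" unfolding a_def F_def
    by (intro div_subring_sum[OF P(1)] div_subringD(6)[OF P(1)] twisted_norm_P[OF k(1)] cj_pow_P c)
  have "k * cj g (F i) = F (Suc i)" for i
    using g twisted_norm_shift[OF g, of k i, symmetric]
    by (simp add: F_def cj_mult cj_cj mult.assoc[symmetric])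
  then have "k * cj g a = (\<Sum>i<m. F (Suc i))"
    by (simp add: a_def cj_sum sum_distrib_left)
  also have "\<dots> = a"
  proof -
    have "F 0 + (\<Sum>i<m. F (Suc i)) = (\<Sum>i<m. F i) + F m"
      by (simp only: sum.lessThan_Suc_shift[symmetric] sum.lessThan_Suc)
    moreover have "F m = F 0" using k(2) m(2)[OF c(1)] by (simp add: F_def)
    ultimately show ?thesis by (simp add: a_def)
  qed
  finally have "k * cj g a = a" .
  then have "k * (cj g a * inverse (cj g a)) = a * inverse (cj g a)" by (simp add: mult.assoc[symmetric])
  then have "k = a * inverse (cj g a)" using a0 g by simp
  then show ?thesis using aP a0 by blast
qed

text \<open>Counting: by Hilbert 90 the kernel of the norm on \<open>P\<^sup>*\<close> lies in the image of \<open>a \<mapsto> a \<sigma>(a)\<inverse>\<close>, so it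
  has at most \<open>|P\<^sup>*| / |V|\<close> elements for the fixed group \<open>V\<close>. Hence the image of the norm has at least
  \<open>|V|\<close> elements, and it is contained in \<open>V\<close>.\<close>

lemma norm_surjective:
  assumes e: "e \<in> P" "e \<noteq> 0" "cj g e = e"
  shows "\<exists>k\<in>P - {0}. twisted_norm g m k = e"
proof -
  define U where "U = P - {0}"
  define V where "V = {z \<in> U. cj g z = z}"
  define N where "N = twisted_norm g m"
  define ker where "ker = {k \<in> U. N k = 1}"
  define h where "h = (\<lambda>a. a * inverse (cj g a))"
  have fin: "finite U" "finite V" "finite ker" using P(3) by (auto simp: U_def V_def ker_def)
  have Umult: "x * y \<in> U" "x * inverse y \<in> U" if "x \<in> U" "y \<in> U" for x y
    using that div_subringD(6,7)[OF P(1)] by (auto simp: U_def)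
  have Ucomm: "x * y = y * x" if "x \<in> U" "y \<in> U" for x y using comm that by (auto simp: U_def)
  have N0: "N k \<noteq> 0" if "k \<in> U" for k
  proof -
    have "twisted_norm g i k \<noteq> 0" for i by (induction i) (use that g in \<open>auto simp: U_def\<close>)
    then show ?thesis by (simp add: N_def)
  qed
  have NV: "N k \<in> V" if "k \<in> U" for k
    using that N0[OF that] twisted_norm_P twisted_norm_fixed by (auto simp: V_def U_def N_def)
  have Nmult: "N (x * y) = N x * N y" if "x \<in> U" "y \<in> U" for x y
    using that twisted_norm_mult by (auto simp: N_def U_def)
  have inj: "inj_on (\<lambda>z. z * a) S" if "a \<in> U" for a S
    using that by (auto simp: inj_on_def U_def)
  have fibN: "card {a \<in> U. N a = b} = card ker" if "b \<in> N ` U" for b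
  proof -
    from that obtain a where a: "a \<in> U" "b = N a" by blast
    have "{x \<in> U. N x = b} = (\<lambda>z. z * a) ` ker"
    proof (intro equalityI subsetI)
      fix x assume x: "x \<in> {x \<in> U. N x = b}"
      define z where "z = x * inverse a"
      have z: "z \<in> U" using Umult x a by (simp add: z_def)
      have xz: "x = z * a" using a by (simp add: z_def U_def mult.assoc)
      have "N z * N a = 1 * N a" using x a Nmult[OF z a(1)] xz by simp
      then have "N z = 1" using N0[OF a(1)] by simp
      then show "x \<in> (\<lambda>z. z * a) ` ker" using z xz by (auto simp: ker_def)
    qed (use a Umult Nmult in \<open>auto simp: ker_def\<close>)
    then show ?thesis using card_image[OF inj[OF a(1)]] by simp
  qed
  have fibh: "card {a \<in> U. h a = b} = card V" if "b \<in> h ` U" for b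
  proof -
    from that obtain a where a: "a \<in> U" "b = h a" by blast
    have cja: "cj g x \<noteq> 0" "cj g x \<in> U" if "x \<in> U" for x using that g norm by (auto simp: U_def)
    have h_iff: "h x = h y \<longleftrightarrow> x * cj g y = y * cj g x" if x: "x \<in> U" and y: "y \<in> U" for x y
    proof -
      have hx: "h z * cj g z = z" if "z \<in> U" for z using cja[OF that] by (simp add: h_def mult.assoc)
      have "h x * (cj g x * cj g y) = x * cj g y" using hx[OF x] by (simp add: mult.assoc[symmetric])
      moreover have "h y * (cj g x * cj g y) = y * cj g x"
        using hx[OF y] Ucomm[OF cja(2)[OF x] cja(2)[OF y]] by (simp add: mult.assoc[symmetric])
      moreover have "h x = h y \<longleftrightarrow> h x * (cj g x * cj g y) = h y * (cj g x * cj g y)"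
        using cja[OF x] cja[OF y] by simp
      ultimately show ?thesis by simp
    qed
    have "{x \<in> U. h x = b} = (\<lambda>z. z * a) ` V"
    proof (intro equalityI subsetI)
      fix x assume x: "x \<in> {x \<in> U. h x = b}"
      define z where "z = x * inverse a"
      have z: "z \<in> U" using Umult x a by (simp add: z_def)
      have xz: "x = z * a" using a by (simp add: z_def U_def mult.assoc)
      have "x * cj g a = a * cj g x" using x a h_iff by auto
      also have "\<dots> = a * cj g z * cj g a" using g by (simp add: xz cj_mult mult.assoc)
      also have "\<dots> = cj g z * a * cj g a" using Ucomm[OF a(1) cja(2)[OF z]] by simp
      finally have "z * a = cj g z * a" using cja[OF a(1)] by (simp add: xz)
      then have "cj g z = z" using a by (simp add: U_def)
      then show "x \<in> (\<lambda>z. z * a) ` V" using z xz by (auto simp: V_def)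
    next
      fix x assume "x \<in> (\<lambda>z. z * a) ` V"
      then obtain z where z: "z \<in> U" "cj g z = z" "x = z * a" by (auto simp: V_def)
      have "a * cj g x = x * cj g a"
        using Ucomm[OF a(1) z(1)] g z by (simp add: cj_mult mult.assoc[symmetric])
      then show "x \<in> {x \<in> U. h x = b}" using z a Umult h_iff by auto
    qed
    then show ?thesis using card_image[OF inj[OF a(1)]] by simp
  qed
  have "ker \<subseteq> h ` U" using hilbert_90 by (force simp: ker_def U_def N_def h_def)
  then have "card V * card ker \<le> card V * card (h ` U)"
    by (intro mult_le_mono2 card_mono) (use fin in auto)
  also have "\<dots> = card ker * card (N ` U)"
    using card_eq_if_fibres_equal[OF fin(1) fibh] card_eq_if_fibres_equal[OF fin(1) fibN] by simp
  finally have "card V * card ker \<le> card (N ` U) * card ker" by (simp add: mult.commute)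
  moreover have "1 \<in> ker"
    using div_subringD(2)[OF P(1)] g
  proof -
    have "twisted_norm g i 1 = 1" for i by (induction i) (use g in auto)
    then show ?thesis using div_subringD(2)[OF P(1)] by (simp add: ker_def U_def N_def)
  qed
  then have "card ker > 0" using fin card_gt_0_iff by blast
  ultimately have "card V \<le> card (N ` U)" by simp
  then have "N ` U = V" using NV fin by (intro card_seteq) auto
  moreover have "e \<in> V" using e by (simp add: V_def U_def)
  ultimately show ?thesis by (auto simp: U_def N_def)
qed

end

text \<open>Suppose that \<open>g\<close> acts on the powers of \<open>x\<close> with order \<open>m > 1\<close>. Norms being surjective,
  \<open>y = k g\<close> can be arranged to satisfy \<open>y\<^sup>m = 1\<close>, whence \<open>1 + y + \<dots> + y\<^sup>m\<^sup>-\<^sup>1 = 0\<close>, and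
  these powers have different types.\<close>

lemma finite_normalizing_commute:
  fixes x g :: "'a::division_ring"
  assumes R: "div_subring R" "finite R" and x: "x \<in> R" and g: "g \<in> R" "g \<noteq> 0" and gx: "cj g x = x ^ i"
  shows "g * x = x * g"
proof (rule ccontr)
  assume nc: "g * x \<noteq> x * g"
  obtain n where n: "n > 0" "g ^ n = 1"
    using finite_order[OF R(2) _ g(2)] div_subring_power[OF R(1) g(1)] by blast
  define m where "m = (LEAST m. m > 0 \<and> cj (g ^ m) x = x)"
  have m: "m > 0 \<and> cj (g ^ m) x = x" unfolding m_def by (rule LeastI[of _ n]) (use n in simp)
  have min: "cj (g ^ j) x \<noteq> x" if "0 < j" "j < m" for j
    using not_less_Least[of j "\<lambda>m. m > 0 \<and> cj (g ^ m) x = x"] that by (auto simp: m_def)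
  define P where "P = div_gen {x, g ^ m}"
  have gm: "g ^ m * x = x * g ^ m" using m g by (simp add: cj_eq_iff)
  have "{x, g ^ m} \<subseteq> R" using x div_subring_power[OF R(1) g(1)] by simp
  then have "P \<subseteq> R" unfolding P_def by (rule div_gen_least[OF R(1)])
  then have fin: "finite P" by (rule finite_subset[OF _ R(2)])
  have Pd: "div_subring P" by (simp add: P_def)
  have gen: "x \<in> P" "g ^ m \<in> P" using div_gen_superset[of "{x, g ^ m}"] by (auto simp: P_def)
  have C: "{x, g ^ m} \<subseteq> centralizer {x, g ^ m}" using gm by (auto simp: centralizer_def)
  have Pc: "P \<subseteq> centralizer P" unfolding P_def by (rule div_gen_commutative[OF C])
  have act: "cj g z \<in> P" if "z \<in> P" for z
    unfolding P_def
  proof (rule div_gen_normalized[OF g(2) _ that[unfolded P_def]])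
    fix s assume "s \<in> {x, g ^ m}"
    then have "cj g s \<in> P"
      using gx gen div_subring_power[OF Pd gen(1), of i] g by (auto simp: cj_power)
    then show "cj g s \<in> div_gen {x, g ^ m}" by (simp add: P_def)
  qed
  interpret finite_cyclic_action P g m
  proof unfold_locales
    show "cj (g ^ m) z = z" if "z \<in> P" for z
      using centralizerD[of "g ^ m" P z] gen Pc that g by (auto simp: cj_eq_iff)
  qed (use Pd Pc fin g act m min gen in auto)
  define s where "s = inverse (g ^ m)"
  have "cj g s = s" using g by (simp add: s_def cj_inverse cj_power)
  then obtain k where k: "k \<in> P" "k \<noteq> 0" "twisted_norm g m k = s"
    using norm_surjective[of s] div_subringD(7)[OF Pd gen(2)] g by (auto simp: s_def)
  define y where "y = k * g"
  have y: "y ^ j = twisted_norm g j k * g ^ j" for j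
    unfolding y_def by (rule power_mult_twisted_norm[OF g])
  have "y ^ m = 1" using y[of m] k g by (simp add: s_def)
  moreover have "y \<noteq> 1"
  proof
    assume "y = 1"
    then have "inverse k = inverse k * (k * g)" by (simp add: y_def)
    then have "g = inverse k" using k by (simp add: mult.assoc[symmetric])
    then have "g \<in> P" using k div_subringD(7)[OF Pd] by simp
    then show False using comm gen nc by blast
  qed
  ultimately have "(\<Sum>j<m. y ^ j) = 0" by (rule geometric_sum_zero)
  then have "\<forall>j\<in>{..<m}. twisted_norm g j k * g ^ j = 0"
  proof (intro independence_of_types[where s = "\<lambda>j. cj (g ^ j)" and P = P])
    fix j z assume z: "z \<in> P"
    have "twisted_norm g j k * g ^ j * z = twisted_norm g j k * cj (g ^ j) z * g ^ j"
      using g by (simp add: mult.assoc cj_left)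
    also have "twisted_norm g j k * cj (g ^ j) z = cj (g ^ j) z * twisted_norm g j k"
      by (intro comm twisted_norm_P cj_pow_P z k)
    finally show "twisted_norm g j k * g ^ j * z = cj (g ^ j) z * (twisted_norm g j k * g ^ j)"
      by (simp add: mult.assoc)
  qed (use y distinct_powers in \<open>auto intro: comm cj_pow_P\<close>)
  then have "twisted_norm g 0 k * g ^ 0 = 0" using m by blast
  then show False by simp
qed

subsection \<open>Eigenvectors of conjugation by a root of unity\<close>

text \<open>Conjugation by \<open>x\<close> with \<open>x\<^sup>n = 1\<close> is diagonalized by a discrete Fourier transform in which \<open>x\<close>
  itself serves as the primitive root of unity.\<close>

lemma fourier_decomposition:
  fixes x d :: "'a::division_ring"
  assumes n: "n > 0" "x ^ n = 1" and min: "\<And>i. 0 < i \<Longrightarrow> i < n \<Longrightarrow> x ^ i \<noteq> 1"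
    and char: "(of_nat n :: 'a) \<noteq> 0"
  obtains D where "d = (\<Sum>j<n. D j)"
    "\<And>W j. div_subring W \<Longrightarrow> x \<in> W \<Longrightarrow> d \<in> W \<Longrightarrow> D j \<in> W"
    "\<And>j. \<exists>i. D j * x = x ^ i * D j"
proof -
  have x0: "x \<noteq> 0" using n by (metis power_0_left less_numeral_extra(3) zero_neq_one)
  define y where "y = inverse x"
  have xy: "x * y = 1" "y * x = 1" using x0 by (auto simp: y_def)
  have yn: "y ^ n = 1" unfolding y_def power_inverse n by simp
  have ymin: "y ^ i \<noteq> 1" if "0 < i" "i < n" for i
  proof
    assume "y ^ i = 1"
    then have "inverse (inverse (x ^ i)) = inverse 1" by (simp only: y_def power_inverse)
    then have "x ^ i = 1" by (simp only: inverse_inverse_eq inverse_1)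
    then show False using min[OF that] by contradiction
  qed
  define c where "c = inverse (of_nat n :: 'a)"
  define F where "F = (\<lambda>j i. y ^ (i * j) * cj (x ^ i) d)"
  define D where "D = (\<lambda>j. c * (\<Sum>i<n. F j i))"
  have c_comm: "c * z = z * c" for z
    unfolding c_def by (rule inverse_commute) (rule mult_of_nat_commute)
  have xF: "cj x (F j i) = x ^ j * F j (Suc i)" for i j
  proof -
    have "x ^ j * y ^ (Suc i * j) = y ^ (i * j)"
    proof -
      have "x ^ j * y ^ j = 1" using power_mult_commuting[of x y j] xy by simp
      then show ?thesis by (simp add: power_add mult.assoc[symmetric])
    qed
    moreover have "cj x (y ^ (i * j)) = y ^ (i * j)"
      using x0 xy power_commuting_commutes[of y x "i * j"] by (simp add: cj_eq_iff)
    ultimately show ?thesis using x0 by (simp add: F_def cj_mult cj_cj mult.assoc[symmetric])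
  qed
  have eig: "cj x (D j) = x ^ j * D j" for j
  proof -
    have "(\<Sum>i<n. F j (Suc i)) = (\<Sum>i<n. F j i)"
    proof -
      have "F j 0 + (\<Sum>i<n. F j (Suc i)) = (\<Sum>i<n. F j i) + F j n"
        by (simp only: sum.lessThan_Suc_shift[symmetric] sum.lessThan_Suc)
      moreover have "F j n = F j 0" by (simp add: F_def power_mult yn n)
      ultimately show ?thesis by simp
    qed
    then have "cj x (\<Sum>i<n. F j i) = x ^ j * (\<Sum>i<n. F j i)"
      by (simp add: cj_sum xF sum_distrib_left[symmetric])
    moreover have "cj x c = c" using c_comm[of x] x0 by (simp add: cj_eq_iff)
    ultimately show ?thesis using x0 c_comm[of "x ^ j"]
      by (simp add: D_def cj_mult mult.assoc[symmetric])
  qed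
  show ?thesis
  proof (rule that[of D])
    have "(\<Sum>j<n. F j i) = (if i = 0 then of_nat n * d else 0)" if "i < n" for i
    proof (cases "i = 0")
      case False
      have "(\<Sum>j<n. (y ^ i) ^ j) = 0"
        by (rule geometric_sum_zero) (use ymin False that in \<open>auto simp: power_mult[symmetric] mult.commute[of i] power_mult yn\<close>)
      then have "(\<Sum>j<n. y ^ (i * j)) * cj (x ^ i) d = 0" by (simp add: power_mult)
      then show ?thesis using False by (simp add: F_def sum_distrib_right)
    qed (simp add: F_def)
    then have "(\<Sum>i<n. \<Sum>j<n. F j i) = (\<Sum>i<n. if i = 0 then of_nat n * d else 0)"
      by (intro sum.cong) auto
    also have "\<dots> = of_nat n * d" using n(1) by simp
    finally have "(\<Sum>j<n. D j) = c * (of_nat n * d)"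
      unfolding D_def sum_distrib_left[symmetric] by (subst sum.swap) simp
    then show "d = (\<Sum>j<n. D j)" using char by (simp add: c_def mult.assoc[symmetric])
  next
    fix W j assume W: "div_subring W" and xW: "x \<in> W" and dW: "d \<in> W"
    show "D j \<in> W" unfolding D_def F_def c_def y_def
      by (intro div_subringD(6,7,8)[OF W] div_subring_sum[OF W] div_subring_power[OF W] div_subring_of_nat[OF W] xW dW)
  next
    fix j
    have "cj x (D j) * x = x * D j" using x0 by (rule cj_left)
    then have "x ^ j * D j * x = x * D j" by (simp add: eig)
    then have "y ^ j * (x ^ j * D j * x) = y ^ j * (x * D j)" by simp
    moreover have "y ^ j * x ^ j = 1" using power_mult_commuting[of y x j] xy by simp
    ultimately have "D j * x = y ^ j * x * D j" by (simp add: mult.assoc[symmetric])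
    moreover have "y = x ^ (n - 1)"
    proof -
      have "x * x ^ (n - 1) = 1" using n by (cases n) auto
      then have "y * (x * x ^ (n - 1)) = y" by simp
      then show ?thesis using xy by (simp add: mult.assoc[symmetric])
    qed
    ultimately have "D j * x = x ^ ((n - 1) * j) * x * D j" by (simp add: power_mult)
    then have "D j * x = x ^ Suc ((n - 1) * j) * D j" by (simp only: power_Suc2)
    then show "\<exists>i. D j * x = x ^ i * D j" by blast
  qed
qed

lemma torsion_eigenvectors:
  fixes x d :: "'a::division_ring"
  assumes p: "Factorial_Ring.prime p" "of_nat p = (0::'a)" and x: "x ^ N = 1" "N > 0"
  obtains D and n :: nat where "d = (\<Sum>j<n. D j)"
    "\<And>W j. div_subring W \<Longrightarrow> x \<in> W \<Longrightarrow> d \<in> W \<Longrightarrow> D j \<in> W"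
    "\<And>j. \<exists>i. D j * x = x ^ i * D j"
proof -
  define n where "n = (LEAST n. n > 0 \<and> x ^ n = 1)"
  have n: "n > 0 \<and> x ^ n = 1" unfolding n_def by (rule LeastI[of _ N]) (use x in simp)
  have min: "x ^ i \<noteq> 1" if "0 < i" "i < n" for i
    using not_less_Least[of i "\<lambda>n. n > 0 \<and> x ^ n = 1"] that by (auto simp: n_def)
  have "(of_nat n :: 'a) \<noteq> 0"
  proof
    assume "of_nat n = (0 :: 'a)"
    then have "CHAR('a) dvd n" by (simp add: of_nat_eq_0_iff_char_dvd)
    moreover have "CHAR('a) = p"
    proof -
      have "CHAR('a) dvd p" using p by (simp add: of_nat_eq_0_iff_char_dvd[symmetric])
      moreover have "CHAR('a) \<noteq> 1"
        by (metis of_nat_1 of_nat_CHAR zero_neq_one)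
      ultimately show ?thesis using p(1) prime_nat_iff by blast
    qed
    ultimately obtain q where q: "n = p * q" by blast
    then have "(x ^ q) ^ (p ^ 1) = 1" using n by (simp add: power_mult[symmetric] mult.commute)
    then have "x ^ q = 1" by (rule prime_root_of_unity[OF p])
    moreover have "0 < q" "q < n" using n q prime_gt_1_nat[OF p(1)] by auto
    ultimately show False using min by blast
  qed
  note fourier = fourier_decomposition[OF conjunct1[OF n] conjunct2[OF n] min this, of d]
  show ?thesis by (rule fourier) (assumption | rule that)+
qed

lemma finite_div_subring_char:
  assumes "div_subring (R :: 'a::division_ring set)" "finite R"
  obtains p where "Factorial_Ring.prime p" "of_nat p = (0::'a)"
proof (rule char_cases[where 'a = 'a])
  assume z: "\<And>n. n > 0 \<Longrightarrow> (of_nat n :: 'a) \<noteq> 0"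
  have "inj (of_nat :: nat \<Rightarrow> 'a)"
  proof (rule injI)
    fix a b :: nat assume ab: "(of_nat a :: 'a) = of_nat b"
    have *: False if "a < b" "(of_nat a :: 'a) = of_nat b" for a b :: nat
      using z[of "b - a"] that by (simp add: of_nat_diff)
    show "a = b" using *[of a b] *[of b a] ab by (metis linorder_neqE_nat)
  qed
  then have "infinite (range (of_nat :: nat \<Rightarrow> 'a))" using finite_imageD by blast
  moreover have "range (of_nat :: nat \<Rightarrow> 'a) \<subseteq> R" using div_subring_of_nat[OF assms(1)] by blast
  ultimately show ?thesis using finite_subset[OF _ assms(2)] by blast
qed (use that in blast)

text \<open>A form of Wedderburn's little theorem. The elements of \<open>Q\<close> span a finite division ring, and there \<open>finite_normalizing_commute\<close> applies to
  eigenvectors.\<close>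

theorem finite_multiplicative_commute:
  fixes Q :: "'a::division_ring set"
  assumes p: "Factorial_Ring.prime p" "of_nat p = (0::'a)"
    and Q: "finite Q" "0 \<notin> Q" "\<And>x y. x \<in> Q \<Longrightarrow> y \<in> Q \<Longrightarrow> x * y \<in> Q"
    and xy: "x \<in> Q" "y \<in> Q"
  shows "x * y = y * x"
proof -
  define f where "f = (\<lambda>c :: 'a \<Rightarrow> nat. \<Sum>q\<in>Q. of_nat (c q) * q)"
  define B where "B = range f"
  have "B \<subseteq> f ` (PiE Q (\<lambda>_. {..<p}))"
  proof
    fix b assume "b \<in> B"
    then obtain c where c: "b = f c" by (auto simp: B_def)
    have p0: "p > 0" using p(1) prime_gt_0_nat by blast
    have *: "(of_nat (k mod p) :: 'a) = of_nat k" for k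
    proof -
      have "(of_nat k :: 'a) = of_nat (k div p * p + k mod p)" by simp
      also have "\<dots> = of_nat (k mod p)" using p by (simp only: of_nat_add of_nat_mult) simp
      finally show ?thesis by simp
    qed
    have "restrict (\<lambda>q. c q mod p) Q \<in> PiE Q (\<lambda>_. {..<p})" using p0 by auto
    moreover have "b = f (restrict (\<lambda>q. c q mod p) Q)" unfolding c f_def by (simp add: *)
    ultimately show "b \<in> f ` (PiE Q (\<lambda>_. {..<p}))" by blast
  qed
  then have finB: "finite B" by (rule finite_subset) (intro finite_imageI finite_PiE Q(1), simp)
  have B0: "0 \<in> B" unfolding B_def by (rule range_eqI[of _ _ "\<lambda>_. 0"]) (simp add: f_def)
  have Badd: "a + b \<in> B" if "a \<in> B" "b \<in> B" for a b
  proof -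
    from that obtain c d where "a = f c" "b = f d" by (auto simp: B_def)
    then have "a + b = f (\<lambda>q. c q + d q)" by (simp add: f_def distrib_right sum.distrib)
    then show ?thesis by (simp add: B_def)
  qed
  have Bsum: "sum h I \<in> B" if "\<And>i. i \<in> I \<Longrightarrow> h i \<in> B" for h :: "'b \<Rightarrow> 'a" and I
    using that by (induction I rule: infinite_finite_induct) (auto intro: Badd B0)
  have BQ: "of_nat k * q \<in> B" if "q \<in> Q" for k q
  proof -
    have "f (\<lambda>q'. if q' = q then k else 0) = (\<Sum>q'\<in>Q. if q' = q then of_nat k * q' else 0)"
      unfolding f_def by (intro sum.cong) auto
    also have "\<dots> = of_nat k * q" using that Q(1) by simp
    finally show ?thesis unfolding B_def by (metis rangeI)
  qed
  have Bmult: "a * b \<in> B" if "a \<in> B" "b \<in> B" for a b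
  proof -
    from that obtain c d where cd: "a = f c" "b = f d" by (auto simp: B_def)
    have "a * b = (\<Sum>q\<in>Q. \<Sum>q'\<in>Q. of_nat (c q * d q') * (q * q'))"
      unfolding cd f_def sum_product
    proof (intro sum.cong refl)
      fix q q' :: 'a
      have "of_nat (c q) * q * (of_nat (d q') * q') = of_nat (c q) * (q * of_nat (d q')) * q'"
        by (simp only: mult.assoc)
      also have "q * of_nat (d q') = of_nat (d q') * q" by (rule mult_of_nat_commute[symmetric])
      finally show "of_nat (c q) * q * (of_nat (d q') * q') = of_nat (c q * d q') * (q * q')"
        by (simp add: mult.assoc)
    qed
    then show ?thesis using Q(3) by (auto simp del: of_nat_mult intro!: Bsum BQ)
  qed
  have QB: "Q \<subseteq> B" using BQ[of _ 1] by auto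
  have pow1: "\<exists>n>0. b ^ n = 1" if b: "b \<in> B" "b \<noteq> 0" for b
  proof -
    have "b ^ Suc n \<in> B" for n by (induction n) (use b Bmult in auto)
    then have "b ^ n \<in> insert 1 B" for n by (cases n) auto
    from finite_order[OF _ this b(2)] finB show ?thesis by blast
  qed
  have pow: "b ^ Suc n \<in> B" if "b \<in> B" for b n by (induction n) (use that Bmult in auto)
  have B1: "1 \<in> B"
  proof -
    have x: "x \<in> B" "x \<noteq> 0" using xy QB Q(2) by auto
    then obtain n where n: "n > 0" "x ^ n = 1" using pow1 by blast
    then show ?thesis using pow[OF x(1), of "n - 1"] by simp
  qed
  have B: "div_subring B"
    unfolding div_subring_def
  proof (intro conjI ballI B0 B1 Badd Bmult)
    fix b assume b: "b \<in> B"
    then obtain c where c: "b = f c" by (auto simp: B_def)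
    have "(of_nat (p - 1) :: 'a) = - 1"
      using p prime_gt_0_nat[OF p(1)] by (simp add: of_nat_diff)
    then have "- b = f (\<lambda>q. (p - 1) * c q)"
      unfolding c f_def by (simp add: sum_negf)
    then show "- b \<in> B" by (simp add: B_def)
    show "inverse b \<in> B"
    proof (cases "b = 0")
      case False
      then obtain n where n: "n > 0" "b ^ n = 1" using pow1 b by blast
      have "b * b ^ (n - 1) = 1" using n by (cases n) auto
      then have "inverse b = b ^ (n - 1)" by (rule inverse_unique)
      then show ?thesis using pow[OF b, of "n - 2"] B1 n
        by (cases "n = 1") (auto simp: Suc_diff_Suc numeral_2_eq_2)
    qed (use B0 in simp)
  qed
  obtain N where N: "N > 0" "x ^ N = 1" using pow1[of x] xy QB Q(2) by blast
  obtain D and n :: nat where D: "y = (\<Sum>j<n. D j)"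
    "\<And>W j. div_subring W \<Longrightarrow> x \<in> W \<Longrightarrow> y \<in> W \<Longrightarrow> D j \<in> W" "\<And>j. \<exists>i. D j * x = x ^ i * D j"
    by (rule torsion_eigenvectors[OF p N(2,1), of y]) (assumption | rule that)+
  have DB: "D j \<in> B" for j using D(2)[OF B] xy QB by blast
  have "D j * x = x * D j" for j
  proof (cases "D j = 0")
    case False
    obtain i where "D j * x = x ^ i * D j" using D(3) by blast
    then have "cj (D j) x = x ^ i" using False by (simp add: cj_eq_iff)
    then show ?thesis using finite_normalizing_commute[OF B finB _ DB False] xy QB by blast
  qed simp
  then have "y * x = x * y" unfolding D(1) sum_distrib_left sum_distrib_right by simp
  then show ?thesis by simp
qed

section \<open>Fields normalized by subnormal subgroups\<close>

text \<open>If \<open>y\<close> acts on the field \<open>P\<close> with infinite order, then \<open>P[y]\<close> is a skew polynomial ring: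
  the monomials have different types. An equation \<open>w g(y) = f(y)\<close> with \<open>w\<close> acting as a power of \<open>y\<close>
  therefore holds coefficientwise.\<close>

lemma skew_fraction_trivial:
  fixes P :: "'a::division_ring set"
  assumes P: "div_subring P" "P \<subseteq> centralizer P" and y: "y \<noteq> 0" and norm: "\<And>z. z \<in> P \<Longrightarrow> cj y z \<in> P"
    and inf: "\<And>m. m > 0 \<Longrightarrow> \<exists>z\<in>P. cj (y ^ m) z \<noteq> z"
    and fg: "\<And>i. f i \<in> P" "\<And>i. g i \<in> P" "\<And>i. i > N \<Longrightarrow> f i = 0" "\<And>i. i > N \<Longrightarrow> g i = 0" "f 0 = 1" "g 0 = 1"
    and eq: "w * peval y N g = peval y N f" and w: "w \<noteq> 0" "\<And>z. z \<in> P \<Longrightarrow> cj w z = cj (y ^ k) z"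
  shows "k = 0 \<and> f 1 = g 1"
proof -
  have comm: "x * z = z * x" if "x \<in> P" "z \<in> P" for x z using P(2) that centralizerD by blast
  have powP: "cj (y ^ i) z \<in> P" if "z \<in> P" for i z
    by (induction i) (use that norm in \<open>auto simp: cj_cj[symmetric]\<close>)
  have dist: "\<exists>z\<in>P. cj (y ^ i) z \<noteq> cj (y ^ j) z" if "i \<noteq> j" for i j
  proof -
    have *: "\<exists>z\<in>P. cj (y ^ i) z \<noteq> cj (y ^ j) z" if "i < j" for i j
    proof -
      have "j - i > 0" using that by simp
      then obtain z where z: "z \<in> P" "cj (y ^ (j - i)) z \<noteq> z" using inf by blast
      have "cj (y ^ j) z = cj (y ^ i) (cj (y ^ (j - i)) z)"
        using that by (simp add: cj_cj power_add[symmetric])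
      then have "cj (y ^ j) z \<noteq> cj (y ^ i) z" using z(2) y by (simp add: cj_inj)
      then show ?thesis using z(1) by metis
    qed
    show ?thesis using *[of i j] *[of j i] that by (metis linorder_neqE_nat)
  qed
  define a where "a = (\<lambda>n. (if k \<le> n then w * (y ^ (n - k) * g (n - k)) else 0) - y ^ n * f n)"
  have "\<forall>n\<in>{..N + k}. a n = 0"
  proof (rule independence_of_types[where s = "\<lambda>n. cj (y ^ n)" and P = P])
    fix n z assume z: "z \<in> P"
    have mono: "y ^ i * h * z = cj (y ^ i) z * (y ^ i * h)" if "h \<in> P" for i h
      using y comm[OF that z] by (simp add: cj_left mult.assoc[symmetric]) (simp add: mult.assoc)
    have "w * (y ^ (n - k) * g (n - k)) * z = cj (y ^ n) z * (w * (y ^ (n - k) * g (n - k)))" if "k \<le> n"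
    proof -
      define z' where "z' = cj (y ^ (n - k)) z"
      have z': "z' \<in> P" unfolding z'_def by (rule powP[OF z])
      have "w * z' = cj (y ^ k) z' * w" using cj_left[OF w(1), of z'] w(2)[OF z'] by simp
      moreover have "cj (y ^ k) z' = cj (y ^ n) z" using that by (simp add: z'_def cj_cj power_add[symmetric])
      ultimately have "w * z' = cj (y ^ n) z * w" by simp
      then show ?thesis using mono[OF fg(2), of "n - k" "n - k"]
        by (simp add: mult.assoc z'_def[symmetric]) (simp add: mult.assoc[symmetric])
    qed
    then show "a n * z = cj (y ^ n) z * a n"
      using mono[OF fg(1)] by (auto simp: a_def left_diff_distrib right_diff_distrib)
  next
    have "(\<Sum>n\<le>N + k. if k \<le> n then w * (y ^ (n - k) * g (n - k)) else 0) = (\<Sum>n\<in>{k..N + k}. w * (y ^ (n - k) * g (n - k)))"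
      by (rule sum.mono_neutral_cong_right) auto
    also have "\<dots> = (\<Sum>i\<le>N. w * (y ^ i * g i))"
      by (rule sum.reindex_bij_witness[of _ "\<lambda>i. i + k" "\<lambda>n. n - k"]) auto
    also have "\<dots> = w * peval y N g" by (simp add: peval_def sum_distrib_left)
    also note eq
    also have "peval y N f = (\<Sum>i\<le>N + k. y ^ i * f i)"
      unfolding peval_def by (rule sum.mono_neutral_left) (use fg(3) in auto)
    finally show "sum a {..N + k} = 0" by (simp add: a_def sum_subtractf)
  qed (use dist powP comm in auto)
  then have a: "a n = 0" if "n \<le> N + k" for n using that by simp
  have k0: "k = 0" using a[of 0] fg(5) by (cases "k = 0") (auto simp: a_def)
  then have "w = 1" using a[of 0] fg(5,6) by (simp add: a_def)
  have "f 1 = g 1"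
  proof (cases "1 \<le> N")
    case True
    then show ?thesis using a[of 1] \<open>w = 1\<close> k0 y by (simp add: a_def)
  qed (use fg(3)[of 1] fg(4)[of 1] in auto)
  then show ?thesis using k0 by blast
qed

text \<open>Here \<open>y\<close> is its own parameter: the bracket of \<open>1 + y u\<close> with \<open>y\<close> is an element \<open>w\<close> with
  \<open>w g(y) = f(y)\<close> for skew polynomials over \<open>P\<close> whose first-order coefficients differ by
  \<open>(dl y ^^ n) u\<close>. As \<open>w\<close> normalizes \<open>P\<close>, comparing types makes it act like a power of \<open>y\<close>, and
  \<open>skew_fraction_trivial\<close> says that the difference is \<open>0\<close>.\<close>

lemma dl_pow_eq_0_if_normalizes:
  fixes P :: "'a::division_ring set"
  assumes P: "div_subring P" "P \<subseteq> centralizer P" and y: "y \<noteq> 0"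
    and norm: "\<And>z. z \<in> P \<Longrightarrow> cj y z \<in> P" "\<And>z. z \<in> P \<Longrightarrow> cj (inverse y) z \<in> P"
    and inf: "\<And>m. m > 0 \<Longrightarrow> \<exists>z\<in>P. cj (y ^ m) z \<noteq> z"
    and u: "u \<in> P" and w: "\<And>z. z \<in> P \<Longrightarrow> cj (iter_comm y n (1 + y * u)) z \<in> P"
  shows "(dl y ^^ n) u = 0"
proof -
  have comm: "x * z = z * x" if "x \<in> P" "z \<in> P" for x z using P(2) that centralizerD by blast
  interpret twisted_poly P "inverse y" by unfold_locales (use P y norm in auto)
  have tw: "twisted y" unfolding twisted_def
    using y by (simp add: cj_def mult.assoc[symmetric])
  define ws where "ws = comm_word y n u"
  have letters: "b \<in> P" if "(b, s) \<in> set ws" for b s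
    using comm_word_letters[OF u norm(1)] that by (auto simp: ws_def)
  have nz: "1 + y * b \<noteq> 0" if b: "b \<in> P" for b
  proof
    assume z: "1 + y * b = 0"
    have b0: "b \<noteq> 0" using z by auto
    have "y = y * b * inverse b" using b0 by (simp add: mult.assoc)
    also have "y * b = - 1" using minus_unique[OF z] by (rule sym)
    finally have "y = - inverse b" by simp
    then have "y \<in> P" using b div_subringD(4,7)[OF P(1)] by metis
    then have "cj (y ^ 1) z = z" if "z \<in> P" for z using comm that y by (simp add: cj_eq_iff)
    then show False using inf[of 1] by auto
  qed
  define w where "w = iter_comm y n (1 + y * u)"
  have w0: "w \<noteq> 0" unfolding w_def by (rule iter_comm_nonzero[OF y nz[OF u]])
  have ev: "word_eval y ws = w" unfolding ws_def w_def by (rule word_eval_comm_word[OF y]) simp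
  obtain N f g where fg: "poly N f" "poly N g" "f 0 = 1" "g 0 = 1" "f 1 - g 1 = word_slope ws"
    and eq: "\<And>y. twisted y \<Longrightarrow> (\<And>b s. (b, s) \<in> set ws \<Longrightarrow> 1 + y * b \<noteq> 0) \<Longrightarrow>
       word_eval y ws * peval y N g = peval y N f"
    using word_fraction[of ws] letters by metis
  have eq: "w * peval y N g = peval y N f" using eq[OF tw] nz letters ev by blast
  have fgP: "\<And>i. f i \<in> P" "\<And>i. g i \<in> P" "\<And>i. i > N \<Longrightarrow> f i = 0" "\<And>i. i > N \<Longrightarrow> g i = 0"
    using fg by (auto simp: poly_def)
  have eq': "inverse w * peval y N f = peval y N g"
    using w0 by (simp add: eq[symmetric] mult.assoc[symmetric])
  have powP: "cj (y ^ i) z \<in> P" "cj (inverse y ^ i) z \<in> P" if "z \<in> P" for i z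
    by (induction i) (use that norm in \<open>auto simp: cj_cj[symmetric]\<close>)
  have "\<exists>i j. \<forall>z\<in>P. cj (w * y ^ i) z = cj (y ^ j) z"
  proof (rule ccontr)
    assume neg: "\<not> ?thesis"
    define a where "a = (\<lambda>(b, i). if b then - (y ^ i * f i) else w * (y ^ i * g i))"
    define s where "s = (\<lambda>(b, i). if b then cj (y ^ i) else cj (w * y ^ i))"
    have dist: "\<exists>z\<in>P. cj (y ^ i) z \<noteq> cj (y ^ j) z" if ij: "i \<noteq> j" for i j
    proof -
      have *: "\<exists>z\<in>P. cj (y ^ i) z \<noteq> cj (y ^ j) z" if "i < j" for i j
      proof -
        have "j - i > 0" using that by simp
        then obtain z where z: "z \<in> P" "cj (y ^ (j - i)) z \<noteq> z" using inf by blast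
        have "cj (y ^ j) z = cj (y ^ i) (cj (y ^ (j - i)) z)"
          using that by (simp add: cj_cj power_add[symmetric])
        then have "cj (y ^ j) z \<noteq> cj (y ^ i) z" using z(2) y by (simp add: cj_inj)
        then show ?thesis using z(1) by metis
      qed
      show ?thesis using *[of i j] *[of j i] ij by (metis linorder_neqE_nat)
    qed
    have sP: "s i z \<in> P" if "z \<in> P" for i :: "bool \<times> nat" and z
      using that powP(1) w by (cases i) (auto simp: s_def w_def cj_cj[symmetric])
    have "\<forall>i\<in>{False, True} \<times> {..N}. a i = 0"
    proof (rule independence_of_types[where s = s and P = P])
      fix p :: "bool \<times> nat" and z assume z: "z \<in> P"
      obtain b and i :: nat where p: "p = (b, i)" by force
      have mono: "y ^ i * h * z = cj (y ^ i) z * (y ^ i * h)" if "h \<in> P" for i h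
        using y comm[OF that z] by (simp add: cj_left mult.assoc[symmetric]) (simp add: mult.assoc)
      have "w * (y ^ i * g i) * z = cj (w * y ^ i) z * (w * (y ^ i * g i))"
      proof -
        have "w * cj (y ^ i) z = cj (w * y ^ i) z * w" using cj_left[OF w0, of "cj (y ^ i) z"] by (simp add: cj_cj)
        then show ?thesis using mono[OF fgP(2)[of i], of i]
          by (simp add: mult.assoc) (simp add: mult.assoc[symmetric])
      qed
      then show "a p * z = s p z * a p"
        using mono[OF fgP(1)[of i], of i] by (cases b) (auto simp: a_def s_def p)
    next
      fix p q assume pq: "p \<in> {False, True} \<times> {..N}" "q \<in> {False, True} \<times> {..N}" "p \<noteq> q"
      obtain b i where p: "p = (b, i)" by force
      obtain c j where q: "q = (c, j)" by force
      have n: "\<exists>z\<in>P. cj (w * y ^ i) z \<noteq> cj (y ^ j) z" for i j using neg by blast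
      show "\<exists>z\<in>P. s p z \<noteq> s q z"
      proof (cases "b = c")
        case True
        then have "i \<noteq> j" using pq p q by auto
        then obtain z where z: "z \<in> P" "cj (y ^ i) z \<noteq> cj (y ^ j) z" using dist by blast
        then have "cj (w * y ^ i) z \<noteq> cj (w * y ^ j) z" using w0 by (simp add: cj_cj[symmetric] cj_inj)
        then show ?thesis using z True by (auto simp: s_def p q)
      next
        case False
        then show ?thesis using n[of i j] n[of j i] by (cases b; cases c) (auto simp: s_def p q, metis)
      qed
    next
      show "sum a ({False, True} \<times> {..N}) = 0"
      proof -
        have "sum a ({False, True} \<times> {..N}) = (\<Sum>b\<in>{False, True}. \<Sum>i\<le>N. a (b, i))"
          by (simp add: sum.cartesian_product)
        also have "\<dots> = w * peval y N g - peval y N f"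
          by (simp add: a_def peval_def sum_distrib_left sum_negf)
        finally show ?thesis using eq by simp
      qed
    qed (use comm sP in auto)
    then have "a (False, 0) = 0" by blast
    then show False using w0 fg(4) by (simp add: a_def)
  qed
  then obtain i j where ij: "\<And>z. z \<in> P \<Longrightarrow> cj (w * y ^ i) z = cj (y ^ j) z" by blast
  have undo: "\<exists>z'\<in>P. z = cj (y ^ i) z'" if "z \<in> P" for z i
  proof (rule bexI[OF _ powP(2)[OF that, of i]])
    show "z = cj (y ^ i) (cj (inverse y ^ i) z)" using y by (simp add: power_inverse)
  qed
  have "f 1 = g 1"
  proof (cases "i \<le> j")
    case True
    have "cj w z = cj (y ^ (j - i)) z" if z: "z \<in> P" for z
    proof -
      obtain z' where z': "z' \<in> P" "z = cj (y ^ i) z'" using undo[OF z] by blast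
      then show ?thesis using ij[OF z'(1)] True by (simp add: cj_cj power_add[symmetric])
    qed
    from skew_fraction_trivial[OF P y norm(1) inf fgP fg(3,4) eq w0 this] show ?thesis by blast
  next
    case False
    have "cj (inverse w) z = cj (y ^ (i - j)) z" if z: "z \<in> P" for z
    proof -
      obtain z' where z': "z' \<in> P" "z = cj (y ^ j) z'" using undo[OF z] by blast
      have "cj w (cj (y ^ (i - j)) z) = z"
        using ij[OF z'(1)] False z'(2) by (simp add: cj_cj mult.assoc power_add[symmetric])
      then show ?thesis using w0 by (metis cj_inv_cancel(1))
    qed
    from skew_fraction_trivial[OF P y norm(1) inf fgP(2,1,4,3) fg(4,3) eq' _ this] w0 show ?thesis by auto
  qed
  then have "word_slope ws = 0" using fg(5) by simp
  then show ?thesis by (simp add: ws_def word_slope_comm_word)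
qed

text \<open>By Artin's theorem \<open>P\<close> is finite-dimensional over the elements that commute with \<open>y\<close>.\<close>

lemma finite_order_infinite_fixed:
  fixes P :: "'a::division_ring set"
  assumes P: "div_subring P" "P \<subseteq> centralizer P" and y: "y \<noteq> 0" and norm: "\<And>z. z \<in> P \<Longrightarrow> cj y z \<in> P"
    and m: "m > 0" "\<And>z. z \<in> P \<Longrightarrow> cj (y ^ m) z = z" and fin: "finite {z \<in> P. y * z = z * y}"
  shows "finite P"
proof -
  have powP: "cj (y ^ i) z \<in> P" if "z \<in> P" for i z
    by (induction i) (use that norm in \<open>auto simp: cj_cj[symmetric]\<close>)
  have mult_m: "cj (y ^ (m * i)) z = z" if "z \<in> P" for i z
    by (induction i) (use m(2)[OF that] in \<open>auto simp: power_add cj_cj[symmetric]\<close>)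
  \<comment> \<open>all elements acting like a power of \<open>y\<close>; with \<open>y\<close> alone one would have to form the cyclic group\<close>
  define M where "M = {a. a \<noteq> 0 \<and> (\<exists>i. \<forall>z\<in>P. cj a z = cj (y ^ i) z)}"
  have yM: "y \<in> M" using y by (auto simp: M_def intro!: exI[of _ 1])
  have M: "mult_group M"
    unfolding mult_group_def
  proof (intro conjI ballI)
    show "1 \<in> M" by (auto simp: M_def intro!: exI[of _ 0])
    show "0 \<notin> M" by (simp add: M_def)
    fix a assume a: "a \<in> M"
    then obtain i where i: "a \<noteq> 0" "\<And>z. z \<in> P \<Longrightarrow> cj a z = cj (y ^ i) z" by (auto simp: M_def)
    have "cj (inverse a) z = cj (y ^ ((m - 1) * i)) z" if z: "z \<in> P" for z
    proof -
      have "i + (m - 1) * i = m * i" using m(1) by (cases m) auto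
      then have "cj (y ^ i) (cj (y ^ ((m - 1) * i)) z) = z"
        using mult_m[OF z, of i] by (simp add: cj_cj power_add[symmetric])
      then have "cj a (cj (y ^ ((m - 1) * i)) z) = z" using i(2)[OF powP[OF z]] by simp
      then show ?thesis using i(1) by (metis cj_inv_cancel(1))
    qed
    then show "inverse a \<in> M" using i(1) by (auto simp: M_def)
    fix b assume "b \<in> M"
    then obtain j where j: "b \<noteq> 0" "\<And>z. z \<in> P \<Longrightarrow> cj b z = cj (y ^ j) z" by (auto simp: M_def)
    have "cj (a * b) z = cj (y ^ (i + j)) z" if z: "z \<in> P" for z
      using i(2)[OF powP[OF z]] j(2)[OF z] by (simp add: cj_cj[symmetric] power_add)
    then show "a * b \<in> M" using i(1) j(1) by (auto simp: M_def)
  qed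
  have "(\<lambda>a. restrict (cj a) P) ` M \<subseteq> (\<lambda>i. restrict (cj (y ^ i)) P) ` {..<m}"
  proof clarify
    fix a assume "a \<in> M"
    then obtain i where i: "\<And>z. z \<in> P \<Longrightarrow> cj a z = cj (y ^ i) z" by (auto simp: M_def)
    have "cj (y ^ i) z = cj (y ^ (i mod m)) z" if z: "z \<in> P" for z
    proof -
      have "y ^ i = y ^ (i mod m) * y ^ (m * (i div m))" by (simp add: power_add[symmetric])
      then show ?thesis using mult_m[OF z] by (simp add: cj_cj[symmetric])
    qed
    then have "restrict (cj a) P = restrict (cj (y ^ (i mod m))) P" using i by (intro restrict_ext) auto
    then show "restrict (cj a) P \<in> (\<lambda>i. restrict (cj (y ^ i)) P) ` {..<m}" using m(1) by auto
  qed
  then have "finite_action M P" unfolding finite_action_def by (rule finite_subset) simp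
  then obtain k :: nat and r where r: "\<And>i. i < k \<Longrightarrow> r i \<in> M"
    "\<And>i j. i < k \<Longrightarrow> j < k \<Longrightarrow> i \<noteq> j \<Longrightarrow> \<exists>z\<in>P. cj (r i) z \<noteq> cj (r j) z"
    "\<And>a. a \<in> M \<Longrightarrow> \<exists>i<k. \<forall>z\<in>P. cj a z = cj (r i) z"
    by (rule finite_action_representatives) (rule that)
  have norm': "cj a z \<in> P" if "a \<in> M" "z \<in> P" for a z
  proof -
    from that(1) obtain i where "\<And>z. z \<in> P \<Longrightarrow> cj a z = cj (y ^ i) z" by (auto simp: M_def)
    then show ?thesis using powP that(2) by simp
  qed
  interpret galois_action P P M k r
    by unfold_locales (use P M norm' r in auto)
  have "P \<inter> centralizer M \<subseteq> {z \<in> P. y * z = z * y}"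
    using yM by (auto simp: centralizer_def)
  then have "finite (P \<inter> centralizer M)" using fin by (rule finite_subset)
  then show ?thesis by (rule finite_if_fixed_finite)
qed

lemma powers_infinite:
  fixes s :: "'a::division_ring"
  assumes "s \<noteq> 0" "\<And>n. n > 0 \<Longrightarrow> s ^ n \<noteq> 1"
  shows "infinite (range (\<lambda>n::nat. s ^ n))"
proof
  assume "finite (range (\<lambda>n::nat. s ^ n))"
  then obtain n where "n > 0" "s ^ n = 1" using finite_order[OF _ _ assms(1)] by blast
  then show False using assms(2) by blast
qed

text \<open>If \<open>y\<close> has finite order, \<open>P\<^sup>*\<close> and \<open>y\<close> generate a finite group, which is commutative in characteristic
  \<open>p\<close>. Otherwise some power \<open>s\<close> of \<open>y\<close> centralizes \<open>P\<close>, its powers form an infinite central set in the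
  centralizer of \<open>s\<close>, and the field generated by \<open>s\<close> and \<open>P\<close> is normalized there.\<close>

lemma finite_field_centralized:
  fixes W :: "'a::division_ring set"
  assumes W: "div_subring W" and A: "subnormal_in W A" and P: "div_subring P" "P \<subseteq> W" "P \<subseteq> centralizer P" "finite P"
    and norm: "\<And>a z. a \<in> A \<Longrightarrow> z \<in> P \<Longrightarrow> cj a z \<in> P" and y: "y \<in> A" and k: "k \<in> P"
  shows "y * k = k * y"
proof (rule ccontr)
  assume nc: "y * k \<noteq> k * y"
  note grp = subnormal_in_group[OF A W]
  have yW: "y \<in> W" "y \<noteq> 0" using subnormal_in_subset[OF A] y mult_groupD(3)[OF grp] by auto
  obtain p where p: "Factorial_Ring.prime p" "of_nat p = (0::'a)"
    using finite_div_subring_char[OF P(1,4)] by blast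
  have comm: "x * z = z * x" if "x \<in> P" "z \<in> P" for x z using P(3) that centralizerD by blast
  have powP: "cj (y ^ i) z \<in> P" if "z \<in> P" for i z
    by (rule norm[OF mult_group_power[OF grp y] that])
  show False
  proof (cases "\<exists>n>0. y ^ n = 1")
    case True
    then obtain n where n: "n > 0" "y ^ n = 1" by blast
    define Q where "Q = (\<lambda>(z, i). z * y ^ i) ` ((P - {0}) \<times> {..<n})"
    have QI: "z * y ^ i \<in> Q" if "z \<in> P" "z \<noteq> 0" for z i
    proof -
      have "y ^ i = y ^ (n * (i div n)) * y ^ (i mod n)" by (simp add: power_add[symmetric])
      then have "y ^ i = y ^ (i mod n)" using n by (simp add: power_mult)
      then show ?thesis using n that by (auto simp: Q_def intro!: image_eqI[of _ _ "(z, i mod n)"])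
    qed
    have "y * k = k * y"
    proof (rule finite_multiplicative_commute[OF p])
      show "finite Q" using P(4) by (simp add: Q_def)
      show "0 \<notin> Q" using yW by (auto simp: Q_def)
      show "y \<in> Q" using QI[of 1 1] div_subringD(2)[OF P(1)] by simp
      have "k \<noteq> 0" using nc by auto
      then show "k \<in> Q" using QI[of k 0] k by simp
      fix a b assume "a \<in> Q" "b \<in> Q"
      then obtain z i z' j where ab: "a = z * y ^ i" "z \<in> P" "z \<noteq> 0" "b = z' * y ^ j" "z' \<in> P" "z' \<noteq> 0"
        by (auto simp: Q_def)
      have "a * b = z * (y ^ i * z') * y ^ j" by (simp add: ab mult.assoc)
      also have "y ^ i * z' = cj (y ^ i) z' * y ^ i" using yW by (simp add: cj_left)
      finally have "a * b = z * cj (y ^ i) z' * y ^ (i + j)" by (simp add: mult.assoc power_add)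
      then show "a * b \<in> Q"
        using QI[of "z * cj (y ^ i) z'" "i + j"] ab yW div_subringD(6)[OF P(1) ab(2) powP[OF ab(5)]] by simp
    qed
    then show False using nc by blast
  next
    case False
    have "finite ((\<lambda>i. restrict (cj (y ^ i)) P) ` UNIV)"
    proof (rule finite_subset)
      show "(\<lambda>i. restrict (cj (y ^ i)) P) ` UNIV \<subseteq> PiE P (\<lambda>_. P)" using powP by auto
    qed (use P(4) in \<open>auto intro: finite_PiE\<close>)
    then have "\<not> inj (\<lambda>i::nat. restrict (cj (y ^ i)) P)" using finite_imageD infinite_UNIV_nat by blast
    then obtain i j :: nat where "restrict (cj (y ^ i)) P = restrict (cj (y ^ j)) P" "i \<noteq> j"
      unfolding inj_def by blast
    then obtain i j :: nat where ij: "restrict (cj (y ^ i)) P = restrict (cj (y ^ j)) P" "i < j"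
      by (metis linorder_neqE_nat)
    define m where "m = j - i"
    define s where "s = y ^ m"
    have m: "m > 0" using ij by (simp add: m_def)
    have sz: "s * z = z * s" if z: "z \<in> P" for z
    proof -
      have "cj (y ^ i) z = cj (y ^ j) z" using fun_cong[OF ij(1), of z] z by simp
      also have "\<dots> = cj (y ^ i) (cj s z)" using ij(2) by (simp add: s_def m_def cj_cj power_add[symmetric])
      finally have "cj s z = z" using yW by (simp add: cj_inj)
      then show ?thesis using yW by (simp add: cj_eq_iff s_def)
    qed
    have s0: "s \<noteq> 0" using yW by (simp add: s_def)
    have sT: "s ^ n \<noteq> 1" if "n > 0" for n
    proof -
      have "m * n > 0" using m that by simp
      then have "y ^ (m * n) \<noteq> 1" using False by blast
      then show ?thesis by (simp add: s_def power_mult)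
    qed
    define V where "V = W \<inter> centralizer {s}"
    have V: "div_subring V" unfolding V_def by (rule div_subring_Int[OF W]) simp
    have VW: "V \<subseteq> W" by (simp add: V_def)
    have yV: "y \<in> V" using yW by (auto simp: V_def centralizer_def s_def power_commutes)
    have sV: "s \<in> V" unfolding s_def by (rule div_subring_power[OF V yV])
    define K where "K = div_gen (insert s P)"
    have K: "div_subring K" by (simp add: K_def)
    have genK: "insert s P \<subseteq> K" unfolding K_def by (rule div_gen_superset)
    have "insert s P \<subseteq> V" using sV P(2) sz by (auto simp: V_def centralizer_def)
    then have KV: "K \<subseteq> V" unfolding K_def by (rule div_gen_least[OF V])
    have "insert s P \<subseteq> centralizer (insert s P)" using sz comm by (auto simp: centralizer_def)
    then have Kc: "K \<subseteq> centralizer K" unfolding K_def by (rule div_gen_commutative)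
    have KneV: "K \<noteq> V"
    proof
      assume "K = V"
      then have "y \<in> centralizer K" using yV Kc by blast
      then show False using nc genK k centralizerD by blast
    qed
    have Knorm: "cj a z \<in> K" if a: "a \<in> A \<inter> V" and z: "z \<in> K" for a z
      unfolding K_def
    proof (rule div_gen_normalized[OF _ _ z[unfolded K_def]])
      show a0: "a \<noteq> 0" using a mult_groupD(3)[OF grp] by blast
      fix t assume "t \<in> insert s P"
      moreover have "cj a s = s" using a a0 by (auto simp: V_def centralizer_def cj_eq_iff)
      ultimately have "cj a t \<in> insert s P" using norm a by auto
      then show "cj a t \<in> div_gen (insert s P)" using genK by (auto simp: K_def)
    qed
    have "y * k = k * y"
    proof (rule normalized_subring_centralized[OF V subnormal_in_Int[OF A W V VW] K KV _ powers_infinite[OF s0 sT]])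
      show "range (\<lambda>n. s ^ n) \<subseteq> K" using genK by (auto intro: div_subring_power[OF K])
      show "t * a = a * t" if "t \<in> range (\<lambda>n. s ^ n)" "a \<in> V" for t a
        using that by (auto simp: V_def centralizer_def intro!: power_commuting_commutes)
    qed (use KneV Knorm y yV k genK in auto)
    then show False using nc by blast
  qed
qed

text \<open>Stuth's theorem for fields. If \<open>y\<close> acts with finite order on an infinite field, its infinite
  fixed field is central in the centralizer of that fixed field; an infinite order is
  excluded by the skew polynomial argument, since it would force \<open>dl y\<close> to be nilpotent.\<close>

theorem normalized_field_centralized:
  fixes W :: "'a::division_ring set"
  assumes W: "div_subring W" and A: "subnormal_in W A" and P: "div_subring P" "P \<subseteq> W" "P \<subseteq> centralizer P"
    and norm: "\<And>a z. a \<in> A \<Longrightarrow> z \<in> P \<Longrightarrow> cj a z \<in> P" and y: "y \<in> A" and k: "k \<in> P"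
  shows "y * k = k * y"
proof (cases "finite P")
  case True
  then show ?thesis by (rule finite_field_centralized[OF W A P _ norm y k])
next
  case infP: False
  note grp = subnormal_in_group[OF A W]
  have yW: "y \<in> W" "y \<noteq> 0" using subnormal_in_subset[OF A] y mult_groupD(3)[OF grp] by auto
  have comm: "x * z = z * x" if "x \<in> P" "z \<in> P" for x z using P(3) that centralizerD by blast
  show ?thesis
  proof (cases "\<exists>m>0. \<forall>z\<in>P. cj (y ^ m) z = z")
    case True
    then obtain m where m: "m > 0" "\<And>z. z \<in> P \<Longrightarrow> cj (y ^ m) z = z" by blast
    define T where "T = {z \<in> P. y * z = z * y}"
    have T: "infinite T"
      using finite_order_infinite_fixed[OF P(1,3) yW(2) norm[OF y] m] infP by (auto simp: T_def)
    define V where "V = W \<inter> centralizer T"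
    have V: "div_subring V" unfolding V_def by (rule div_subring_Int[OF W]) simp
    have VW: "V \<subseteq> W" by (simp add: V_def)
    have yV: "y \<in> V" using yW by (auto simp: V_def T_def centralizer_def)
    have PV: "P \<subseteq> V" using P(2) comm by (auto simp: V_def T_def centralizer_def)
    show ?thesis
    proof (cases "P = V")
      case True
      then show ?thesis using comm yV k by blast
    next
      case False
      show ?thesis
      proof (rule normalized_subring_centralized[OF V subnormal_in_Int[OF A W V VW] P(1) PV False T])
        show "t * a = a * t" if "t \<in> T" "a \<in> V" for t a
          using that by (auto simp: V_def centralizer_def)
      qed (use y yV k norm in \<open>auto simp: T_def\<close>)
    qed
  next
    case False
    then have inf: "\<exists>z\<in>P. cj (y ^ m) z \<noteq> z" if "m > 0" for m using that by blast
    obtain n where n: "\<forall>x\<in>A. \<forall>v\<in>W - {0}. iter_comm x n v \<in> A"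
      using subnormal_in_iter_comm[OF A W] by blast
    have nil: "(dl y ^^ n) u = 0" if u: "u \<in> P" for u
    proof (rule dl_pow_eq_0_if_normalizes[OF P(1,3) yW(2) norm[OF y] norm[OF mult_groupD(5)[OF grp y]] inf u])
      fix z assume z: "z \<in> P"
      show "cj (iter_comm y n (1 + y * u)) z \<in> P"
      proof (cases "1 + y * u = 0")
        case True
        have "iter_comm y i 0 = 0" if "i = i" for i :: nat by (induction i) auto
        then show ?thesis using True div_subringD(1)[OF P(1)] by (simp add: cj_def)
      next
        case False
        have "1 + y * u \<in> W" using yW u P(2) by (intro div_subringD(2,3,6)[OF W]) auto
        then show ?thesis using n y False z by (intro norm) auto
      qed
    qed
    have norm_y: "cj y z \<in> P" if "z \<in> P" for z by (rule norm[OF y that])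
    have "y * z = z * y" if z: "z \<in> P" for z
    proof (rule char_cases[where 'a = 'a])
      assume zero: "\<And>n. n > 0 \<Longrightarrow> (of_nat n :: 'a) \<noteq> 0"
      show ?thesis
      proof (rule nilpotent_dl_trivial[OF P(1) norm_y yW(2) nil _ z])
        fix p g assume "Factorial_Ring.prime p" "of_nat p = (0 :: 'a)"
        then show "\<exists>r s. iter_comm y r g ^ p ^ s * y = y * iter_comm y r g ^ p ^ s"
          using zero[of p] prime_gt_0_nat by blast
      qed
    next
      fix p assume p: "Factorial_Ring.prime p" "of_nat p = (0 :: 'a)"
      \<comment> \<open>nilpotency of \<open>dl y\<close> makes a power of \<open>y\<close> act trivially, against the infinite order\<close>
      have "n \<le> p ^ n" using self_le_power less_exp p
        by (metis less_imp_le_nat order_trans power_mono prime_ge_2_nat zero_le)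
      then have "(dl y ^^ (p ^ n)) z = 0" if "z \<in> P" for z by (rule dl_pow_ge[OF nil[OF that]])
      then have "cj (y ^ (p ^ n)) z = z" if "z \<in> P" for z
        using that dl_pow_prime_power[OF p yW(2), of n] by (simp add: dl_def)
      moreover have "p ^ n > 0" using prime_gt_0_nat[OF p(1)] by simp
      ultimately show ?thesis using inf by blast
    qed
    then show ?thesis using k by blast
  qed
qed

section \<open>Division subrings generated by subnormal subgroups\<close>

subsection \<open>Subnormal subgroups with a noncentral torsion element\<close>

text \<open>Here the center may be finite. Suitable infinite central sets are the powers of \<open>b\<^sup>m\<close> in
  \<open>C(b\<^sup>m)\<close>, for elements \<open>b\<close> that normalize the powers of a torsion element \<open>\<alpha>\<close> nontrivially.\<close>

text \<open>If \<open>b\<close> had finite order, the products \<open>\<alpha>\<^sup>j b\<^sup>l\<close> would form a finite group, which is commutative in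
  characteristic \<open>p\<close>. The exponent \<open>m\<close> exists because the powers of \<open>\<alpha>\<close> are finitely many.\<close>

lemma torsion_normalizer:
  fixes b \<alpha> :: "'a::division_ring"
  assumes p: "Factorial_Ring.prime p" "of_nat p = (0::'a)" and a: "\<alpha> ^ N = 1" "N > 0"
    and b: "b * \<alpha> = \<alpha> ^ i * b" "b * \<alpha> \<noteq> \<alpha> * b"
  obtains m where "m > 0" "b ^ m * \<alpha> = \<alpha> * b ^ m" "infinite (range (\<lambda>n::nat. (b ^ m) ^ n))"
proof -
  have b0: "b \<noteq> 0" using b(2) by auto
  have a0: "\<alpha> \<noteq> 0" using a by (metis power_0_left less_numeral_extra(3) zero_neq_one)
  have baj: "b * \<alpha> ^ j = \<alpha> ^ (i * j) * b" for j
  proof -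
    have "cj b \<alpha> = \<alpha> ^ i" using b(1) b0 by (simp add: cj_eq_iff)
    then have "cj b (\<alpha> ^ j) = (\<alpha> ^ i) ^ j" using b0 by (simp add: cj_power)
    then show ?thesis using b0 by (simp add: cj_eq_iff power_mult)
  qed
  have bla: "b ^ l * \<alpha> ^ j = \<alpha> ^ (i ^ l * j) * b ^ l" for l j
  proof (induction l)
    case (Suc l)
    have "b ^ Suc l * \<alpha> ^ j = b * (b ^ l * \<alpha> ^ j)" by (simp add: mult.assoc)
    also have "\<dots> = (b * \<alpha> ^ (i ^ l * j)) * b ^ l" by (simp only: Suc mult.assoc)
    also have "\<dots> = \<alpha> ^ (i * (i ^ l * j)) * b * b ^ l" by (simp only: baj)
    finally show ?case by (simp add: mult.assoc)
  qed simp
  have red: "\<alpha> ^ j = \<alpha> ^ (j mod N)" for j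
  proof -
    have "\<alpha> ^ j = \<alpha> ^ (N * (j div N)) * \<alpha> ^ (j mod N)" by (simp add: power_add[symmetric])
    then show ?thesis using a(1) by (simp add: power_mult)
  qed
  have nt: "b ^ n \<noteq> 1" if n: "n > 0" for n
  proof
    assume bn: "b ^ n = 1"
    have redb: "b ^ j = b ^ (j mod n)" for j
    proof -
      have "b ^ j = b ^ (n * (j div n)) * b ^ (j mod n)" by (simp add: power_add[symmetric])
      then show ?thesis using bn by (simp add: power_mult)
    qed
    define Q where "Q = (\<lambda>(j, l). \<alpha> ^ j * b ^ l) ` (UNIV \<times> UNIV)"
    have QI: "\<alpha> ^ j * b ^ l \<in> Q" for j l unfolding Q_def by (rule image_eqI[of _ _ "(j, l)"]) auto
    have "Q \<subseteq> (\<lambda>(j, l). \<alpha> ^ j * b ^ l) ` ({..<N} \<times> {..<n})"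
    proof
      fix q assume "q \<in> Q"
      then obtain j l where q: "q = \<alpha> ^ j * b ^ l" by (auto simp: Q_def)
      have "q = \<alpha> ^ (j mod N) * b ^ (l mod n)" unfolding q using red[of j] redb[of l] by simp
      then show "q \<in> (\<lambda>(j, l). \<alpha> ^ j * b ^ l) ` ({..<N} \<times> {..<n})"
        using a(2) n by (intro image_eqI[of _ _ "(j mod N, l mod n)"]) auto
    qed
    then have fin: "finite Q" by (rule finite_subset) simp
    have "b * \<alpha> = \<alpha> * b"
    proof (rule finite_multiplicative_commute[OF p fin])
      show "0 \<notin> Q" using a0 b0 by (auto simp: Q_def)
      show "b \<in> Q" using QI[of 0 1] by simp
      show "\<alpha> \<in> Q" using QI[of 1 0] by simp
      fix u v assume "u \<in> Q" "v \<in> Q"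
      then obtain j l j' l' where uv: "u = \<alpha> ^ j * b ^ l" "v = \<alpha> ^ j' * b ^ l'" by (auto simp: Q_def)
      have "u * v = \<alpha> ^ j * (b ^ l * \<alpha> ^ j') * b ^ l'" by (simp add: uv mult.assoc)
      also have "\<dots> = \<alpha> ^ (j + i ^ l * j') * b ^ (l + l')" by (simp add: bla power_add mult.assoc)
      finally show "u * v \<in> Q" using QI by simp
    qed
    then show False using b(2) by contradiction
  qed
  have "finite (range (\<lambda>l. cj (b ^ l) \<alpha>))"
  proof (rule finite_subset)
    show "range (\<lambda>l. cj (b ^ l) \<alpha>) \<subseteq> (\<lambda>j. \<alpha> ^ j) ` {..<N}"
    proof clarify
      fix l
      have "b ^ l * \<alpha> = \<alpha> ^ (i ^ l mod N) * b ^ l"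
        using bla[of l 1] red[of "i ^ l"] by simp
      then have "cj (b ^ l) \<alpha> = \<alpha> ^ (i ^ l mod N)" using b0 by (simp add: cj_eq_iff)
      then show "cj (b ^ l) \<alpha> \<in> (\<lambda>j. \<alpha> ^ j) ` {..<N}" using a(2) by auto
    qed
  qed simp
  then have "\<not> inj (\<lambda>l. cj (b ^ l) \<alpha>)" using finite_imageD infinite_UNIV_nat by blast
  then obtain l l' where "cj (b ^ l) \<alpha> = cj (b ^ l') \<alpha>" "l \<noteq> l'" unfolding inj_def by blast
  then obtain l l' where l: "cj (b ^ l) \<alpha> = cj (b ^ l') \<alpha>" "l < l'" by (metis linorder_neqE_nat)
  define m where "m = l' - l"
  have m: "m > 0" using l by (simp add: m_def)
  have "cj (b ^ l) (cj (b ^ m) \<alpha>) = cj (b ^ l') \<alpha>"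
    using l(2) by (simp add: m_def cj_cj power_add[symmetric])
  then have "cj (b ^ m) \<alpha> = \<alpha>" using l(1) b0 by (metis cj_inj power_not_zero)
  then have "b ^ m * \<alpha> = \<alpha> * b ^ m" using b0 by (simp add: cj_eq_iff)
  moreover have "infinite (range (\<lambda>n::nat. (b ^ m) ^ n))"
  proof (rule powers_infinite)
    fix n :: nat assume "n > 0"
    then have "m * n > 0" using m by simp
    then show "(b ^ m) ^ n \<noteq> 1" using nt by (simp add: power_mult[symmetric])
  qed (use b0 in simp)
  ultimately show ?thesis using m that by blast
qed

text \<open>Every element is a sum of eigenvectors for conjugation by \<open>\<alpha>\<close>, so it suffices to treat an \<open>e\<close> that
  normalizes the powers of \<open>\<alpha>\<close>. Once \<open>e\<^sup>m\<close> is in \<open>L\<close>, so is \<open>C(e\<^sup>m)\<close> and with it \<open>e\<close>. To get \<open>e\<^sup>m\<close>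
  into \<open>L\<close>, take an eigenvector \<open>b \<in> L\<close> that commutes with \<open>e\<^sup>m\<close>: then \<open>e\<^sup>m \<in> C(b\<^sup>m\<^sup>') \<subseteq> L\<close>.\<close>

theorem torsion_subnormal_generates:
  fixes A :: "'a::division_ring set"
  assumes p: "Factorial_Ring.prime p" "of_nat p = (0::'a)" and A: "subnormal_in UNIV A"
    and \<alpha>: "\<alpha> \<in> A" "\<alpha> ^ N = 1" "N > 0" and nc: "\<alpha> * d0 \<noteq> d0 * \<alpha>"
    and L: "div_subring L" "A \<subseteq> L"
  shows "L = UNIV"
proof -
  define normalizes where "normalizes = (\<lambda>b. (\<exists>i. b * \<alpha> = \<alpha> ^ i * b) \<and> b * \<alpha> \<noteq> \<alpha> * b)"
  have \<alpha>L: "\<alpha> \<in> L" using \<alpha> L by blast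
  \<comment> \<open>once \<open>b\<^sup>m\<close> is in \<open>L\<close>, so is its whole centralizer\<close>
  have gen: "centralizer {b ^ m} \<subseteq> K" if b: "normalizes b" and m: "b ^ m * \<alpha> = \<alpha> * b ^ m"
    "infinite (range (\<lambda>n::nat. (b ^ m) ^ n))" and K: "div_subring K" "b ^ m \<in> K" "A \<inter> centralizer {b ^ m} \<subseteq> K" for b m K
  proof -
    define V where "V = centralizer {b ^ m}"
    have V: "div_subring V" by (simp add: V_def)
    have sub: "subnormal_in V (A \<inter> V)" by (rule subnormal_in_Int[OF A _ V]) auto
    have bV: "b \<in> V" "b ^ m \<in> V" by (auto simp: V_def centralizer_def power_commutes)
    have "K \<inter> V = V"
    proof (rule subnormal_generates[OF V sub div_subring_Int[OF K(1) V] _ _ m(2)])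
      show "range (\<lambda>n. (b ^ m) ^ n) \<subseteq> K \<inter> V"
        using K(2) bV by (auto intro: div_subring_power[OF K(1)] div_subring_power[OF V])
      show "t * a = a * t" if "t \<in> range (\<lambda>n. (b ^ m) ^ n)" "a \<in> V" for t a
      proof -
        obtain n where n: "t = (b ^ m) ^ n" using \<open>t \<in> _\<close> by blast
        have "b ^ m * a = a * b ^ m" using \<open>a \<in> V\<close> by (auto simp: V_def centralizer_def)
        then show ?thesis unfolding n by (rule power_commuting_commutes)
      qed
      show "\<alpha> \<in> A \<inter> V" using \<alpha> m(1) by (auto simp: V_def centralizer_def)
      show "\<alpha> * b \<noteq> b * \<alpha>" using b by (auto simp: normalizes_def)
    qed (use K(3) bV in \<open>auto simp: V_def\<close>)
    then show ?thesis by (auto simp: V_def)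
  qed
  have eig: "\<exists>D n. d = (\<Sum>j<n::nat. D j) \<and> (\<forall>W j. div_subring W \<longrightarrow> \<alpha> \<in> W \<longrightarrow> d \<in> W \<longrightarrow> D j \<in> W) \<and>
      (\<forall>j. D j * \<alpha> = \<alpha> * D j \<or> normalizes (D j))" for d
  proof -
    obtain D and n :: nat where D: "d = (\<Sum>j<n. D j)"
      "\<And>W j. div_subring W \<Longrightarrow> \<alpha> \<in> W \<Longrightarrow> d \<in> W \<Longrightarrow> D j \<in> W" "\<And>j. \<exists>i. D j * \<alpha> = \<alpha> ^ i * D j"
      by (rule torsion_eigenvectors[OF p \<alpha>(2,3), of d]) (assumption | rule that)+
    show ?thesis by (rule exI[of _ D], rule exI[of _ n]) (use D in \<open>auto simp: normalizes_def\<close>)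
  qed
  have normalizing_in_V: "\<exists>b. normalizes b \<and> (\<forall>W. div_subring W \<longrightarrow> \<alpha> \<in> W \<longrightarrow> a \<in> W \<longrightarrow> b \<in> W)"
    if a: "\<alpha> * a \<noteq> a * \<alpha>" for a
  proof (rule ccontr)
    assume neg: "\<not> ?thesis"
    obtain D and n :: nat where D: "a = (\<Sum>j<n. D j)"
      "\<forall>W j. div_subring W \<longrightarrow> \<alpha> \<in> W \<longrightarrow> a \<in> W \<longrightarrow> D j \<in> W"
      "\<forall>j. D j * \<alpha> = \<alpha> * D j \<or> normalizes (D j)" using eig[of a] by blast
    have "D j * \<alpha> = \<alpha> * D j" for j using D(2,3) neg by blast
    then have "a * \<alpha> = \<alpha> * a" unfolding D(1) sum_distrib_left sum_distrib_right by simp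
    then show False using a by simp
  qed
  have normalizing_in_L: "e \<in> L" if e: "normalizes e" for e
  proof -
    obtain m where m: "e ^ m * \<alpha> = \<alpha> * e ^ m" "infinite (range (\<lambda>n::nat. (e ^ m) ^ n))"
      using e torsion_normalizer[OF p \<alpha>(2,3)] unfolding normalizes_def by metis
    define V where "V = centralizer {e ^ m}"
    have V: "div_subring V" by (simp add: V_def)
    have eV: "e \<in> V" "\<alpha> \<in> V" using m(1) by (auto simp: V_def centralizer_def power_commutes)
    have "\<exists>a\<in>A \<inter> V. \<alpha> * a \<noteq> a * \<alpha>"
    proof (rule ccontr)
      assume "\<not> ?thesis"
      then have AV: "A \<inter> V \<subseteq> centralizer {\<alpha>}" by (auto simp: centralizer_def)
      have "V \<subseteq> centralizer {\<alpha>}" unfolding V_def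
      proof (rule gen[OF e m div_subring_centralizer])
        show "e ^ m \<in> centralizer {\<alpha>}" using m(1) by (simp add: centralizer_def)
      qed (use AV in \<open>simp add: V_def\<close>)
      then show False using eV e by (auto simp: normalizes_def centralizer_def)
    qed
    then obtain a where a: "a \<in> A" "a \<in> V" "\<alpha> * a \<noteq> a * \<alpha>" by blast
    obtain b where b: "normalizes b" "\<And>W. div_subring W \<Longrightarrow> \<alpha> \<in> W \<Longrightarrow> a \<in> W \<Longrightarrow> b \<in> W"
      using normalizing_in_V[OF a(3)] by blast
    have bV: "b \<in> V" using b(2)[OF V eV(2) a(2)] .
    have bL: "b \<in> L" using b(2)[OF L(1) \<alpha>L] a(1) L(2) by blast
    obtain m' where m': "b ^ m' * \<alpha> = \<alpha> * b ^ m'" "infinite (range (\<lambda>n::nat. (b ^ m') ^ n))"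
      using b(1) torsion_normalizer[OF p \<alpha>(2,3)] unfolding normalizes_def by metis
    have "centralizer {b ^ m'} \<subseteq> L"
      by (rule gen[OF b(1) m' L(1) div_subring_power[OF L(1) bL]]) (use L(2) in blast)
    moreover have "e ^ m \<in> centralizer {b ^ m'}"
    proof -
      have "b * e ^ m = e ^ m * b" using bV by (auto simp: V_def centralizer_def)
      then have "b ^ m' * e ^ m = e ^ m * b ^ m'" by (rule power_commuting_commutes)
      then show ?thesis by (simp add: centralizer_def)
    qed
    ultimately have "e ^ m \<in> L" by blast
    then have "V \<subseteq> L" unfolding V_def by (rule gen[OF e m L(1)]) (use L(2) in blast)
    then show ?thesis using eV by blast
  qed
  obtain e0 where e0: "normalizes e0" using normalizing_in_V[OF nc] by blast
  have commuting_in_L: "c \<in> L" if c: "c * \<alpha> = \<alpha> * c" for c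
  proof (cases "c = 0")
    case True
    then show ?thesis using div_subringD(1)[OF L(1)] by simp
  next
    case False
    obtain i where i: "e0 * \<alpha> = \<alpha> ^ i * e0" "e0 * \<alpha> \<noteq> \<alpha> * e0" using e0 by (auto simp: normalizes_def)
    have ci: "c * \<alpha> ^ i = \<alpha> ^ i * c" using power_commuting_commutes[of \<alpha> c i] c by simp
    have "c * e0 * \<alpha> = \<alpha> ^ i * (c * e0)"
      using i(1) ci by (simp add: mult.assoc) (simp add: mult.assoc[symmetric])
    moreover have "c * e0 * \<alpha> \<noteq> \<alpha> * (c * e0)"
    proof
      assume "c * e0 * \<alpha> = \<alpha> * (c * e0)"
      then have "c * (e0 * \<alpha>) = c * (\<alpha> * e0)" using c by (simp add: mult.assoc[symmetric])
      then show False using False i(2) by simp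
    qed
    ultimately have "normalizes (c * e0)" by (auto simp: normalizes_def)
    from div_subringD(6)[OF L(1) normalizing_in_L[OF this] div_subringD(7)[OF L(1) normalizing_in_L[OF e0]]]
    have "c * e0 * inverse e0 \<in> L" .
    moreover have "e0 \<noteq> 0" using i(2) by auto
    ultimately show ?thesis by (simp add: mult.assoc)
  qed
  have "d \<in> L" for d
  proof -
    obtain D and n :: nat where D: "d = (\<Sum>j<n. D j)" "\<forall>j. D j * \<alpha> = \<alpha> * D j \<or> normalizes (D j)"
      using eig[of d] by blast
    show ?thesis unfolding D(1)
      by (rule div_subring_sum[OF L(1)]) (use D(2) commuting_in_L normalizing_in_L in blast)
  qed
  then show ?thesis by blast
qed

subsection \<open>Subnormal subgroups generating a ring with infinite center\<close>

text \<open>Climbing the subnormal chain: if \<open>A \<subseteq> L\<close> is normal in \<open>B\<close>, then \<open>B\<close> normalizes \<open>L\<close>, hence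
  centralizes the center \<open>Z\<close> of \<open>L\<close>, and \<open>subnormal_generates\<close> inside \<open>C(Z)\<close> puts \<open>B\<close> into \<open>L\<close>.\<close>

theorem subnormal_generates_if_infinite_center:
  fixes G :: "'a::division_ring set"
  assumes G: "subnormal_in UNIV G" and L: "L = div_gen (D_center \<union> G)"
    and Z: "infinite (L \<inter> centralizer L)" and nc: "a \<in> G" "w \<in> L" "a * w \<noteq> w * a"
  shows "L = UNIV"
proof -
  define Z where "Z = L \<inter> centralizer L"
  have Ld: "div_subring L" by (simp add: L)
  have Zd: "div_subring Z" unfolding Z_def by (rule div_subring_Int[OF Ld]) simp
  have "UNIV \<subseteq> L" if "subnormal_in UNIV B" "G \<subseteq> B" "B \<subseteq> L" for B
    using that
  proof (induction rule: subnormal_in.induct)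
    case units
    then show ?case using div_subringD(1)[OF Ld] by blast
  next
    case (step B A)
    note grp = subnormal_in_group[OF step.hyps(1) div_subring_UNIV]
    have "D_center \<union> A \<subseteq> L" using div_gen_superset[of "D_center \<union> G"] step.prems(2) by (auto simp: L)
    then have LA: "L = div_gen (D_center \<union> A)"
      using div_gen_least[OF Ld] div_gen_mono[of "D_center \<union> G" "D_center \<union> A"] step.prems(1) L by blast
    have norm: "cj b l \<in> L" if b: "b \<in> B" and l: "l \<in> L" for b l
      unfolding LA
    proof (rule div_gen_normalized[OF mult_groupD(3)[OF grp b] _ l[unfolded LA]])
      fix s assume s: "s \<in> D_center \<union> A"
      show "cj b s \<in> div_gen (D_center \<union> A)"
      proof (cases "s \<in> A")
        case True
        then have "cj b s \<in> D_center \<union> A" using step.hyps(4)[OF b] by blast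
        then show ?thesis using div_gen_superset by blast
      next
        case False
        then have "cj b s = s" using s mult_groupD(3)[OF grp b] by (auto simp: centralizer_def cj_eq_iff)
        then show ?thesis using s div_gen_superset[of "D_center \<union> A"] by auto
      qed
    qed
    have normZ: "cj b z \<in> Z" if b: "b \<in> B" and z: "z \<in> Z" for b z
    proof -
      have b0: "b \<noteq> 0" by (rule mult_groupD(3)[OF grp b])
      have "cj b z * l = l * cj b z" if l: "l \<in> L" for l
      proof -
        have l': "cj (inverse b) l \<in> L" by (rule norm[OF mult_groupD(5)[OF grp b] l])
        have "cj b (z * cj (inverse b) l) = cj b (cj (inverse b) l * z)"
          using z l' by (simp add: Z_def centralizer_def)
        then show ?thesis using b0 by (simp add: cj_mult)
      qed
      then show ?thesis using norm[OF b] z by (auto simp: Z_def centralizer_def)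
    qed
    have cent: "b * z = z * b" if "b \<in> B" "z \<in> Z" for b z
      by (rule normalized_field_centralized[OF div_subring_UNIV step.hyps(1) Zd _ _ normZ that])
        (auto simp: Z_def centralizer_def)
    define V where "V = centralizer Z"
    have BV: "B \<subseteq> V" and LV: "L \<subseteq> V" using cent by (auto simp: V_def Z_def centralizer_def)
    have Vd: "div_subring V" by (simp add: V_def)
    have subA: "subnormal_in UNIV A" by (rule subnormal_in.step[OF step.hyps])
    have "A \<inter> V = A" using step.hyps(3) BV by blast
    then have subV: "subnormal_in V A" using subnormal_in_Int[OF subA div_subring_UNIV Vd] by simp
    have "L = V"
    proof (rule subnormal_generates[OF Vd subV Ld LV step.prems(2)])
      show "infinite Z" using Z by (simp add: Z_def)
      show "t * a = a * t" if "t \<in> Z" "a \<in> V" for t a using that by (auto simp: V_def centralizer_def)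
    qed (use nc step.prems(1) LV in \<open>auto simp: Z_def\<close>)
    then have "B \<subseteq> L" using BV by simp
    then show ?case using step.IH step.prems(1) step.hyps(3) by blast
  qed
  moreover have "G \<subseteq> L" using div_gen_superset[of "D_center \<union> G"] by (auto simp: L)
  ultimately show ?thesis using G by blast
qed

section \<open>Linear dependence and finite-dimensional subrings\<close>

text \<open>Gaussian elimination: multiples of a vector with a nonzero coefficient at \<open>v i0\<close> are subtracted from the
  others.\<close>

lemma linear_dependence:
  fixes K :: "'a::division_ring set"
  assumes K: "div_subring K" and I: "finite I" and J: "finite J" "card I < card J"
    and u: "\<And>j. j \<in> J \<Longrightarrow> u j = (\<Sum>i\<in>I. c j i * v i)" "\<And>j i. j \<in> J \<Longrightarrow> i \<in> I \<Longrightarrow> c j i \<in> K"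
  shows "\<exists>q. (\<forall>j\<in>J. q j \<in> K) \<and> (\<exists>j\<in>J. q j \<noteq> 0) \<and> (\<Sum>j\<in>J. q j * u j) = 0"
  using I J u
proof (induction I arbitrary: J u c rule: finite_induct)
  case empty
  then obtain j where "j \<in> J" by (metis card.empty less_irrefl all_not_in_conv)
  then show ?case using empty.prems(3) div_subringD(2)[OF K] by (intro exI[of _ "\<lambda>_. 1"]) auto
next
  case (insert i0 I)
  show ?case
  proof (cases "\<forall>j\<in>J. c j i0 = 0")
    case True
    have "u j = (\<Sum>i\<in>I. c j i * v i)" if "j \<in> J" for j
      using insert.prems(3)[OF that] insert.hyps True that by simp
    then show ?thesis using insert.IH[of J u c] insert.prems insert.hyps by auto
  next
    case False
    then obtain j0 where j0: "j0 \<in> J" "c j0 i0 \<noteq> 0" by blast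
    define J' where "J' = J - {j0}"
    define t where "t = (\<lambda>j. c j i0 * inverse (c j0 i0))"
    define u' where "u' = (\<lambda>j. u j - t j * u j0)"
    define c' where "c' = (\<lambda>j i. c j i - t j * c j0 i)"
    have cK: "c j i \<in> K" if "j \<in> J" "i \<in> insert i0 I" for j i using insert.prems(4) that by blast
    have tK: "t j \<in> K" if "j \<in> J" for j unfolding t_def
      using that j0 by (intro div_subringD(6,7)[OF K] cK) auto
    have t0: "t j * c j0 i0 = c j i0" for j using j0 by (simp add: t_def mult.assoc)
    have "\<exists>q. (\<forall>j\<in>J'. q j \<in> K) \<and> (\<exists>j\<in>J'. q j \<noteq> 0) \<and> (\<Sum>j\<in>J'. q j * u' j) = 0"
    proof (rule insert.IH[of J' u' c'])
      show "finite J'" using insert.prems(1) by (simp add: J'_def)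
      show "card I < card J'" using insert.prems(1,2) insert.hyps j0(1) by (simp add: J'_def)
      show "c' j i \<in> K" if "j \<in> J'" "i \<in> I" for j i unfolding c'_def
        using that j0 by (intro div_subringD(5,6)[OF K] cK tK) (auto simp: J'_def)
      show "u' j = (\<Sum>i\<in>I. c' j i * v i)" if "j \<in> J'" for j
      proof -
        have j: "j \<in> J" using that by (simp add: J'_def)
        have "u' j = (c j i0 * v i0 + (\<Sum>i\<in>I. c j i * v i)) - t j * (c j0 i0 * v i0 + (\<Sum>i\<in>I. c j0 i * v i))"
          using insert.prems(3)[OF j] insert.prems(3)[OF j0(1)] insert.hyps by (simp add: u'_def)
        also have "\<dots> = (\<Sum>i\<in>I. c' j i * v i)"
          using t0[of j] by (simp add: c'_def distrib_left left_diff_distrib sum_subtractf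
              sum_distrib_left mult.assoc[symmetric])
        finally show ?thesis .
      qed
    qed
    then obtain q where q: "\<forall>j\<in>J'. q j \<in> K" "\<exists>j\<in>J'. q j \<noteq> 0" "(\<Sum>j\<in>J'. q j * u' j) = 0" by blast
    define q' where "q' = q(j0 := - (\<Sum>j\<in>J'. q j * t j))"
    have "q' j \<in> K" if "j \<in> J" for j
    proof (cases "j = j0")
      case True
      have "(\<Sum>j\<in>J'. q j * t j) \<in> K"
        using q(1) tK by (intro div_subring_sum[OF K] div_subringD(6)[OF K]) (auto simp: J'_def)
      then show ?thesis using True div_subringD(4)[OF K] by (simp add: q'_def)
    qed (use that q(1) in \<open>auto simp: q'_def J'_def\<close>)
    moreover have "\<exists>j\<in>J. q' j \<noteq> 0" using q(2) by (auto simp: q'_def J'_def)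
    moreover have "(\<Sum>j\<in>J. q' j * u j) = 0"
    proof -
      have "(\<Sum>j\<in>J. q' j * u j) = q' j0 * u j0 + (\<Sum>j\<in>J'. q' j * u j)"
        unfolding J'_def using insert.prems(1) j0(1) by (rule sum.remove)
      also have "(\<Sum>j\<in>J'. q' j * u j) = (\<Sum>j\<in>J'. q j * u j)"
        by (intro sum.cong) (auto simp: q'_def J'_def)
      also have "q' j0 * u j0 + (\<Sum>j\<in>J'. q j * u j) = (\<Sum>j\<in>J'. q j * u' j)"
        by (simp add: q'_def u'_def right_diff_distrib sum_subtractf sum_distrib_right mult.assoc)
      finally show ?thesis using q(3) by simp
    qed
    ultimately show ?thesis by blast
  qed
qed

definition lin_span :: "'a::division_ring set \<Rightarrow> 'a set \<Rightarrow> 'a set" where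
  "lin_span K S = {(\<Sum>s\<in>S. c s * s) | c. \<forall>s\<in>S. c s \<in> K}"

lemma lin_spanI: "(\<And>s. s \<in> S \<Longrightarrow> c s \<in> K) \<Longrightarrow> (\<Sum>s\<in>S. c s * s) \<in> lin_span K S"
  by (auto simp: lin_span_def)

lemma powers_dependent:
  assumes K: "div_subring K" and S: "finite S" and u: "\<And>j::nat. u ^ j \<in> lin_span K S"
  obtains N q where "\<And>j. j \<le> N \<Longrightarrow> q j \<in> K" "\<exists>j\<le>N. q j \<noteq> 0" "(\<Sum>j\<le>N. q j * u ^ j) = 0"
proof -
  have "\<exists>c. (\<forall>s\<in>S. c s \<in> K) \<and> u ^ j = (\<Sum>s\<in>S. c s * s)" for j :: nat
    using u[of j] unfolding lin_span_def by blast
  then obtain c where c: "\<And>j s. s \<in> S \<Longrightarrow> c j s \<in> K" "\<And>j. u ^ j = (\<Sum>s\<in>S. c j s * s)" by metis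
  have "\<exists>q. (\<forall>j\<in>{..card S}. q j \<in> K) \<and> (\<exists>j\<in>{..card S}. q j \<noteq> 0) \<and> (\<Sum>j\<in>{..card S}. q j * u ^ j) = 0"
    by (rule linear_dependence[OF K S, where c = c and v = id]) (use c in auto)
  then obtain q where q: "\<forall>j\<in>{..card S}. q j \<in> K" "\<exists>j\<in>{..card S}. q j \<noteq> 0" "(\<Sum>j\<in>{..card S}. q j * u ^ j) = 0"
    by blast
  show ?thesis by (rule that[of "card S" q]) (use q in auto)
qed

lemma lin_span_closed:
  assumes K: "div_subring K"
  shows "0 \<in> lin_span K S" "x \<in> lin_span K S \<Longrightarrow> y \<in> lin_span K S \<Longrightarrow> x + y \<in> lin_span K S"
    "a \<in> K \<Longrightarrow> x \<in> lin_span K S \<Longrightarrow> a * x \<in> lin_span K S"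
proof -
  show "0 \<in> lin_span K S"
    using lin_spanI[of S "\<lambda>_. 0" K] div_subringD(1)[OF K] by simp
  show "x + y \<in> lin_span K S" if xy: "x \<in> lin_span K S" "y \<in> lin_span K S"
  proof -
    from xy obtain c d where cd: "\<forall>s\<in>S. c s \<in> K" "x = (\<Sum>s\<in>S. c s * s)" "\<forall>s\<in>S. d s \<in> K" "y = (\<Sum>s\<in>S. d s * s)"
      unfolding lin_span_def by blast
    have "x + y = (\<Sum>s\<in>S. (c s + d s) * s)" by (simp add: cd distrib_right sum.distrib)
    moreover have "(\<Sum>s\<in>S. (c s + d s) * s) \<in> lin_span K S"
      by (rule lin_spanI) (use cd div_subringD(3)[OF K] in blast)
    ultimately show ?thesis by simp
  qed
  show "a * x \<in> lin_span K S" if ax: "a \<in> K" "x \<in> lin_span K S"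
  proof -
    from ax obtain c where c: "\<forall>s\<in>S. c s \<in> K" "x = (\<Sum>s\<in>S. c s * s)" unfolding lin_span_def by blast
    have "a * x = (\<Sum>s\<in>S. (a * c s) * s)" by (simp add: c sum_distrib_left mult.assoc)
    moreover have "(\<Sum>s\<in>S. (a * c s) * s) \<in> lin_span K S"
      by (rule lin_spanI) (use c ax(1) div_subringD(6)[OF K] in blast)
    ultimately show ?thesis by simp
  qed
qed

lemma lin_span_base: "div_subring K \<Longrightarrow> finite S \<Longrightarrow> s \<in> S \<Longrightarrow> s \<in> lin_span K S"
proof -
  assume K: "div_subring K" and S: "finite S" "s \<in> S"
  have "(\<Sum>t\<in>S. (if t = s then 1 else 0) * t) = (\<Sum>t\<in>S. if t = s then t else 0)"
    by (intro sum.cong) auto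
  also have "\<dots> = s" using S by simp
  finally show ?thesis
    using lin_spanI[of S "\<lambda>t. if t = s then 1 else 0" K] div_subringD(1,2)[OF K] by simp
qed

lemma lin_span_sum:
  "div_subring K \<Longrightarrow> (\<And>i. i \<in> I \<Longrightarrow> f i \<in> lin_span K S) \<Longrightarrow> sum f I \<in> lin_span K S"
  by (induction I rule: infinite_finite_induct) (auto intro: lin_span_closed)

text \<open>A linear relation among the powers of \<open>v\<close> expresses \<open>v\<inverse>\<close> as a polynomial in \<open>v\<close>.\<close>

lemma div_subring_lin_span:
  fixes K :: "'a::division_ring set"
  assumes K: "div_subring K" and S: "finite S" and one: "1 \<in> lin_span K S"
    and mult: "\<And>x y. x \<in> lin_span K S \<Longrightarrow> y \<in> lin_span K S \<Longrightarrow> x * y \<in> lin_span K S"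
  shows "div_subring (lin_span K S)"
proof -
  define V where "V = lin_span K S"
  note cl = lin_span_closed[OF K, where S = S, folded V_def]
  have pow: "v ^ n \<in> V" if "v \<in> V" for v n
    by (induction n) (use that one mult in \<open>auto simp: V_def\<close>)
  have sumV: "sum f I \<in> V" if "\<And>i. i \<in> I \<Longrightarrow> f i \<in> V" for f :: "nat \<Rightarrow> 'a" and I
    unfolding V_def by (rule lin_span_sum[OF K]) (rule that[unfolded V_def])
  have neg: "- x \<in> V" if "x \<in> V" for x
  proof -
    have "- 1 * x \<in> V" by (rule cl(3)[OF div_subringD(4)[OF K div_subringD(2)[OF K]] that])
    then show ?thesis by simp
  qed
  have inv: "inverse v \<in> V" if v: "v \<in> V" for v
  proof (cases "v = 0")
    case True
    then show ?thesis using cl(1) by simp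
  next
    case v0: False
    obtain N q where q: "\<And>j. j \<le> N \<Longrightarrow> q j \<in> K" "\<exists>j\<le>N. q j \<noteq> 0" "(\<Sum>j\<le>N. q j * v ^ j) = 0"
      by (rule powers_dependent[OF K S pow[OF v, unfolded V_def]]) (rule that)
    define j0 where "j0 = (LEAST j. q j \<noteq> 0)"
    have j0: "q j0 \<noteq> 0" unfolding j0_def using q(2) by (metis (mono_tags) LeastI)
    have small: "q j = 0" if "j < j0" for j using not_less_Least[OF that[unfolded j0_def]] by simp
    have j0N: "j0 \<le> N" using q(2) small not_le by (metis order.strict_trans1 order.strict_trans2 not_less)
    define b where "b = (\<Sum>j\<in>{Suc j0..N}. q j * v ^ (j - Suc j0))"
    have bV: "b \<in> V" unfolding b_def by (intro sumV cl(3) q(1) pow v) simp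
    have "(\<Sum>j\<le>N. q j * v ^ j) = (\<Sum>j\<in>{j0..N}. q j * v ^ j)"
      by (rule sum.mono_neutral_right) (use small in \<open>auto simp: not_le\<close>)
    also have "\<dots> = q j0 * v ^ j0 + (\<Sum>j\<in>{Suc j0..N}. q j * v ^ j)"
      by (rule sum.atLeast_Suc_atMost[OF j0N])
    also have "(\<Sum>j\<in>{Suc j0..N}. q j * v ^ j) = b * v * v ^ j0"
      unfolding b_def sum_distrib_right
    proof (rule sum.cong[OF refl])
      fix j assume "j \<in> {Suc j0..N}"
      then have "j = (j - Suc j0) + Suc j0" by simp
      then have "v ^ j = v ^ (j - Suc j0) * v ^ Suc j0" by (metis power_add)
      then show "q j * v ^ j = q j * v ^ (j - Suc j0) * v * v ^ j0" by (simp add: mult.assoc)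
    qed
    finally have "(q j0 + b * v) * v ^ j0 = 0" using q(3) by (simp add: distrib_right)
    then have "q j0 + b * v = 0" using v0 by simp
    then have "q j0 = (- b) * v" by (simp add: eq_neg_iff_add_eq_0)
    then have "inverse (q j0) * q j0 = inverse (q j0) * (- b) * v" by (simp add: mult.assoc)
    then have "inverse (q j0) * (- b) * v = 1" using j0 by simp
    then have "inverse (q j0) * (- b) * (v * inverse v) = inverse v" by (simp add: mult.assoc[symmetric])
    then have "inverse v = inverse (q j0) * (- b)" using v0 by simp
    moreover have "inverse (q j0) * (- b) \<in> V"
      by (rule cl(3)[OF div_subringD(7)[OF K q(1)[OF j0N]] neg[OF bV]])
    ultimately show ?thesis by simp
  qed
  show ?thesis unfolding div_subring_def V_def[symmetric]
    using cl(1,2) one mult neg inv by (auto simp: V_def)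
qed

section \<open>Valuation rings\<close>

definition is_subring :: "'a::division_ring set \<Rightarrow> bool" where
  "is_subring B \<longleftrightarrow> 0 \<in> B \<and> 1 \<in> B \<and> (\<forall>x\<in>B. \<forall>y\<in>B. x + y \<in> B) \<and> (\<forall>x\<in>B. - x \<in> B) \<and> (\<forall>x\<in>B. \<forall>y\<in>B. x * y \<in> B)"

lemma is_subringD:
  assumes "is_subring B"
  shows "0 \<in> B" "1 \<in> B" "x \<in> B \<Longrightarrow> y \<in> B \<Longrightarrow> x + y \<in> B" "x \<in> B \<Longrightarrow> - x \<in> B"
    "x \<in> B \<Longrightarrow> y \<in> B \<Longrightarrow> x - y \<in> B" "x \<in> B \<Longrightarrow> y \<in> B \<Longrightarrow> x * y \<in> B"
proof -
  show "x - y \<in> B" if "x \<in> B" "y \<in> B"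
    using assms that unfolding is_subring_def by (metis diff_conv_add_uminus)
qed (use assms in \<open>auto simp: is_subring_def\<close>)

lemma is_subring_power: "is_subring B \<Longrightarrow> x \<in> B \<Longrightarrow> x ^ n \<in> B"
  by (induction n) (auto intro: is_subringD)

lemma is_subring_sum: "is_subring B \<Longrightarrow> (\<And>i. i \<in> I \<Longrightarrow> f i \<in> B) \<Longrightarrow> sum f I \<in> B"
  by (induction I rule: infinite_finite_induct) (auto intro: is_subringD)

lemma subring_adjoin:
  fixes B :: "'a::division_ring set"
  assumes B: "is_subring B" and comm: "\<And>b. b \<in> B \<Longrightarrow> x * b = b * x"
  defines "E \<equiv> {peval x n f | n f. \<forall>i. f i \<in> B}"
  shows "is_subring E" "B \<subseteq> E" "x \<in> E"
proof -
  have EI: "peval x n f \<in> E" if "\<And>i. f i \<in> B" for n f using that by (auto simp: E_def)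
  have add: "a + b \<in> E" if ab: "a \<in> E" "b \<in> E" for a b
  proof -
    from ab obtain n f k g where fg: "a = peval x n f" "\<forall>i. f i \<in> B" "b = peval x k g" "\<forall>i. g i \<in> B"
      by (auto simp: E_def)
    define f' g' where "f' = (\<lambda>i. if i \<le> n then f i else 0)" and "g' = (\<lambda>i. if i \<le> k then g i else 0)"
    have "a = peval x (max n k) f'" "b = peval x (max n k) g'"
      unfolding fg peval_def f'_def g'_def by (auto intro!: sum.mono_neutral_cong_left split: if_splits)
    then have "a + b = peval x (max n k) (\<lambda>i. f' i + g' i)"
      by (simp add: peval_def distrib_left sum.distrib)
    also have "\<dots> \<in> E"
      by (rule EI) (use fg is_subringD(1,3)[OF B] in \<open>auto simp: f'_def g'_def\<close>)
    finally show ?thesis .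
  qed
  have scale: "a * b \<in> E" if ab: "a \<in> E" "b \<in> B" for a b
  proof -
    from ab obtain n f where f: "a = peval x n f" "\<forall>i. f i \<in> B" by (auto simp: E_def)
    have "a * b = peval x n (\<lambda>i. f i * b)" by (simp add: f peval_def sum_distrib_right mult.assoc)
    also have "\<dots> \<in> E" by (rule EI) (use f ab is_subringD(6)[OF B] in blast)
    finally show ?thesis .
  qed
  have timesx: "x * a \<in> E" if a: "a \<in> E" for a
  proof -
    from a obtain n f where f: "a = peval x n f" "\<forall>i. f i \<in> B" by (auto simp: E_def)
    have "x * a = peval x (Suc n) (\<lambda>i. case i of 0 \<Rightarrow> 0 | Suc j \<Rightarrow> f j)"
      unfolding f peval_def by (subst sum.atMost_Suc_shift) (simp add: sum_distrib_left mult.assoc)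
    also have "\<dots> \<in> E" by (rule EI) (use f is_subringD(1)[OF B] in \<open>auto split: nat.split\<close>)
    finally show ?thesis .
  qed
  have BE: "B \<subseteq> E"
  proof
    fix b assume "b \<in> B"
    then show "b \<in> E" using EI[of "\<lambda>_. b" 0] by (simp add: peval_def)
  qed
  have powx: "x ^ i * a \<in> E" if "a \<in> E" for i a
    by (induction i) (use that timesx in \<open>auto simp: mult.assoc\<close>)
  have sumE: "sum h I \<in> E" if "\<And>i. i \<in> I \<Longrightarrow> h i \<in> E" for h :: "nat \<Rightarrow> 'a" and I
    using that by (induction I rule: infinite_finite_induct) (use add BE is_subringD(1)[OF B] in auto)
  have xcomm: "a * x = x * a" if a: "a \<in> E" for a
  proof -
    from a obtain n f where f: "a = peval x n f" "\<forall>i. f i \<in> B" by (auto simp: E_def)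
    have "x ^ i * f i * x = x * (x ^ i * f i)" for i
    proof -
      have "x ^ i * f i * x = x ^ i * (x * f i)" using comm[of "f i"] f(2) by (simp add: mult.assoc)
      also have "\<dots> = x * (x ^ i * f i)" by (simp only: mult.assoc[symmetric] power_commutes)
      finally show ?thesis .
    qed
    then show ?thesis by (simp add: f peval_def sum_distrib_left sum_distrib_right)
  qed
  have mult: "a * b \<in> E" if a: "a \<in> E" and b: "b \<in> E" for a b
  proof -
    from b obtain n f where f: "b = peval x n f" "\<forall>i. f i \<in> B" by (auto simp: E_def)
    have "a * b = (\<Sum>i\<le>n. x ^ i * (a * f i))"
      unfolding f peval_def sum_distrib_left
    proof (rule sum.cong[OF refl])
      fix i
      have "a * x ^ i = x ^ i * a" using power_commuting_commutes[of x a i] xcomm[OF a] by simp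
      then show "a * (x ^ i * f i) = x ^ i * (a * f i)" by (simp add: mult.assoc[symmetric])
    qed
    also have "\<dots> \<in> E" by (intro sumE powx scale a) (use f in blast)
    finally show ?thesis .
  qed
  have "- a \<in> E" if "a \<in> E" for a
    using scale[OF that, of "- 1"] is_subringD(2,4)[OF B] by simp
  then show "is_subring E" unfolding is_subring_def
    using add mult BE is_subringD(1,2)[OF B] by auto
  show "B \<subseteq> E" by (rule BE)
  show "x \<in> E" using timesx[of 1] BE is_subringD(2)[OF B] by auto
qed

text \<open>Chevalley's construction: a subring of the field \<open>Z\<close> maximal among those that contain \<open>\<pi>\<close>
  but not \<open>\<pi>\<inverse>\<close> is a valuation ring in which \<open>1 + \<pi> b\<close> is always invertible.\<close>

locale valuation_subring =
  fixes Z B :: "'a::division_ring set" and \<pi> :: 'a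
  assumes Z: "div_subring Z" "Z \<subseteq> centralizer Z" and \<pi>0: "\<pi> \<noteq> 0"
    and B: "is_subring B" "B \<subseteq> Z" "\<pi> \<in> B" "inverse \<pi> \<notin> B"
    and max: "\<And>C. is_subring C \<Longrightarrow> B \<subseteq> C \<Longrightarrow> C \<subseteq> Z \<Longrightarrow> inverse \<pi> \<notin> C \<Longrightarrow> C = B"
begin

lemma comm: "x \<in> Z \<Longrightarrow> y \<in> Z \<Longrightarrow> x * y = y * x"
  using Z(2) centralizerD by blast

lemma \<pi>Z: "\<pi> \<in> Z" using B by blast

lemma not_one: "b \<in> B \<Longrightarrow> \<pi> * b \<noteq> 1"
  using inverse_unique[of \<pi> b] B(4) by metis

text \<open>The element \<open>1\<close> is in the ideal generated by \<open>\<pi>\<close> in \<open>B[x]\<close>, with a witness of degree \<open>n\<close>.\<close>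

definition small_relation :: "'a \<Rightarrow> nat \<Rightarrow> bool" where
  "small_relation x n \<longleftrightarrow> (\<exists>f. (\<forall>i. f i \<in> B) \<and> 1 = (\<Sum>i\<le>n. \<pi> * f i * x ^ i))"

text \<open>By maximality of \<open>B\<close>, the ring \<open>B[x]\<close> contains \<open>\<pi>\<inverse>\<close>.\<close>

lemma small_relation_if_not_in:
  assumes x: "x \<in> Z" "x \<notin> B"
  shows "\<exists>n. small_relation x n"
proof -
  have c: "x * b = b * x" if "b \<in> B" for b using comm x(1) that B(2) by blast
  define E where "E = {peval x n f | n f. \<forall>i. f i \<in> B}"
  note E = subring_adjoin[OF B(1) c, folded E_def]
  have "E \<subseteq> Z"
  proof
    fix e assume "e \<in> E"
    then obtain n f where f: "e = peval x n f" "\<forall>i. f i \<in> B" by (auto simp: E_def)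
    show "e \<in> Z" unfolding f peval_def
      using f(2) B(2) x(1) by (intro div_subring_sum[OF Z(1)] div_subringD(6)[OF Z(1)] div_subring_power[OF Z(1)]) auto
  qed
  then have "inverse \<pi> \<in> E" using max[OF E(1,2)] E(3) x(2) by blast
  then obtain n f where f: "inverse \<pi> = peval x n f" "\<forall>i. f i \<in> B" by (auto simp: E_def)
  have "1 = \<pi> * peval x n f" using \<pi>0 by (simp add: f(1)[symmetric])
  also have "\<dots> = (\<Sum>i\<le>n. \<pi> * f i * x ^ i)"
    unfolding peval_def sum_distrib_left
  proof (rule sum.cong[OF refl])
    fix i
    have "x ^ i * f i = f i * x ^ i"
      using f(2) B(2) x(1) by (intro comm div_subring_power[OF Z(1)]) auto
    then show "\<pi> * (x ^ i * f i) = \<pi> * f i * x ^ i" by (simp add: mult.assoc)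
  qed
  finally show ?thesis using f(2) unfolding small_relation_def by blast
qed

text \<open>If the inverse \<open>u\<inverse>\<close> were not in \<open>B\<close>, a small relation for \<open>u\<inverse>\<close> multiplied by \<open>u\<^sup>n\<close> would show that
  \<open>\<pi>\<close> divides \<open>u\<^sup>n\<close>; but \<open>u\<^sup>n\<close> is \<open>1\<close> modulo \<open>\<pi>\<close>.\<close>

lemma unit_one_plus:
  assumes b: "b \<in> B"
  shows "1 + \<pi> * b \<noteq> 0" "inverse (1 + \<pi> * b) \<in> B"
proof -
  define u where "u = 1 + \<pi> * b"
  show u0: "1 + \<pi> * b \<noteq> 0"
  proof
    assume "1 + \<pi> * b = 0"
    then have "\<pi> * b = - 1" by (rule minus_unique[symmetric])
    then have "\<pi> * - b = 1" by simp
    then show False using not_one[OF is_subringD(4)[OF B(1) b]] by contradiction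
  qed
  have uB: "u \<in> B" unfolding u_def by (intro is_subringD(2,3,6)[OF B(1)] B(3) b)
  have uZ: "u \<in> Z" "u \<noteq> 0" using uB B(2) u0 by (auto simp: u_def)
  have upow: "\<exists>d\<in>B. u ^ n = 1 + \<pi> * d" for n
  proof (induction n)
    case 0
    then show ?case using is_subringD(1)[OF B(1)] by (intro bexI[of _ 0]) auto
  next
    case (Suc n)
    then obtain d where d: "d \<in> B" "u ^ n = 1 + \<pi> * d" by blast
    have "u ^ Suc n = (1 + \<pi> * b) * (1 + \<pi> * d)" using d by (simp add: u_def)
    also have "\<dots> = 1 + \<pi> * (d + b + b * (\<pi> * d))" by (simp add: algebra_simps)
    finally show ?case using d b B(3) by (intro bexI[of _ "d + b + b * (\<pi> * d)"] is_subringD(3,6)[OF B(1)])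
  qed
  show "inverse (1 + \<pi> * b) \<in> B"
  proof (rule ccontr)
    assume "inverse (1 + \<pi> * b) \<notin> B"
    then have "inverse u \<notin> B" by (simp add: u_def)
    then obtain n where "small_relation (inverse u) n"
      using small_relation_if_not_in[OF div_subringD(7)[OF Z(1) uZ(1)]] by blast
    then obtain f where f: "\<And>i. f i \<in> B" "1 = (\<Sum>i\<le>n. \<pi> * f i * inverse u ^ i)"
      unfolding small_relation_def by blast
    define c where "c = (\<Sum>i\<le>n. f i * u ^ (n - i))"
    have cB: "c \<in> B" unfolding c_def by (intro is_subring_sum[OF B(1)] is_subringD(6)[OF B(1)] f is_subring_power[OF B(1)] uB)
    have "u ^ n = 1 * u ^ n" by simp
    also have "\<dots> = (\<Sum>i\<le>n. \<pi> * f i * inverse u ^ i) * u ^ n" using f(2) by simp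
    also have "\<dots> = \<pi> * c"
      unfolding c_def sum_distrib_left sum_distrib_right
    proof (rule sum.cong[OF refl])
      fix i assume "i \<in> {..n}"
      then have "u ^ n = u ^ i * u ^ (n - i)" by (simp add: power_add[symmetric])
      moreover have "inverse u ^ i * u ^ i = 1" using uZ(2) by (simp add: power_inverse)
      ultimately have "inverse u ^ i * u ^ n = u ^ (n - i)" by (simp add: mult.assoc[symmetric])
      then show "\<pi> * f i * inverse u ^ i * u ^ n = \<pi> * (f i * u ^ (n - i))" by (simp add: mult.assoc)
    qed
    finally have "u ^ n = \<pi> * c" .
    moreover obtain d where d: "d \<in> B" "u ^ n = 1 + \<pi> * d" using upow by blast
    ultimately have "\<pi> * c = 1 + \<pi> * d" by simp
    then have "\<pi> * (c - d) = 1" unfolding right_diff_distrib by simp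
    then show False using not_one[OF is_subringD(5)[OF B(1) cB d(1)]] by contradiction
  qed
qed

text \<open>The relation for \<open>x\<inverse>\<close>, solved for its constant term and multiplied by \<open>x\<^sup>n\<close>, expresses \<open>x\<^sup>n\<close> by lower
  powers of \<open>x\<close>; this removes the top term of the relation for \<open>x\<close>.\<close>

lemma shorten_relation:
  assumes x: "x \<in> Z" "x \<noteq> 0" and n: "small_relation x n" and m: "small_relation (inverse x) m" and mn: "m \<le> n"
  shows "0 < n \<and> small_relation x (n - 1)"
proof -
  obtain f where f: "\<And>i. f i \<in> B" "1 = (\<Sum>i\<le>n. \<pi> * f i * x ^ i)" using n unfolding small_relation_def by blast
  obtain g where g: "\<And>i. g i \<in> B" "1 = (\<Sum>i\<le>m. \<pi> * g i * inverse x ^ i)" using m unfolding small_relation_def by blast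
  define v where "v = 1 + \<pi> * - g 0"
  have v: "v \<noteq> 0" "inverse v \<in> B" unfolding v_def using unit_one_plus[OF is_subringD(4)[OF B(1) g(1)]] by auto
  have "(\<Sum>i\<le>m. \<pi> * g i * inverse x ^ i) = \<pi> * g 0 + (\<Sum>i\<in>{1..m}. \<pi> * g i * inverse x ^ i)"
    unfolding atMost_atLeast0 by (subst sum.atLeast_Suc_atMost) auto
  then have vg: "v = (\<Sum>i\<in>{1..m}. \<pi> * g i * inverse x ^ i)" using g(2) by (simp add: v_def algebra_simps)
  have m1: "m \<ge> 1" using vg v(1) by (cases m) auto
  then have n1: "n \<ge> 1" using mn by simp
  define h where "h = (\<lambda>i. inverse v * g i)"
  have hB: "h i \<in> B" for i unfolding h_def by (rule is_subringD(6)[OF B(1) v(2) g(1)])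
  have vZ: "inverse v \<in> Z" using v B by blast
  have "1 = inverse v * (\<Sum>i\<in>{1..m}. \<pi> * g i * inverse x ^ i)" using v(1) vg by (metis left_inverse)
  also have "\<dots> = (\<Sum>i\<in>{1..m}. \<pi> * h i * inverse x ^ i)"
    unfolding sum_distrib_left h_def
  proof (rule sum.cong[OF refl])
    fix i
    show "inverse v * (\<pi> * g i * inverse x ^ i) = \<pi> * (inverse v * g i) * inverse x ^ i"
      using comm[OF vZ \<pi>Z] by (simp add: mult.assoc[symmetric])
  qed
  finally have one: "1 = (\<Sum>i\<in>{1..m}. \<pi> * h i * inverse x ^ i)" .
  have xn: "x ^ n = (\<Sum>i\<in>{1..m}. \<pi> * h i * x ^ (n - i))"
  proof -
    have "x ^ n = (\<Sum>i\<in>{1..m}. \<pi> * h i * inverse x ^ i) * x ^ n" using one by simp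
    also have "\<dots> = (\<Sum>i\<in>{1..m}. \<pi> * h i * x ^ (n - i))"
      unfolding sum_distrib_right
    proof (rule sum.cong[OF refl])
      fix i assume "i \<in> {1..m}"
      then have "x ^ n = x ^ i * x ^ (n - i)" using mn by (simp add: power_add[symmetric])
      moreover have "inverse x ^ i * x ^ i = 1" using x(2) by (simp add: power_inverse)
      ultimately have "inverse x ^ i * x ^ n = x ^ (n - i)" by (simp add: mult.assoc[symmetric])
      then show "\<pi> * h i * inverse x ^ i * x ^ n = \<pi> * h i * x ^ (n - i)" by (simp add: mult.assoc)
    qed
    finally show ?thesis .
  qed
  define f' where "f' = (\<lambda>i. f i + (if n - m \<le> i \<and> i < n then \<pi> * (f n * h (n - i)) else 0))"
  have f'B: "f' i \<in> B" for i unfolding f'_def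
    using is_subringD(3)[OF B(1)] is_subringD(6)[OF B(1)] is_subringD(1)[OF B(1)] f(1) hB B(3) by simp
  have "\<pi> * f n * x ^ n = (\<Sum>i\<in>{1..m}. \<pi> * (\<pi> * (f n * h i)) * x ^ (n - i))"
    unfolding xn sum_distrib_left
  proof (rule sum.cong[OF refl])
    fix i
    have "f n * \<pi> = \<pi> * f n" using comm[of "f n" \<pi>] f(1) B(2) \<pi>Z by blast
    then show "\<pi> * f n * (\<pi> * h i * x ^ (n - i)) = \<pi> * (\<pi> * (f n * h i)) * x ^ (n - i)"
      by (simp add: mult.assoc) (simp add: mult.assoc[symmetric])
  qed
  also have "\<dots> = (\<Sum>i\<in>{n - m..<n}. \<pi> * (\<pi> * (f n * h (n - i))) * x ^ i)"
    by (rule sum.reindex_bij_witness[of _ "\<lambda>i. n - i" "\<lambda>i. n - i"]) (use mn in auto)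
  also have "\<dots> = (\<Sum>i<n. \<pi> * (if n - m \<le> i \<and> i < n then \<pi> * (f n * h (n - i)) else 0) * x ^ i)"
    by (rule sum.mono_neutral_cong_left) auto
  finally have top: "\<pi> * f n * x ^ n = \<dots>" .
  have "1 = (\<Sum>i<n. \<pi> * f i * x ^ i) + \<pi> * f n * x ^ n"
    using f(2) by (simp add: lessThan_Suc_atMost[symmetric])
  also have "\<dots> = (\<Sum>i<n. \<pi> * f' i * x ^ i)"
    unfolding top f'_def by (simp only: sum.distrib[symmetric] distrib_left distrib_right)
  also have "{..<n} = {..n - 1}" using n1 by auto
  finally have "small_relation x (n - 1)" unfolding small_relation_def using f'B by blast
  then show ?thesis using n1 by simp
qed

text \<open>If neither \<open>x\<close> nor \<open>x\<inverse>\<close> is in \<open>B\<close>, both satisfy small relations, and the longer of the two can be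
  shortened forever.\<close>

lemma valuation: "x \<in> Z \<Longrightarrow> x \<in> B \<or> inverse x \<in> B"
proof (rule ccontr)
  assume x: "x \<in> Z" and neg: "\<not> (x \<in> B \<or> inverse x \<in> B)"
  have x0: "x \<noteq> 0" using neg is_subringD(1)[OF B(1)] by auto
  have "False" if "small_relation x n" "small_relation (inverse x) m" "x \<in> Z" "x \<noteq> 0" for n m x
    using that
  proof (induction "n + m" arbitrary: n m x rule: less_induct)
    case less
    show ?case
    proof (cases "m \<le> n")
      case True
      from shorten_relation[OF less.prems(3,4,1,2) True]
      show ?thesis using less.hyps[of "n - 1" m x] less.prems by auto
    next
      case False
      have ix: "inverse x \<in> Z" "inverse x \<noteq> 0" "small_relation (inverse (inverse x)) n"
        using less.prems div_subringD(7)[OF Z(1)] by auto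
      from shorten_relation[OF ix(1,2) less.prems(2) ix(3)] False
      show ?thesis using less.hyps[of n "m - 1" x] less.prems by auto
    qed
  qed
  then show False
    using small_relation_if_not_in[of x] small_relation_if_not_in[of "inverse x"]
      div_subringD(7)[OF Z(1) x] neg x x0 by blast
qed

lemma denominator:
  assumes "x \<in> Z"
  shows "\<exists>a\<in>B - {0}. a * x \<in> B"
proof (cases "x \<in> B")
  case True
  then show ?thesis using is_subringD(2)[OF B(1)] by (intro bexI[of _ 1]) auto
next
  case False
  then have "inverse x \<in> B" "x \<noteq> 0" using valuation[OF assms] is_subringD(1)[OF B(1)] by auto
  then show ?thesis using is_subringD(2)[OF B(1)] by (intro bexI[of _ "inverse x"]) auto
qed

lemma B_comm: "x \<in> B \<Longrightarrow> y \<in> B \<Longrightarrow> x * y = y * x"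
  using comm B(2) by blast

lemma common_denominator:
  assumes "finite I" "\<And>i. i \<in> I \<Longrightarrow> c i \<in> Z"
  shows "\<exists>a\<in>B - {0}. \<forall>i\<in>I. a * c i \<in> B"
  using assms
proof (induction I rule: finite_induct)
  case empty
  then show ?case using is_subringD(2)[OF B(1)] by (intro bexI[of _ 1]) auto
next
  case (insert j I)
  then obtain a where a: "a \<in> B - {0}" "\<forall>i\<in>I. a * c i \<in> B" by blast
  obtain b where b: "b \<in> B - {0}" "b * c j \<in> B" using denominator[of "c j"] insert.prems by blast
  have "(a * b) * c j \<in> B" using is_subringD(6)[OF B(1), of a "b * c j"] a b by (simp add: mult.assoc)
  moreover have "(a * b) * c i \<in> B" if "i \<in> I" for i
  proof -
    have "b * (a * c i) \<in> B" using is_subringD(6)[OF B(1), of b "a * c i"] a b that by simp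
    then show ?thesis using B_comm[of a b] a b by (simp add: mult.assoc[symmetric])
  qed
  ultimately show ?case using a b is_subringD(6)[OF B(1)] by (intro bexI[of _ "a * b"]) auto
qed

end

lemma valuation_subring_exists:
  fixes Z :: "'a::division_ring set"
  assumes Z: "div_subring Z" "Z \<subseteq> centralizer Z" and \<pi>: "\<pi> \<noteq> 0"
    and A: "is_subring A" "A \<subseteq> Z" "\<pi> \<in> A" "inverse \<pi> \<notin> A"
  obtains B where "valuation_subring Z B \<pi>"
proof -
  define \<A> where "\<A> = {B. is_subring B \<and> B \<subseteq> Z \<and> \<pi> \<in> B \<and> inverse \<pi> \<notin> B}"
  have "\<exists>B\<in>\<A>. \<forall>C\<in>\<A>. B \<subseteq> C \<longrightarrow> C = B"
  proof (rule subset_Zorn_nonempty)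
    show "\<A> \<noteq> {}" using A by (auto simp: \<A>_def)
    fix \<C> assume ne: "\<C> \<noteq> {}" and ch: "subset.chain \<A> \<C>"
    have sub: "C \<in> \<A>" if "C \<in> \<C>" for C using ch that by (auto simp: subset_chain_def)
    have two: "\<exists>C\<in>\<C>. x \<in> C \<and> y \<in> C" if "x \<in> \<Union>\<C>" "y \<in> \<Union>\<C>" for x y
      using that ch unfolding subset_chain_def by blast
    have sr: "is_subring C" if "C \<in> \<C>" for C using sub[OF that] by (simp add: \<A>_def)
    obtain C0 where C0: "C0 \<in> \<C>" using ne by blast
    have "is_subring (\<Union>\<C>)"
      unfolding is_subring_def
    proof (intro conjI ballI)
      show "0 \<in> \<Union>\<C>" "1 \<in> \<Union>\<C>" using is_subringD(1,2)[OF sr[OF C0]] C0 by auto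
      fix x assume x: "x \<in> \<Union>\<C>"
      show "- x \<in> \<Union>\<C>" using x is_subringD(4)[OF sr] by blast
      fix y assume y: "y \<in> \<Union>\<C>"
      obtain C where C: "C \<in> \<C>" "x \<in> C" "y \<in> C" using two[OF x y] by blast
      show "x + y \<in> \<Union>\<C>" "x * y \<in> \<Union>\<C>"
        using is_subringD(3)[OF sr[OF C(1)] C(2,3)] is_subringD(6)[OF sr[OF C(1)] C(2,3)] C(1) by auto
    qed
    then show "\<Union>\<C> \<in> \<A>" using sub C0 by (auto simp: \<A>_def)
  qed
  then obtain B where B: "B \<in> \<A>" "\<And>C. C \<in> \<A> \<Longrightarrow> B \<subseteq> C \<Longrightarrow> C = B" by blast
  have "valuation_subring Z B \<pi>"
  proof unfold_locales
    fix C assume "is_subring C" "B \<subseteq> C" "C \<subseteq> Z" "inverse \<pi> \<notin> C"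
    then show "C = B" using B by (auto simp: \<A>_def)
  qed (use Z \<pi> B(1) in \<open>auto simp: \<A>_def\<close>)
  then show ?thesis by (rule that)
qed

section \<open>Maximal subgroups that are finite modulo the center\<close>

text \<open>The situation to be excluded: \<open>W\<close> is spanned by \<open>M\<close> over its infinite center \<open>Z\<close>, the group \<open>M\<close>
  is maximal in the subnormal subgroup \<open>G\<close>, and \<open>M\<close> is finite modulo \<open>Z\<close> with representatives \<open>R\<close>.\<close>

locale central_by_finite_maximal =
  fixes W Z G M R :: "'a::division_ring set"
  assumes W: "div_subring W" and Z_def: "Z = W \<inter> centralizer W" and infZ: "infinite Z"
    and G: "subnormal_in W G" and M: "mult_group M" "M \<subseteq> G" "M \<noteq> G"
    and maximal: "\<And>N. mult_group N \<Longrightarrow> M \<subseteq> N \<Longrightarrow> N \<subseteq> G \<Longrightarrow> N = M \<or> N = G"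
    and R: "finite R" "R \<subseteq> M" "\<And>m. m \<in> M \<Longrightarrow> \<exists>r\<in>R. \<exists>z\<in>Z. m = r * z"
    and span: "\<And>w. w \<in> W \<Longrightarrow> w \<in> lin_span Z R"
begin

lemma Zd: "div_subring Z" unfolding Z_def by (rule div_subring_Int[OF W]) simp

lemma ZW: "Z \<subseteq> W" by (simp add: Z_def)

lemma central: "z \<in> Z \<Longrightarrow> w \<in> W \<Longrightarrow> z * w = w * z"
  by (auto simp: Z_def centralizer_def)

lemma Zc: "Z \<subseteq> centralizer Z" using central ZW by (auto simp: centralizer_def)

lemma Ggrp: "mult_group G" by (rule subnormal_in_group[OF G W])

lemma GW: "G \<subseteq> W" by (rule subnormal_in_subset[OF G])

lemma R_nonzero: "r \<in> R \<Longrightarrow> r \<noteq> 0" using R(2) mult_groupD(3)[OF M(1)] by blast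

lemma MW: "M \<subseteq> W" using M(2) GW by blast

text \<open>Algebraic over a finite field, the center would make \<open>M\<close> a finite group up to scalars and so
  commutative. Otherwise some \<open>\<pi>\<close> is not a unit of the subring it generates.\<close>

lemma commutative_if_no_nonunit:
  assumes none: "\<And>\<pi> A. \<pi> \<noteq> 0 \<Longrightarrow> is_subring A \<Longrightarrow> A \<subseteq> Z \<Longrightarrow> \<pi> \<in> A \<Longrightarrow> inverse \<pi> \<in> A"
    and xy: "x \<in> M" "y \<in> M"
  shows "x * y = y * x"
proof -
  define I where "I = (range of_int :: 'a set)"
  have I: "is_subring I" unfolding is_subring_def I_def
    by (auto intro: range_eqI[of _ _ 0] range_eqI[of _ _ 1] simp flip: of_int_add of_int_minus of_int_mult)
  have of_int_Z: "of_int k \<in> Z" for k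
  proof (cases k rule: int_cases2)
    case (nonneg n)
    then show ?thesis using div_subring_of_nat[OF Zd, of n] by simp
  next
    case (nonpos n)
    then show ?thesis using div_subringD(4)[OF Zd div_subring_of_nat[OF Zd, of n]] by simp
  qed
  have inv: "\<exists>n f. (\<forall>i. f i \<in> I) \<and> inverse z = peval z n f" if z: "z \<in> Z" "z \<noteq> 0" for z
  proof -
    have c: "z * b = b * z" if "b \<in> I" for b
      using that central[OF z(1)] of_int_Z ZW by (auto simp: I_def)
    define E where "E = {peval z n f | n f. \<forall>i. f i \<in> I}"
    note E = subring_adjoin[OF I c, folded E_def]
    have "E \<subseteq> Z"
    proof
      fix e assume "e \<in> E"
      then obtain n f where f: "e = peval z n f" "\<forall>i. f i \<in> I" by (auto simp: E_def)
      have "f i \<in> Z" for i using f(2)[rule_format, of i] of_int_Z by (auto simp: I_def)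
      then show "e \<in> Z" unfolding f peval_def
        by (intro div_subring_sum[OF Zd] div_subringD(6)[OF Zd] div_subring_power[OF Zd] z(1))
    qed
    then have "inverse z \<in> E" using none[OF z(2) E(1)] E(3) by blast
    then show ?thesis by (auto simp: E_def)
  qed
  \<comment> \<open>in characteristic \<open>0\<close> the inverse of \<open>2\<close> would be an integer\<close>
  obtain p where p: "Factorial_Ring.prime p" "of_nat p = (0::'a)"
  proof (rule char_cases[where 'a = 'a])
    assume zero: "\<And>n. n > 0 \<Longrightarrow> (of_nat n :: 'a) \<noteq> 0"
    have two: "(2::'a) \<noteq> 0" using zero[of 2] by simp
    have "(2::'a) \<in> Z" using of_int_Z[of 2] by simp
    then obtain n f where f: "\<forall>i. f i \<in> I" "inverse 2 = peval (2::'a) n f" using inv two by blast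
    have "peval (2::'a) n f \<in> I" unfolding peval_def
    proof (intro is_subring_sum[OF I] is_subringD(6)[OF I] is_subring_power[OF I])
      show "(2::'a) \<in> I" unfolding I_def by (rule range_eqI[of _ _ 2]) simp
    qed (use f in blast)
    then have "inverse (2::'a) \<in> I" using f(2) by (simp only:)
    then obtain k where k: "inverse (2::'a) = of_int k" unfolding I_def by (rule rangeE)
    have "of_int k * (2::'a) = 1" using two by (simp only: k[symmetric] left_inverse not_False_eq_True)
    moreover have "(of_int (1 - 2 * k) :: 'a) = 1 - of_int k * 2" by (simp add: mult.commute[of 2 k])
    ultimately have e: "(of_int (1 - 2 * k) :: 'a) = 0" by simp
    define n where "n = nat \<bar>1 - 2 * k\<bar>"
    have "1 - 2 * k \<noteq> 0" by presburger
    then have n0: "n > 0" by (simp add: n_def)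
    have "(of_nat n :: 'a) = of_int \<bar>1 - 2 * k\<bar>" by (simp add: n_def)
    also have "\<dots> = 0" using e by (cases "1 - 2 * k \<ge> 0") (auto simp: abs_if)
    finally show ?thesis using zero[OF n0] by contradiction
  qed (use that in blast)
  have torsion: "\<exists>k>0. z ^ k = 1" if z: "z \<in> Z" "z \<noteq> 0" for z
  proof -
    obtain n f where f: "\<forall>i. f i \<in> I" "inverse (inverse z) = peval (inverse z) n f"
      using inv[OF div_subringD(7)[OF Zd z(1)]] z by auto
    \<comment> \<open>all powers of \<open>z\<close> lie in the finite span \<open>V\<close> of \<open>1, \<dots>, z\<^sup>n\<close> over the prime field\<close>
    define V where "V = (\<lambda>c. \<Sum>i\<le>n. of_int (c i) * z ^ i) ` (UNIV :: (nat \<Rightarrow> int) set)"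
    have VI: "(\<Sum>i\<le>n. c i * z ^ i) \<in> V" if c: "\<forall>i. c i \<in> I" for c
    proof -
      have "\<forall>i. \<exists>k. c i = of_int k" using c by (auto simp: I_def)
      then obtain d where "\<And>i. c i = of_int (d i)" by metis
      then show ?thesis by (auto simp: V_def)
    qed
    have top: "z ^ Suc n = (\<Sum>i\<le>n. f (n - i) * z ^ i)"
    proof -
      have "z ^ Suc n = peval (inverse z) n f * z ^ n" using f(2) by simp
      also have "\<dots> = (\<Sum>i\<le>n. f i * z ^ (n - i))"
        unfolding peval_def sum_distrib_right
      proof (rule sum.cong[OF refl])
        fix i assume i: "i \<in> {..n}"
        have fi: "f i * a = a * f i" for a
        proof -
          obtain k where "f i = of_int k" using f(1) by (auto simp: I_def)
          then show ?thesis using mult_of_int_commute[of k a] by simp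
        qed
        have "inverse z ^ i * z ^ i = 1" using z by (simp add: power_inverse)
        moreover have "z ^ n = z ^ i * z ^ (n - i)" using i by (simp add: power_add[symmetric])
        ultimately have "inverse z ^ i * z ^ n = z ^ (n - i)" by (simp add: mult.assoc[symmetric])
        then have "f i * (inverse z ^ i * z ^ n) = f i * z ^ (n - i)" by simp
        then show "inverse z ^ i * f i * z ^ n = f i * z ^ (n - i)"
          using fi[of "inverse z ^ i"] by (simp add: mult.assoc[symmetric])
      qed
      also have "\<dots> = (\<Sum>i\<le>n. f (n - i) * z ^ i)"
        by (rule sum.reindex_bij_witness[of _ "\<lambda>i. n - i" "\<lambda>i. n - i"]) auto
      finally show ?thesis .
    qed
    have step: "z * v \<in> V" if v: "v \<in> V" for v
    proof -
      obtain c :: "nat \<Rightarrow> int" where c: "v = (\<Sum>i\<le>n. of_int (c i) * z ^ i)" using v by (auto simp: V_def)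
      have zi: "z * (of_int k * a) = of_int k * (z * a)" for k a
        using mult_of_int_commute[of k z] by (simp add: mult.assoc[symmetric])
      have "z * v = (\<Sum>i\<le>n. of_int (c i) * z ^ Suc i)"
        by (simp add: c sum_distrib_left zi)
      also have "\<dots> = (\<Sum>i<n. of_int (c i) * z ^ Suc i) + of_int (c n) * z ^ Suc n"
        by (simp add: lessThan_Suc_atMost[symmetric])
      also have "(\<Sum>i<n. of_int (c i) * z ^ Suc i) = (\<Sum>i\<le>n. of_int (if i = 0 then 0 else c (i - 1)) * z ^ i)"
        by (subst sum.atMost_shift) simp
      also have "of_int (c n) * z ^ Suc n = (\<Sum>i\<le>n. of_int (c n) * f (n - i) * z ^ i)"
        unfolding top sum_distrib_left by (simp add: mult.assoc)
      also have "(\<Sum>i\<le>n. of_int (if i = 0 then 0 else c (i - 1)) * z ^ i) + \<dots> =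
          (\<Sum>i\<le>n. (of_int (if i = 0 then 0 else c (i - 1)) + of_int (c n) * f (n - i)) * z ^ i)"
        by (simp only: distrib_right sum.distrib)
      also have "\<dots> \<in> V"
      proof (rule VI, rule allI)
        fix i
        have ofI: "of_int k \<in> I" for k by (simp add: I_def)
        show "of_int (if i = 0 then 0 else c (i - 1)) + of_int (c n) * f (n - i) \<in> I"
          by (intro is_subringD(3,6)[OF I] ofI f(1)[rule_format])
      qed
      finally show ?thesis .
    qed
    have "V \<subseteq> (\<lambda>c. \<Sum>i\<le>n. of_int (c i) * z ^ i) ` (PiE {..n} (\<lambda>_. {0..<int p}))"
    proof
      fix v assume "v \<in> V"
      then obtain c :: "nat \<Rightarrow> int" where c: "v = (\<Sum>i\<le>n. of_int (c i) * z ^ i)" by (auto simp: V_def)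
      have p0: "int p > 0" using prime_gt_0_nat[OF p(1)] by simp
      have red: "(of_int (k mod int p) :: 'a) = of_int k" for k
      proof -
        have "(of_int k :: 'a) = of_int (k div int p * int p + k mod int p)" by simp
        also have "\<dots> = of_int (k mod int p)" using p(2) by (simp only: of_int_add of_int_mult of_int_of_nat_eq) simp
        finally show ?thesis by simp
      qed
      have "restrict (\<lambda>i. c i mod int p) {..n} \<in> PiE {..n} (\<lambda>_. {0..<int p})" using p0 by auto
      moreover have "v = (\<Sum>i\<le>n. of_int (restrict (\<lambda>i. c i mod int p) {..n} i) * z ^ i)"
        by (simp add: c red)
      ultimately show "v \<in> (\<lambda>c. \<Sum>i\<le>n. of_int (c i) * z ^ i) ` (PiE {..n} (\<lambda>_. {0..<int p}))" by blast
    qed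
    moreover have "finite ((\<lambda>c. \<Sum>i\<le>n. of_int (c i) * z ^ i) ` (PiE {..n} (\<lambda>_. {0..<int p})))"
      by (intro finite_imageI finite_PiE) auto
    ultimately have finV: "finite V" by (rule finite_subset)
    have "1 = (\<Sum>i\<le>n. (if i = 0 then 1 else 0) * z ^ i)"
    proof -
      have "(\<Sum>i\<le>n. (if i = 0 then 1 else 0) * z ^ i) = (\<Sum>i\<le>n. if i = 0 then 1 else 0)"
        by (intro sum.cong) auto
      then show ?thesis by simp
    qed
    also have "\<dots> \<in> V" by (rule VI) (use is_subringD(1,2)[OF I] in auto)
    finally have "z ^ k \<in> V" for k by (induction k) (use step in auto)
    from finite_order[OF finV this z(2)] show ?thesis by blast
  qed
  \<comment> \<open>\<open>M\<close> modulo \<open>Z\<close> is given by a cocycle with finitely many values, all of them roots of unity; for a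
    common order \<open>k\<close> the representatives and the \<open>k\<close>-th roots of unity generate a finite group\<close>
  define zz where "zz = (\<lambda>r r'. SOME z. z \<in> Z \<and> (\<exists>r''\<in>R. r * r' = r'' * z))"
  have zz: "zz r r' \<in> Z \<and> (\<exists>r''\<in>R. r * r' = r'' * zz r r')" if "r \<in> R" "r' \<in> R" for r r'
  proof -
    have "r * r' \<in> M" using that R(2) mult_groupD(4)[OF M(1)] by blast
    then have "\<exists>z. z \<in> Z \<and> (\<exists>r''\<in>R. r * r' = r'' * z)" using R(3) by blast
    then show ?thesis unfolding zz_def by (rule someI_ex)
  qed
  have zz0: "zz r r' \<noteq> 0" if "r \<in> R" "r' \<in> R" for r r'
    using zz[OF that] R_nonzero that by force
  have "\<exists>k>0. \<forall>q\<in>S. (case q of (r, r') \<Rightarrow> zz r r' ^ k = 1)" if "finite S" "S \<subseteq> R \<times> R" for S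
    using that
  proof (induction S rule: finite_induct)
    case (insert q S)
    obtain r r' where q: "q = (r, r')" by force
    have rr: "r \<in> R" "r' \<in> R" using insert.prems q by auto
    obtain k where k: "k > 0" "\<forall>q\<in>S. (case q of (r, r') \<Rightarrow> zz r r' ^ k = 1)" using insert by auto
    obtain l where l: "l > 0" "zz r r' ^ l = 1" using torsion[of "zz r r'"] zz[OF rr] zz0[OF rr] by blast
    have "zz a b ^ (k * l) = 1" if "(a, b) \<in> insert q S" for a b
    proof (cases "(a, b) = q")
      case True
      then show ?thesis using l q by (simp add: mult.commute[of k] power_mult)
    next
      case False
      then have "zz a b ^ k = 1" using k(2) that by auto
      then show ?thesis by (simp add: power_mult)
    qed
    then show ?case using k l by (intro exI[of _ "k * l"]) auto
  qed (auto intro: exI[of _ 1])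
  from this[of "R \<times> R"] R(1) obtain k where k: "k > 0" "\<forall>q\<in>R \<times> R. (case q of (r, r') \<Rightarrow> zz r r' ^ k = 1)"
    by auto
  define U where "U = {z \<in> Z. z ^ k = 1}"
  define Q where "Q = (\<lambda>(r, z). r * z) ` (R \<times> U)"
  have Ufin: "finite U" unfolding U_def by (rule finite_roots_of_unity[OF Zd Zc k(1)])
  have Umult: "a * b \<in> U" if "a \<in> U" "b \<in> U" for a b
    using that div_subringD(6)[OF Zd] power_mult_commuting[of a b k] central[of a b] ZW
    by (auto simp: U_def)
  have U0: "a \<noteq> 0" if "a \<in> U" for a using that k(1) by (auto simp: U_def power_0_left)
  have U1: "1 \<in> U" using div_subringD(2)[OF Zd] by (simp add: U_def)
  have commR: "r * r' = r' * r" if "r \<in> R" "r' \<in> R" for r r'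
  proof (rule finite_multiplicative_commute[OF p, of Q])
    show "finite Q" using R(1) Ufin by (simp add: Q_def)
    show "0 \<notin> Q" using R_nonzero U0 by (auto simp: Q_def)
    show "r \<in> Q" "r' \<in> Q" using that U1 by (auto simp: Q_def intro!: image_eqI[of _ _ "(_, 1)"])
    fix a b assume "a \<in> Q" "b \<in> Q"
    then obtain s z s' z' where ab: "a = s * z" "s \<in> R" "z \<in> U" "b = s' * z'" "s' \<in> R" "z' \<in> U"
      by (auto simp: Q_def)
    obtain s'' where s'': "s'' \<in> R" "s * s' = s'' * zz s s'" using zz[OF ab(2,5)] by blast
    have zU: "zz s s' \<in> U" using zz[OF ab(2,5)] k(2) ab(2,5) by (auto simp: U_def)
    have "z * s' = s' * z" using ab central[of z s'] R(2) MW by (auto simp: U_def)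
    then have "a * b = s * s' * (z * z')" by (simp add: ab mult.assoc) (simp add: mult.assoc[symmetric])
    also have "\<dots> = s'' * (zz s s' * (z * z'))" by (simp add: s'' mult.assoc)
    finally show "a * b \<in> Q" using s''(1) Umult[OF zU Umult[OF ab(3,6)]] unfolding Q_def
      by (intro image_eqI[of _ _ "(s'', zz s s' * (z * z'))"]) auto
  qed
  obtain r z where rz: "r \<in> R" "z \<in> Z" "x = r * z" using R(3)[OF xy(1)] by blast
  obtain r' z' where rz': "r' \<in> R" "z' \<in> Z" "y = r' * z'" using R(3)[OF xy(2)] by blast
  have in_W: "r \<in> W" "r' \<in> W" "z' \<in> W" "z \<in> W" using rz rz' R(2) MW ZW by auto
  have "x * y = (r * r') * (z * z')"
    using central[OF rz(2) in_W(2)] by (simp add: rz rz' mult.assoc) (simp add: mult.assoc[symmetric])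
  also have "\<dots> = (r' * r) * (z' * z)" using commR[OF rz(1) rz'(1)] central[OF rz(2) in_W(3)] by simp
  also have "\<dots> = y * x"
    using central[OF rz'(2) in_W(1)] by (simp add: rz rz' mult.assoc) (simp add: mult.assoc[symmetric])
  finally show ?thesis .
qed

end

text \<open>A valuation ring \<open>B\<close> of the center yields \<open>M\<close>-invariant lattices and congruence subgroups.\<close>

locale lattice = central_by_finite_maximal W Z G M R + valuation_subring Z B \<pi>
  for W Z G M R B :: "'a::division_ring set" and \<pi> :: 'a
begin

definition S :: "'a set" where "S = (\<lambda>(m, r). cj m r) ` (M \<times> R)"

definition \<Lambda> :: "'a set" where "\<Lambda> = {(\<Sum>s\<in>S. c s * s) | c. \<forall>s\<in>S. c s \<in> B}"

text \<open>The elements that multiply the lattice into itself from both sides: an order in the finite-dimensional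
  algebra \<open>W\<close>.\<close>

definition order :: "'a set" where "order = {w \<in> W. \<forall>l\<in>\<Lambda>. w * l \<in> \<Lambda> \<and> l * w \<in> \<Lambda>}"

text \<open>The elements that act trivially by conjugation on the lattice modulo \<open>a\<close>. Inverses are included in the
  definition, so that it is visibly a group; \<open>congruence 1\<close> is the stabilizer of the lattice.\<close>

definition congruence :: "'a \<Rightarrow> 'a set" where
  "congruence a = {g \<in> W - {0}. \<forall>l\<in>\<Lambda>. (\<exists>\<mu>\<in>\<Lambda>. cj g l - l = a * \<mu>) \<and> (\<exists>\<mu>\<in>\<Lambda>. cj (inverse g) l - l = a * \<mu>)}"

lemma BW: "B \<subseteq> W" using B(2) ZW by blast

lemma finS: "finite S"
proof -
  have "S \<subseteq> (\<lambda>(m, r). cj m r) ` (R \<times> R)"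
  proof
    fix s assume "s \<in> S"
    then obtain m r where s: "m \<in> M" "r \<in> R" "s = cj m r" by (auto simp: S_def)
    obtain r' z where rz: "r' \<in> R" "z \<in> Z" "m = r' * z" using R(3)[OF s(1)] by blast
    have "z \<noteq> 0" using rz mult_groupD(3)[OF M(1) s(1)] by auto
    then have "cj z r = r" using central[OF rz(2), of r] s(2) R(2) MW by (auto simp: cj_eq_iff)
    then have "s = cj r' r" by (simp add: s(3) rz(3) cj_cj[symmetric])
    then show "s \<in> (\<lambda>(m, r). cj m r) ` (R \<times> R)" using rz(1) s(2) by auto
  qed
  then show ?thesis by (rule finite_subset) (use R(1) in auto)
qed

lemma SW: "S \<subseteq> W"
proof -
  have "cj m r \<in> W" if "m \<in> M" "r \<in> R" for m r
    using div_subringD(8)[OF W subsetD[OF MW that(1)] subsetD[OF MW subsetD[OF R(2) that(2)]]] .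
  then show ?thesis by (auto simp: S_def)
qed

lemma S_cj: "m \<in> M \<Longrightarrow> s \<in> S \<Longrightarrow> cj m s \<in> S"
  using mult_groupD(4)[OF M(1)] by (fastforce simp: S_def cj_cj)

lemma RS: "R \<subseteq> S"
proof
  fix r assume "r \<in> R"
  then show "r \<in> S" using mult_groupD(1)[OF M(1)] by (auto simp: S_def intro!: image_eqI[of _ _ "(1, r)"])
qed

lemma \<Lambda>I: "(\<And>s. s \<in> S \<Longrightarrow> c s \<in> B) \<Longrightarrow> (\<Sum>s\<in>S. c s * s) \<in> \<Lambda>"
  by (auto simp: \<Lambda>_def)

lemma \<Lambda>_add: assumes "x \<in> \<Lambda>" "y \<in> \<Lambda>" shows "x + y \<in> \<Lambda>"
proof -
  from assms obtain c d where cd: "\<forall>s\<in>S. c s \<in> B" "x = (\<Sum>s\<in>S. c s * s)" "\<forall>s\<in>S. d s \<in> B" "y = (\<Sum>s\<in>S. d s * s)"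
    unfolding \<Lambda>_def by blast
  have "x + y = (\<Sum>s\<in>S. (c s + d s) * s)" by (simp add: cd distrib_right sum.distrib)
  also have "\<dots> \<in> \<Lambda>" by (rule \<Lambda>I) (use cd is_subringD(3)[OF B(1)] in blast)
  finally show ?thesis .
qed

lemma \<Lambda>_scale: assumes "b \<in> B" "x \<in> \<Lambda>" shows "b * x \<in> \<Lambda>"
proof -
  from assms obtain c where c: "\<forall>s\<in>S. c s \<in> B" "x = (\<Sum>s\<in>S. c s * s)" unfolding \<Lambda>_def by blast
  have "b * x = (\<Sum>s\<in>S. (b * c s) * s)" by (simp add: c sum_distrib_left mult.assoc)
  also have "\<dots> \<in> \<Lambda>" by (rule \<Lambda>I) (use c assms(1) is_subringD(6)[OF B(1)] in blast)
  finally show ?thesis .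
qed

lemma \<Lambda>_0: "0 \<in> \<Lambda>" using \<Lambda>I[of "\<lambda>_. 0"] is_subringD(1)[OF B(1)] by simp

lemma \<Lambda>_neg: "x \<in> \<Lambda> \<Longrightarrow> - x \<in> \<Lambda>"
  using \<Lambda>_scale[OF is_subringD(4)[OF B(1) is_subringD(2)[OF B(1)]], of x] by simp

lemma \<Lambda>_diff: "x \<in> \<Lambda> \<Longrightarrow> y \<in> \<Lambda> \<Longrightarrow> x - y \<in> \<Lambda>"
  using \<Lambda>_add[of x "- y"] \<Lambda>_neg by simp

lemma \<Lambda>_sum: "(\<And>i. i \<in> I \<Longrightarrow> f i \<in> \<Lambda>) \<Longrightarrow> sum f I \<in> \<Lambda>"
  by (induction I rule: infinite_finite_induct) (auto intro: \<Lambda>_add \<Lambda>_0)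

lemma S\<Lambda>: "s \<in> S \<Longrightarrow> s \<in> \<Lambda>"
proof -
  assume s: "s \<in> S"
  have "(\<Sum>t\<in>S. (if t = s then 1 else 0) * t) = (\<Sum>t\<in>S. if t = s then t else 0)"
    by (intro sum.cong) auto
  also have "\<dots> = s" using s finS by simp
  finally show ?thesis
    using \<Lambda>I[of "\<lambda>t. if t = s then 1 else 0"] is_subringD(1,2)[OF B(1)] by simp
qed

lemma \<Lambda>W: "\<Lambda> \<subseteq> W"
proof
  fix x assume "x \<in> \<Lambda>"
  then obtain c where c: "\<forall>s\<in>S. c s \<in> B" "x = (\<Sum>s\<in>S. c s * s)" unfolding \<Lambda>_def by blast
  show "x \<in> W" unfolding c by (intro div_subring_sum[OF W] div_subringD(6)[OF W]) (use c BW SW in auto)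
qed

lemma \<Lambda>_cj: assumes m: "m \<in> M" and x: "x \<in> \<Lambda>" shows "cj m x \<in> \<Lambda>"
proof -
  from x obtain c where c: "\<forall>s\<in>S. c s \<in> B" "x = (\<Sum>s\<in>S. c s * s)" unfolding \<Lambda>_def by blast
  have m0: "m \<noteq> 0" by (rule mult_groupD(3)[OF M(1) m])
  have "cj m (c s * s) \<in> \<Lambda>" if s: "s \<in> S" for s
  proof -
    have "c s * m = m * c s" using central[of "c s" m] c(1) s B(2) m MW by blast
    then have "cj m (c s) = c s" using m0 by (simp add: cj_eq_iff)
    then have "cj m (c s * s) = c s * cj m s" using m0 by (simp add: cj_mult)
    then show ?thesis using \<Lambda>_scale[of "c s"] c(1) s S\<Lambda>[OF S_cj[OF m s]] by simp
  qed
  then show ?thesis unfolding c(2) cj_sum by (rule \<Lambda>_sum)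
qed

lemma Bcentral: "b \<in> B \<Longrightarrow> w \<in> W \<Longrightarrow> b * w = w * b"
  using central B(2) by blast

lemma multiple_in_\<Lambda>:
  assumes "w \<in> W"
  shows "\<exists>a\<in>B - {0}. a * w \<in> \<Lambda>"
proof -
  obtain c where c: "\<forall>r\<in>R. c r \<in> Z" "w = (\<Sum>r\<in>R. c r * r)" using span[OF assms] unfolding lin_span_def by blast
  obtain a where a: "a \<in> B - {0}" "\<forall>r\<in>R. a * c r \<in> B" using common_denominator[OF R(1)] c(1) by blast
  have "a * w = (\<Sum>r\<in>R. (a * c r) * r)" by (simp add: c(2) sum_distrib_left mult.assoc)
  also have "\<dots> \<in> \<Lambda>" by (intro \<Lambda>_sum \<Lambda>_scale) (use a RS S\<Lambda> in auto)
  finally show ?thesis using a(1) by blast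
qed

lemma B_mult_nonzero: "a \<in> B - {0} \<Longrightarrow> b \<in> B - {0} \<Longrightarrow> a * b \<in> B - {0}"
  using is_subringD(6)[OF B(1)] by auto

lemma common_multiple_in_\<Lambda>:
  assumes "finite T" "T \<subseteq> W"
  shows "\<exists>a\<in>B - {0}. \<forall>w\<in>T. a * w \<in> \<Lambda>"
  using assms
proof (induction T rule: finite_induct)
  case empty
  then show ?case using is_subringD(2)[OF B(1)] by (intro bexI[of _ 1]) auto
next
  case (insert t T)
  then obtain a where a: "a \<in> B - {0}" "\<forall>w\<in>T. a * w \<in> \<Lambda>" by blast
  obtain b where b: "b \<in> B - {0}" "b * t \<in> \<Lambda>" using multiple_in_\<Lambda>[of t] insert.prems by blast
  have "(a * b) * t \<in> \<Lambda>" using \<Lambda>_scale[of a "b * t"] a b by (simp add: mult.assoc)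
  moreover have "(a * b) * w \<in> \<Lambda>" if "w \<in> T" for w
    using \<Lambda>_scale[of b "a * w"] a b that B_comm[of a b] by (simp add: mult.assoc[symmetric])
  ultimately show ?case using B_mult_nonzero[OF a(1) b(1)] by (intro bexI[of _ "a * b"]) auto
qed

lemma order_subring: "is_subring order"
  unfolding is_subring_def
proof (intro conjI ballI)
  show "0 \<in> order" "1 \<in> order" using div_subringD(1,2)[OF W] \<Lambda>_0 by (auto simp: order_def)
  fix x assume x: "x \<in> order"
  show "- x \<in> order" using x div_subringD(4)[OF W] by (simp add: order_def \<Lambda>_neg)
  fix y assume y: "y \<in> order"
  show "x + y \<in> order" using x y div_subringD(3)[OF W]
    by (simp add: order_def distrib_left distrib_right \<Lambda>_add)
  have "x * y * l \<in> \<Lambda> \<and> l * (x * y) \<in> \<Lambda>" if l: "l \<in> \<Lambda>" for l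
  proof -
    have "y * l \<in> \<Lambda>" "l * x \<in> \<Lambda>" using x y l by (simp_all add: order_def)
    then have "x * (y * l) \<in> \<Lambda>" "(l * x) * y \<in> \<Lambda>" using x y by (simp_all add: order_def)
    then show ?thesis by (simp only: mult.assoc)
  qed
  moreover have "x * y \<in> W" using x y div_subringD(6)[OF W] by (simp add: order_def)
  ultimately show "x * y \<in> order" by (simp add: order_def)
qed

lemma B_order: "B \<subseteq> order"
proof
  fix b assume b: "b \<in> B"
  have "l * b = b * l" if "l \<in> \<Lambda>" for l using Bcentral[OF b] that \<Lambda>W by auto
  then show "b \<in> order" using b BW \<Lambda>_scale by (auto simp: order_def)
qed

lemma multiple_in_order:
  assumes w: "w \<in> W"
  shows "\<exists>a\<in>B - {0}. a * w \<in> order"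
proof -
  have "(\<lambda>(s, t). s * t) ` (S \<times> S) \<subseteq> W" using SW div_subringD(6)[OF W] by auto
  then obtain d where d: "d \<in> B - {0}" "\<forall>v\<in>(\<lambda>(s, t). s * t) ` (S \<times> S). d * v \<in> \<Lambda>"
    using common_multiple_in_\<Lambda>[of "(\<lambda>(s, t). s * t) ` (S \<times> S)"] finS by blast
  have prod: "d * (x * y) \<in> \<Lambda>" if xy: "x \<in> \<Lambda>" "y \<in> \<Lambda>" for x y
  proof -
    from xy obtain c e where ce: "\<forall>s\<in>S. c s \<in> B" "x = (\<Sum>s\<in>S. c s * s)" "\<forall>s\<in>S. e s \<in> B" "y = (\<Sum>s\<in>S. e s * s)"
      unfolding \<Lambda>_def by blast
    have "d * (x * y) = (\<Sum>s\<in>S. \<Sum>t\<in>S. (c s * e t) * (d * (s * t)))"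
      unfolding ce(2,4) sum_product unfolding sum_distrib_left
    proof (intro sum.cong refl)
      fix s t assume st: "s \<in> S" "t \<in> S"
      have 1: "s * e t = e t * s" using Bcentral[of "e t" s] ce st SW by auto
      have 2: "d * (c s * e t) = (c s * e t) * d"
        using B_comm[of d "c s * e t"] d ce st is_subringD(6)[OF B(1)] by auto
      have "d * (c s * s * (e t * t)) = d * (c s * (s * e t) * t)" by (simp add: mult.assoc)
      also have "\<dots> = d * (c s * e t) * (s * t)" by (simp add: 1 mult.assoc)
      finally show "d * (c s * s * (e t * t)) = (c s * e t) * (d * (s * t))" by (simp add: 2 mult.assoc)
    qed
    also have "\<dots> \<in> \<Lambda>"
    proof (intro \<Lambda>_sum)
      fix s t assume "s \<in> S" "t \<in> S"
      then have "c s * e t \<in> B" "d * (s * t) \<in> \<Lambda>" using is_subringD(6)[OF B(1)] ce d(2) by auto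
      then show "c s * e t * (d * (s * t)) \<in> \<Lambda>" by (rule \<Lambda>_scale)
    qed
    finally show ?thesis .
  qed
  obtain a where a: "a \<in> B - {0}" "a * w \<in> \<Lambda>" using multiple_in_\<Lambda>[OF w] by blast
  have "(d * a) * w \<in> order"
    unfolding order_def
  proof (intro CollectI conjI ballI)
    show "d * a * w \<in> W" using d a w BW by (intro div_subringD(6)[OF W]) auto
    fix l assume l: "l \<in> \<Lambda>"
    show "d * a * w * l \<in> \<Lambda>" using prod[OF a(2) l] by (simp add: mult.assoc)
    have "l * (d * a * w) = d * (l * (a * w))"
      using Bcentral[of d l] d l \<Lambda>W by (auto simp: mult.assoc[symmetric])
    then show "l * (d * a * w) \<in> \<Lambda>" using prod[OF l a(2)] by simp
  qed
  then show ?thesis using B_mult_nonzero[OF d(1) a(1)] by blast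
qed

text \<open>A \<open>Z\<close>-linear functional that maps \<open>w\<close> to \<open>1\<close> takes values with bounded denominators on the lattice, whereas
  it maps \<open>a\<inverse> w\<close> to \<open>a\<inverse>\<close>.\<close>

lemma divisible_is_zero:
  assumes div: "\<And>a. a \<in> B - {0} \<Longrightarrow> \<exists>\<mu>\<in>\<Lambda>. w = a * \<mu>"
  shows "w = 0"
proof (rule ccontr)
  assume w0: "w \<noteq> 0"
  obtain c where cZ: "\<forall>s\<in>S. c s \<in> Z" and rel: "\<forall>z r. z \<in> Z \<and> (\<forall>s\<in>S. r s \<in> Z) \<and>
      z + (\<Sum>s\<in>S. r s * (s * inverse w)) = 0 \<longrightarrow> z + (\<Sum>s\<in>S. r s * c s) = 0"
    using linear_functional_on_finite_family[OF Zd finS, of "\<lambda>s. s * inverse w"] by auto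
  obtain d where d: "d \<in> B - {0}" "\<forall>s\<in>S. d * c s \<in> B" using common_denominator[OF finS] cZ by blast
  have d\<pi>: "d * \<pi> \<in> B - {0}" using B_mult_nonzero[OF d(1)] B(3) \<pi>0 by blast
  obtain \<mu> where \<mu>: "\<mu> \<in> \<Lambda>" "w = d * \<pi> * \<mu>" using div[OF d\<pi>] by blast
  obtain f where f: "\<forall>s\<in>S. f s \<in> B" "\<mu> = (\<Sum>s\<in>S. f s * s)" using \<mu>(1) unfolding \<Lambda>_def by blast
  define q where "q = inverse (d * \<pi>)"
  have qZ: "q \<in> Z" unfolding q_def using d\<pi> B(2) by (intro div_subringD(7)[OF Zd]) auto
  have "d * \<pi> \<noteq> 0" using d\<pi> by blast
  then have "inverse (d * \<pi>) * (d * \<pi>) * \<mu> = \<mu>" by (simp only: left_inverse mult_1_left not_False_eq_True)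
  then have "q * w = \<mu>" unfolding \<mu>(2) q_def by (simp only: mult.assoc)
  then have "q * w * inverse w = \<mu> * inverse w" by (simp only:)
  then have "q = (\<Sum>s\<in>S. f s * (s * inverse w))" using w0 by (simp add: f(2) sum_distrib_right mult.assoc)
  then have "q + (\<Sum>s\<in>S. (- f s) * (s * inverse w)) = 0" by (simp add: sum_negf)
  moreover have "\<forall>s\<in>S. - f s \<in> Z" using f(1) B(2) div_subringD(4)[OF Zd] by blast
  ultimately have "q + (\<Sum>s\<in>S. (- f s) * c s) = 0"
    using rel[THEN spec, THEN spec, of q "\<lambda>s. - f s"] qZ by simp
  then have q: "q = (\<Sum>s\<in>S. f s * c s)" by (simp add: sum_negf)
  have "d * q = (\<Sum>s\<in>S. f s * (d * c s))"
    unfolding q sum_distrib_left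
  proof (rule sum.cong[OF refl])
    fix s assume "s \<in> S"
    then have "d * f s = f s * d" using B_comm d(1) f(1) by blast
    then show "d * (f s * c s) = f s * (d * c s)" by (simp add: mult.assoc[symmetric])
  qed
  also have "\<dots> \<in> B" by (intro is_subring_sum[OF B(1)]) (use f d is_subringD(6)[OF B(1)] in auto)
  finally have "d * q \<in> B" .
  moreover have "d * q = inverse \<pi>"
  proof -
    have "inverse (d * \<pi>) = inverse (\<pi> * d)" using B_comm[of d \<pi>] d(1) B(3) by simp
    then show ?thesis using d(1) by (simp add: q_def inverse_mult_rev mult.assoc[symmetric])
  qed
  ultimately show False using B(4) by simp
qed

lemma congruence_group:
  assumes a: "a \<in> B - {0}"
  shows "mult_group (congruence a)"
  unfolding mult_group_def
proof (intro conjI ballI)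
  show "1 \<in> congruence a" using div_subringD(2)[OF W] \<Lambda>_0 by (auto simp: congruence_def intro!: bexI[of _ 0])
  show "0 \<notin> congruence a" by (simp add: congruence_def)
  fix g assume g: "g \<in> congruence a"
  show "inverse g \<in> congruence a" using g div_subringD(7)[OF W] by (auto simp: congruence_def)
  fix h assume h: "h \<in> congruence a"
  have comp: "\<exists>\<nu>\<in>\<Lambda>. cj (x * y) l - l = a * \<nu>"
    if x: "x \<in> W" "x \<noteq> 0" "\<forall>l\<in>\<Lambda>. \<exists>\<mu>\<in>\<Lambda>. cj x l - l = a * \<mu>" and y: "\<forall>l\<in>\<Lambda>. \<exists>\<mu>\<in>\<Lambda>. cj y l - l = a * \<mu>"
      and l: "l \<in> \<Lambda>" for x y l
  proof -
    obtain \<mu> where \<mu>: "\<mu> \<in> \<Lambda>" "cj y l - l = a * \<mu>" using y l by blast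
    obtain \<mu>' where \<mu>': "\<mu>' \<in> \<Lambda>" "cj x \<mu> - \<mu> = a * \<mu>'" using x(3) \<mu>(1) by blast
    obtain \<mu>'' where \<mu>'': "\<mu>'' \<in> \<Lambda>" "cj x l - l = a * \<mu>''" using x(3) l by blast
    have "cj x a = a" using Bcentral[of a x] a x by (auto simp: cj_eq_iff)
    have "cj (x * y) l - l = cj x (cj y l - l) + (cj x l - l)" by (simp add: cj_cj cj_diff)
    also have "cj x (cj y l - l) = a * cj x \<mu>" using x(2) \<open>cj x a = a\<close> by (simp add: \<mu>(2) cj_mult)
    also have "cj x \<mu> = \<mu> + a * \<mu>'" using \<mu>'(2) by (simp add: algebra_simps)
    finally have "cj (x * y) l - l = a * (\<mu> + a * \<mu>' + \<mu>'')" by (simp add: \<mu>''(2) distrib_left)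
    moreover have "\<mu> + a * \<mu>' + \<mu>'' \<in> \<Lambda>"
      using \<mu>(1) \<mu>'(1) \<mu>''(1) a \<Lambda>_scale[of a \<mu>'] by (intro \<Lambda>_add) auto
    ultimately show ?thesis by blast
  qed
  have gh: "g \<in> W" "g \<noteq> 0" "h \<in> W" "h \<noteq> 0" "inverse g \<in> W" "inverse h \<in> W"
    using g h div_subringD(7)[OF W] by (auto simp: congruence_def)
  have 1: "\<exists>\<nu>\<in>\<Lambda>. cj (g * h) l - l = a * \<nu>" if "l \<in> \<Lambda>" for l
    by (rule comp[OF gh(1,2) _ _ that]) (use g h in \<open>auto simp: congruence_def\<close>)
  have 2: "\<exists>\<nu>\<in>\<Lambda>. cj (inverse h * inverse g) l - l = a * \<nu>" if "l \<in> \<Lambda>" for l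
    by (rule comp[OF gh(6) _ _ _ that]) (use g h gh in \<open>auto simp: congruence_def\<close>)
  show "g * h \<in> congruence a"
    using 1 2 gh div_subringD(6)[OF W gh(1,3)] by (simp add: congruence_def inverse_mult_rev)
qed

lemma congruence_one_cj: "g \<in> congruence 1 \<Longrightarrow> l \<in> \<Lambda> \<Longrightarrow> cj g l \<in> \<Lambda> \<and> cj (inverse g) l \<in> \<Lambda>"
proof -
  assume g: "g \<in> congruence 1" and l: "l \<in> \<Lambda>"
  obtain \<mu> \<nu> where "\<mu> \<in> \<Lambda>" "cj g l - l = 1 * \<mu>" "\<nu> \<in> \<Lambda>" "cj (inverse g) l - l = 1 * \<nu>"
    using g l unfolding congruence_def by blast
  then show ?thesis using \<Lambda>_add[of \<mu> l] \<Lambda>_add[of \<nu> l] l by (simp add: algebra_simps)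
qed

lemma M_congruence: "M \<subseteq> congruence 1"
proof
  fix m assume m: "m \<in> M"
  have "cj m l - l \<in> \<Lambda> \<and> cj (inverse m) l - l \<in> \<Lambda>" if "l \<in> \<Lambda>" for l
    using \<Lambda>_cj[OF m that] \<Lambda>_cj[OF mult_groupD(5)[OF M(1) m] that] \<Lambda>_diff that by blast
  then show "m \<in> congruence 1" using m MW mult_groupD(3)[OF M(1) m] by (auto simp: congruence_def)
qed

lemma congruence_normal:
  assumes a: "a \<in> B - {0}" and g: "g \<in> congruence 1" and h: "h \<in> congruence a"
  shows "cj g h \<in> congruence a"
proof -
  have g0: "g \<noteq> 0" "g \<in> W" using g by (auto simp: congruence_def)
  have ga: "cj g a = a" using Bcentral[of a g] a g0 by (auto simp: cj_eq_iff)
  have key: "\<exists>\<nu>\<in>\<Lambda>. cj (cj g x) l - l = a * \<nu>" if x: "\<forall>l\<in>\<Lambda>. \<exists>\<mu>\<in>\<Lambda>. cj x l - l = a * \<mu>" and l: "l \<in> \<Lambda>" for x l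
  proof -
    define l' where "l' = cj (inverse g) l"
    have l': "l' \<in> \<Lambda>" using congruence_one_cj[OF g l] by (simp add: l'_def)
    obtain \<mu> where \<mu>: "\<mu> \<in> \<Lambda>" "cj x l' - l' = a * \<mu>" using x l' by blast
    have "cj (cj g x) l = cj g (cj x l')" unfolding l'_def cj_cj by (simp only: cj_def[of g x] mult.assoc)
    moreover have "cj g l' = l" using g0 by (simp add: l'_def)
    ultimately have "cj (cj g x) l - l = cj g (a * \<mu>)" by (simp add: \<mu>(2)[symmetric] cj_diff)
    also have "\<dots> = a * cj g \<mu>" using g0 ga by (simp add: cj_mult)
    finally show ?thesis using congruence_one_cj[OF g \<mu>(1)] by blast
  qed
  have h': "\<forall>l\<in>\<Lambda>. \<exists>\<mu>\<in>\<Lambda>. cj h l - l = a * \<mu>" "\<forall>l\<in>\<Lambda>. \<exists>\<mu>\<in>\<Lambda>. cj (inverse h) l - l = a * \<mu>" "h \<in> W" "h \<noteq> 0"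
    using h by (auto simp: congruence_def)
  have "\<exists>\<nu>\<in>\<Lambda>. cj (cj g h) l - l = a * \<nu>" "\<exists>\<nu>\<in>\<Lambda>. cj (inverse (cj g h)) l - l = a * \<nu>" if "l \<in> \<Lambda>" for l
    using key[OF h'(1) that] key[OF h'(2) that] g0 by (simp_all add: cj_inverse)
  moreover have "cj g h \<in> W - {0}" using div_subringD(8)[OF W g0(2) h'(3)] g0 h' by simp
  ultimately show ?thesis unfolding congruence_def by blast
qed

text \<open>The multiples \<open>\<pi> b u\<close> of a good \<open>u\<close> behave like elements of the Jacobson radical of the order.\<close>

definition good :: "'a \<Rightarrow> bool" where
  "good u \<longleftrightarrow> u \<in> order \<and> (\<forall>b\<in>B. 1 + \<pi> * b * u \<noteq> 0 \<and> inverse (1 + \<pi> * b * u) \<in> order)"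

lemma good_scale:
  assumes u: "good u" and c: "c \<in> B"
  shows "good (c * u)"
proof -
  have "1 + \<pi> * b * (c * u) = 1 + \<pi> * (b * c) * u" for b by (simp add: mult.assoc)
  moreover have "b * c \<in> B" if "b \<in> B" for b using is_subringD(6)[OF B(1) that c] .
  moreover have "c * u \<in> order" using is_subringD(6)[OF order_subring] B_order c u by (auto simp: good_def)
  ultimately show ?thesis using u by (simp add: good_def)
qed

text \<open>After scaling, \<open>u\<close> is integral over \<open>B\<close>. Its equation evaluated at \<open>- 1 / s\<close> is a unit for \<open>s\<close> divisible by
  \<open>\<pi>\<close>, and dividing the equation by \<open>1 + s u\<close> shows that \<open>1 + s u\<close> is invertible in the order.\<close>

lemma good_multiple:
  assumes u: "u \<in> W"
  shows "\<exists>c\<in>B - {0}. good (c * u)"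
proof -
  obtain N q where q: "\<And>j. j \<le> N \<Longrightarrow> q j \<in> Z" "\<exists>j\<le>N. q j \<noteq> 0" "(\<Sum>j\<le>N. q j * u ^ j) = 0"
    by (rule powers_dependent[OF Zd R(1) span[OF div_subring_power[OF W u]]]) (rule that)
  define n where "n = (GREATEST j. j \<le> N \<and> q j \<noteq> 0)"
  have n: "n \<le> N \<and> q n \<noteq> 0" unfolding n_def by (rule GreatestI_ex_nat[of _ N]) (use q(2) in auto)
  have big: "q j = 0" if "n < j" "j \<le> N" for j
  proof (rule ccontr)
    assume "q j \<noteq> 0"
    then have "j \<le> n" unfolding n_def by (intro Greatest_le_nat[of _ j N]) (use that in auto)
    then show False using that by simp
  qed
  define p where "p = (\<lambda>i. - (inverse (q n) * q i))"
  have pZ: "p i \<in> Z" if "i \<in> {..<n}" for i unfolding p_def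
    using that n by (intro div_subringD(4,6,7)[OF Zd] q(1)) auto
  have "(\<Sum>j\<le>N. q j * u ^ j) = (\<Sum>j\<le>n. q j * u ^ j)"
    by (rule sum.mono_neutral_right) (use n big in auto)
  then have "(\<Sum>j<n. q j * u ^ j) + q n * u ^ n = 0" using q(3) by (simp add: lessThan_Suc_atMost[symmetric])
  then have "q n * u ^ n = - (\<Sum>j<n. q j * u ^ j)" by (metis add.commute eq_neg_iff_add_eq_0)
  then have "inverse (q n) * (q n * u ^ n) = inverse (q n) * - (\<Sum>j<n. q j * u ^ j)" by simp
  then have un: "u ^ n = (\<Sum>i<n. p i * u ^ i)"
    using n by (simp add: p_def mult.assoc[symmetric] sum_distrib_left sum_negf)
  obtain c1 where c1: "c1 \<in> B - {0}" "\<forall>i\<in>{..<n}. c1 * p i \<in> B" using common_denominator[of "{..<n}" p] pZ by auto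
  obtain c2 where c2: "c2 \<in> B - {0}" "c2 * u \<in> order" using multiple_in_order[OF u] by blast
  define c where "c = c1 * c2"
  have c: "c \<in> B - {0}" unfolding c_def by (rule B_mult_nonzero[OF c1(1) c2(1)])
  have cB: "c \<in> B" "c \<in> Z" using c B(2) by auto
  define v where "v = c * u"
  have vO: "v \<in> order" unfolding v_def c_def mult.assoc
    using is_subringD(6)[OF order_subring] B_order c1(1) c2(2) by blast
  have cp: "c * p i \<in> B" if "i < n" for i
  proof -
    have "c * p i = c2 * (c1 * p i)" using B_comm[of c1 c2] c1 c2 by (simp add: c_def mult.assoc[symmetric])
    then show ?thesis using is_subringD(6)[OF B(1)] c1(2) c2(1) that by simp
  qed
  define e where "e = (\<lambda>i. c ^ (n - i) * p i)"
  have eB: "e i \<in> B" if "i < n" for i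
  proof -
    have "n - i = Suc (n - i - 1)" using that by simp
    then have "c ^ (n - i) = c ^ (n - i - 1) * c" by (metis power_Suc2)
    then show ?thesis using is_subringD(6)[OF B(1) is_subring_power[OF B(1) cB(1)] cp[OF that]]
      by (simp add: e_def mult.assoc)
  qed
  have vpow: "v ^ i = c ^ i * u ^ i" for i
    unfolding v_def by (rule power_mult_commuting) (use central[OF cB(2) u] in simp)
  have vn: "v ^ n = (\<Sum>i<n. e i * v ^ i)"
    unfolding vpow un sum_distrib_left
  proof (rule sum.cong[OF refl])
    fix i assume "i \<in> {..<n}"
    then have i: "i < n" by simp
    have "c ^ n = c ^ (n - i) * c ^ i" using i by (simp add: power_add[symmetric])
    moreover have "c ^ i * p i = p i * c ^ i"
      using i by (intro comm div_subring_power[OF Zd] cB pZ) auto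
    ultimately show "c ^ n * (p i * u ^ i) = e i * (c ^ i * u ^ i)"
      by (simp add: e_def mult.assoc) (simp add: mult.assoc[symmetric])
  qed
  have "1 + \<pi> * b * v \<noteq> 0 \<and> inverse (1 + \<pi> * b * v) \<in> order" if b: "b \<in> B" for b
  proof -
    define s where "s = \<pi> * b"
    define y where "y = 1 + s * v"
    have sB: "s \<in> B" unfolding s_def by (rule is_subringD(6)[OF B(1) B(3) b])
    have sv: "s * v \<in> order" using is_subringD(6)[OF order_subring] sB vO B_order by blast
    have vW: "v \<in> W" using vO by (simp add: order_def)
    have swap: "s ^ i * w = w * s ^ i" if "w \<in> W" for i w
      using Bcentral[OF is_subring_power[OF B(1) sB] that] .
    have div1: "\<exists>t\<in>order. (s * v) ^ i - (- 1) ^ i = y * t" for i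
    proof (induction i)
      case 0
      then show ?case using is_subringD(1)[OF order_subring] by (intro bexI[of _ 0]) auto
    next
      case (Suc i)
      then obtain t where t: "t \<in> order" "(s * v) ^ i - (- 1) ^ i = y * t" by blast
      have "(s * v) ^ Suc i - (- 1) ^ Suc i = s * v * ((s * v) ^ i - (- 1) ^ i) + (- 1) ^ i * y"
        by (cases "even i") (simp_all add: y_def algebra_simps)
      also have "\<dots> = s * v * (y * t) + y * (- 1) ^ i"
        using t(2) by (cases "even i") simp_all
      also have "s * v * (y * t) = y * (s * v * t)" by (simp add: y_def algebra_simps)
      finally have "(s * v) ^ Suc i - (- 1) ^ Suc i = y * (s * v * t + (- 1) ^ i)" by (simp add: distrib_left)
      moreover have "s * v * t + (- 1) ^ i \<in> order"
        using is_subringD(2,4)[OF order_subring]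
        by (intro is_subringD(3)[OF order_subring] is_subringD(6)[OF order_subring sv t(1)] is_subring_power[OF order_subring]) auto
      ultimately show ?case by blast
    qed
    then obtain t where t: "\<And>i. t i \<in> order" "\<And>i. (s * v) ^ i - (- 1) ^ i = y * t i" by metis
    define h where "h = (\<lambda>i. e i * s ^ (n - i))"
    have svpow: "(s * v) ^ i = s ^ i * v ^ i" for i
      by (rule power_mult_commuting) (use Bcentral[OF sB vW] in simp)
    have svn: "(s * v) ^ n = (\<Sum>i<n. h i * (s * v) ^ i)"
    proof -
      have "s ^ n * v ^ n = (\<Sum>i<n. s ^ n * (e i * v ^ i))" by (simp add: vn sum_distrib_left)
      also have "\<dots> = (\<Sum>i<n. h i * (s ^ i * v ^ i))"
      proof (rule sum.cong[OF refl])
        fix i assume "i \<in> {..<n}"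
        then have i: "i < n" by simp
        have "s ^ n = s ^ (n - i) * s ^ i" using i by (simp add: power_add[symmetric])
        moreover have "s ^ n * e i = e i * s ^ n" by (rule swap) (use eB[OF i] BW in blast)
        ultimately have "s ^ n * (e i * v ^ i) = e i * (s ^ (n - i) * s ^ i) * v ^ i"
          by (simp add: mult.assoc[symmetric])
        then show "s ^ n * (e i * v ^ i) = h i * (s ^ i * v ^ i)" by (simp add: h_def mult.assoc)
      qed
      finally show ?thesis by (simp only: svpow)
    qed
    define k where "k = (\<Sum>i<n. e i * (b * s ^ (n - i - 1)) * (- 1) ^ i)"
    have hk: "(\<Sum>i<n. h i * (- 1) ^ i) = \<pi> * k"
      unfolding k_def sum_distrib_left
    proof (rule sum.cong[OF refl])
      fix i assume "i \<in> {..<n}"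
      then have i: "i < n" by simp
      then have "n - i = Suc (n - i - 1)" by simp
      then have "s ^ (n - i) = \<pi> * (b * s ^ (n - i - 1))" by (metis power_Suc s_def mult.assoc)
      moreover have "e i * \<pi> = \<pi> * e i" using B_comm[OF eB[OF i] B(3)] .
      ultimately show "h i * (- 1) ^ i = \<pi> * (e i * (b * s ^ (n - i - 1)) * (- 1) ^ i)"
        by (simp add: h_def mult.assoc) (simp add: mult.assoc[symmetric])
    qed
    have m1: "(- 1) ^ i \<in> B" for i
      using is_subringD(2,4)[OF B(1)] by (intro is_subring_power[OF B(1)]) auto
    have kB: "k \<in> B" unfolding k_def
      by (intro is_subring_sum[OF B(1)] is_subringD(6)[OF B(1)] eB b is_subring_power[OF B(1) sB] m1) simp
    define \<epsilon> where "\<epsilon> = (- 1) ^ n - \<pi> * k"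
    define \<rho> where "\<rho> = (\<Sum>i<n. h i * t i) - t n"
    have hB: "h i \<in> B" if "i < n" for i unfolding h_def
      by (rule is_subringD(6)[OF B(1) eB[OF that] is_subring_power[OF B(1) sB]])
    have \<rho>O: "\<rho> \<in> order" unfolding \<rho>_def
      by (intro is_subringD(5)[OF order_subring] is_subring_sum[OF order_subring] is_subringD(6)[OF order_subring] t(1))
        (use hB B_order in blast)
    have yW: "y \<in> W" unfolding y_def using sB BW vW by (intro div_subringD(2,3,6)[OF W]) auto
    have "y * \<rho> = (\<Sum>i<n. h i * (y * t i)) - y * t n"
      unfolding \<rho>_def right_diff_distrib sum_distrib_left
      using Bcentral[OF hB yW] by (simp add: mult.assoc[symmetric])
    also have "\<dots> = (\<Sum>i<n. h i * (s * v) ^ i) - (\<Sum>i<n. h i * (- 1) ^ i) - ((s * v) ^ n - (- 1) ^ n)"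
      unfolding t(2)[symmetric] by (simp add: right_diff_distrib sum_subtractf)
    also have "\<dots> = \<epsilon>" unfolding svn[symmetric] hk \<epsilon>_def by simp
    finally have y\<rho>: "y * \<rho> = \<epsilon>" .
    define \<eta> where "\<eta> = 1 + \<pi> * (- ((- 1) ^ n * k))"
    have "- ((- 1) ^ n * k) \<in> B" by (intro is_subringD(4,6)[OF B(1)] m1 kB)
    from unit_one_plus[OF this] have \<eta>: "\<eta> \<noteq> 0" "inverse \<eta> \<in> B" by (simp_all add: \<eta>_def)
    have \<epsilon>\<eta>: "\<epsilon> * (- 1) ^ n = \<eta>" unfolding \<epsilon>_def \<eta>_def
      by (cases "even n") (simp_all add: algebra_simps)
    have one: "y * (\<rho> * ((- 1) ^ n * inverse \<eta>)) = 1"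
      using y\<rho> \<epsilon>\<eta> \<eta>(1) by (simp add: mult.assoc[symmetric])
    then have "y \<noteq> 0" by auto
    moreover have "inverse y = \<rho> * ((- 1) ^ n * inverse \<eta>)" using one by (rule inverse_unique)
    moreover have "(- 1) ^ n * inverse \<eta> \<in> order" using is_subringD(6)[OF B(1) m1 \<eta>(2)] B_order by blast
    ultimately show ?thesis using is_subringD(6)[OF order_subring \<rho>O] by (simp add: y_def s_def)
  qed
  then have "good v" using vO by (simp add: good_def)
  then show ?thesis using c by (auto simp: v_def)
qed

text \<open>For \<open>v = 1 + t u\<close> one has \<open>cj v l - l = t (u l - l u) v\<inverse>\<close>, which is a multiple of \<open>t\<close> in the lattice
  because \<open>v\<inverse>\<close> preserves it.\<close>

lemma good_in_congruence:
  assumes u: "good u" and a: "a \<in> B - {0}" and b: "b \<in> B"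
  shows "1 + a * \<pi> * b * u \<in> congruence a"
proof -
  define t where "t = a * \<pi> * b"
  define v where "v = 1 + t * u"
  have "t = \<pi> * (a * b)" unfolding t_def using B_comm[of a \<pi>] a B(3) by (simp add: mult.assoc)
  moreover have "a * b \<in> B" using is_subringD(6)[OF B(1) _ b] a by blast
  ultimately have v: "v \<noteq> 0" "inverse v \<in> order" using u by (auto simp: good_def v_def)
  have uO: "u \<in> order" using u by (simp add: good_def)
  have uW: "u \<in> W" using uO by (simp add: order_def)
  have tW: "t \<in> B" unfolding t_def using a b B(3) by (intro is_subringD(6)[OF B(1)]) auto
  have vW: "v \<in> W" unfolding v_def using tW BW uW by (intro div_subringD(2,3,6)[OF W]) auto
  define k where "k = \<pi> * b"
  have kB: "k \<in> B" unfolding k_def by (rule is_subringD(6)[OF B(1) B(3) b])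
  have tk: "t = a * k" by (simp add: t_def k_def mult.assoc)
  have "(\<exists>\<mu>\<in>\<Lambda>. cj v l - l = a * \<mu>) \<and> (\<exists>\<mu>\<in>\<Lambda>. cj (inverse v) l - l = a * \<mu>)" if l: "l \<in> \<Lambda>" for l
  proof
    have lt: "l * t = t * l" using Bcentral[OF tW] l \<Lambda>W by auto
    define d where "d = k * (u * l - l * u)"
    have "u * l \<in> \<Lambda>" "l * u \<in> \<Lambda>" using uO l by (auto simp: order_def)
    then have d: "d \<in> \<Lambda>" unfolding d_def by (intro \<Lambda>_scale[OF kB] \<Lambda>_diff)
    have vl: "v * l - l * v = a * d"
    proof -
      have "v * l - l * v = t * (u * l) - l * t * u" by (simp add: v_def algebra_simps)
      also have "\<dots> = t * (u * l - l * u)" unfolding lt by (simp add: algebra_simps)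
      finally show ?thesis by (simp add: tk d_def mult.assoc)
    qed
    have "cj v l - l = (v * l - l * v) * inverse v"
      using v(1) by (simp add: cj_def left_diff_distrib mult.assoc)
    also have "\<dots> = a * (d * inverse v)" by (simp add: vl mult.assoc)
    finally show "\<exists>\<mu>\<in>\<Lambda>. cj v l - l = a * \<mu>" using d v(2) by (auto simp: order_def)
    have "cj (inverse v) l - l = - (inverse v * (v * l - l * v))"
      using v(1) by (simp add: cj_def right_diff_distrib mult.assoc[symmetric])
    also have "\<dots> = a * - (inverse v * d)"
    proof -
      have "inverse v * a = a * inverse v" using Bcentral[of a "inverse v"] a div_subringD(7)[OF W vW] by auto
      then show ?thesis by (simp add: vl mult.assoc[symmetric])
    qed
    finally have e: "cj (inverse v) l - l = a * - (inverse v * d)" .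
    have "- (inverse v * d) \<in> \<Lambda>" using d v(2) by (intro \<Lambda>_neg) (auto simp: order_def)
    then show "\<exists>\<mu>\<in>\<Lambda>. cj (inverse v) l - l = a * \<mu>" using e by blast
  qed
  then have "v \<in> congruence a" using v(1) vW by (simp add: congruence_def)
  then show ?thesis by (simp add: v_def t_def)
qed

lemma iter_comm_in_group:
  assumes U: "mult_group U" and x: "x \<noteq> 0" and v: "\<And>j. j \<le> n \<Longrightarrow> cj (x ^ j) v \<in> U"
  shows "iter_comm x n v \<in> U"
proof -
  have "cj (x ^ j) (iter_comm x i v) \<in> U" if "i + j \<le> n" for i j
    using that
  proof (induction i arbitrary: j)
    case (Suc i)
    define w where "w = iter_comm x i v"
    have "cj (x ^ j) w \<in> U" "cj (x ^ Suc j) w \<in> U" using Suc.IH[of j] Suc.IH[of "Suc j"] Suc.prems by (simp_all add: w_def)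
    moreover have "cj (x ^ j) (iter_comm x (Suc i) v) = cj (x ^ j) w * inverse (cj (x ^ Suc j) w)"
      using x by (simp add: w_def[symmetric] cj_mult cj_inverse cj_cj power_commutes)
    ultimately show ?case using mult_groupD(4,5)[OF U] by simp
  qed (use v in simp)
  from this[of n 0] show ?thesis by simp
qed

lemma infinite_multiples:
  assumes "a \<in> B - {0}"
  shows "infinite ((\<lambda>b. a * b) ` B)"
proof
  assume fin: "finite ((\<lambda>b. a * b) ` B)"
  have "inj_on (\<lambda>b. a * b) B" using assms by (auto simp: inj_on_def)
  then have "finite B" using fin finite_imageD by blast
  then obtain n where n: "n > 0" "\<pi> ^ n = 1"
    using finite_order[OF _ is_subring_power[OF B(1) B(3)] \<pi>0] by blast
  then have "\<pi> * \<pi> ^ (n - 1) = 1" by (cases n) auto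
  then show False using not_one[OF is_subring_power[OF B(1) B(3)]] by blast
qed

text \<open>Congruence subgroups meet \<open>G\<close> in too much to be contained in \<open>M\<close>: their commutators with \<open>x \<in> G\<close>
  would take finitely many values.\<close>

lemma congruence_not_in_M:
  assumes a: "a \<in> B - {0}" and sub: "G \<inter> congruence a \<subseteq> M" and x: "x \<in> G" "w \<in> W"
  shows "x * w = w * x"
proof -
  obtain n where n: "\<forall>x\<in>G. \<forall>v\<in>W - {0}. iter_comm x n v \<in> G"
    using subnormal_in_iter_comm[OF G W] by blast
  show ?thesis
  proof (rule subnormal_central_if_comm_finite[OF W G _ x, where n = "Suc n"])
    fix x u assume x: "x \<in> G" and u: "u \<in> W"
    have x0: "x \<noteq> 0" by (rule mult_groupD(3)[OF Ggrp x])
    have xW: "x \<in> W" using x GW by blast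
    have uj: "cj (x ^ j) u \<in> W" for j by (rule div_subringD(8)[OF W div_subring_power[OF W xW] u])
    have "\<exists>c\<in>B - {0}. \<forall>j<k. good (c * cj (x ^ j) u)" for k
    proof (induction k)
      case 0
      then show ?case using is_subringD(2)[OF B(1)] by (intro bexI[of _ 1]) auto
    next
      case (Suc k)
      then obtain c where c: "c \<in> B - {0}" "\<forall>j<k. good (c * cj (x ^ j) u)" by blast
      obtain d where d: "d \<in> B - {0}" "good (d * cj (x ^ k) u)" using good_multiple[OF uj] by blast
      have "good (c * d * cj (x ^ k) u)" using good_scale[OF d(2), of c] c(1) by (simp add: mult.assoc)
      moreover have "good (c * d * cj (x ^ j) u)" if "j < k" for j
      proof -
        have "c * d * cj (x ^ j) u = d * (c * cj (x ^ j) u)"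
          using B_comm[of c d] c(1) d(1) by (simp add: mult.assoc[symmetric])
        then show ?thesis using good_scale[of "c * cj (x ^ j) u" d] c(2) d(1) that by simp
      qed
      ultimately show ?case using B_mult_nonzero[OF c(1) d(1)] less_Suc_eq by (intro bexI[of _ "c * d"]) auto
    qed
    then obtain c where c: "c \<in> B - {0}" "\<And>j. j < Suc n \<Longrightarrow> good (c * cj (x ^ j) u)" by blast
    \<comment> \<open>for \<open>t\<close> divisible by \<open>e\<close>, all conjugates of \<open>1 + t u\<close> that occur in the bracket are in \<open>congruence a\<close>\<close>
    define e where "e = a * \<pi> * c"
    have e: "e \<in> B - {0}" unfolding e_def using B(3) \<pi>0 by (intro B_mult_nonzero a c(1)) auto
    define T where "T = (\<lambda>b. e * b) ` B"
    have T: "infinite T" unfolding T_def by (rule infinite_multiples[OF e])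
    have TB: "T \<subseteq> B" unfolding T_def using e is_subringD(6)[OF B(1)] by auto
    have "(\<lambda>t. iter_comm x (Suc n) (1 + t * u)) ` {t \<in> T. 1 + t * u \<noteq> 0} \<subseteq> (\<lambda>r. r * inverse (cj x r)) ` R"
    proof clarify
      fix t assume t: "t \<in> T" "1 + t * u \<noteq> 0"
      obtain b where b: "b \<in> B" "t = e * b" using t(1) by (auto simp: T_def)
      have tB: "t \<in> B" using t(1) TB by blast
      define w where "w = iter_comm x n (1 + t * u)"
      have "1 + t * u \<in> W" using tB BW u by (intro div_subringD(2,3,6)[OF W]) auto
      then have wG: "w \<in> G" unfolding w_def using n x t(2) by blast
      have "w \<in> congruence a" unfolding w_def
      proof (rule iter_comm_in_group[OF congruence_group[OF a] x0])
        fix j assume j: "j \<le> n"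
        have "cj (x ^ j) t = t" using Bcentral[OF tB div_subring_power[OF W xW, of j]] x0 by (simp add: cj_eq_iff)
        then have "cj (x ^ j) (1 + t * u) = 1 + t * cj (x ^ j) u" using x0 by (simp add: cj_add cj_mult)
        also have "t * cj (x ^ j) u = a * \<pi> * b * c * cj (x ^ j) u"
          using B_comm[of b c] b c(1) by (simp add: b(2) e_def mult.assoc)
        finally have "cj (x ^ j) (1 + t * u) = 1 + a * \<pi> * b * (c * cj (x ^ j) u)" by (simp add: mult.assoc)
        then show "cj (x ^ j) (1 + t * u) \<in> congruence a"
          using good_in_congruence[OF c(2) a b(1), of j] j by simp
      qed
      then have wM: "w \<in> M" using sub wG by blast
      obtain r z where rz: "r \<in> R" "z \<in> Z" "w = r * z" using R(3)[OF wM] by blast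
      have z0: "z \<noteq> 0" using rz(3) mult_groupD(3)[OF M(1) wM] by auto
      have "cj x z = z" using central[OF rz(2) xW] x0 by (simp add: cj_eq_iff)
      then have "w * inverse (cj x w) = r * (z * inverse z) * inverse (cj x r)"
        using rz x0 by (simp add: cj_mult inverse_mult_rev mult.assoc)
      then have "w * inverse (cj x w) = r * inverse (cj x r)" using z0 by simp
      then show "iter_comm x (Suc n) (1 + t * u) \<in> (\<lambda>r. r * inverse (cj x r)) ` R"
        using rz(1) by (auto simp: w_def)
    qed
    then have "finite ((\<lambda>t. iter_comm x (Suc n) (1 + t * u)) ` {t \<in> T. 1 + t * u \<noteq> 0})"
      by (rule finite_subset) (intro finite_imageI R(1))
    moreover have "\<forall>t\<in>T. \<forall>a\<in>W. t * a = a * t" using TB Bcentral by blast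
    ultimately show "\<exists>T. infinite T \<and> T \<subseteq> W \<and> (\<forall>t\<in>T. \<forall>a\<in>W. t * a = a * t) \<and>
      finite ((\<lambda>t. iter_comm x (Suc n) (1 + t * u)) ` {t \<in> T. 1 + t * u \<noteq> 0})"
      using T TB BW by (intro exI[of _ T] conjI) auto
  qed
qed

text \<open>Maximality forces \<open>G\<close> to preserve the lattice and to equal \<open>M\<close> times each congruence subgroup.
  As \<open>M\<close> is finite modulo the center, some coset of \<open>M\<close> approximates a given \<open>g \<in> G\<close> arbitrarily
  well, which puts \<open>g\<close> into \<open>M\<close>.\<close>

lemma central_G:
  assumes x: "x \<in> G" "w \<in> W"
  shows "x * w = w * x"
proof (rule ccontr)
  assume nc: "x * w \<noteq> w * x"
  have notM: "\<not> G \<inter> congruence a \<subseteq> M" if "a \<in> B - {0}" for a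
    using congruence_not_in_M[OF that _ x] nc by blast
  have B1: "1 \<in> B - {0}" using is_subringD(2)[OF B(1)] by simp
  have prod_group: "mult_group ((\<lambda>(m, u). m * u) ` (M \<times> U))" "M \<subseteq> (\<lambda>(m, u). m * u) ` (M \<times> U)"
    "U \<subseteq> (\<lambda>(m, u). m * u) ` (M \<times> U)"
    if U: "mult_group U" and norm: "\<And>m u. m \<in> M \<Longrightarrow> u \<in> U \<Longrightarrow> cj m u \<in> U" for U
  proof -
    have mem: "m * u \<in> (\<lambda>(m, u). m * u) ` (M \<times> U)" if "m \<in> M" "u \<in> U" for m u using that by auto
    show "M \<subseteq> (\<lambda>(m, u). m * u) ` (M \<times> U)" using mem[OF _ mult_groupD(1)[OF U]] by auto
    show "U \<subseteq> (\<lambda>(m, u). m * u) ` (M \<times> U)" using mem[OF mult_groupD(1)[OF M(1)]] by auto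
    show "mult_group ((\<lambda>(m, u). m * u) ` (M \<times> U))"
      unfolding mult_group_def
    proof (intro conjI ballI)
      show "1 \<in> (\<lambda>(m, u). m * u) ` (M \<times> U)" using mem[OF mult_groupD(1)[OF M(1)] mult_groupD(1)[OF U]] by simp
      show "0 \<notin> (\<lambda>(m, u). m * u) ` (M \<times> U)" using mult_groupD(3)[OF M(1)] mult_groupD(3)[OF U] by fastforce
      fix g assume "g \<in> (\<lambda>(m, u). m * u) ` (M \<times> U)"
      then obtain m u where g: "m \<in> M" "u \<in> U" "g = m * u" by auto
      have m0: "m \<noteq> 0" by (rule mult_groupD(3)[OF M(1) g(1)])
      have "inverse g = inverse m * cj m (inverse u)"
        using m0 by (simp add: g(3) inverse_mult_rev cj_def mult.assoc[symmetric])
      then show "inverse g \<in> (\<lambda>(m, u). m * u) ` (M \<times> U)"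
        using mem[OF mult_groupD(5)[OF M(1) g(1)] norm[OF g(1) mult_groupD(5)[OF U g(2)]]] by simp
      fix h assume "h \<in> (\<lambda>(m, u). m * u) ` (M \<times> U)"
      then obtain m' u' where h: "m' \<in> M" "u' \<in> U" "h = m' * u'" by auto
      have m'0: "m' \<noteq> 0" by (rule mult_groupD(3)[OF M(1) h(1)])
      have "g * h = m * m' * (cj (inverse m') u * u')"
        using m'0 by (simp add: g(3) h(3) cj_def mult.assoc) (simp add: mult.assoc[symmetric])
      then show "g * h \<in> (\<lambda>(m, u). m * u) ` (M \<times> U)"
        using mem[OF mult_groupD(4)[OF M(1) g(1) h(1)]
            mult_groupD(4)[OF U norm[OF mult_groupD(5)[OF M(1) h(1)] g(2)] h(2)]] by simp
    qed
  qed
  have prod_cases: "U \<subseteq> M \<or> G = (\<lambda>(m, u). m * u) ` (M \<times> U)"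
    if U: "mult_group U" "U \<subseteq> G" and norm: "\<And>m u. m \<in> M \<Longrightarrow> u \<in> U \<Longrightarrow> cj m u \<in> U" for U
  proof -
    have "(\<lambda>(m, u). m * u) ` (M \<times> U) \<subseteq> G" using U(2) M(2) mult_groupD(4)[OF Ggrp] by auto
    moreover have "mult_group ((\<lambda>(m, u). m * u) ` (M \<times> U))"
      by (rule prod_group(1)[OF U(1)]) (rule norm)
    moreover have "M \<subseteq> (\<lambda>(m, u). m * u) ` (M \<times> U)"
      by (rule prod_group(2)[OF U(1)]) (rule norm)
    moreover have "U \<subseteq> (\<lambda>(m, u). m * u) ` (M \<times> U)"
      by (rule prod_group(3)[OF U(1)]) (rule norm)
    ultimately show ?thesis using maximal[of "(\<lambda>(m, u). m * u) ` (M \<times> U)"] by metis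
  qed
  \<comment> \<open>the central elements of \<open>G\<close> lie in \<open>M\<close>\<close>
  have ZG: "Z \<inter> G \<subseteq> M"
  proof (rule ccontr)
    assume neg: "\<not> Z \<inter> G \<subseteq> M"
    have "mult_group (G \<inter> Z)" by (rule mult_group_Int[OF Ggrp Zd])
    moreover have "cj m u \<in> G \<inter> Z" if "m \<in> M" "u \<in> G \<inter> Z" for m u
    proof -
      have "cj m u = u" using central[of u m] that MW mult_groupD(3)[OF M(1)] by (auto simp: cj_eq_iff)
      then show ?thesis using that by simp
    qed
    ultimately have GM: "G = (\<lambda>(m, u). m * u) ` (M \<times> (G \<inter> Z))" using prod_cases[of "G \<inter> Z"] neg by blast
    have "\<exists>r\<in>R. \<exists>z. g = r * z \<and> z \<in> centralizer W" if g: "g \<in> G" for g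
    proof -
      have "g \<in> (\<lambda>(m, u). m * u) ` (M \<times> (G \<inter> Z))" using g GM by blast
      then obtain m u where mu: "m \<in> M" "u \<in> Z" "g = m * u" by auto
      obtain r z where rz: "r \<in> R" "z \<in> Z" "m = r * z" using R(3)[OF mu(1)] by blast
      have "g = r * (z * u)" by (simp add: mu(3) rz(3) mult.assoc)
      moreover have "z * u \<in> centralizer W" using div_subringD(6)[OF Zd rz(2) mu(2)] by (simp add: Z_def)
      ultimately show ?thesis using rz(1) by blast
    qed
    then have "x * w = w * x"
      by (intro subnormal_central_if_finite_mod_center[OF W G infZ ZW _ R(1) _ x]) (use central in auto)
    then show False using nc by contradiction
  qed
  have GU: "mult_group (G \<inter> congruence a)" if "a \<in> B - {0}" for a
    using Ggrp congruence_group[OF that] by (auto simp: mult_group_def)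
  have G1: "G \<subseteq> congruence 1"
  proof -
    have "M \<subseteq> G \<inter> congruence 1" using M(2) M_congruence by blast
    from maximal[OF GU[OF B1] this] have "G \<inter> congruence 1 = G" using notM[OF B1] by auto
    then show ?thesis by blast
  qed
  have GMU: "G = (\<lambda>(m, u). m * u) ` (M \<times> (G \<inter> congruence a))" if a: "a \<in> B - {0}" for a
  proof -
    have "cj m u \<in> G \<inter> congruence a" if "m \<in> M" "u \<in> G \<inter> congruence a" for m u
      using that congruence_normal[OF a] M_congruence mult_groupD(6)[OF Ggrp] M(2) by blast
    then show ?thesis using prod_cases[OF GU[OF a]] notM[OF a] by blast
  qed
  obtain g where g: "g \<in> G" "g \<notin> M" using M(2,3) by blast
  have approx: "\<exists>r\<in>R. inverse r * g \<in> congruence a" if a: "a \<in> B - {0}" for a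
  proof -
    have "g \<in> (\<lambda>(m, u). m * u) ` (M \<times> (G \<inter> congruence a))" using g(1) GMU[OF a] by blast
    then obtain m u where mu: "m \<in> M" "u \<in> congruence a" "g = m * u" by auto
    obtain r z where rz: "r \<in> R" "z \<in> Z" "m = r * z" using R(3)[OF mu(1)] by blast
    have z: "z \<in> W" "z \<noteq> 0" using rz ZW mult_groupD(3)[OF M(1) mu(1)] by auto
    have zl: "cj z l = l" "cj (inverse z) l = l" if "l \<in> \<Lambda>" for l
    proof -
      have "z * l = l * z" using central[OF rz(2)] that \<Lambda>W by blast
      then show "cj z l = l" "cj (inverse z) l = l"
        using z(2) inverse_commute[of z l] by (simp_all add: cj_eq_iff)
    qed
    have "z \<in> congruence a" using z zl \<Lambda>_0 by (auto simp: congruence_def intro!: bexI[of _ 0])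
    then have "z * u \<in> congruence a" using mult_groupD(4)[OF congruence_group[OF a]] mu(2) by blast
    moreover have "inverse r * g = z * u" using R_nonzero[OF rz(1)] by (simp add: mu(3) rz(3) mult.assoc[symmetric])
    ultimately have "inverse r * g \<in> congruence a" by (simp only:)
    then show ?thesis using rz(1) by blast
  qed
  have "\<exists>r\<in>R. \<forall>a\<in>B - {0}. inverse r * g \<in> congruence a"
  proof (rule ccontr)
    assume neg: "\<not> ?thesis"
    have "\<exists>a\<in>B - {0}. \<forall>r\<in>S. inverse r * g \<notin> congruence a" if "finite S" "S \<subseteq> R" for S
      using that
    proof (induction S rule: finite_induct)
      case empty
      then show ?case using B1 by blast
    next
      case (insert r S)
      then obtain a where a: "a \<in> B - {0}" "\<forall>r\<in>S. inverse r * g \<notin> congruence a" by blast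
      obtain b where b: "b \<in> B - {0}" "inverse r * g \<notin> congruence b" using neg insert.prems by blast
      have sub: "congruence (c * d) \<subseteq> congruence c" if "d \<in> B" for c d
      proof
        fix h assume h: "h \<in> congruence (c * d)"
        have "\<exists>\<mu>\<in>\<Lambda>. y = c * \<mu>" if "\<exists>\<mu>\<in>\<Lambda>. y = c * d * \<mu>" for y
          using that \<Lambda>_scale[OF \<open>d \<in> B\<close>] by (auto simp: mult.assoc)
        then show "h \<in> congruence c" using h by (simp add: congruence_def)
      qed
      have "congruence (a * b) \<subseteq> congruence a" using sub[of b a] b(1) by blast
      moreover have "congruence (a * b) \<subseteq> congruence b"
        using sub[of a b] a(1) B_comm[of a b] b(1) by auto
      ultimately have "\<forall>r\<in>insert r S. inverse r * g \<notin> congruence (a * b)" using a(2) b(2) by blast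
      then show ?case using B_mult_nonzero[OF a(1) b(1)] by blast
    qed
    from this[OF R(1) order.refl] show False using approx by blast
  qed
  then obtain r where r: "r \<in> R" "\<And>a. a \<in> B - {0} \<Longrightarrow> inverse r * g \<in> congruence a" by blast
  define h where "h = inverse r * g"
  have rG: "r \<in> G" using r(1) R(2) M(2) by blast
  have hG: "h \<in> G" unfolding h_def by (rule mult_groupD(4)[OF Ggrp mult_groupD(5)[OF Ggrp rG] g(1)])
  have h0: "h \<noteq> 0" by (rule mult_groupD(3)[OF Ggrp hG])
  have hl: "h * l = l * h" if l: "l \<in> \<Lambda>" for l
  proof -
    have "cj h l - l = 0"
    proof (rule divisible_is_zero)
      fix a assume "a \<in> B - {0}"
      then show "\<exists>\<mu>\<in>\<Lambda>. cj h l - l = a * \<mu>" using r(2) l by (auto simp: congruence_def h_def)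
    qed
    then show ?thesis using h0 by (simp add: cj_eq_iff)
  qed
  have "h * w = w * h" if w: "w \<in> W" for w
  proof -
    obtain a where a: "a \<in> B - {0}" "a * w \<in> \<Lambda>" using multiple_in_\<Lambda>[OF w] by blast
    have "h * a = a * h" using Bcentral[of a h] a(1) hG GW by auto
    then have "a * (h * w) = h * (a * w)" by (simp add: mult.assoc[symmetric])
    also have "\<dots> = a * (w * h)" using hl[OF a(2)] by (simp add: mult.assoc)
    finally show ?thesis using a(1) by simp
  qed
  then have "h \<in> Z" using hG GW by (auto simp: Z_def centralizer_def)
  then have "h \<in> M" using ZG hG by blast
  then have "r * h \<in> M" using r(1) R(2) mult_groupD(4)[OF M(1)] by blast
  moreover have "r * h = g" using R_nonzero[OF r(1)] by (simp add: h_def mult.assoc[symmetric])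
  ultimately show False using g(2) by simp
qed

end

theorem (in central_by_finite_maximal) maximal_commutative:
  assumes "x \<in> M" "y \<in> M"
  shows "x * y = y * x"
proof (cases "\<exists>\<pi> A. \<pi> \<noteq> 0 \<and> is_subring A \<and> A \<subseteq> Z \<and> \<pi> \<in> A \<and> inverse \<pi> \<notin> A")
  case True
  then obtain \<pi> A where A: "\<pi> \<noteq> 0" "is_subring A" "A \<subseteq> Z" "\<pi> \<in> A" "inverse \<pi> \<notin> A" by blast
  obtain B where "valuation_subring Z B \<pi>"
    by (rule valuation_subring_exists[OF Zd Zc A])
  then interpret valuation_subring Z B \<pi> .
  interpret lattice W Z G M R B \<pi> ..
  show ?thesis using central_G assms M(2) MW by blast
next
  case False
  then show ?thesis using commutative_if_no_nonunit[OF _ assms] by blast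
qed

section \<open>The division subring generated by a finite class is a field\<close>

lemma centralizer_normalized:
  assumes m: "m \<noteq> 0" and norm: "\<And>z. z \<in> P \<Longrightarrow> cj (inverse m) z \<in> P" and c: "c \<in> centralizer P"
  shows "cj m c \<in> centralizer P"
  unfolding centralizer_def
proof (intro CollectI ballI)
  fix z assume z: "z \<in> P"
  define y where "y = cj (inverse m) z"
  have zy: "z = cj m y" using m by (simp add: y_def)
  have "c * y = y * c" by (rule centralizerD[OF c]) (simp add: y_def norm z)
  then show "cj m c * z = z * cj m c" unfolding zy cj_mult[OF m, symmetric] by (rule arg_cong)
qed

lemma cj_eq_on_iff:
  assumes "m \<noteq> 0" "n \<noteq> 0"
  shows "cj m z = cj n z \<longleftrightarrow> inverse n * m * z = z * (inverse n * m)"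
proof -
  have "cj m z = cj n z \<longleftrightarrow> cj (inverse n) (cj m z) = cj (inverse n) (cj n z)"
    using cj_inj[of "inverse n" "cj m z" "cj n z"] assms(2) by (simp del: cj_inv_cancel)
  also have "\<dots> \<longleftrightarrow> cj (inverse n * m) z = z" by (simp only: cj_cj[symmetric] cj_inv_cancel(1)[OF assms(2)])
  also have "\<dots> \<longleftrightarrow> inverse n * m * z = z * (inverse n * m)" using assms by (simp add: cj_eq_iff)
  finally show ?thesis .
qed

lemma cj_eq_on_div_gen:
  assumes mn: "m \<noteq> 0" "n \<noteq> 0" and S: "\<And>s. s \<in> S \<Longrightarrow> cj m s = cj n s" and z: "z \<in> div_gen S"
  shows "cj m z = cj n z"
proof -
  have "S \<subseteq> centralizer {inverse n * m}" using S cj_eq_on_iff[OF mn] by (auto simp: centralizer_def)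
  then have "div_gen S \<subseteq> centralizer {inverse n * m}" by (rule div_gen_least[OF div_subring_centralizer])
  then have "z \<in> centralizer {inverse n * m}" using z by blast
  then show ?thesis using cj_eq_on_iff[OF mn] by (simp add: centralizer_def)
qed

lemma finite_image_factor:
  assumes "finite (\<sigma> ` A)" and eq: "\<And>a b. a \<in> A \<Longrightarrow> b \<in> A \<Longrightarrow> \<sigma> a = \<sigma> b \<Longrightarrow> \<rho> a = \<rho> b"
  shows "finite (\<rho> ` A)"
proof (rule finite_subset)
  show "\<rho> ` A \<subseteq> (\<lambda>q. \<rho> (inv_into A \<sigma> q)) ` (\<sigma> ` A)"
  proof clarify
    fix a assume a: "a \<in> A"
    have "inv_into A \<sigma> (\<sigma> a) \<in> A" by (rule inv_into_into) (use a in blast)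
    moreover have "\<sigma> (inv_into A \<sigma> (\<sigma> a)) = \<sigma> a" by (rule f_inv_into_f) (use a in blast)
    ultimately have "\<rho> a = \<rho> (inv_into A \<sigma> (\<sigma> a))" by (intro eq[OF a]) simp_all
    then show "\<rho> a \<in> (\<lambda>q. \<rho> (inv_into A \<sigma> q)) ` (\<sigma> ` A)" using a by blast
  qed
qed (use assms(1) in blast)

lemma central_cj: "f \<in> D_center \<Longrightarrow> m \<noteq> 0 \<Longrightarrow> cj m f = f"
  using centralizerD[of f UNIV m] by (simp add: cj_eq_iff)

lemma D_centerD: "f \<in> D_center \<Longrightarrow> f * x = x * f"
  using centralizerD[of f UNIV x] by simp

lemma cj_trivial_on:
  assumes m: "m \<noteq> 0" and r: "r \<noteq> 0" and eq: "\<And>z. z \<in> P \<Longrightarrow> cj m z = cj r z"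
  shows "inverse r * m \<in> centralizer P"
  using eq cj_eq_on_iff[OF m r] by (simp add: centralizer_def)

text \<open>A group normalizing \<open>K\<close> and contained in a finite-dimensional \<open>K\<close>-space spans a ring: this is the
  multiplication rule of a crossed product.\<close>

lemma div_subring_lin_span_group:
  fixes K M R :: "'a::division_ring set"
  assumes K: "div_subring K" and M: "mult_group M" and R: "finite R" "R \<subseteq> M" "M \<subseteq> lin_span K R"
    and norm: "\<And>r z. r \<in> R \<Longrightarrow> z \<in> K \<Longrightarrow> cj r z \<in> K"
  shows "div_subring (lin_span K R)"
proof (rule div_subring_lin_span[OF K R(1)])
  show "1 \<in> lin_span K R" using mult_groupD(1)[OF M] R(3) by blast
  fix x y assume "x \<in> lin_span K R" "y \<in> lin_span K R"
  then obtain c d where c: "x = (\<Sum>s\<in>R. c s * s)" "\<forall>s\<in>R. c s \<in> K" and d: "y = (\<Sum>s\<in>R. d s * s)" "\<forall>s\<in>R. d s \<in> K"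
    unfolding lin_span_def by blast
  have "x * y = (\<Sum>s\<in>R. \<Sum>t\<in>R. c s * s * (d t * t))" unfolding c(1) d(1) by (rule sum_product)
  also have "\<dots> \<in> lin_span K R"
  proof (intro lin_span_sum[OF K])
    fix s t assume st: "s \<in> R" "t \<in> R"
    have s0: "s \<noteq> 0" using st(1) R(2) mult_groupD(3)[OF M] by blast
    have "s * d t = cj s (d t) * s" using s0 by (simp add: cj_left)
    then have "c s * s * (d t * t) = (c s * cj s (d t)) * (s * t)" by (simp add: mult.assoc) (simp add: mult.assoc[symmetric])
    moreover have "s * t \<in> lin_span K R" using st R(2,3) mult_groupD(4)[OF M] by blast
    moreover have "c s * cj s (d t) \<in> K" using div_subringD(6)[OF K] c(2) d(2) st norm by blast
    ultimately show "c s * s * (d t * t) \<in> lin_span K R" using lin_span_closed(3)[OF K] by simp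
  qed
  finally show "x * y \<in> lin_span K R" .
qed

locale maximal_subnormal =
  fixes G M :: "'a::division_ring set"
  assumes G: "subnormal_in UNIV G" and M: "mult_group M" "M \<subseteq> G" "M \<noteq> G"
    and maximal: "\<And>N. mult_group N \<Longrightarrow> M \<subseteq> N \<Longrightarrow> N \<subseteq> G \<Longrightarrow> N = M \<or> N = G"
begin

lemma Ggrp: "mult_group G" by (rule subnormal_in_group[OF G div_subring_UNIV])

lemma M_nonzero: "m \<in> M \<Longrightarrow> m \<noteq> 0" by (rule mult_groupD(3)[OF M(1)])

lemma G_nonzero: "g \<in> G \<Longrightarrow> g \<noteq> 0" by (rule mult_groupD(3)[OF Ggrp])

text \<open>The normalizer of \<open>P\<close> in \<open>G\<close> is a group that contains \<open>M\<close>. Stability under both \<open>g\<close> and \<open>g\<inverse>\<close> has to be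
  required, as \<open>P\<close> may be infinite.\<close>

lemma normalizer_cases:
  assumes norm: "\<And>m z. m \<in> M \<Longrightarrow> z \<in> P \<Longrightarrow> cj m z \<in> P"
  shows "(\<forall>g\<in>G. \<forall>z\<in>P. cj g z \<in> P) \<or>
    (\<forall>g\<in>G. (\<forall>z\<in>P. cj g z \<in> P \<and> cj (inverse g) z \<in> P) \<longrightarrow> g \<in> M)"
proof -
  define N where "N = {g \<in> G. \<forall>z\<in>P. cj g z \<in> P \<and> cj (inverse g) z \<in> P}"
  have "mult_group N" unfolding mult_group_def
  proof (intro conjI ballI)
    show "1 \<in> N" using mult_groupD(1)[OF Ggrp] by (simp add: N_def)
    show "0 \<notin> N" using mult_groupD(2)[OF Ggrp] by (simp add: N_def)
    fix g assume g: "g \<in> N"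
    then show "inverse g \<in> N" using mult_groupD(5)[OF Ggrp] by (simp add: N_def)
    fix h assume h: "h \<in> N"
    show "g * h \<in> N" using g h mult_groupD(4)[OF Ggrp] by (simp add: N_def inverse_mult_rev cj_cj[symmetric])
  qed
  moreover have "M \<subseteq> N" using M(2) norm mult_groupD(5)[OF M(1)] by (auto simp: N_def)
  moreover have "N \<subseteq> G" by (auto simp: N_def)
  ultimately have "N = M \<or> N = G" by (rule maximal)
  then show ?thesis by (auto simp: N_def)
qed

end

locale maximal_with_finite_class = maximal_subnormal G M for G M :: "'a::division_ring set" +
  fixes C :: "'a set"
  assumes C: "finite C" "C \<subseteq> M" "\<And>m s. m \<in> M \<Longrightarrow> s \<in> C \<Longrightarrow> cj m s \<in> C"
    and noncentral: "\<exists>s\<in>C. \<exists>m\<in>M. s * m \<noteq> m * s"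
begin

definition K :: "'a set" where "K = div_gen (D_center \<union> C)"

definition H :: "'a set" where "H = centralizer K"

lemma Kd [simp]: "div_subring K" by (simp add: K_def)

lemma Hd [simp]: "div_subring H" by (simp add: H_def)

lemma CK: "C \<subseteq> K" and FK: "D_center \<subseteq> K"
  using div_gen_superset[of "D_center \<union> C"] by (auto simp: K_def)

lemma FH: "D_center \<subseteq> H"
  using centralizer_antimono[of K UNIV] by (simp add: H_def)

lemma K_normalized: assumes m: "m \<in> M" and z: "z \<in> K" shows "cj m z \<in> K"
  unfolding K_def
proof (rule div_gen_normalized[OF M_nonzero[OF m]])
  show "z \<in> div_gen (D_center \<union> C)" using z by (simp add: K_def)
  fix s assume "s \<in> D_center \<union> C"
  then have "cj m s \<in> D_center \<union> C" using central_cj[OF _ M_nonzero[OF m]] C(3)[OF m] by auto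
  then show "cj m s \<in> div_gen (D_center \<union> C)" using div_gen_superset by blast
qed

lemma finite_action: "finite_action M K"
  unfolding finite_action_def
proof (rule finite_image_factor)
  have "(\<lambda>m. restrict (cj m) C) ` M \<subseteq> (C \<rightarrow>\<^sub>E C)" using C(3) by auto
  then show "finite ((\<lambda>m. restrict (cj m) C) ` M)"
    by (rule finite_subset) (intro finite_PiE C(1))
  fix m n assume mn: "m \<in> M" "n \<in> M" and eq: "restrict (cj m) C = restrict (cj n) C"
  have "cj m s = cj n s" if s: "s \<in> D_center \<union> C" for s
  proof (cases "s \<in> C")
    case True
    then show ?thesis using fun_cong[OF eq, of s] by simp
  next
    case False
    then have "s \<in> D_center" using s by blast
    then show ?thesis using central_cj[OF _ M_nonzero[OF mn(1)]] central_cj[OF _ M_nonzero[OF mn(2)]] by simp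
  qed
  then have "cj m z = cj n z" if "z \<in> K" for z
    using cj_eq_on_div_gen[OF M_nonzero[OF mn(1)] M_nonzero[OF mn(2)]] that unfolding K_def by blast
  then show "restrict (cj m) K = restrict (cj n) K" by (intro restrict_ext)
qed

text \<open>Two elements of \<open>K\<close> act on \<open>K\<close> in the same way if and only if they differ by a central factor.\<close>

lemma finite_mod_center:
  assumes A: "A \<subseteq> M" "A \<subseteq> K"
  obtains R where "finite R" "R \<subseteq> A" "\<And>a. a \<in> A \<Longrightarrow> \<exists>r\<in>R. \<exists>z\<in>K \<inter> centralizer K. a = r * z"
proof -
  have "finite_action A K" using finite_action A(1) unfolding finite_action_def by (meson finite_subset image_mono)
  then obtain k :: nat and r where r: "\<And>i. i < k \<Longrightarrow> r i \<in> A"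
    and cover: "\<And>a. a \<in> A \<Longrightarrow> \<exists>i<k. \<forall>z\<in>K. cj a z = cj (r i) z"
    by (rule finite_action_representatives) (rule that)
  show ?thesis
  proof (rule that[of "r ` {..<k}"])
    show "r ` {..<k} \<subseteq> A" using r by blast
    fix a assume a: "a \<in> A"
    obtain i where i: "i < k" "\<forall>z\<in>K. cj a z = cj (r i) z" using cover[OF a] by blast
    have nz: "a \<noteq> 0" "r i \<noteq> 0" using a r[OF i(1)] A(1) M_nonzero by blast+
    have "inverse (r i) * a \<in> centralizer K" by (rule cj_trivial_on[OF nz]) (use i(2) in blast)
    moreover have "inverse (r i) * a \<in> K"
      using a r[OF i(1)] A(2) by (intro div_subringD(6,7)[OF Kd]) auto
    moreover have "a = r i * (inverse (r i) * a)" using nz(2) by (simp add: mult.assoc[symmetric])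
    ultimately show "\<exists>r\<in>r ` {..<k}. \<exists>z\<in>K \<inter> centralizer K. a = r * z" using i(1) by blast
  qed simp
qed

lemma commutative_if_C_commutes:
  assumes "\<And>x y. x \<in> C \<Longrightarrow> y \<in> C \<Longrightarrow> x * y = y * x"
  shows "K \<subseteq> centralizer K"
  unfolding K_def
proof (rule div_gen_commutative)
  have "x * y = y * x" if "x \<in> D_center \<union> C" "y \<in> D_center \<union> C" for x y
    using that assms D_centerD[of x y] D_centerD[of y x] by auto
  then show "D_center \<union> C \<subseteq> centralizer (D_center \<union> C)" by (auto simp: centralizer_def)
qed

text \<open>With a finite center, \<open>M \<inter> K\<close> is a finite group in positive characteristic.\<close>

lemma commutative_if_finite_center:
  assumes fin: "finite (K \<inter> centralizer K)"
  shows "K \<subseteq> centralizer K"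
proof (rule commutative_if_C_commutes)
  have "div_subring (K \<inter> centralizer K)" by (rule div_subring_Int) simp_all
  then obtain p where p: "Factorial_Ring.prime p" "of_nat p = (0::'a)"
    using finite_div_subring_char fin by metis
  obtain R where R: "finite R" "R \<subseteq> M \<inter> K" "\<And>a. a \<in> M \<inter> K \<Longrightarrow> \<exists>r\<in>R. \<exists>z\<in>K \<inter> centralizer K. a = r * z"
    by (rule finite_mod_center[of "M \<inter> K"]) (auto intro: that)
  have "M \<inter> K \<subseteq> (\<lambda>(r, z). r * z) ` (R \<times> (K \<inter> centralizer K))"
  proof
    fix a assume "a \<in> M \<inter> K"
    then obtain r z where "r \<in> R" "z \<in> K \<inter> centralizer K" "a = r * z" using R(3) by blast
    then show "a \<in> (\<lambda>(r, z). r * z) ` (R \<times> (K \<inter> centralizer K))" by (intro image_eqI[of _ _ "(r, z)"]) auto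
  qed
  then have finQ: "finite (M \<inter> K)" by (rule finite_subset) (use R(1) fin in simp)
  fix x y assume "x \<in> C" "y \<in> C"
  then have "x \<in> M \<inter> K" "y \<in> M \<inter> K" using C(2) CK by auto
  then show "x * y = y * x"
  proof (intro finite_multiplicative_commute[OF p finQ])
    show "0 \<notin> M \<inter> K" using mult_groupD(2)[OF M(1)] by blast
    show "x * y \<in> M \<inter> K" if "x \<in> M \<inter> K" "y \<in> M \<inter> K" for x y
      using that mult_groupD(4)[OF M(1)] div_subringD(6)[OF Kd] by blast
  qed
qed

text \<open>If \<open>G\<close> normalized \<open>K\<close>, it would centralize the center \<open>Z\<close> of \<open>K\<close>. For infinite \<open>Z\<close> the normal
  subgroup \<open>K \<inter> G\<close> of \<open>G\<close> generates \<open>C_D(Z)\<close>, so that \<open>G\<close> lies in \<open>K\<close> and \<open>M\<close> is finite modulo \<open>Z\<close>.\<close>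

lemma not_normalized: "\<not> (\<forall>g\<in>G. \<forall>z\<in>K. cj g z \<in> K)"
proof
  assume "\<forall>g\<in>G. \<forall>z\<in>K. cj g z \<in> K"
  then have norm: "cj g z \<in> K" if "g \<in> G" "z \<in> K" for g z using that by blast
  define Z where "Z = K \<inter> centralizer K"
  have Zd: "div_subring Z" unfolding Z_def by (rule div_subring_Int) simp_all
  have ZK: "Z \<subseteq> K" by (simp add: Z_def)
  have Zcomm: "z * w = w * z" if "z \<in> Z" "w \<in> K" for z w
    using that centralizerD[of z K w] by (simp add: Z_def)
  have Zc: "Z \<subseteq> centralizer Z" using Zcomm ZK by (auto simp: centralizer_def)
  have normZ: "cj g z \<in> Z" if g: "g \<in> G" and z: "z \<in> Z" for g z
  proof -
    have "cj g z \<in> centralizer K"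
      by (rule centralizer_normalized[OF G_nonzero[OF g] norm[OF mult_groupD(5)[OF Ggrp g]]])
        (use z in \<open>simp_all add: Z_def\<close>)
    then show ?thesis using norm[OF g] z by (simp add: Z_def)
  qed
  have GZ: "g * z = z * g" if "g \<in> G" "z \<in> Z" for g z
    by (rule normalized_field_centralized[OF div_subring_UNIV G Zd subset_UNIV Zc normZ that])
  obtain s m where sm: "s \<in> C" "m \<in> M" "s * m \<noteq> m * s" using noncentral by blast
  show False
  proof (cases "finite Z")
    case True
    then have KK: "K \<subseteq> centralizer K" using commutative_if_finite_center by (simp add: Z_def)
    have "m * s = s * m"
      by (rule normalized_field_centralized[OF div_subring_UNIV G Kd subset_UNIV KK norm])
        (use sm CK M(2) in auto)
    then show False using sm(3) by simp
  next
    case infZ: False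
    define V where "V = centralizer Z"
    have Vd: "div_subring V" by (simp add: V_def)
    have KV: "K \<subseteq> V" using Zcomm by (auto simp: V_def centralizer_def)
    have GV: "G \<subseteq> V" using GZ by (auto simp: V_def centralizer_def)
    have ZV: "z * v = v * z" if "z \<in> Z" "v \<in> V" for z v
      using centralizerD[of v Z z] that by (simp add: V_def)
    have "G \<inter> V = G" using GV by blast
    then have GsubV: "subnormal_in V G"
      using subnormal_in_Int[OF G div_subring_UNIV Vd subset_UNIV] by simp
    have "subnormal_in V (G \<inter> K)"
    proof (rule subnormal_in.step[OF GsubV])
      show "mult_group (G \<inter> K)" by (rule mult_group_Int[OF Ggrp Kd])
      show "cj b a \<in> G \<inter> K" if "b \<in> G" "a \<in> G \<inter> K" for b a
        using that norm mult_groupD(6)[OF Ggrp] by blast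
    qed simp
    then have "K = V"
    proof (rule subnormal_generates[OF Vd _ Kd KV _ infZ ZK ZV])
      show "s \<in> G \<inter> K" using sm(1) C(2) M(2) CK by blast
      show "m \<in> V" using sm(2) M(2) GV by blast
    qed (use sm(3) in auto)
    then have GK: "G \<subseteq> K" and GsubK: "subnormal_in K G" using GV GsubV by auto
    obtain R where R: "finite R" "R \<subseteq> M" "\<And>a. a \<in> M \<Longrightarrow> \<exists>r\<in>R. \<exists>z\<in>K \<inter> centralizer K. a = r * z"
      by (rule finite_mod_center[of M]) (use M(2) GK in \<open>auto intro: that\<close>)
    have MK: "M \<subseteq> K" using M(2) GK by blast
    have Mspan: "M \<subseteq> lin_span Z R"
    proof
      fix a assume "a \<in> M"
      then obtain r z where rz: "r \<in> R" "z \<in> Z" "a = r * z" using R(3) unfolding Z_def by blast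
      have "a = z * r" using rz Zcomm[of z r] R(2) MK by auto
      then show "a \<in> lin_span Z R"
        using lin_span_closed(3)[OF Zd rz(2) lin_span_base[OF Zd R(1) rz(1)]] by simp
    qed
    have sd: "div_subring (lin_span Z R)"
    proof (rule div_subring_lin_span_group[OF Zd M(1) R(1,2) Mspan])
      fix r z assume rz: "r \<in> R" "z \<in> Z"
      then show "cj r z \<in> Z" using normZ R(2) M(2) by blast
    qed
    have "D_center \<subseteq> Z" using FK FH by (auto simp: Z_def H_def)
    then have "D_center \<subseteq> lin_span Z R"
      using lin_span_closed(3)[OF Zd _ div_subringD(2)[OF sd]] by fastforce
    then have "D_center \<union> C \<subseteq> lin_span Z R" using C(2) Mspan by blast
    then have Kspan: "K \<subseteq> lin_span Z R" unfolding K_def by (rule div_gen_least[OF sd])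
    interpret central_by_finite_maximal K Z G M R
      using GsubK M maximal R infZ Kspan by unfold_locales (simp_all add: Z_def subset_iff)
    show False using maximal_commutative[of s m] sm C(2) by blast
  qed
qed

lemma normalizer:
  assumes "g \<in> G" "\<And>z. z \<in> K \<Longrightarrow> cj g z \<in> K" "\<And>z. z \<in> K \<Longrightarrow> cj (inverse g) z \<in> K"
  shows "g \<in> M"
  using normalizer_cases[of K] K_normalized not_normalized assms by blast

lemma K_Int_G: "G \<inter> K \<subseteq> M"
proof
  fix g assume g: "g \<in> G \<inter> K"
  show "g \<in> M"
  proof (rule normalizer)
    show "cj g z \<in> K" "cj (inverse g) z \<in> K" if "z \<in> K" for z
      using that g by (auto intro!: div_subringD(7,8)[OF Kd])
  qed (use g in blast)
qed

lemma centralizes_cj: "h \<in> centralizer P \<Longrightarrow> h \<noteq> 0 \<Longrightarrow> z \<in> P \<Longrightarrow> cj h z = z"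
  using centralizerD[of h P z] by (simp add: cj_eq_iff)

lemma H_Int_G: "G \<inter> H \<subseteq> M"
proof
  fix g assume g: "g \<in> G \<inter> H"
  show "g \<in> M"
  proof (rule normalizer)
    have "g \<in> centralizer K" "inverse g \<in> centralizer K" "g \<noteq> 0"
      using g div_subringD(7)[OF Hd] G_nonzero by (auto simp: H_def)
    then show "cj g z \<in> K" "cj (inverse g) z \<in> K" if "z \<in> K" for z
      using that centralizes_cj[of g K z] centralizes_cj[of "inverse g" K z] by simp_all
  qed (use g in blast)
qed

text \<open>Now \<open>K \<inter> G\<close> is subnormal in \<open>K\<^sup>*\<close> and contained in \<open>M\<close>, hence finite modulo the center of \<open>K\<close>.\<close>

theorem K_field: "K \<subseteq> centralizer K"
proof (cases "finite (K \<inter> centralizer K)")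
  case True
  then show ?thesis by (rule commutative_if_finite_center)
next
  case inf: False
  have sub: "subnormal_in K (G \<inter> K)" by (rule subnormal_in_Int[OF G div_subring_UNIV Kd subset_UNIV])
  obtain R where R: "finite R" "R \<subseteq> G \<inter> K" "\<And>a. a \<in> G \<inter> K \<Longrightarrow> \<exists>r\<in>R. \<exists>z\<in>K \<inter> centralizer K. a = r * z"
    by (rule finite_mod_center[of "G \<inter> K"]) (use K_Int_G in \<open>auto intro: that\<close>)
  show ?thesis
  proof (rule commutative_if_C_commutes)
    fix x y assume xy: "x \<in> C" "y \<in> C"
    show "x * y = y * x"
    proof (rule subnormal_central_if_finite_mod_center[OF Kd sub inf _ _ R(1)])
      show "t * a = a * t" if "t \<in> K \<inter> centralizer K" "a \<in> K" for t a
        using that centralizerD[of t K a] by blast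
      show "\<exists>r\<in>R. \<exists>z. a = r * z \<and> z \<in> centralizer K" if "a \<in> G \<inter> K" for a
        using R(3)[OF that] by blast
    qed (use xy C(2) M(2) CK in auto)
  qed
qed

lemma K_comm: "x \<in> K \<Longrightarrow> y \<in> K \<Longrightarrow> x * y = y * x"
  using K_field centralizerD[of x K y] by blast

lemma K_subset_H: "K \<subseteq> H" using K_field by (simp add: H_def)

lemma H_comm: "h \<in> H \<Longrightarrow> z \<in> K \<Longrightarrow> h * z = z * h"
  using centralizerD[of h K z] by (simp add: H_def)

lemma H_normalized: "m \<in> M \<Longrightarrow> h \<in> H \<Longrightarrow> cj m h \<in> H"
  unfolding H_def using mult_groupD(5)[OF M(1)] K_normalized M_nonzero
  by (intro centralizer_normalized) auto

lemma not_central: "\<not> M \<subseteq> H"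
proof
  assume "M \<subseteq> H"
  then show False using noncentral CK H_comm by (metis subsetD)
qed

lemma galois_action_K:
  obtains k :: nat and r where "galois_action K K M k r"
proof -
  obtain k :: nat and r where "\<And>i. i < k \<Longrightarrow> r i \<in> M"
    "\<And>i j. i < k \<Longrightarrow> j < k \<Longrightarrow> i \<noteq> j \<Longrightarrow> \<exists>z\<in>K. cj (r i) z \<noteq> cj (r j) z"
    "\<And>m. m \<in> M \<Longrightarrow> \<exists>i<k. \<forall>z\<in>K. cj m z = cj (r i) z"
    by (rule finite_action_representatives[OF finite_action]) (rule that)
  then have "galois_action K K M k r"
    using K_field M(1) K_normalized by unfold_locales auto
  then show ?thesis by (rule that)
qed

section \<open>The fixed field\<close>

text \<open>The division ring \<open>L\<close> generated by \<open>M\<close> meets \<open>G\<close> in \<open>M\<close> or \<open>G\<close>. In the first case \<open>M\<close> is subnormal in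
  \<open>L\<^sup>*\<close> and would centralize \<open>K\<close>.\<close>

theorem generated: "div_gen (D_center \<union> M) = UNIV"
proof -
  define L where "L = div_gen (D_center \<union> M)"
  have Ld: "div_subring L" by (simp add: L_def)
  have MsubL: "M \<subseteq> L" using div_gen_superset[of "D_center \<union> M"] by (auto simp: L_def)
  have KL: "K \<subseteq> L" unfolding K_def L_def by (rule div_gen_mono) (use C(2) in blast)
  obtain s m where sm: "s \<in> C" "m \<in> M" "s * m \<noteq> m * s" using noncentral by blast
  have sG: "s \<in> G" using sm(1) C(2) M(2) by blast
  have "G \<inter> L = M \<or> G \<inter> L = G"
    by (rule maximal[OF mult_group_Int[OF Ggrp Ld]]) (use M(2) MsubL in auto)
  then have "L = UNIV"
  proof
    assume "G \<inter> L = M"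
    then have sub: "subnormal_in L M" using subnormal_in_Int[OF G div_subring_UNIV Ld subset_UNIV] by simp
    have "m * s = s * m"
      by (rule normalized_field_centralized[OF Ld sub Kd KL K_field K_normalized sm(2)]) (use sm(1) CK in auto)
    then show ?thesis using sm(3) by simp
  next
    assume "G \<inter> L = G"
    then have GL: "G \<subseteq> L" by blast
    have LG: "L = div_gen (D_center \<union> G)"
    proof
      show "L \<subseteq> div_gen (D_center \<union> G)" unfolding L_def by (rule div_gen_mono) (use M(2) in blast)
      have "D_center \<subseteq> L" using div_gen_superset[of "D_center \<union> M"] by (auto simp: L_def)
      then show "div_gen (D_center \<union> G) \<subseteq> L" by (intro div_gen_least[OF Ld]) (use GL in blast)
    qed
    show ?thesis
    proof (cases "finite (L \<inter> centralizer L)")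
      case False
      then show ?thesis
        by (rule subnormal_generates_if_infinite_center[OF G LG _ sG _ sm(3)]) (use sm(2) MsubL in blast)
    next
      case True
      have "centralizer M \<subseteq> centralizer L"
        unfolding L_def centralizer_div_gen using D_centerD by (auto simp: centralizer_def)
      then have "K \<inter> centralizer M \<subseteq> L \<inter> centralizer L" using KL by blast
      then have fin: "finite (K \<inter> centralizer M)" by (rule finite_subset[OF _ True])
      obtain k :: nat and r where "galois_action K K M k r" by (rule galois_action_K)
      then interpret galois_action K K M k r .
      have finK: "finite K" by (rule finite_if_fixed_finite[OF fin])
      obtain p where p: "Factorial_Ring.prime p" "of_nat p = (0::'a)"
        using finite_div_subring_char[OF Kd finK] by metis
      have s0: "s \<noteq> 0" using sG G_nonzero by blast
      have "s ^ n \<in> K" for n by (rule div_subring_power[OF Kd]) (use sm(1) CK in blast)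
      then obtain n where "n > 0" "s ^ n = 1" using finite_order[OF finK _ s0] by metis
      then show ?thesis using torsion_subnormal_generates[OF p G sG _ _ sm(3) Ld GL] by blast
    qed
  qed
  then show ?thesis by (simp add: L_def)
qed

lemma centralizer_M: "centralizer M = D_center"
proof
  have "centralizer M \<subseteq> centralizer (div_gen (D_center \<union> M))"
    unfolding centralizer_div_gen using D_centerD by (auto simp: centralizer_def)
  then show "centralizer M \<subseteq> D_center" by (simp only: generated)
qed (rule centralizer_antimono, simp)

lemma fixed_field: "K \<inter> centralizer M = D_center"
  using centralizer_M FK by blast

text \<open>The fixed field of \<open>N\<close> in \<open>K\<close> is stable under \<open>M\<close>. If \<open>G\<close> normalizes it, it is central; otherwise its
  centralizer meets \<open>G\<close> inside \<open>M\<close>, in a subnormal subgroup that normalizes \<open>K\<close> and therefore centralizes it.\<close>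

theorem normal_subgroup_dichotomy:
  assumes N: "mult_group N" "N \<subseteq> M" and normal: "\<And>m n. m \<in> M \<Longrightarrow> n \<in> N \<Longrightarrow> cj m n \<in> N"
  shows "N \<subseteq> H \<or> K \<inter> centralizer N = D_center"
proof -
  define P where "P = K \<inter> centralizer N"
  have Pd: "div_subring P" unfolding P_def by (rule div_subring_Int) simp_all
  have PK: "P \<subseteq> K" by (simp add: P_def)
  have Pc: "P \<subseteq> centralizer P" using K_comm PK by (auto simp: centralizer_def)
  have normP: "cj m z \<in> P" if m: "m \<in> M" and z: "z \<in> P" for m z
  proof -
    have "cj m z \<in> centralizer N"
      by (rule centralizer_normalized[OF M_nonzero[OF m] normal[OF mult_groupD(5)[OF M(1) m]]])
        (use z in \<open>simp_all add: P_def\<close>)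
    then show ?thesis using K_normalized[OF m] z by (simp add: P_def)
  qed
  from normalizer_cases[of P, OF normP] show ?thesis
  proof
    assume "\<forall>g\<in>G. \<forall>z\<in>P. cj g z \<in> P"
    then have normG: "cj g z \<in> P" if "g \<in> G" "z \<in> P" for g z using that by blast
    have "g * z = z * g" if "g \<in> G" "z \<in> P" for g z
      by (rule normalized_field_centralized[OF div_subring_UNIV G Pd subset_UNIV Pc normG that])
    then have "P \<subseteq> centralizer M" using M(2) by (fastforce simp: centralizer_def)
    then have "P \<subseteq> D_center" using centralizer_M by simp
    moreover have "D_center \<subseteq> P" using FK centralizer_antimono[of N UNIV] by (auto simp: P_def)
    ultimately show ?thesis by (auto simp: P_def)
  next
    assume norm: "\<forall>g\<in>G. (\<forall>z\<in>P. cj g z \<in> P \<and> cj (inverse g) z \<in> P) \<longrightarrow> g \<in> M"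
    define E where "E = centralizer P"
    have Ed: "div_subring E" by (simp add: E_def)
    have EM: "G \<inter> E \<subseteq> M"
    proof
      fix g assume g: "g \<in> G \<inter> E"
      then have "g \<in> centralizer P" "inverse g \<in> centralizer P" "g \<noteq> 0"
        using div_subringD(7)[OF Ed] G_nonzero by (auto simp: E_def)
      then have "\<forall>z\<in>P. cj g z \<in> P \<and> cj (inverse g) z \<in> P"
        using centralizes_cj[of g P] centralizes_cj[of "inverse g" P] by simp
      then show "g \<in> M" using norm g by blast
    qed
    have sub: "subnormal_in E (G \<inter> E)" by (rule subnormal_in_Int[OF G div_subring_UNIV Ed subset_UNIV])
    have KE: "K \<subseteq> E" using K_comm PK by (auto simp: E_def centralizer_def)
    have "n * z = z * n" if n: "n \<in> N" and z: "z \<in> K" for n z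
    proof (rule normalized_field_centralized[OF Ed sub Kd KE K_field _ _ z])
      show "cj a z \<in> K" if "a \<in> G \<inter> E" "z \<in> K" for a z using that K_normalized EM by blast
      have "n * z = z * n" if "z \<in> P" for z using that n centralizerD[of z N n] by (simp add: P_def)
      then have "n \<in> E" by (simp add: E_def centralizer_def)
      then show "n \<in> G \<inter> E" using n N(2) M(2) by blast
    qed
    then have "N \<subseteq> H" by (auto simp: H_def centralizer_def)
    then show ?thesis ..
  qed
qed

end

section \<open>The FC-center\<close>

context maximal_with_finite_class
begin

lemma M_in_G: "m \<in> M \<Longrightarrow> m \<in> G" using M(2) by blast

text \<open>\<open>H \<inter> G\<close> is the kernel of the action of \<open>M\<close> on \<open>K\<close>, so it has finite index in \<open>M\<close>.\<close>

lemma finite_class_if_centralized: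
  assumes "\<And>h. h \<in> G \<inter> H \<Longrightarrow> h * b = b * h"
  shows "finite ((\<lambda>m. cj m b) ` M)"
proof (rule finite_image_factor)
  show "finite ((\<lambda>m. restrict (cj m) K) ` M)" using finite_action by (simp add: finite_action_def)
  fix m n assume mn: "m \<in> M" "n \<in> M" and eq: "restrict (cj m) K = restrict (cj n) K"
  have nz: "m \<noteq> 0" "n \<noteq> 0" using mn M_nonzero by auto
  have "inverse n * m \<in> H" unfolding H_def
  proof (rule cj_trivial_on[OF nz])
    show "cj m z = cj n z" if "z \<in> K" for z using fun_cong[OF eq, of z] that by simp
  qed
  moreover have "inverse n * m \<in> G" using mn M(2) mult_groupD(4,5)[OF M(1)] by blast
  ultimately show "cj m b = cj n b" unfolding cj_eq_on_iff[OF nz] by (intro assms) simp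
qed

text \<open>Let \<open>b\<close> have a finite class, and let \<open>K'\<close> be the field that belongs to the union of this class
  with \<open>C\<close>. The centralizer of \<open>K\<close> in \<open>M\<close> is normal and fixes more than the center in \<open>K'\<close>, so it acts
  trivially on \<open>K'\<close>. Then \<open>M\<close> acts on both fields through the same group and fixes the center in both,
  and by Artin's theorem \<open>K' = K\<close>.\<close>

lemma finite_class_in_K:
  assumes b: "b \<in> M" and fin: "finite ((\<lambda>m. cj m b) ` M)"
  shows "b \<in> K"
proof -
  define C' where "C' = C \<union> (\<lambda>m. cj m b) ` M"
  interpret E: maximal_with_finite_class G M C'
  proof unfold_locales
    show "finite C'" using fin C(1) by (simp add: C'_def)
    show "C' \<subseteq> M" using b C(2) mult_groupD(6)[OF M(1)] by (auto simp: C'_def)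
    show "cj m s \<in> C'" if "m \<in> M" "s \<in> C'" for m s
      using that C(3) mult_groupD(4)[OF M(1)] by (auto simp: C'_def cj_cj)
    show "\<exists>s\<in>C'. \<exists>m\<in>M. s * m \<noteq> m * s" using noncentral by (auto simp: C'_def)
  qed
  have KE: "K \<subseteq> E.K" unfolding K_def E.K_def by (rule div_gen_mono) (auto simp: C'_def)
  have N: "mult_group (M \<inter> H)" by (rule mult_group_Int[OF M(1) Hd])
  have "M \<inter> H \<subseteq> E.H \<or> E.K \<inter> centralizer (M \<inter> H) = D_center"
    by (rule E.normal_subgroup_dichotomy[OF N]) (use H_normalized mult_groupD(6)[OF M(1)] in auto)
  moreover have "E.K \<inter> centralizer (M \<inter> H) \<noteq> D_center"
  proof
    assume e: "E.K \<inter> centralizer (M \<inter> H) = D_center"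
    have "K \<subseteq> centralizer (M \<inter> H)" using H_comm by (fastforce simp: centralizer_def)
    then have "K \<subseteq> D_center" using KE e by blast
    then show False using noncentral CK D_centerD by blast
  qed
  ultimately have NE: "M \<inter> H \<subseteq> E.H" by blast
  obtain k :: nat and r where r: "\<And>i. i < k \<Longrightarrow> r i \<in> M"
    and dist: "\<And>i j. i < k \<Longrightarrow> j < k \<Longrightarrow> i \<noteq> j \<Longrightarrow> \<exists>z\<in>E.K. cj (r i) z \<noteq> cj (r j) z"
    and cover: "\<And>m. m \<in> M \<Longrightarrow> \<exists>i<k. \<forall>z\<in>E.K. cj m z = cj (r i) z"
    by (rule finite_action_representatives[OF E.finite_action]) (rule that)
  have "\<exists>z\<in>K. cj (r i) z \<noteq> cj (r j) z" if ij: "i < k" "j < k" "i \<noteq> j" for i j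
  proof (rule ccontr)
    assume neg: "\<not> ?thesis"
    have rr: "r i \<in> M" "r j \<in> M" "r i \<noteq> 0" "r j \<noteq> 0" using r ij M_nonzero by auto
    have "inverse (r j) * r i \<in> H" unfolding H_def
      by (rule cj_trivial_on[OF rr(3,4)]) (use neg in blast)
    moreover have "inverse (r j) * r i \<in> M" using rr mult_groupD(4,5)[OF M(1)] by blast
    ultimately have "inverse (r j) * r i \<in> E.H" using NE by blast
    then have "cj (r i) z = cj (r j) z" if "z \<in> E.K" for z
      unfolding cj_eq_on_iff[OF rr(3,4)] using E.H_comm that by blast
    then show False using dist[OF ij] by blast
  qed
  then interpret galois_action E.K K M k r
    using E.K_field M(1) E.K_normalized KE r cover by unfold_locales auto
  obtain c a where ca: "dual_bases c a" by (rule artin_basis)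
  have bE: "b \<in> E.K"
  proof -
    have "cj 1 b \<in> (\<lambda>m. cj m b) ` M" using mult_groupD(1)[OF M(1)] by (rule imageI)
    then show ?thesis using E.CK by (auto simp: C'_def)
  qed
  have "b = (\<Sum>j<k. (\<Sum>i<k. a j i * cj (r i) b) * c j)" by (rule dual_basesD(6)[OF ca bE])
  also have "\<dots> \<in> K"
  proof (rule div_subring_sum[OF Kd])
    fix j assume "j \<in> {..<k}"
    then have j: "j < k" by simp
    have "c j \<in> K" by (rule dual_basesD(1)[OF ca j])
    moreover have "(\<Sum>i<k. a j i * cj (r i) b) \<in> K" using dual_basesD(5)[OF ca j bE] FK E.fixed_field by blast
    ultimately show "(\<Sum>i<k. a j i * cj (r i) b) * c j \<in> K" by (intro div_subringD(6)[OF Kd])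
  qed
  finally show ?thesis .
qed

theorem FC_center_eq: "G \<inter> K = {x \<in> M. finite ((\<lambda>m. cj m x) ` M)}"
proof
  show "G \<inter> K \<subseteq> {x \<in> M. finite ((\<lambda>m. cj m x) ` M)}"
    using finite_class_if_centralized H_comm K_Int_G by blast
  show "{x \<in> M. finite ((\<lambda>m. cj m x) ` M)} \<subseteq> G \<inter> K" using finite_class_in_K M(2) by blast
qed

lemma in_K_if_centralized: "b \<in> M \<Longrightarrow> (\<And>h. h \<in> G \<inter> H \<Longrightarrow> h * b = b * h) \<Longrightarrow> b \<in> K"
  using finite_class_in_K finite_class_if_centralized by blast

section \<open>Nilpotent normal subgroups\<close>

lemma HG_subnormal: "subnormal_in H (G \<inter> H)"
  by (rule subnormal_in_Int[OF G div_subring_UNIV Hd subset_UNIV])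

text \<open>The elements of a nilpotent normal subgroup that centralize \<open>K\<close>: climbing the central series,
  adjoining one step yields fields normalized by subnormal subgroups of \<open>H\<^sup>*\<close>.\<close>

lemma nilpotent_normal_Int_H:
  assumes \<gamma>: "\<And>i. mult_group (\<gamma> i)" "\<And>i. \<gamma> i \<subseteq> M" "\<And>i m x. m \<in> M \<Longrightarrow> x \<in> \<gamma> i \<Longrightarrow> cj m x \<in> \<gamma> i"
    and comm: "\<And>i x y. x \<in> \<gamma> i \<Longrightarrow> y \<in> \<gamma> 0 \<Longrightarrow> x * y * inverse x * inverse y \<in> \<gamma> (Suc i)"
    and le: "\<And>i. \<gamma> i \<subseteq> \<gamma> 0" and triv: "\<gamma> c = {1}" and i: "i \<le> c"
  shows "\<forall>x\<in>\<gamma> i \<inter> H. \<forall>h\<in>G \<inter> H. h * x = x * h"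
  using i
proof (induction i rule: inc_induct)
  case base
  then show ?case using triv by simp
next
  case (step i)
  define P where "P = \<gamma> i \<inter> H"
  have Pg: "mult_group P" unfolding P_def by (rule mult_group_Int[OF \<gamma>(1) Hd])
  have PGH: "P \<subseteq> G \<inter> H" using \<gamma>(2) M(2) by (auto simp: P_def)
  have normP: "cj h x \<in> P" if "h \<in> G \<inter> H" "x \<in> P" for h x
    using that \<gamma>(3) H_Int_G div_subringD(8)[OF Hd] by (auto simp: P_def)
  have subP: "subnormal_in H P" by (rule subnormal_in.step[OF HG_subnormal Pg PGH normP])
  have IH: "h * x = x * h" if "x \<in> \<gamma> (Suc i) \<inter> H" "h \<in> G \<inter> H" for x h using step.IH that by blast
  have Pcomm: "y * x = x * y" if x: "x \<in> P" and y: "y \<in> P" for x y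
  proof -
    define S where "S = D_center \<union> (\<gamma> (Suc i) \<inter> H) \<union> {x}"
    have GHs: "\<gamma> (Suc i) \<inter> H \<subseteq> G \<inter> H" using \<gamma>(2) M(2) by blast
    have xG: "x \<in> G \<inter> H" using x PGH by blast
    have "u * v = v * u" if uv: "u \<in> S" "v \<in> S" for u v
    proof -
      define Q where "Q = \<gamma> (Suc i) \<inter> H"
      consider "u \<in> D_center" | "v \<in> D_center" | "u \<in> Q" "v \<in> Q \<union> {x}" | "v \<in> Q" "u \<in> Q \<union> {x}" | "u = v"
        using uv unfolding S_def Q_def by blast
      then show ?thesis
      proof cases
        case 1
        then show ?thesis by (rule D_centerD)
      next
        case 2
        then show ?thesis by (rule D_centerD[symmetric])
      next
        case 3
        then have "v \<in> G \<inter> H" using GHs xG by (auto simp: Q_def)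
        then show ?thesis using IH[of u v] 3(1) by (simp add: Q_def)
      next
        case 4
        then have "u \<in> G \<inter> H" using GHs xG by (auto simp: Q_def)
        then show ?thesis using IH[of v u] 4(1) by (simp add: Q_def)
      qed simp
    qed
    then have "S \<subseteq> centralizer S" by (auto simp: centralizer_def)
    then have field: "div_gen S \<subseteq> centralizer (div_gen S)" by (rule div_gen_commutative)
    have "S \<subseteq> H" using FH x by (auto simp: S_def P_def)
    then have SH: "div_gen S \<subseteq> H" by (rule div_gen_least[OF Hd])
    show ?thesis
    proof (rule normalized_field_centralized[OF Hd subP div_subring_div_gen SH field _ y])
      show "x \<in> div_gen S" using div_gen_superset[of S] by (auto simp: S_def)
      fix w u assume w: "w \<in> P" and u: "u \<in> div_gen S"
      have w0: "w \<noteq> 0" by (rule mult_groupD(3)[OF Pg w])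
      have wG: "w \<in> G \<inter> H" using w PGH by blast
      show "cj w u \<in> div_gen S"
      proof (rule div_gen_normalized[OF w0 _ u])
        fix s assume s: "s \<in> S"
        consider "s \<in> D_center" | "s \<in> \<gamma> (Suc i) \<inter> H" | "s = x" using s by (auto simp: S_def)
        then show "cj w s \<in> div_gen S"
        proof cases
          case 1
          then show ?thesis using central_cj[OF 1 w0] s div_gen_superset[of S] by auto
        next
          case 2
          then have "cj w s = s" using IH[OF 2 wG] w0 by (simp add: cj_eq_iff)
          then show ?thesis using s div_gen_superset[of S] by auto
        next
          case 3
          define z where "z = w * x * inverse w * inverse x"
          have x0: "x \<noteq> 0" by (rule mult_groupD(3)[OF Pg x])
          have "z \<in> \<gamma> (Suc i)" unfolding z_def using comm[of w i x] w x le by (auto simp: P_def)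
          moreover have "z \<in> H" unfolding z_def using w x by (intro div_subringD(6,7)[OF Hd]) (auto simp: P_def)
          ultimately have "z \<in> div_gen S" using div_gen_superset[of S] by (auto simp: S_def)
          moreover have "x \<in> div_gen S" using div_gen_superset[of S] by (auto simp: S_def)
          ultimately have "z * x \<in> div_gen S" by (rule div_subringD(6)[OF div_subring_div_gen])
          moreover have "cj w s = z * x" using x0 by (simp add: 3 z_def cj_def mult.assoc)
          ultimately show ?thesis by simp
        qed
      qed
    qed
  qed
  define S where "S = D_center \<union> P"
  have "u * v = v * u" if uv: "u \<in> S" "v \<in> S" for u v
  proof -
    consider "u \<in> D_center" | "v \<in> D_center" | "u \<in> P" "v \<in> P" using uv unfolding S_def by blast
    then show ?thesis
    proof cases
      case 1
      then show ?thesis by (rule D_centerD)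
    next
      case 2
      then show ?thesis by (rule D_centerD[symmetric])
    next
      case 3
      then show ?thesis by (intro Pcomm)
    qed
  qed
  then have "S \<subseteq> centralizer S" by (auto simp: centralizer_def)
  then have field: "div_gen S \<subseteq> centralizer (div_gen S)" by (rule div_gen_commutative)
  have "S \<subseteq> H" using FH by (auto simp: S_def P_def)
  then have SH: "div_gen S \<subseteq> H" by (rule div_gen_least[OF Hd])
  have norm: "cj h u \<in> div_gen S" if h: "h \<in> G \<inter> H" and u: "u \<in> div_gen S" for h u
  proof (rule div_gen_normalized[OF _ _ u])
    show h0: "h \<noteq> 0" using h G_nonzero by blast
    fix s assume "s \<in> S"
    then have "cj h s \<in> S" using normP[OF h] central_cj[OF _ h0] by (auto simp: S_def)
    then show "cj h s \<in> div_gen S" using div_gen_superset[of S] by blast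
  qed
  show ?case
  proof (intro ballI)
    fix x h assume x: "x \<in> \<gamma> i \<inter> H" and h: "h \<in> G \<inter> H"
    show "h * x = x * h"
    proof (rule normalized_field_centralized[OF Hd HG_subnormal div_subring_div_gen SH field norm h])
      show "x \<in> div_gen S" using x div_gen_superset[of S] by (auto simp: S_def P_def)
    qed
  qed
qed

lemma twisted_norm_in_K: "b \<in> M \<Longrightarrow> z \<in> K \<Longrightarrow> twisted_norm b n z \<in> K"
  by (induction n) (auto intro!: div_subringD(2,6)[OF Kd] K_normalized mult_group_power[OF M(1)])

lemma twisted_norm_power:
  assumes b: "b \<in> M" and z: "z \<in> K"
  shows "twisted_norm b n (z ^ e) = twisted_norm b n z ^ e"
proof (induction n)
  case (Suc n)
  have bn: "b ^ n \<in> M" by (rule mult_group_power[OF M(1) b])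
  have "twisted_norm b n z * cj (b ^ n) z = cj (b ^ n) z * twisted_norm b n z"
    by (rule K_comm[OF twisted_norm_in_K[OF b z] K_normalized[OF bn z]])
  then have "(twisted_norm b n z * cj (b ^ n) z) ^ e = twisted_norm b n z ^ e * cj (b ^ n) z ^ e"
    by (rule power_mult_commuting)
  then show ?case using Suc M_nonzero[OF bn] by (simp add: cj_power)
qed simp

lemma twisted_norm_of_fixed:
  assumes "b \<noteq> 0" "b * u = u * b"
  shows "twisted_norm b n u = u ^ n"
proof (induction n)
  case (Suc n)
  have "b ^ n * u = u * b ^ n" using power_commuting_commutes[of b u n] assms(2) by simp
  then have "cj (b ^ n) u = u" using assms(1) by (simp add: cj_eq_iff)
  then show ?case using Suc by (simp add: power_commutes)
qed simp

text \<open>The powers of \<open>b\<close> induce finitely many automorphisms of \<open>K\<close>.\<close>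

lemma power_in_H:
  assumes b: "b \<in> M"
  obtains n where "n > 0" "b ^ n \<in> H"
proof -
  define f where "f = (\<lambda>n::nat. restrict (cj (b ^ n)) K)"
  have "range f \<subseteq> (\<lambda>m. restrict (cj m) K) ` M" using mult_group_power[OF M(1) b] by (auto simp: f_def)
  then have "finite (range f)" using finite_action finite_subset unfolding finite_action_def by blast
  then have "\<not> inj f" using finite_imageD[of f UNIV] by auto
  then obtain i j where "f i = f j" "i \<noteq> j" by (auto simp: inj_def)
  then obtain i j where ij: "f i = f j" "i < j" by (metis nat_neq_iff)
  have bi: "b ^ i \<noteq> 0" "b ^ j \<noteq> 0" using M_nonzero[OF b] by auto
  have "b ^ j = b ^ i * b ^ (j - i)" using ij(2) by (simp add: power_add[symmetric])
  then have e: "inverse (b ^ i) * b ^ j = b ^ (j - i)" using bi(1) by (simp add: mult.assoc[symmetric])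
  have "inverse (b ^ i) * b ^ j \<in> H" unfolding H_def
  proof (rule cj_trivial_on[OF bi(2,1)])
    show "cj (b ^ j) z = cj (b ^ i) z" if "z \<in> K" for z using fun_cong[OF ij(1), of z] that by (simp add: f_def)
  qed
  then show ?thesis using that[of "j - i"] ij(2) e by simp
qed

text \<open>For \<open>b\<close> in a nilpotent normal subgroup and \<open>h\<close> centralizing \<open>K\<close>, \<open>h b h\<inverse> = z b\<close> with \<open>z \<in> K\<close>. Since
  \<open>b ^ n\<close> commutes with \<open>h\<close> and \<open>K\<close>, the iterated commutators of \<open>b\<close> and \<open>z\<close> have trivial norm for
  \<open>b\<close>; as they end at \<open>1\<close>, each is a root of unity of bounded order. So \<open>z\<close> takes finitely many values.\<close>

theorem nilpotent_normal_in_K: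
  assumes \<gamma>: "\<And>i. mult_group (\<gamma> i)" "\<And>i. \<gamma> i \<subseteq> M" "\<And>i m x. m \<in> M \<Longrightarrow> x \<in> \<gamma> i \<Longrightarrow> cj m x \<in> \<gamma> i"
    and comm: "\<And>i x y. x \<in> \<gamma> i \<Longrightarrow> y \<in> \<gamma> 0 \<Longrightarrow> x * y * inverse x * inverse y \<in> \<gamma> (Suc i)"
    and le: "\<And>i. \<gamma> i \<subseteq> \<gamma> 0" and triv: "\<gamma> c = {1}"
  shows "\<gamma> 0 \<subseteq> K"
proof
  fix b assume b: "b \<in> \<gamma> 0"
  have bM: "b \<in> M" using b \<gamma>(2) by blast
  have b0: "b \<noteq> 0" by (rule M_nonzero[OF bM])
  have NHc: "h * x = x * h" if "x \<in> \<gamma> 0 \<inter> H" "h \<in> G \<inter> H" for x h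
    using nilpotent_normal_Int_H[of \<gamma> c 0, OF \<gamma> comm le triv] that by blast
  have NHK: "\<gamma> 0 \<inter> H \<subseteq> K" using in_K_if_centralized NHc \<gamma>(2) by blast
  obtain n where n: "n > 0" "b ^ n \<in> H" using power_in_H[OF bM] by blast
  have bn: "b ^ n \<in> \<gamma> 0 \<inter> H" using mult_group_power[OF \<gamma>(1) b] n(2) by simp
  define U where "U = {z \<in> K. z ^ (n ^ c) = 1}"
  have finU: "finite U" unfolding U_def by (rule finite_roots_of_unity[OF Kd K_field]) (use n(1) in simp)
  have key: "cj h b \<in> (\<lambda>z. z * b) ` U" if h: "h \<in> G \<inter> H" for h
  proof -
    define z where "z = cj h b * inverse b"
    have hM: "h \<in> M" and h0: "h \<noteq> 0" using h H_Int_G G_nonzero by auto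
    have zb: "z * b = cj h b" using b0 by (simp add: z_def mult.assoc)
    have z0: "z \<in> \<gamma> 0" unfolding z_def
      by (rule mult_groupD(4)[OF \<gamma>(1) \<gamma>(3)[OF hM b] mult_groupD(5)[OF \<gamma>(1) b]])
    \<comment> \<open>\<open>b\<close> normalizes \<open>H\<close>, so that \<open>z = h (b h\<inverse> b\<inverse>)\<close> is in \<open>H\<close>\<close>
    have "cj b (inverse h) \<in> H" using H_normalized[OF bM] div_subringD(7)[OF Hd] h by blast
    moreover have "z = h * cj b (inverse h)" by (simp add: z_def cj_def mult.assoc)
    ultimately have "z \<in> H" using div_subringD(6)[OF Hd] h by simp
    then have zK: "z \<in> K" using NHK z0 by blast
    have zj: "iter_comm b j z \<in> \<gamma> j \<inter> K" for j
    proof (induction j)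
      case (Suc j)
      define y where "y = iter_comm b j z"
      have y: "y \<in> \<gamma> j" "y \<in> K" using Suc by (auto simp: y_def)
      have "iter_comm b (Suc j) z = y * inverse (cj b y)" by (simp add: y_def)
      moreover have "y * inverse (cj b y) \<in> K" using y(2) K_normalized[OF bM] by (intro div_subringD(6,7)[OF Kd])
      moreover have "y * inverse (cj b y) = y * b * inverse y * inverse b"
        by (simp add: cj_def inverse_mult_rev mult.assoc)
      ultimately show ?case using comm[OF y(1) b] by simp
    qed (use z0 zK in simp)
    have norm1: "twisted_norm b n (iter_comm b j z) = 1" for j
    proof -
      \<comment> \<open>the product of \<open>b\<close> and the next commutator is the conjugate of \<open>b\<close> by the previous one; conjugation
        does not change \<open>b ^ n\<close>\<close>
      have "\<exists>u. u \<noteq> 0 \<and> u * b ^ n = b ^ n * u \<and> iter_comm b j z * b = cj u b"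
      proof (cases j)
        case 0
        then show ?thesis using zb h0 NHc[OF bn h] by auto
      next
        case (Suc i)
        define y where "y = iter_comm b i z"
        have y: "y \<in> \<gamma> i" "y \<in> K" using zj[of i] by (auto simp: y_def)
        have "y \<noteq> 0" using mult_groupD(3)[OF \<gamma>(1) y(1)] .
        moreover have "iter_comm b j z * b = cj y b"
          using b0 by (simp add: Suc y_def[symmetric] cj_def inverse_mult_rev mult.assoc)
        moreover have "y * b ^ n = b ^ n * y" using H_comm[OF n(2) y(2)] by simp
        ultimately show ?thesis by blast
      qed
      then obtain u where u: "u \<noteq> 0" "u * b ^ n = b ^ n * u" "iter_comm b j z * b = cj u b" by blast
      have "(iter_comm b j z * b) ^ n = cj u (b ^ n)" using u(1,3) by (simp add: cj_power)
      also have "\<dots> = b ^ n" using u(1,2) by (simp add: cj_eq_iff)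
      finally have "twisted_norm b n (iter_comm b j z) * b ^ n = 1 * b ^ n"
        using power_mult_twisted_norm[OF b0] by simp
      then show ?thesis using b0 by simp
    qed
    have "iter_comm b i z ^ (n ^ (c - i)) = 1" if "i \<le> c" for i
      using that
    proof (induction i rule: inc_induct)
      case base
      then show ?case using zj[of c] triv by simp
    next
      case (step i)
      define y where "y = iter_comm b i z"
      define e where "e = n ^ (c - Suc i)"
      have yK: "y \<in> K" and y0: "y \<noteq> 0" using zj[of i] mult_groupD(3)[OF \<gamma>(1)] by (auto simp: y_def)
      have yeK: "y ^ e \<in> K" by (rule div_subring_power[OF Kd yK])
      have by0: "cj b y \<noteq> 0" using y0 b0 by simp
      \<comment> \<open>the next commutator has order dividing \<open>e\<close>, so \<open>y ^ e\<close> is fixed by \<open>b\<close> and its norm is its \<open>n\<close>-th power\<close>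
      have "(y * inverse (cj b y)) ^ e = 1" using step.IH by (simp add: y_def e_def)
      moreover have "y * inverse (cj b y) = inverse (cj b y) * y"
        by (intro K_comm yK div_subringD(7)[OF Kd] K_normalized[OF bM])
      ultimately have "y ^ e * inverse (cj b y) ^ e = 1" using power_mult_commuting[of y "inverse (cj b y)" e] by metis
      then have "y ^ e * inverse (cj b y ^ e) = 1" by (simp only: power_inverse)
      then have "y ^ e * inverse (cj b y ^ e) * cj b y ^ e = cj b y ^ e" by simp
      then have "y ^ e = cj b y ^ e" using by0 by (simp add: mult.assoc)
      then have "cj b (y ^ e) = y ^ e" unfolding cj_power[OF b0] by (rule sym)
      then have "b * y ^ e = y ^ e * b" using b0 by (simp add: cj_eq_iff)
      then have "(y ^ e) ^ n = twisted_norm b n (y ^ e)" using twisted_norm_of_fixed[OF b0] by simp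
      also have "\<dots> = 1" using twisted_norm_power[OF bM yK] norm1[of i] by (simp add: y_def)
      finally have "y ^ (e * n) = 1" by (simp only: power_mult)
      moreover have "e * n = n ^ (c - i)"
      proof -
        have "c - i = Suc (c - Suc i)" using step.hyps by simp
        then show ?thesis by (simp add: e_def)
      qed
      ultimately show ?case by (simp add: y_def)
    qed
    from this[of 0] have "z \<in> U" using zK by (simp add: U_def)
    then show ?thesis using zb by (intro image_eqI[of _ _ z]) simp_all
  qed
  obtain k :: nat and r where ga: "galois_action K K M k r" by (rule galois_action_K)
  interpret galois_action K K M k r by (rule ga)
  have "(\<lambda>m. cj m b) ` M \<subseteq> (\<lambda>(i, w). cj (r i) w) ` ({..<k} \<times> (\<lambda>z. z * b) ` U)"
  proof clarify
    fix m assume m: "m \<in> M"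
    obtain i where i: "i < k" "\<forall>z\<in>K. cj m z = cj (r i) z" using cover[OF m] by blast
    define h where "h = inverse (r i) * m"
    have ri: "r i \<in> M" "r i \<noteq> 0" using r[OF i(1)] M_nonzero by blast+
    have "h \<in> H" unfolding h_def H_def by (rule cj_trivial_on[OF M_nonzero[OF m] ri(2)]) (use i(2) in blast)
    moreover have "h \<in> G" unfolding h_def using m ri M_in_G mult_groupD(4,5)[OF M(1)] by blast
    ultimately have "cj h b \<in> (\<lambda>z. z * b) ` U" using key by blast
    moreover have "cj m b = cj (r i) (cj h b)" using ri(2) by (simp add: h_def cj_cj mult.assoc[symmetric])
    ultimately show "cj m b \<in> (\<lambda>(i, w). cj (r i) w) ` ({..<k} \<times> (\<lambda>z. z * b) ` U)"
      using i(1) by (intro image_eqI[of _ _ "(i, cj h b)"]) auto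
  qed
  then have "finite ((\<lambda>m. cj m b) ` M)" by (rule finite_subset) (use finU in auto)
  then show "b \<in> K" by (rule finite_class_in_K[OF bM])
qed

section \<open>The case that \<open>H \<inter> G\<close> lies in \<open>K\<close>\<close>

text \<open>Representatives of \<open>M\<close> modulo \<open>H \<inter> G\<close> then span \<open>D\<close> over \<open>K\<close>, and comparing types shows that
  the elements of \<open>H\<close> are multiples of a single representative.\<close>

lemma spanned_over_K:
  assumes sub: "G \<inter> H \<subseteq> K" and ga: "galois_action K K M k r"
  shows "lin_span K (r ` {..<k}) = UNIV"
proof -
  interpret galois_action K K M k r by (rule ga)
  have rM: "r ` {..<k} \<subseteq> M" using r by blast
  have Mspan: "M \<subseteq> lin_span K (r ` {..<k})"
  proof
    fix m assume m: "m \<in> M"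
    obtain i where i: "i < k" "\<forall>z\<in>K. cj m z = cj (r i) z" using cover[OF m] by blast
    define h where "h = inverse (r i) * m"
    have ri: "r i \<in> M" "r i \<noteq> 0" using rM i(1) M_nonzero by blast+
    have "h \<in> H" unfolding h_def H_def by (rule cj_trivial_on[OF M_nonzero[OF m] ri(2)]) (use i(2) in blast)
    moreover have "h \<in> G" unfolding h_def using m ri M_in_G mult_groupD(4,5)[OF M(1)] by blast
    ultimately have "cj (r i) h \<in> K" using sub K_normalized[OF ri(1)] by blast
    moreover have "r i \<in> lin_span K (r ` {..<k})" by (rule lin_span_base[OF Kd]) (use i(1) in auto)
    ultimately have "cj (r i) h * r i \<in> lin_span K (r ` {..<k})" by (rule lin_span_closed(3)[OF Kd])
    moreover have "cj (r i) h * r i = m" using ri(2) by (simp add: cj_left h_def mult.assoc[symmetric])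
    ultimately show "m \<in> lin_span K (r ` {..<k})" by simp
  qed
  have sd: "div_subring (lin_span K (r ` {..<k}))"
    by (rule div_subring_lin_span_group[OF Kd M(1) _ rM Mspan]) (use rM K_normalized in auto)
  have "f \<in> lin_span K (r ` {..<k})" if "f \<in> D_center" for f
    using lin_span_closed(3)[OF Kd subsetD[OF FK that] div_subringD(2)[OF sd]] by simp
  then have "div_gen (D_center \<union> M) \<subseteq> lin_span K (r ` {..<k})" by (intro div_gen_least[OF sd]) (use Mspan in blast)
  then show ?thesis using generated by blast
qed

theorem H_eq_K:
  assumes sub: "G \<inter> H \<subseteq> K"
  shows "H = K"
proof
  show "K \<subseteq> H" by (rule K_subset_H)
  show "H \<subseteq> K"
  proof
    fix d assume d: "d \<in> H"
    obtain k :: nat and r where ga: "galois_action K K M k r" by (rule galois_action_K)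
    interpret galois_action K K M k r by (rule ga)
    have inj: "inj_on r {..<k}" unfolding inj_on_def using dist by fastforce
    have "d \<in> lin_span K (r ` {..<k})" using spanned_over_K[OF sub ga] by simp
    then obtain c where c: "\<forall>s\<in>r ` {..<k}. c s \<in> K" "d = (\<Sum>s\<in>r ` {..<k}. c s * s)"
      unfolding lin_span_def by blast
    have dsum: "d = (\<Sum>i<k. c (r i) * r i)" unfolding c(2) by (simp add: sum.reindex[OF inj])
    obtain l where l: "l < k" "\<forall>z\<in>K. cj 1 z = cj (r l) z" using cover[OF mult_groupD(1)[OF M(1)]] by blast
    have rl: "r l \<noteq> 0" "r l \<in> M" using r_nonzero[OF l(1)] r[OF l(1)] by auto
    define a where "a = (\<lambda>i. c (r i) * r i - (if i = l then d else 0))"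
    have "\<forall>i\<in>{..<k}. a i = 0"
    proof (rule independence_of_types[of _ K _ "\<lambda>i. cj (r i)"])
      fix i z assume "i \<in> {..<k}" and z: "z \<in> K"
      then have i: "i < k" by simp
      have cK: "c (r i) \<in> K" using c(1) i by blast
      have "c (r i) * r i * z = cj (r i) z * (c (r i) * r i)"
      proof -
        have "r i * z = cj (r i) z * r i" using r_nonzero[OF i] by (simp add: cj_left)
        moreover have "c (r i) * cj (r i) z = cj (r i) z * c (r i)"
          by (rule K_comm[OF cK K_normalized[OF r[OF i] z]])
        ultimately show ?thesis by (simp add: mult.assoc) (simp add: mult.assoc[symmetric])
      qed
      moreover have "d * z = cj (r i) z * d" if "i = l"
        using l(2) z that H_comm[OF d z] by simp
      ultimately show "a i * z = cj (r i) z * a i"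
        by (auto simp: a_def left_diff_distrib right_diff_distrib)
    next
      show "sum a {..<k} = 0" using l(1) dsum by (simp add: a_def sum_subtractf)
      show "cj (r i) z * cj (r j) w = cj (r j) w * cj (r i) z"
        if "i \<in> {..<k}" "j \<in> {..<k}" "z \<in> K" "w \<in> K" for i j z w
        using that r by (intro K_comm K_normalized) auto
    qed (use dist in auto)
    then have "d = c (r l) * r l" using l(1) by (auto simp: a_def)
    moreover have "inverse 1 * r l \<in> H" unfolding H_def
      by (rule cj_trivial_on) (use rl l(2) in auto)
    then have "r l \<in> K" using sub rl(2) M_in_G by auto
    moreover have "c (r l) \<in> K" using c(1) l(1) by blast
    ultimately show "d \<in> K" using div_subringD(6)[OF Kd] by simp
  qed
qed

end

section \<open>Groups, fields and dimensions inside the division ring\<close>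

lemma D_ring_simps [simp]:
  "carrier D_ring = UNIV" "x \<otimes>\<^bsub>D_ring\<^esub> y = x * y" "\<one>\<^bsub>D_ring\<^esub> = 1" "\<zero>\<^bsub>D_ring\<^esub> = 0" "x \<oplus>\<^bsub>D_ring\<^esub> y = x + y"
  by (simp_all add: ring_of_type_algebra_def)

lemma D_ring_minus [simp]: "\<ominus>\<^bsub>D_ring\<^esub> x = - x"
proof -
  interpret ring "D_ring :: 'a ring" by (rule ring_D_ring)
  show ?thesis by (rule minus_equality) simp_all
qed

lemma D_ring_inv: "x \<noteq> 0 \<Longrightarrow> inv\<^bsub>D_ring\<^esub> x = inverse x"
  by (rule monoid.inv_char[OF ring.is_monoid[OF ring_D_ring]]) simp_all

lemma D_units_simps [simp]: "x \<otimes>\<^bsub>D_units\<^esub> y = x * y" "\<one>\<^bsub>D_units\<^esub> = 1"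
  by (simp_all add: units_of_def)

abbreviation grp :: "'a::division_ring set \<Rightarrow> 'a monoid" where
  "grp A \<equiv> D_units\<lparr>carrier := A\<rparr>"

lemma subgroup_D_units: "mult_group A \<Longrightarrow> subgroup A D_units"
proof (rule subgroup.intro)
  assume A: "mult_group A"
  show "A \<subseteq> carrier D_units" using mult_groupD(2)[OF A] by (auto simp: carrier_D_units)
  fix x assume x: "x \<in> A"
  have "inv\<^bsub>D_units\<^esub> x = inverse x"
    by (rule group.inv_equality[OF group_D_units]) (use mult_groupD(3)[OF A x] in \<open>simp_all add: carrier_D_units\<close>)
  then show "inv\<^bsub>D_units\<^esub> x \<in> A" using mult_groupD(5)[OF A x] by simp
qed (use mult_groupD(1,4) in auto)

lemma group_grp: "mult_group A \<Longrightarrow> group (grp A)"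
  by (rule subgroup.subgroup_is_group[OF subgroup_D_units group_D_units])

lemma grp_inv: "mult_group A \<Longrightarrow> x \<in> A \<Longrightarrow> inv\<^bsub>grp A\<^esub> x = inverse x"
  by (rule group.inv_equality[OF group_grp]) (auto dest: mult_groupD(3) intro: mult_groupD(5))

lemma subgroup_grp_iff:
  assumes A: "mult_group A"
  shows "subgroup N (grp A) \<longleftrightarrow> mult_group N \<and> N \<subseteq> A"
proof
  assume N: "subgroup N (grp A)"
  have NA: "N \<subseteq> A" using subgroup.subset[OF N] by simp
  have "inverse x \<in> N" if "x \<in> N" for x
    using subgroup.m_inv_closed[OF N that] grp_inv[OF A] NA that by auto
  then show "mult_group N \<and> N \<subseteq> A"
    using NA subgroup.m_closed[OF N] subgroup.one_closed[OF N] mult_groupD(2)[OF A]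
    unfolding mult_group_def by auto
next
  assume N: "mult_group N \<and> N \<subseteq> A"
  show "subgroup N (grp A)"
  proof (rule subgroup.intro)
    show "inv\<^bsub>grp A\<^esub> x \<in> N" if "x \<in> N" for x
      using grp_inv[OF A, of x] N that mult_groupD(5)[of N x] by auto
  qed (use N mult_groupD(1,4)[of N] in auto)
qed

lemma normal_grp_iff:
  assumes A: "mult_group A"
  shows "N \<lhd> grp A \<longleftrightarrow> mult_group N \<and> N \<subseteq> A \<and> (\<forall>a\<in>A. \<forall>n\<in>N. cj a n \<in> N)"
  unfolding group.normal_inv_iff[OF group_grp[OF A]] subgroup_grp_iff[OF A]
  by (simp add: cj_def grp_inv[OF A] conj_assoc)

lemma subnormal_in_UNIV: "subnormal D_units A \<Longrightarrow> subnormal_in UNIV A"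
proof (induction rule: subnormal.induct)
  case whole
  then show ?case using subnormal_in.units[of UNIV] by (simp add: carrier_D_units)
next
  case (step B N)
  have "mult_group B" by (rule subnormal_in_group[OF step.IH div_subring_UNIV])
  then have "mult_group N \<and> N \<subseteq> B \<and> (\<forall>a\<in>B. \<forall>n\<in>N. cj a n \<in> N)" using step.hyps normal_grp_iff by blast
  then show ?case by (intro subnormal_in.step[OF step.IH]) auto
qed

lemma generate_field_eq_div_gen: "generate_field D_ring T = div_gen T"
proof
  show "generate_field D_ring T \<subseteq> div_gen T"
  proof
    fix x assume "x \<in> generate_field D_ring T"
    then show "x \<in> div_gen T"
    proof (induction rule: generate_field.induct)
      case one
      then show ?case using div_subringD(2)[OF div_subring_div_gen] by simp
    next
      case (incl h)
      then show ?case using div_gen_superset[of T] by blast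
    next
      case (a_inv h)
      then show ?case using div_subringD(4)[OF div_subring_div_gen] by simp
    next
      case (m_inv h)
      then show ?case using D_ring_inv[of h] div_subringD(7)[OF div_subring_div_gen] by simp
    next
      case (eng_add h1 h2)
      then show ?case using div_subringD(3)[OF div_subring_div_gen] by simp
    next
      case (eng_mult h1 h2)
      then show ?case using div_subringD(6)[OF div_subring_div_gen] by simp
    qed
  qed
  have one: "1 \<in> generate_field D_ring T" using generate_field.one[of D_ring T] by simp
  have neg: "- x \<in> generate_field D_ring T" if "x \<in> generate_field D_ring T" for x
    using generate_field.a_inv[OF that] by simp
  have add: "x + y \<in> generate_field D_ring T" if "x \<in> generate_field D_ring T" "y \<in> generate_field D_ring T" for x y
    using generate_field.eng_add[OF that] by simp
  have mult: "x * y \<in> generate_field D_ring T" if "x \<in> generate_field D_ring T" "y \<in> generate_field D_ring T" for x y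
    using generate_field.eng_mult[OF that] by simp
  have zero: "0 \<in> generate_field D_ring T" using add[OF one neg[OF one]] by simp
  have "inverse x \<in> generate_field D_ring T" if "x \<in> generate_field D_ring T" for x
    using generate_field.m_inv[OF that] D_ring_inv[of x] zero by (cases "x = 0") simp_all
  then have "div_subring (generate_field D_ring T)"
    unfolding div_subring_def by (intro conjI ballI one neg add mult zero)
  then show "div_gen T \<subseteq> generate_field D_ring T"
    by (rule div_gen_least) (rule subsetI, rule generate_field.incl)
qed

lemma adjoin_eq: "adjoin T = div_gen (D_center \<union> T)"
  by (simp add: adjoin_def generate_field_eq_div_gen)

lemma conjugates_eq: "conjugates x A = (\<lambda>m. cj m x) ` A"
  by (auto simp: conjugates_def cj_def)

lemma subfield_D_ring:
  assumes P: "div_subring P" "P \<subseteq> centralizer P"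
  shows "subfield P D_ring"
proof -
  interpret ring "D_ring :: 'a ring" by (rule ring_D_ring)
  have "subring P D_ring"
    by (rule subringI) (use div_subringD(2-4,6)[OF P(1)] in auto)
  then have "subcring P D_ring"
    by (rule subcringI) (use P(2) centralizerD in auto)
  moreover have "Units (D_ring\<lparr>carrier := P\<rparr>) = P - {0}"
  proof
    show "Units (D_ring\<lparr>carrier := P\<rparr>) \<subseteq> P - {0}" by (auto simp: Units_def)
    show "P - {0} \<subseteq> Units (D_ring\<lparr>carrier := P\<rparr>)"
      using div_subringD(7)[OF P(1)] by (auto simp: Units_def intro!: bexI[of _ "inverse _"])
  qed
  ultimately show ?thesis by (intro subfieldI) simp_all
qed

lemma combine_map:
  "ring.combine D_ring (map f xs) (map c xs) = sum_list (map (\<lambda>i. f i * c i) xs)"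
  by (induction xs) (simp_all add: ring.combine.simps[OF ring_D_ring])

lemma combine_upt:
  "ring.combine D_ring (map f [0..<k]) (map c [0..<k]) = (\<Sum>i<k. f i * c i)"
  unfolding combine_map by (simp add: interv_sum_list_conv_sum_set_nat atLeast0LessThan)

lemma Span_upt:
  assumes P: "subfield P D_ring"
  shows "ring.Span D_ring P (map c [0..<k]) = {(\<Sum>i<k. f i * c i) | f. \<forall>i<k. f i \<in> P}"
proof -
  have "ring.Span D_ring P (map c [0..<k]) =
      {ring.combine D_ring Ks (map c [0..<k]) | Ks. length Ks = length (map c [0..<k]) \<and> set Ks \<subseteq> P}"
    by (rule ring.Span_eq_combine_set_length_version[OF ring_D_ring P]) simp
  also have "\<dots> = {(\<Sum>i<k. f i * c i) | f. \<forall>i<k. f i \<in> P}"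
  proof (intro equalityI subsetI)
    fix x assume "x \<in> {ring.combine D_ring Ks (map c [0..<k]) | Ks. length Ks = length (map c [0..<k]) \<and> set Ks \<subseteq> P}"
    then obtain Ks where Ks: "x = ring.combine D_ring Ks (map c [0..<k])" "length Ks = k" "set Ks \<subseteq> P" by auto
    have "Ks = map (nth Ks) [0..<k]" using map_nth[of Ks] Ks(2) by simp
    then have "x = (\<Sum>i<k. Ks ! i * c i)" using combine_upt[of "nth Ks" k c] Ks(1) by simp
    moreover have "\<forall>i<k. Ks ! i \<in> P" using Ks(2,3) by (auto simp: subset_iff)
    ultimately show "x \<in> {(\<Sum>i<k. f i * c i) | f. \<forall>i<k. f i \<in> P}" by blast
  next
    fix x assume "x \<in> {(\<Sum>i<k. f i * c i) | f. \<forall>i<k. f i \<in> P}"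
    then obtain f where f: "x = (\<Sum>i<k. f i * c i)" "\<forall>i<k. f i \<in> P" by blast
    show "x \<in> {ring.combine D_ring Ks (map c [0..<k]) | Ks. length Ks = length (map c [0..<k]) \<and> set Ks \<subseteq> P}"
      by (rule CollectI, rule exI[of _ "map f [0..<k]"]) (use f in \<open>auto simp: combine_upt\<close>)
  qed
  finally show ?thesis .
qed

lemma dimension_if_basis:
  assumes P: "subfield P D_ring" and k: "k > 0"
    and ind: "\<And>f i. (\<And>i. i < k \<Longrightarrow> f i \<in> P) \<Longrightarrow> (\<Sum>i<k. f i * c i) = 0 \<Longrightarrow> i < k \<Longrightarrow> f i = 0"
    and E: "E = {(\<Sum>i<k. f i * c i) | f. \<forall>i<k. f i \<in> P}"
  shows "ring.dimension D_ring k P E"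
proof -
  interpret ring "D_ring :: 'a ring" by (rule ring_D_ring)
  have "independent P (map c [0..<k])"
  proof (rule ccontr)
    assume "dependent P (map c [0..<k])"
    then obtain Ks where Ks: "length Ks = length (map c [0..<k])" "combine Ks (map c [0..<k]) = \<zero>\<^bsub>D_ring\<^esub>"
      "set Ks \<subseteq> P" "set Ks \<noteq> {\<zero>\<^bsub>D_ring\<^esub>}"
      using dependent_imp_non_trivial_combine[OF P, of "map c [0..<k]"] by auto
    have len: "length Ks = k" using Ks(1) by simp
    have "Ks = map (nth Ks) [0..<k]" using map_nth[of Ks] len by simp
    then have "(\<Sum>i<k. Ks ! i * c i) = 0" using combine_upt[of "nth Ks" k c] Ks(2) by simp
    moreover have "Ks ! i \<in> P" if "i < k" for i using Ks(3) len that nth_mem by blast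
    ultimately have z: "Ks ! i = 0" if "i < k" for i using ind[of "nth Ks"] that by blast
    have "set Ks \<subseteq> {0}" using z len by (auto simp: in_set_conv_nth)
    moreover have "set Ks \<noteq> {}" using k len by auto
    ultimately have "set Ks = {0}" using subset_singletonD by metis
    then show False using Ks(4) by simp
  qed
  then have "dimension (length (map c [0..<k])) P E" by (rule dimensionI[OF P]) (simp only: Span_upt[OF P] E)
  then show ?thesis by simp
qed

subsection \<open>The lower central series\<close>

lemma cj_generate:
  assumes N: "mult_group N" and T: "T \<subseteq> N" and m: "m \<noteq> 0" "\<And>t. t \<in> T \<Longrightarrow> cj m t \<in> T"
    and x: "x \<in> generate (grp N) T"
  shows "cj m x \<in> generate (grp N) T"
  using x
proof (induction rule: generate.induct)
  case one
  then show ?case using generate.one[of "grp N" T] m(1) by simp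
next
  case (incl h)
  then show ?case by (intro generate.incl m(2))
next
  case (inv h)
  have hN: "h \<in> N" "cj m h \<in> N" using inv m(2)[OF inv] T by auto
  have "cj m (inv\<^bsub>grp N\<^esub> h) = inv\<^bsub>grp N\<^esub> (cj m h)"
    unfolding grp_inv[OF N hN(1)] grp_inv[OF N hN(2)] by (rule cj_inverse[OF m(1)])
  then show ?case using generate.inv[where G = "grp N", OF m(2)[OF inv]] by (simp only:)
next
  case (eng h1 h2)
  then show ?case using generate.eng[of "cj m h1" "grp N" T "cj m h2"] m(1) by (simp add: cj_mult)
qed

context
  fixes N :: "'a::division_ring set"
  assumes N: "mult_group N"
begin

lemma commutator_eq:
  assumes "x \<in> N" "y \<in> N"
  shows "x \<otimes>\<^bsub>grp N\<^esub> y \<otimes>\<^bsub>grp N\<^esub> inv\<^bsub>grp N\<^esub> x \<otimes>\<^bsub>grp N\<^esub> inv\<^bsub>grp N\<^esub> y = x * y * inverse x * inverse y"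
  using assms by (simp add: grp_inv[OF N])

lemma lower_central_Suc:
  assumes "lower_central (grp N) i \<subseteq> N"
  shows "lower_central (grp N) (Suc i) =
    generate (grp N) {x * y * inverse x * inverse y | x y. x \<in> lower_central (grp N) i \<and> y \<in> N}"
proof -
  have "v = x \<otimes>\<^bsub>grp N\<^esub> y \<otimes>\<^bsub>grp N\<^esub> inv\<^bsub>grp N\<^esub> x \<otimes>\<^bsub>grp N\<^esub> inv\<^bsub>grp N\<^esub> y \<and>
      x \<in> lower_central (grp N) i \<and> y \<in> carrier (grp N) \<longleftrightarrow>
    v = x * y * inverse x * inverse y \<and> x \<in> lower_central (grp N) i \<and> y \<in> N" for v x y
  proof (cases "x \<in> lower_central (grp N) i \<and> y \<in> N")
    case True
    then have "x \<in> N" "y \<in> N" using assms by auto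
    from commutator_eq[OF this] show ?thesis using True by simp
  qed auto
  then show ?thesis by (simp only: lower_central.simps)
qed

lemma commutators_in: "A \<subseteq> N \<Longrightarrow> {x * y * inverse x * inverse y | x y. x \<in> A \<and> y \<in> N} \<subseteq> N"
  by (auto intro!: mult_groupD(4,5)[OF N])

lemma lower_central_group: "mult_group (lower_central (grp N) i) \<and> lower_central (grp N) i \<subseteq> N"
proof (induction i)
  case (Suc i)
  have "subgroup (lower_central (grp N) (Suc i)) (grp N)"
    unfolding lower_central_Suc[OF conjunct2[OF Suc]]
    by (rule group.generate_is_subgroup[OF group_grp[OF N]]) (use commutators_in Suc in simp)
  then show ?case using subgroup_grp_iff[OF N] by blast
qed (use N in simp)

lemma lower_central_normal:
  assumes m: "m \<noteq> 0" "\<And>n. n \<in> N \<Longrightarrow> cj m n \<in> N" and x: "x \<in> lower_central (grp N) i"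
  shows "cj m x \<in> lower_central (grp N) i"
  using x
proof (induction i arbitrary: x)
  case (Suc i)
  note sub = conjunct2[OF lower_central_group[of i]]
  show ?case
    unfolding lower_central_Suc[OF sub]
  proof (rule cj_generate[OF N commutators_in[OF sub] m(1)])
    show "x \<in> generate (grp N) {x * y * inverse x * inverse y | x y. x \<in> lower_central (grp N) i \<and> y \<in> N}"
      using Suc.prems unfolding lower_central_Suc[OF sub] .
    fix t assume "t \<in> {x * y * inverse x * inverse y | x y. x \<in> lower_central (grp N) i \<and> y \<in> N}"
    then obtain u v where t: "t = u * v * inverse u * inverse v" "u \<in> lower_central (grp N) i" "v \<in> N" by blast
    have "cj m t = cj m u * cj m v * inverse (cj m u) * inverse (cj m v)"
      using m(1) by (simp add: t(1) cj_mult cj_inverse)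
    then show "cj m t \<in> {x * y * inverse x * inverse y | x y. x \<in> lower_central (grp N) i \<and> y \<in> N}"
      using Suc.IH[OF t(2)] m(2)[OF t(3)] by blast
  qed
qed (use m in simp)

lemma commutator_in_lower_central:
  assumes "x \<in> lower_central (grp N) i" "y \<in> N"
  shows "x * y * inverse x * inverse y \<in> lower_central (grp N) (Suc i)"
  unfolding lower_central_Suc[OF conjunct2[OF lower_central_group]]
  by (rule generate.incl) (use assms in blast)

lemma nilpotent_if_commutative:
  assumes "\<And>x y. x \<in> N \<Longrightarrow> y \<in> N \<Longrightarrow> x * y = y * x"
  shows "nilpotent_group (grp N)"
proof -
  interpret group "grp N" by (rule group_grp[OF N])
  have "x * y * inverse x * inverse y = 1" if "x \<in> N" "y \<in> N" for x y
  proof -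
    have nz: "x \<noteq> 0" "y \<noteq> 0" using that mult_groupD(3)[OF N] by auto
    have "x * y * inverse x * inverse y = y * (x * inverse x) * inverse y"
      using assms[OF that] by (simp only: mult.assoc)
    then show ?thesis using nz by simp
  qed
  then have "{x * y * inverse x * inverse y | x y. x \<in> N \<and> y \<in> N} = {\<one>\<^bsub>grp N\<^esub>}"
    using mult_groupD(1)[OF N] by (auto intro!: exI[of _ 1])
  then have "lower_central (grp N) (Suc 0) = {\<one>\<^bsub>grp N\<^esub>}"
    using lower_central_Suc[of 0] generate_one by simp
  then show ?thesis unfolding nilpotent_group_def using group_axioms by blast
qed

end

context maximal_with_finite_class
begin

theorem fitting_subgroup_eq: "fitting_subgroup (grp M) = G \<inter> K"
proof -
  interpret gM: group "grp M" by (rule group_grp[OF M(1)])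
  have GK: "mult_group (G \<inter> K)" by (rule mult_group_Int[OF Ggrp Kd])
  show ?thesis
  proof
    have "N \<subseteq> G \<inter> K" if N: "N \<lhd> grp M" "nilpotent_group (grp N)" for N
    proof -
      have N': "mult_group N" "N \<subseteq> M" "\<And>a n. a \<in> M \<Longrightarrow> n \<in> N \<Longrightarrow> cj a n \<in> N"
        using N(1) normal_grp_iff[OF M(1)] by auto
      obtain c where c: "lower_central (grp N) c = {\<one>\<^bsub>grp N\<^esub>}" using N(2) unfolding nilpotent_group_def by blast
      have "lower_central (grp N) 0 \<subseteq> K"
      proof (rule nilpotent_normal_in_K)
        show "mult_group (lower_central (grp N) i)" "lower_central (grp N) i \<subseteq> M"
          "lower_central (grp N) i \<subseteq> lower_central (grp N) 0" for i
          using lower_central_group[OF N'(1), of i] N'(2) by auto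
        show "cj m x \<in> lower_central (grp N) i" if "m \<in> M" "x \<in> lower_central (grp N) i" for m x i
          using lower_central_normal[OF N'(1) M_nonzero[OF that(1)] N'(3)[OF that(1)] that(2)] .
        show "x * y * inverse x * inverse y \<in> lower_central (grp N) (Suc i)"
          if "x \<in> lower_central (grp N) i" "y \<in> lower_central (grp N) 0" for x y i
          by (rule commutator_in_lower_central[OF N'(1) that(1)]) (use that(2) in simp)
        show "lower_central (grp N) c = {1}" using c by simp
      qed
      then show ?thesis using N'(2) M(2) by auto
    qed
    then have "\<Union>{N. N \<lhd> grp M \<and> nilpotent_group ((grp M)\<lparr>carrier := N\<rparr>)} \<subseteq> G \<inter> K" by auto
    moreover have "subgroup (G \<inter> K) (grp M)" using GK K_Int_G subgroup_grp_iff[OF M(1)] by blast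
    ultimately show "fitting_subgroup (grp M) \<subseteq> G \<inter> K"
      unfolding fitting_subgroup_def by (rule gM.generate_subgroup_incl)
    have "cj m x \<in> G \<inter> K" if "m \<in> M" "x \<in> G \<inter> K" for m x
      using that K_normalized mult_groupD(6)[OF Ggrp] M(2) by blast
    then have "G \<inter> K \<lhd> grp M" unfolding normal_grp_iff[OF M(1)] using GK K_Int_G by blast
    moreover have "nilpotent_group (grp (G \<inter> K))"
      by (rule nilpotent_if_commutative[OF GK]) (use K_comm in blast)
    ultimately show "G \<inter> K \<subseteq> fitting_subgroup (grp M)"
      unfolding fitting_subgroup_def by (auto intro: generate.incl)
  qed
qed

subsection \<open>The Galois group\<close>

abbreviation gal :: "('a \<Rightarrow> 'a) monoid" where "gal \<equiv> galois_group D_ring K D_center"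

definition act :: "'a \<Rightarrow> 'a \<Rightarrow> 'a" where "act m = restrict (cj m) K"

lemma act_eq_iff: "act m = act n \<longleftrightarrow> (\<forall>z\<in>K. cj m z = cj n z)"
proof
  assume e: "act m = act n"
  show "\<forall>z\<in>K. cj m z = cj n z"
  proof
    fix z assume "z \<in> K"
    then show "cj m z = cj n z" using fun_cong[OF e, of z] by (simp add: act_def)
  qed
qed (auto simp: act_def intro: restrict_ext)

lemma act_Bij: assumes m: "m \<in> M" shows "act m \<in> Bij K"
proof -
  have "bij_betw (act m) K K"
  proof (rule bij_betwI[where g = "act (inverse m)"])
    show "act m \<in> K \<rightarrow> K" using K_normalized[OF m] by (auto simp: act_def)
    show "act (inverse m) \<in> K \<rightarrow> K" using K_normalized[OF mult_groupD(5)[OF M(1) m]] by (auto simp: act_def)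
    show "act (inverse m) (act m x) = x" if "x \<in> K" for x
      using that K_normalized[OF m that] M_nonzero[OF m] by (simp add: act_def)
    show "act m (act (inverse m) y) = y" if "y \<in> K" for y
      using that K_normalized[OF mult_groupD(5)[OF M(1) m] that] M_nonzero[OF m] by (simp add: act_def)
  qed
  then show ?thesis by (simp add: Bij_def act_def)
qed

text \<open>Every automorphism over the fixed field of \<open>M\<close> comes from \<open>M\<close>, by Artin's theorem.\<close>

lemma carrier_gal: "carrier gal = act ` M"
proof
  show "act ` M \<subseteq> carrier gal"
  proof clarify
    fix m assume m: "m \<in> M"
    have "act m \<in> ring_hom (D_ring\<lparr>carrier := K\<rparr>) (D_ring\<lparr>carrier := K\<rparr>)"
    proof (rule ring_hom_memI)
      fix x y assume "x \<in> carrier (D_ring\<lparr>carrier := K\<rparr>)" "y \<in> carrier (D_ring\<lparr>carrier := K\<rparr>)"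
      then have xy: "x \<in> K" "y \<in> K" by simp_all
      show "act m x \<in> carrier (D_ring\<lparr>carrier := K\<rparr>)" using K_normalized[OF m xy(1)] xy by (simp add: act_def)
      show "act m (x \<otimes>\<^bsub>D_ring\<lparr>carrier := K\<rparr>\<^esub> y) = act m x \<otimes>\<^bsub>D_ring\<lparr>carrier := K\<rparr>\<^esub> act m y"
        using xy div_subringD(6)[OF Kd xy] M_nonzero[OF m] by (simp add: act_def cj_mult)
      show "act m (x \<oplus>\<^bsub>D_ring\<lparr>carrier := K\<rparr>\<^esub> y) = act m x \<oplus>\<^bsub>D_ring\<lparr>carrier := K\<rparr>\<^esub> act m y"
        using xy div_subringD(3)[OF Kd xy] by (simp add: act_def cj_add)
    next
      show "act m \<one>\<^bsub>D_ring\<lparr>carrier := K\<rparr>\<^esub> = \<one>\<^bsub>D_ring\<lparr>carrier := K\<rparr>\<^esub>"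
        using div_subringD(2)[OF Kd] M_nonzero[OF m] by (simp add: act_def)
    qed
    moreover have "\<forall>x\<in>D_center. act m x = x" using FK central_cj M_nonzero[OF m] by (auto simp: act_def)
    ultimately show "act m \<in> carrier gal" using act_Bij[OF m] by (simp add: galois_group_def)
  qed
  show "carrier gal \<subseteq> act ` M"
  proof
    fix \<sigma> assume "\<sigma> \<in> carrier gal"
    then have \<sigma>: "\<sigma> \<in> Bij K" "\<sigma> \<in> ring_hom (D_ring\<lparr>carrier := K\<rparr>) (D_ring\<lparr>carrier := K\<rparr>)" "\<forall>x\<in>D_center. \<sigma> x = x"
      by (auto simp: galois_group_def)
    obtain k :: nat and r where ga: "galois_action K K M k r" by (rule galois_action_K)
    interpret galois_action K K M k r by (rule ga)
    have "\<exists>i<k. \<forall>z\<in>K. \<sigma> z = cj (r i) z"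
    proof (rule hom_is_conjugation[OF refl])
      show "\<sigma> z \<in> K" if "z \<in> K" for z using ring_hom_closed[OF \<sigma>(2), of z] that by simp
      show "\<sigma> (z + w) = \<sigma> z + \<sigma> w" if "z \<in> K" "w \<in> K" for z w using ring_hom_add[OF \<sigma>(2), of z w] that by simp
      show "\<sigma> (z * w) = \<sigma> z * \<sigma> w" if "z \<in> K" "w \<in> K" for z w using ring_hom_mult[OF \<sigma>(2), of z w] that by simp
      show "\<sigma> z = z" if "z \<in> K \<inter> centralizer M" for z using \<sigma>(3) that fixed_field by blast
    qed
    then obtain i where i: "i < k" "\<forall>z\<in>K. \<sigma> z = cj (r i) z" by blast
    have "\<sigma> = act (r i)"
      by (rule extensionalityI[of _ K]) (use Bij_imp_extensional[OF \<sigma>(1)] i(2) in \<open>simp_all add: act_def\<close>)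
    then show "\<sigma> \<in> act ` M" using r[OF i(1)] by blast
  qed
qed

lemma act_mult: assumes "m \<in> M" "n \<in> M" shows "act (m * n) = compose K (act m) (act n)"
  by (rule extensionalityI[of _ K]) (use K_normalized[OF assms(2)] in \<open>simp_all add: act_def compose_def cj_cj\<close>)

lemma act_hom_BijGroup: "group_hom (grp M) (BijGroup K) act"
proof (intro group_hom.intro group_hom_axioms.intro group_grp[OF M(1)] group_BijGroup homI)
  show "act x \<in> carrier (BijGroup K)" if "x \<in> carrier (grp M)" for x
    using act_Bij that by (simp add: BijGroup_def)
  show "act (x \<otimes>\<^bsub>grp M\<^esub> y) = act x \<otimes>\<^bsub>BijGroup K\<^esub> act y" if "x \<in> carrier (grp M)" "y \<in> carrier (grp M)" for x y
    using act_Bij act_mult that by (simp add: BijGroup_def)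
qed

lemma gal_eq: "gal = (BijGroup K)\<lparr>carrier := act ` M\<rparr>"
  using carrier_gal by (simp add: galois_group_def)

lemma group_gal: "group gal"
  unfolding gal_eq
  using group_hom.img_is_subgroup[OF act_hom_BijGroup] by (intro subgroup.subgroup_is_group[OF _ group_BijGroup]) simp

lemma act_hom: "group_hom (grp M) gal act"
proof (intro group_hom.intro group_hom_axioms.intro group_grp[OF M(1)] group_gal homI)
  show "act x \<in> carrier gal" if "x \<in> carrier (grp M)" for x
    using carrier_gal that by simp
  show "act (x \<otimes>\<^bsub>grp M\<^esub> y) = act x \<otimes>\<^bsub>gal\<^esub> act y" if "x \<in> carrier (grp M)" "y \<in> carrier (grp M)" for x y
    using group_hom.hom_mult[OF act_hom_BijGroup that] by (simp add: gal_eq)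
qed

lemma one_gal: "\<one>\<^bsub>gal\<^esub> = act 1"
  using group_hom.hom_one[OF act_hom] by simp

lemma act_eq_one_iff: assumes m: "m \<in> M" shows "act m = \<one>\<^bsub>gal\<^esub> \<longleftrightarrow> m \<in> H"
proof -
  have "act m = \<one>\<^bsub>gal\<^esub> \<longleftrightarrow> (\<forall>z\<in>K. cj m z = cj 1 z)" by (simp only: one_gal act_eq_iff)
  also have "\<dots> \<longleftrightarrow> m \<in> H" using cj_eq_iff[OF M_nonzero[OF m]] by (simp add: H_def centralizer_def)
  finally show ?thesis .
qed

lemma kernel_act: "kernel (grp M) gal act = G \<inter> H"
  using act_eq_one_iff H_Int_G M(2) by (auto simp: kernel_def)

theorem H_Int_G_normal: "G \<inter> H \<lhd> grp M"
  using group_hom.normal_kernel[OF act_hom] by (simp add: kernel_act)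

theorem Mod_iso_gal: "grp M Mod (G \<inter> H) \<cong> gal"
  using group_hom.FactGroup_iso[OF act_hom] by (simp add: kernel_act carrier_gal)

lemma finite_gal: "finite (carrier gal)"
  using finite_action by (simp add: carrier_gal finite_action_def act_def)

text \<open>A normal subgroup of the Galois group is the image of a normal subgroup \<open>N\<close> of \<open>M\<close>. If the fixed field of
  \<open>N\<close> is the center, Artin's theorem for \<open>N\<close> shows that \<open>N\<close> induces all automorphisms.\<close>

theorem simple_gal: "simple_group gal"
proof (intro simple_group.intro group_gal simple_group_axioms.intro)
  obtain m where m: "m \<in> M" "m \<notin> H" using not_central by blast
  have "act m \<noteq> \<one>\<^bsub>gal\<^esub>" using act_eq_one_iff[OF m(1)] m(2) by simp
  then have "{act m, \<one>\<^bsub>gal\<^esub>} \<subseteq> carrier gal" "card {act m, \<one>\<^bsub>gal\<^esub>} = 2"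
    using m(1) group.is_monoid[OF group_gal] monoid.one_closed by (auto simp: carrier_gal[symmetric]) (simp add: carrier_gal)
  then have "2 \<le> card (carrier gal)" using card_mono[OF finite_gal] by metis
  then show "1 < Coset.order gal" by (simp add: Coset.order_def)
next
  fix \<N> assume normal: "\<N> \<lhd> gal"
  interpret act: group_hom "grp M" gal act by (rule act_hom)
  have sub: "subgroup \<N> gal" using normal group.normal_inv_iff[OF group_gal] by blast
  have conj: "x \<otimes>\<^bsub>gal\<^esub> h \<otimes>\<^bsub>gal\<^esub> inv\<^bsub>gal\<^esub> x \<in> \<N>" if "x \<in> carrier gal" "h \<in> \<N>" for x h
    using normal group.normal_inv_iff[OF group_gal] that by blast
  define N where "N = {m \<in> M. act m \<in> \<N>}"
  have act_mul: "act (x * y) = act x \<otimes>\<^bsub>gal\<^esub> act y" if "x \<in> M" "y \<in> M" for x y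
    using act.hom_mult[of x y] that by simp
  have act_inv: "act (inverse x) = inv\<^bsub>gal\<^esub> (act x)" if "x \<in> M" for x
    using act.hom_inv[of x] grp_inv[OF M(1) that] that by simp
  have Ngrp: "mult_group N"
    unfolding mult_group_def
  proof (intro conjI ballI)
    show "1 \<in> N" using mult_groupD(1)[OF M(1)] subgroup.one_closed[OF sub] by (simp add: N_def one_gal)
    show "0 \<notin> N" using mult_groupD(2)[OF M(1)] by (simp add: N_def)
    fix x assume x: "x \<in> N"
    show "inverse x \<in> N" using x act_inv mult_groupD(5)[OF M(1)] subgroup.m_inv_closed[OF sub] by (simp add: N_def)
    fix y assume y: "y \<in> N"
    show "x * y \<in> N" using x y act_mul mult_groupD(4)[OF M(1)] subgroup.m_closed[OF sub] by (simp add: N_def)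
  qed
  have NM: "N \<subseteq> M" by (auto simp: N_def)
  have Nnormal: "cj m n \<in> N" if m: "m \<in> M" and n: "n \<in> N" for m n
  proof -
    have nM: "n \<in> M" using n NM by blast
    have "act (cj m n) = act m \<otimes>\<^bsub>gal\<^esub> act n \<otimes>\<^bsub>gal\<^esub> inv\<^bsub>gal\<^esub> (act m)"
      unfolding cj_def using act_mul act_inv m nM mult_groupD(4,5)[OF M(1)] by simp
    also have "\<dots> \<in> \<N>" by (rule conj) (use m n in \<open>simp_all add: carrier_gal N_def\<close>)
    finally show ?thesis using mult_groupD(6)[OF M(1) m nM] by (simp add: N_def)
  qed
  have N_img: "\<N> = act ` N"
    using subgroup.subset[OF sub] by (auto simp: N_def carrier_gal)
  from normal_subgroup_dichotomy[OF Ngrp NM Nnormal] show "\<N> = carrier gal \<or> \<N> = {\<one>\<^bsub>gal\<^esub>}"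
  proof
    assume "N \<subseteq> H"
    then have "\<N> \<subseteq> {\<one>\<^bsub>gal\<^esub>}" unfolding N_img using act_eq_one_iff NM by blast
    then show ?thesis using subgroup.one_closed[OF sub] by blast
  next
    assume fixed: "K \<inter> centralizer N = D_center"
    have "finite_action N K"
      using finite_action NM unfolding finite_action_def by (meson finite_subset image_mono)
    then obtain k :: nat and r where r: "\<And>i. i < k \<Longrightarrow> r i \<in> N"
      and dist: "\<And>i j. i < k \<Longrightarrow> j < k \<Longrightarrow> i \<noteq> j \<Longrightarrow> \<exists>z\<in>K. cj (r i) z \<noteq> cj (r j) z"
      and cover: "\<And>m. m \<in> N \<Longrightarrow> \<exists>i<k. \<forall>z\<in>K. cj m z = cj (r i) z"
      by (rule finite_action_representatives) (rule that)
    have "galois_action K K N k r"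
      using K_field Ngrp K_normalized NM r dist cover by unfold_locales auto
    then interpret N: galois_action K K N k r .
    have "act m \<in> \<N>" if m: "m \<in> M" for m
    proof -
      have "\<exists>i<k. \<forall>z\<in>K. cj m z = cj (r i) z"
        by (rule N.hom_is_conjugation[OF refl])
          (use K_normalized[OF m] M_nonzero[OF m] central_cj fixed in \<open>auto simp: cj_add cj_mult\<close>)
      then obtain i where i: "i < k" "\<forall>z\<in>K. cj m z = cj (r i) z" by blast
      then have "act m = act (r i)" by (simp add: act_eq_iff)
      then show ?thesis using r[OF i(1)] by (simp add: N_def)
    qed
    then have "carrier gal \<subseteq> \<N>" by (auto simp: carrier_gal)
    then show ?thesis using subgroup.subset[OF sub] by blast
  qed
qed

subsection \<open>Dimensions\<close>

lemma subfield_K: "subfield K D_ring" by (rule subfield_D_ring[OF Kd K_field])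

lemma subfield_F: "subfield (D_center :: 'a set) D_ring"
  by (rule subfield_D_ring) (simp, rule centralizer_antimono, simp)

text \<open>The Artin basis is a basis of \<open>K\<close> over the center. Representatives \<open>r i\<close> of the action of \<open>M\<close> form a right
  basis of the division ring over \<open>H\<close>: the elements of type \<open>cj (r i)\<close> are exactly \<open>r i H\<close>, elements of
  different types are independent, and \<open>type_decomposition\<close> says that they span. Both bases have one element for each
  automorphism.\<close>

lemma dimensions:
  assumes ga: "galois_action K K M k r"
  shows "ring.dimension D_ring k D_center K" "right_dimension k H UNIV"
proof -
  interpret galois_action K K M k r by (rule ga)
  obtain c a where ca: "dual_bases c a" by (rule artin_basis)
  have k0: "k > 0" using cover[OF mult_groupD(1)[OF M(1)]] by auto
  show "ring.dimension D_ring k D_center K"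
  proof (rule dimension_if_basis[OF subfield_F k0, of c])
    fix f j assume f: "\<And>i. i < k \<Longrightarrow> f i \<in> D_center" and sum0: "(\<Sum>i<k. f i * c i) = 0" and j: "j < k"
    have fc: "f l * x = x * f l" if "l < k" for l x using D_centerD[OF f[OF that]] .
    have "(\<Sum>i<k. a j i * cj (r i) (\<Sum>l<k. f l * c l)) = (\<Sum>i<k. \<Sum>l<k. f l * (a j i * cj (r i) (c l)))"
      unfolding cj_sum sum_distrib_left
    proof (intro sum.cong refl)
      fix i l assume "i \<in> {..<k}" "l \<in> {..<k}"
      then have i: "i < k" and l: "l < k" by auto
      have "cj (r i) (f l * c l) = f l * cj (r i) (c l)"
        using central_cj[OF f[OF l] r_nonzero[OF i]] r_nonzero[OF i] by (simp add: cj_mult)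
      then have "a j i * cj (r i) (f l * c l) = (a j i * f l) * cj (r i) (c l)" by (simp add: mult.assoc)
      then show "a j i * cj (r i) (f l * c l) = f l * (a j i * cj (r i) (c l))"
        unfolding fc[OF l, symmetric] by (simp add: mult.assoc)
    qed
    also have "\<dots> = (\<Sum>l<k. f l * (\<Sum>i<k. a j i * cj (r i) (c l)))"
      by (subst sum.swap) (simp add: sum_distrib_left)
    also have "\<dots> = (\<Sum>l<k. if l = j then f l else 0)"
      by (intro sum.cong refl) (simp add: dual_basesD(3)[OF ca j])
    also have "\<dots> = f j" using j by simp
    finally show "f j = 0" by (simp add: sum0)
  next
    show "K = {(\<Sum>i<k. f i * c i) | f. \<forall>i<k. f i \<in> D_center}"
    proof (intro equalityI subsetI)
      fix z assume z: "z \<in> K"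
      have "\<forall>j<k. (\<Sum>i<k. a j i * cj (r i) z) \<in> D_center" using dual_basesD(5)[OF ca _ z] fixed_field by blast
      then show "z \<in> {(\<Sum>i<k. f i * c i) | f. \<forall>i<k. f i \<in> D_center}"
        using dual_basesD(6)[OF ca z] by (intro CollectI exI[of _ "\<lambda>j. \<Sum>i<k. a j i * cj (r i) z"] conjI)
    next
      fix z assume "z \<in> {(\<Sum>i<k. f i * c i) | f. \<forall>i<k. f i \<in> D_center}"
      then obtain f where f: "z = (\<Sum>i<k. f i * c i)" "\<forall>i<k. f i \<in> D_center" by blast
      show "z \<in> K" unfolding f(1)
        by (intro div_subring_sum[OF Kd] div_subringD(6)[OF Kd]) (use f(2) FK dual_basesD(1)[OF ca] in auto)
    qed
  qed
  have inj: "inj_on r {..<k}" unfolding inj_on_def using dist by fastforce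
  have "right_basis H UNIV (r ` {..<k})"
    unfolding right_basis_def
  proof (intro conjI allI impI)
    fix c assume c: "(\<forall>b\<in>r ` {..<k}. c b \<in> H) \<and> (\<Sum>b\<in>r ` {..<k}. b * c b) = 0"
    have "\<forall>i\<in>{..<k}. r i * c (r i) = 0"
    proof (rule independence_of_types[of _ K _ "\<lambda>i. cj (r i)"])
      fix i z assume "i \<in> {..<k}" and z: "z \<in> K"
      then have i: "i < k" by simp
      have "c (r i) * z = z * c (r i)" by (rule H_comm[OF _ z]) (use c i in blast)
      then have "r i * c (r i) * z = r i * z * c (r i)" by (simp add: mult.assoc)
      also have "r i * z = cj (r i) z * r i" using r_nonzero[OF i] by (simp add: cj_left)
      finally show "r i * c (r i) * z = cj (r i) z * (r i * c (r i))" by (simp add: mult.assoc)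
    next
      show "(\<Sum>i<k. r i * c (r i)) = 0" using c by (simp add: sum.reindex[OF inj])
      show "cj (r i) z * cj (r j) w = cj (r j) w * cj (r i) z"
        if "i \<in> {..<k}" "j \<in> {..<k}" "z \<in> K" "w \<in> K" for i j z w
        using that r by (intro K_comm K_normalized) auto
    qed (use dist in auto)
    then show "\<forall>b\<in>r ` {..<k}. c b = 0" using r_nonzero by auto
  next
    have "d \<in> {(\<Sum>b\<in>r ` {..<k}. b * c b) | c. \<forall>b\<in>r ` {..<k}. c b \<in> H}" for d
    proof -
      obtain \<pi> where \<pi>: "d = (\<Sum>i<k. \<pi> i)" "\<And>i z. i < k \<Longrightarrow> z \<in> K \<Longrightarrow> \<pi> i * z = cj (r i) z * \<pi> i"
        by (rule type_decomposition[of d]) (use fixed_field D_centerD that in auto)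
      define c where "c = (\<lambda>b. inverse b * \<pi> (inv_into {..<k} r b))"
      have cr: "c (r i) = inverse (r i) * \<pi> i" if "i < k" for i
        using that inv_into_f_f[OF inj, of i] by (simp add: c_def)
      have "c (r i) \<in> H" if i: "i < k" for i
      proof -
        have "c (r i) * z = z * c (r i)" if z: "z \<in> K" for z
        proof -
          have "c (r i) * z = inverse (r i) * cj (r i) z * \<pi> i" by (simp add: cr[OF i] mult.assoc \<pi>(2)[OF i z])
          also have "inverse (r i) * cj (r i) z = z * inverse (r i)"
            using r_nonzero[OF i] by (simp add: cj_def mult.assoc[symmetric])
          finally show ?thesis by (simp add: cr[OF i] mult.assoc)
        qed
        then show ?thesis by (simp add: H_def centralizer_def)
      qed
      moreover have "d = (\<Sum>b\<in>r ` {..<k}. b * c b)"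
        unfolding sum.reindex[OF inj] \<pi>(1)
      proof (rule sum.cong[OF refl])
        fix i assume "i \<in> {..<k}"
        then show "\<pi> i = ((\<lambda>b. b * c b) \<circ> r) i" using cr r_nonzero by (simp add: mult.assoc[symmetric])
      qed
      ultimately show ?thesis by blast
    qed
    then show "UNIV = {(\<Sum>b\<in>r ` {..<k}. b * c b) | c. \<forall>b\<in>r ` {..<k}. c b \<in> H}" by blast
  qed simp_all
  moreover have "card (r ` {..<k}) = k" using card_image[OF inj] by simp
  ultimately show "right_dimension k H UNIV" unfolding right_dimension_def by blast
qed

text \<open>The tower law for \<open>F \<subseteq> K \<subseteq> D\<close>.\<close>

lemma finite_dimension_if_H_Int_G_subset:
  assumes sub: "G \<inter> H \<subseteq> K"
  shows "ring.finite_dimension D_ring D_center (UNIV :: 'a set)"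
proof -
  interpret R: ring "D_ring :: 'a ring" by (rule ring_D_ring)
  obtain k :: nat and r where ga: "galois_action K K M k r" by (rule galois_action_K)
  interpret galois_action K K M k r by (rule ga)
  have inj: "inj_on r {..<k}" unfolding inj_on_def using dist by fastforce
  have "d \<in> R.Span K (map r [0..<k])" for d
  proof -
    have "d \<in> lin_span K (r ` {..<k})" using spanned_over_K[OF sub ga] by simp
    then obtain c where c: "\<forall>s\<in>r ` {..<k}. c s \<in> K" "d = (\<Sum>s\<in>r ` {..<k}. c s * s)"
      unfolding lin_span_def by blast
    have "d = (\<Sum>i<k. c (r i) * r i)" unfolding c(2) by (simp add: sum.reindex[OF inj])
    then show ?thesis unfolding Span_upt[OF subfield_K]
      using c(1) by (intro CollectI exI[of _ "\<lambda>i. c (r i)"]) auto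
  qed
  then have "R.Span K (map r [0..<k]) = UNIV" by blast
  then have "R.finite_dimension K UNIV" using R.Span_finite_dimension[OF subfield_K, of "map r [0..<k]"] by simp
  then obtain n where "R.dimension n K UNIV" by (rule R.finite_dimensionE')
  then have "R.dimension (k * n) D_center UNIV"
    by (rule R.telescopic_base[OF subfield_F subfield_K dimensions(1)[OF ga]])
  then show ?thesis by (rule R.finite_dimensionI)
qed

end

theorem theorem3p2:
  fixes F G M K H :: "'a::division_ring set" and \<alpha> :: 'a
  assumes F: "F = D_center"
    and G: "subnormal D_units G"
    and M: "maximal_subgroup (D_units\<lparr>carrier := G\<rparr>) M"
    and \<alpha>: "\<alpha> \<in> M" "\<alpha> \<notin> M \<inter> centralizer M" "finite (conjugates \<alpha> M)"
    and K: "K = adjoin (conjugates \<alpha> M)"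
    and H: "H = centralizer K"
  shows
    "(subfield K D_ring \<and>
      (\<exists>n. ring.dimension D_ring n F K \<and> right_dimension n H UNIV) \<and>
      adjoin M = UNIV) \<and>
     ((K - {0}) \<inter> G = FC_center M \<and>
      (K - {0}) \<inter> G = fitting_subgroup (D_units\<lparr>carrier := M\<rparr>)) \<and>
     (galois_extension D_ring K F \<and>
      (H - {0}) \<inter> G \<lhd> D_units\<lparr>carrier := M\<rparr> \<and>
      (D_units\<lparr>carrier := M\<rparr>) Mod ((H - {0}) \<inter> G) \<cong> galois_group D_ring K F \<and>
      finite (carrier (galois_group D_ring K F)) \<and>
      simple_group (galois_group D_ring K F)) \<and>
     ((H - {0}) \<inter> G \<subseteq> K \<longrightarrow>
      H = K \<and> ring.finite_dimension D_ring F UNIV)"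
proof -
  have Gsub: "subnormal_in UNIV G" by (rule subnormal_in_UNIV[OF G])
  have Ggrp: "mult_group G" by (rule subnormal_in_group[OF Gsub div_subring_UNIV])
  have M': "mult_group M" "M \<subseteq> G" "M \<noteq> G" "\<And>N. mult_group N \<Longrightarrow> M \<subseteq> N \<Longrightarrow> N \<subseteq> G \<Longrightarrow> N = M \<or> N = G"
    using M subgroup_grp_iff[OF Ggrp] unfolding maximal_subgroup_def by auto
  define C where "C = conjugates \<alpha> M"
  have \<alpha>C: "\<alpha> \<in> C" unfolding C_def conjugates_eq
    by (rule image_eqI[of _ _ 1]) (use mult_groupD(1)[OF M'(1)] in auto)
  interpret E: maximal_with_finite_class G M C
  proof unfold_locales
    show "C \<subseteq> M" unfolding C_def conjugates_eq using mult_groupD(6)[OF M'(1)] \<alpha>(1) by blast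
    show "cj m s \<in> C" if "m \<in> M" "s \<in> C" for m s
      using that mult_groupD(4)[OF M'(1)] unfolding C_def conjugates_eq by (auto simp: cj_cj)
    show "\<exists>s\<in>C. \<exists>m\<in>M. s * m \<noteq> m * s" using \<alpha>C \<alpha>(1,2) by (auto simp: centralizer_def)
  qed (use Gsub M' \<alpha>(3) in \<open>simp_all add: C_def\<close>)
  have KE: "K = E.K" unfolding K adjoin_eq E.K_def unfolding C_def ..
  have HE: "H = E.H" unfolding H KE E.H_def ..
  have G0: "(K - {0}) \<inter> G = G \<inter> E.K" "(H - {0}) \<inter> G = G \<inter> E.H"
    using mult_groupD(2)[OF Ggrp] by (auto simp: KE HE)
  obtain k :: nat and r where ga: "galois_action E.K E.K M k r" by (rule E.galois_action_K)
  have fixed: "{x \<in> E.K. \<forall>\<sigma>\<in>carrier E.gal. \<sigma> x = x} = D_center"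
  proof -
    have "(\<forall>\<sigma>\<in>carrier E.gal. \<sigma> x = x) \<longleftrightarrow> x \<in> centralizer M" if x: "x \<in> E.K" for x
    proof -
      have "E.act m x = x \<longleftrightarrow> x * m = m * x" if "m \<in> M" for m
        using x cj_eq_iff[OF E.M_nonzero[OF that]] by (auto simp: E.act_def)
      then show ?thesis unfolding E.carrier_gal by (simp add: centralizer_def)
    qed
    then show ?thesis using E.fixed_field by blast
  qed
  have "galois_extension D_ring E.K D_center"
    unfolding galois_extension_def
    using E.subfield_K E.subfield_F ring.finite_dimensionI[OF ring_D_ring E.dimensions(1)[OF ga]] fixed by blast
  moreover have "FC_center M = G \<inter> E.K"
    unfolding FC_center_def conjugates_eq E.FC_center_eq ..
  moreover have "adjoin M = UNIV" unfolding adjoin_eq by (rule E.generated)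
  moreover have "G \<inter> E.H \<subseteq> E.K \<longrightarrow> E.H = E.K \<and> ring.finite_dimension D_ring D_center (UNIV :: 'a set)"
    using E.H_eq_K E.finite_dimension_if_H_Int_G_subset by blast
  ultimately show ?thesis
    unfolding G0 unfolding KE HE F
    using E.subfield_K E.dimensions[OF ga] E.fitting_subgroup_eq E.H_Int_G_normal E.Mod_iso_gal
      E.finite_gal E.simple_gal by blast
qed

end
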